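(* Assume that $\sup_{u\in[0,T]}\sum_{k\in\mathbb Z} f(u-k\Delta)<\infty$. Let $(S_i)_{i\ge1}$ be i.i.d. positive random variables with log-moment generating function $\Lambda_S(\theta):=\log\mathbb E e^{\theta S_1}$, let $V_n:=\sum_{i=1}^nS_i$ (with $V_0=0$), $S(t):=\sup\{n\ge0:V_n\le t\}$, and $\bar S^{(n)}(t):=\frac1nS(nt)$ for $t\in[0,T]$. Assume that $\bar A^{(n)}$ and $\bar S^{(n)}$ are independent. Define $$B^{(n)}(t):=\bar A^{(n)}(t)-\bar S^{(n)}(t),\qquad Q^{(n)}(t):=\sup_{0\le s\le t}\bigl(B^{(n)}(t)-B^{(n)}(s)\bigr),\qquad t\in[0,T].$$ Then the sequence of workload processes $\{Q^{(n)}\}_{n\ge1}$ satisfies a large deviations principle on $D([0,T])$, equipped with the Skorokhod $J_1$ topology, with speed $n$ and rate function $$K_T(q)=\inf\bigl\{I_T(\phi)+L_T(\psi):\ \phi,\psi\in D([0,T]),\ q=\Psi(\phi-\psi)\bigr\},\qquad q\in D([0,T]),$$ where $\Psi(x)(t):=\sup_{0\le s\le t}(x(t)-x(s))$ for $x\in D([0,T])$, $t\in[0,T]$.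
   Context: Fix $\Delta>0$ and $T>0$. Let $(T_k)_{k\in\mathbb Z}$ be i.i.d. real random variables with distribution function $F$ and probability density $f$. Put $A_k:=k\Delta+T_k$ for $k\in\mathbb Z$, and define the arrival counting process $A(t):=\sum_{k\in\mathbb Z}\mathbf 1_{\{0<A_k\le t\}}$, $t\in[0,T]$, which is nondecreasing with càdlàg paths (almost surely finite). Let $A^{(1)},A^{(2)},\dots$ be i.i.d. copies of the process $A$ and set $\bar A^{(n)}(t):=\frac1n\sum_{i=1}^nA^{(i)}(t)$, $t\in[0,T]$. $D([0,T])$ is the space of càdlàg functions $[0,T]\to\mathbb R$. For $\phi\in D([0,T])$ define $$I_T(\phi)=\sup_{m\ge1}\ \sup_{0<t_1<\cdots<t_m\le T}\ \sup_{\alpha\in\mathbb R^m}\Bigl\{\sum_{\ell=1}^m\alpha_\ell\phi(t_\ell)-\log\mathbb E\exp\Bigl(\sum_{\ell=1}^m\alpha_\ell A(t_\ell)\Bigr)\Bigr\}.$$ Let $\Lambda_S^*(x):=\sup_{\theta\in\mathbb R}\{\theta x-\Lambda_S(\theta)\}$ be the Legendre transform of $\Lambda_S$. For $\psi\in D([0,T])$ define $$L_T(\psi)=\int_0^T\psi'(t)\,\Lambda_S^*\Bigl(\frac1{\psi'(t)}\Bigr)dt$$ if $\psi$ is absolutely continuous and nondecreasing with $\psi(0)=0$, and $L_T(\psi)=+\infty$ otherwise; at points where $\psi'(t)=0$ the integrand is interpreted as the limit $\lim_{y\downarrow0}y\,\Lambda_S^*(1/y)\in[0,\infty]$. Large deviations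 principle: random elements $X^{(n)}$ of a topological space $E$ satisfy an LDP with speed $n$ and rate function $I:E\to[0,\infty]$ if $\limsup_{n}\frac1n\log\mathbb P(X^{(n)}\in C)\le-\inf_{x\in C}I(x)$ for every closed $C\subset E$ and $\liminf_n\frac1n\log\mathbb P(X^{(n)}\in G)\ge-\inf_{x\in G}I(x)$ for every open $G\subset E$. The infimum over the empty set is $+\infty$. *)

theory Defs
  imports "HOL-Probability.Probability"
begin

section \<open>The Skorokhod space on a compact interval\<close>

text \<open>Paths on \<open>[0,T]\<close> are extensional functions, so that equality of paths is equality on \<open>[0,T]\<close>.\<close>

definition cadlag_space :: "real \<Rightarrow> (real \<Rightarrow> real) set" where
  "cadlag_space T = {x \<in> extensional {0..T}.
     (\<forall>t\<in>{0..<T}. (x \<longlongrightarrow> x t) (at_right t)) \<and>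
     (\<forall>t\<in>{0<..T}. \<exists>l. (x \<longlongrightarrow> l) (at_left t))}"

definition time_changes :: "real \<Rightarrow> (real \<Rightarrow> real) set" where
  "time_changes T =
     {l. strict_mono_on {0..T} l \<and> continuous_on {0..T} l \<and> l 0 = 0 \<and> l T = T}"

definition skorokhod_dist :: "real \<Rightarrow> (real \<Rightarrow> real) \<Rightarrow> (real \<Rightarrow> real) \<Rightarrow> real" where
  "skorokhod_dist T x y =
     (INF l\<in>time_changes T.
        max (SUP t\<in>{0..T}. \<bar>l t - t\<bar>) (SUP t\<in>{0..T}. \<bar>x t - y (l t)\<bar>))"

definition J1_topology :: "real \<Rightarrow> (real \<Rightarrow> real) topology" where
  "J1_topology T = topology (\<lambda>U. U \<subseteq> cadlag_space T \<and>
     (\<forall>x\<in>U. \<exists>e>0. \<forall>y\<in>cadlag_space T. skorokhod_dist T x y < e \<longrightarrow> y \<in> U))"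

lemma openin_J1_topology:
  "openin (J1_topology T) U \<longleftrightarrow> U \<subseteq> cadlag_space T \<and>
     (\<forall>x\<in>U. \<exists>e>0. \<forall>y\<in>cadlag_space T. skorokhod_dist T x y < e \<longrightarrow> y \<in> U)"
proof -
  let ?P = "\<lambda>U. U \<subseteq> cadlag_space T \<and>
     (\<forall>x\<in>U. \<exists>e>0. \<forall>y\<in>cadlag_space T. skorokhod_dist T x y < e \<longrightarrow> y \<in> U)"
  have "?P (A \<inter> B)" if A: "?P A" and B: "?P B" for A B
  proof (intro conjI ballI)
    show "A \<inter> B \<subseteq> cadlag_space T" using A by blast
    fix x assume "x \<in> A \<inter> B"
    then obtain a b where "a > 0" "b > 0"
      and "\<forall>y\<in>cadlag_space T. skorokhod_dist T x y < a \<longrightarrow> y \<in> A"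
      and "\<forall>y\<in>cadlag_space T. skorokhod_dist T x y < b \<longrightarrow> y \<in> B"
      using A B by (metis IntE)
    then show "\<exists>e>0. \<forall>y\<in>cadlag_space T. skorokhod_dist T x y < e \<longrightarrow> y \<in> A \<inter> B"
      by (intro exI[of _ "min a b"]) auto
  qed
  moreover have "?P (\<Union>K)" if K: "\<forall>A\<in>K. ?P A" for K
  proof (intro conjI ballI)
    show "\<Union>K \<subseteq> cadlag_space T" using K by blast
    fix x assume "x \<in> \<Union>K"
    then obtain A where "A \<in> K" "x \<in> A" by blast
    then show "\<exists>e>0. \<forall>y\<in>cadlag_space T. skorokhod_dist T x y < e \<longrightarrow> y \<in> \<Union>K"
      using K by (meson UnionI)
  qed
  ultimately have "istopology ?P"
    unfolding istopology_def by blast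
  then show ?thesis
    by (simp add: J1_topology_def topology_inverse')
qed

lemma topspace_J1_topology: "topspace (J1_topology T) = cadlag_space T"
proof
  show "topspace (J1_topology T) \<subseteq> cadlag_space T"
    using openin_J1_topology openin_topspace by blast
  have "openin (J1_topology T) (cadlag_space T)"
    unfolding openin_J1_topology by (auto intro: exI[of _ 1])
  then show "cadlag_space T \<subseteq> topspace (J1_topology T)"
    by (rule openin_subset)
qed

text \<open>The \<open>\<sigma>\<close>-algebra generated by the coordinate projections, in which laws and independence
  of processes are expressed; on the Skorokhod space its trace is the Borel \<open>\<sigma>\<close>-algebra of
  the \<open>J\<^sub>1\<close> topology.\<close>

abbreviation path_algebra :: "real \<Rightarrow> (real \<Rightarrow> real) measure" where
  "path_algebra T \<equiv> PiM {0..T} (\<lambda>_. borel)"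

section \<open>Large deviations principles\<close>

definition elog :: "ennreal \<Rightarrow> ereal" where
  "elog x = (if x = 0 then -\<infinity> else if x = \<infinity> then \<infinity> else ereal (ln (enn2real x)))"

text \<open>A random element of \<open>E\<close> may be defined only almost surely, so \<open>X n\<close> takes values in \<open>E\<close>
  outside a null set and is Borel measurable with respect to the completion of \<open>M\<close>.\<close>

definition satisfies_LDP ::
    "'a measure \<Rightarrow> 'b topology \<Rightarrow> (nat \<Rightarrow> 'a \<Rightarrow> 'b) \<Rightarrow> ('b \<Rightarrow> ereal) \<Rightarrow> bool" where
  "satisfies_LDP M E X I \<longleftrightarrow>
     (\<forall>n\<ge>1. (AE \<omega> in M. X n \<omega> \<in> topspace E) \<and>
        (\<forall>U. openin E U \<longrightarrow> {\<omega> \<in> space M. X n \<omega> \<in> U} \<in> sets (completion M))) \<and>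
     (\<forall>x\<in>topspace E. 0 \<le> I x) \<and>
     (\<forall>C. closedin E C \<longrightarrow>
        limsup (\<lambda>n. ereal (1 / real n) * elog (emeasure (completion M) {\<omega> \<in> space M. X n \<omega> \<in> C}))
          \<le> - (INF x\<in>C. I x)) \<and>
     (\<forall>G. openin E G \<longrightarrow>
        liminf (\<lambda>n. ereal (1 / real n) * elog (emeasure (completion M) {\<omega> \<in> space M. X n \<omega> \<in> G}))
          \<ge> - (INF x\<in>G. I x))"

definition log_exp_moment :: "'a measure \<Rightarrow> ('a \<Rightarrow> real) \<Rightarrow> ereal" where
  "log_exp_moment M Y = elog (\<integral>\<^sup>+\<omega>. ennreal (exp (Y \<omega>)) \<partial>M)"

definition log_mgf :: "'a measure \<Rightarrow> ('a \<Rightarrow> real) \<Rightarrow> real \<Rightarrow> ereal" where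
  "log_mgf M Y \<theta> = log_exp_moment M (\<lambda>\<omega>. \<theta> * Y \<omega>)"

definition legendre :: "(real \<Rightarrow> ereal) \<Rightarrow> real \<Rightarrow> ereal" where
  "legendre \<Lambda> x = (SUP \<theta>. ereal (\<theta> * x) - \<Lambda> \<theta>)"

section \<open>Arrivals\<close>

text \<open>On the null event that infinitely many arrivals fall in \<open>(0,t]\<close>, \<open>card\<close> returns \<open>0\<close>.\<close>

definition arrival_count :: "real \<Rightarrow> (int \<Rightarrow> 'a \<Rightarrow> real) \<Rightarrow> 'a \<Rightarrow> real \<Rightarrow> real" where
  "arrival_count \<Delta> \<tau> \<omega> t =
     real (card {k. 0 < real_of_int k * \<Delta> + \<tau> k \<omega> \<and> real_of_int k * \<Delta> + \<tau> k \<omega> \<le> t})"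

definition arrival_rate ::
    "'a measure \<Rightarrow> ('a \<Rightarrow> real \<Rightarrow> real) \<Rightarrow> real \<Rightarrow> (real \<Rightarrow> real) \<Rightarrow> ereal" where
  "arrival_rate N A T \<phi> =
     (SUP m\<in>{1::nat..}. SUP t\<in>{t. strict_mono_on {1..m} t \<and> t ` {1..m} \<subseteq> {0<..T}}.
        SUP \<alpha>::nat \<Rightarrow> real.
          ereal (\<Sum>l=1..m. \<alpha> l * \<phi> (t l)) -
          log_exp_moment N (\<lambda>\<omega>. \<Sum>l=1..m. \<alpha> l * A \<omega> (t l)))"

definition empirical_mean :: "real \<Rightarrow> (nat \<Rightarrow> 'a \<Rightarrow> real \<Rightarrow> real) \<Rightarrow> nat \<Rightarrow> 'a \<Rightarrow> real \<Rightarrow> real" where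
  "empirical_mean T X n \<omega> = (\<lambda>t\<in>{0..T}. (1 / real n) * (\<Sum>i=1..n. X i \<omega> t))"

section \<open>Services\<close>

text \<open>On the null event that the set of indices below is infinite, \<open>Sup\<close> is an unspecified number.\<close>

definition renewal_count :: "(nat \<Rightarrow> 'a \<Rightarrow> real) \<Rightarrow> 'a \<Rightarrow> real \<Rightarrow> nat" where
  "renewal_count S \<omega> t = Sup {n. (\<Sum>i=1..n. S i \<omega>) \<le> t}"

definition scaled_renewal :: "real \<Rightarrow> (nat \<Rightarrow> 'a \<Rightarrow> real) \<Rightarrow> nat \<Rightarrow> 'a \<Rightarrow> real \<Rightarrow> real" where
  "scaled_renewal T S n \<omega> = (\<lambda>t\<in>{0..T}. (1 / real n) * real (renewal_count S \<omega> (real n * t)))"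

definition abs_continuous_on :: "real \<Rightarrow> real \<Rightarrow> (real \<Rightarrow> real) \<Rightarrow> bool" where
  "abs_continuous_on a b g \<longleftrightarrow>
     (\<forall>e>0. \<exists>d>0. \<forall>P. finite P \<and> (\<forall>(u, v)\<in>P. a \<le> u \<and> u < v \<and> v \<le> b) \<and>
        disjoint_family_on (\<lambda>(u, v). {u<..<v}) P \<and> (\<Sum>(u, v)\<in>P. v - u) < d
        \<longrightarrow> (\<Sum>(u, v)\<in>P. \<bar>g v - g u\<bar>) < e)"

definition service_integrand :: "(real \<Rightarrow> ereal) \<Rightarrow> real \<Rightarrow> ereal" where
  "service_integrand \<Lambda> y =
     (if y = 0 then Lim (at_right 0) (\<lambda>z. ereal z * legendre \<Lambda> (1 / z))
      else ereal y * legendre \<Lambda> (1 / y))"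

text \<open>The derivative of \<open>\<psi>\<close> exists almost everywhere on \<open>[0,T]\<close>, and the integrand is nonnegative
  wherever it does.\<close>

definition service_rate :: "(real \<Rightarrow> ereal) \<Rightarrow> real \<Rightarrow> (real \<Rightarrow> real) \<Rightarrow> ereal" where
  "service_rate \<Lambda> T \<psi> =
     (if abs_continuous_on 0 T \<psi> \<and> mono_on {0..T} \<psi> \<and> \<psi> 0 = 0
      then enn2ereal (\<integral>\<^sup>+t\<in>{0..T}. e2ennreal (service_integrand \<Lambda> (deriv \<psi> t)) \<partial>lborel)
      else \<infinity>)"

section \<open>Workload\<close>

definition path_diff :: "real \<Rightarrow> (real \<Rightarrow> real) \<Rightarrow> (real \<Rightarrow> real) \<Rightarrow> real \<Rightarrow> real" where
  "path_diff T x y = (\<lambda>t\<in>{0..T}. x t - y t)"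

definition reflection_map :: "real \<Rightarrow> (real \<Rightarrow> real) \<Rightarrow> real \<Rightarrow> real" where
  "reflection_map T x = (\<lambda>t\<in>{0..T}. SUP s\<in>{0..t}. x t - x s)"

definition workload_rate ::
    "real \<Rightarrow> ((real \<Rightarrow> real) \<Rightarrow> ereal) \<Rightarrow> ((real \<Rightarrow> real) \<Rightarrow> ereal) \<Rightarrow> (real \<Rightarrow> real) \<Rightarrow> ereal" where
  "workload_rate T I L q =
     Inf {I \<phi> + L \<psi> | \<phi> \<psi>. \<phi> \<in> cadlag_space T \<and> \<psi> \<in> cadlag_space T \<and>
       q = reflection_map T (path_diff T \<phi> \<psi>)}"

end

theory Submission
 imports Defs
begin

text \<open>Arrival and service paths are nondecreasing, and paths of finite rate are continuous. A nondecreasing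
 path that is close to a continuous one on a fine finite grid is uniformly close to it, so that the
 \<open>J\<^sub>1\<close> topology enters only through the Lipschitz continuity of the reflection map in the supremum
 norm and through the measurability of open events.

 Upper bound: paths with values in \<open>[0,R]\<close> form a compact set for pointwise convergence, hence a
 closed event is covered by finitely many events about finitely many coordinates of both processes.
 Their probabilities factorise, and exponential Chebyshev bounds apply: to the finite-dimensional
 Laplace transforms of the arrivals, and to a supermartingale with piecewise constant tilt \<open>\<theta>\<close> along
 the renewal epochs of the services. The latter produces the functional \<open>\<Sum>\<^sub>p \<theta>\<^sub>p |p| - \<Lambda>\<^sub>S(\<theta>\<^sub>p) \<psi>(p)\<close>
 over disjoint intervals \<open>p\<close>, whose supremum is \<open>L\<^sub>T(\<psi>)\<close> by Lebesgue differentiation.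

 Lower bound: Cramer's lower bound, which needs no moment assumption after truncation and a
 quadratically penalised tilt, applies to the vectors of arrival counts on a grid and to consecutive
 blocks of service times.\<close>

section \<open>Derivatives of absolutely continuous functions\<close>

text \<open>The compact box consists of all functions, so a finite cover may be centred at functions
  that are not cadlag, monotone or zero at the origin. Hence local upper bounds are proved at
  arbitrary centres, and a discontinuous centre of the services needs an estimate of its own
  (\<open>Sbar_window\<close>). Renewal counts over neighbouring cells are coupled by the service
  time that straddles the boundary, so their joint Laplace transform does not factorise. Both
  service bounds therefore run along the index of the service time, where independence is exact: the
  supermartingale pays a small price near interval ends, and the lower bound prescribes durations of
  index blocks instead of counts in time cells. \<open>service_rate\<close> is defined through
  \<open>deriv\<close>, but probabilities see only increments of the path; equating the almost
  everywhere derivative with the Radon-Nikodym density of the Stieltjes measure joins the two.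
  \<open>\<Lambda>S\<close> may be infinite at every positive argument. Negative tilts are always
  available and suffice for tails and continuity; positive tilts are used only inside the
  domain.\<close>

lemma null_measure_density_zero:
 fixes M :: "real measure"
 assumes "finite_measure M" and [measurable_cong]: "sets M = sets borel"
  and E: "E \<in> sets borel" "emeasure M E = 0" and c: "c > 0"
 shows "AE t in lborel. t \<in> E \<longrightarrow> (\<exists>d>0. \<forall>s. 0 < s \<and> s < d \<longrightarrow> measure M (ball t s) \<le> c * s)"
proof -
 interpret finite_measure M by fact
 \<comment> \<open>\<open>S\<close> is the set of bad points. A bad ball has Lebesgue measure
   \<open>2 * s\<close>, less than \<open>2 / c\<close> times its \<open>M\<close>-measure, so
   disjoint bad balls inside an open set of small \<open>M\<close>-measure have small total length.
   Vitali's theorem supplies such balls covering almost all of \<open>S\<close>.\<close>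
 define S where "S = {t\<in>E. \<forall>d>0. \<exists>s. 0 < s \<and> s < d \<and> measure M (ball t s) > c * s}"
 have "negligible S"
 proof (unfold negligible_outer_le, intro allI impI)
  fix e :: real assume e: "e > 0"
  have "(INF U \<in> {U. E \<subseteq> U \<and> open U}. emeasure M U) < ennreal (c * e / 2)" using outer_regular[OF assms(2) _ E(1)] E(2) e c by simp
  then obtain U where U: "E \<subseteq> U" "open U" "emeasure M U < ennreal (c * e / 2)"
   unfolding INF_less_iff by auto
  define K where "K = {(t, s). t \<in> S \<and> 0 < s \<and> ball t s \<subseteq> U \<and> measure M (ball t s) > c * s}"
  have V: "\<exists>i. i \<in> K \<and> x \<in> ball (fst i) (snd i) \<and> snd i < d" if x: "x \<in> S" and d: "0 < d" for x d
  proof -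
   have "x \<in> U" using x U(1) by (auto simp: S_def)
   then obtain d' where d': "d' > 0" "ball x d' \<subseteq> U" using U(2) open_contains_ball by blast
   then obtain s where s: "0 < s" "s < min d d'" "measure M (ball x s) > c * s"
   proof -
    have "min d d' > 0" using d d' by simp
    then show ?thesis using x that unfolding S_def by blast
   qed
   show ?thesis using d' s s x by (intro exI[of _ "(x, s)"]) (auto simp: K_def)
  qed
  obtain C where C: "countable C" "C \<subseteq> K"
   "pairwise (\<lambda>i j. disjnt (ball (fst i) (snd i)) (ball (fst j) (snd j))) C"
   "negligible (S - (\<Union>i \<in> C. ball (fst i) (snd i)))"
   by (rule Vitali_covering_theorem_balls[of S K fst snd, OF V])
  let ?B = "\<lambda>i. ball (fst i) (snd i) :: real set"
  have disj: "disjoint_family_on ?B C"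
   using C(3) by (auto simp: disjoint_family_on_def pairwise_def disjnt_def)
  have "emeasure lborel (\<Union>i\<in>C. ?B i) = (\<integral>\<^sup>+i. emeasure lborel (?B i) \<partial>count_space C)"
   using C(1) disj by (intro emeasure_UN_countable) auto
  also have "\<dots> \<le> (\<integral>\<^sup>+i. ennreal (2 / c) * emeasure M (?B i) \<partial>count_space C)"
   by (use C c in \<open>auto simp: K_def ball_eq_greaterThanLessThan field_simps emeasure_eq_measure ennreal_mult[symmetric] intro!: nn_integral_mono ennreal_leI\<close>)
  also have "\<dots> = ennreal (2 / c) * emeasure M (\<Union>i\<in>C. ?B i)"
   using C(1) disj by (subst emeasure_UN_countable) (auto simp: nn_integral_cmult)
  also have "\<dots> \<le> ennreal (2 / c) * ennreal (c * e / 2)"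
  proof (intro mult_left_mono)
   have "?B i \<subseteq> U" if "i \<in> C" for i
    using subsetD[OF C(2) that] by (cases i) (simp add: K_def)
   then have "emeasure M (\<Union>i\<in>C. ?B i) \<le> emeasure M U"
    using U(2) by (intro emeasure_mono UN_least) (auto simp: assms(2))
   then show "emeasure M (\<Union>i\<in>C. ?B i) \<le> ennreal (c * e / 2)" using U(3) by simp
  qed simp
  also have "\<dots> = ennreal e" using c e by (simp add: ennreal_mult[symmetric])
  finally have le: "emeasure lborel (\<Union>i\<in>C. ?B i) \<le> ennreal e" .
  have bs: "(\<Union>i\<in>C. ?B i) \<in> sets lborel" using C(1) by (intro sets.countable_UN') auto
  have m1: "(\<Union>i\<in>C. ?B i) \<in> lmeasurable"
  proof (rule fmeasurableI)
   show "emeasure lebesgue (\<Union>i\<in>C. ?B i) < \<infinity>"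
    using le bs by (simp add: le_less_trans)
   show "(\<Union>i\<in>C. ?B i) \<in> sets lebesgue" using bs by (rule sets_completionI_sets)
  qed
  show "\<exists>T. S \<subseteq> T \<and> T \<in> lmeasurable \<and> measure lebesgue T \<le> e"
  proof (intro exI conjI)
   let ?T = "(\<Union>i\<in>C. ?B i) \<union> (S - (\<Union>i \<in> C. ?B i))"
   show "S \<subseteq> ?T" by auto
   show "?T \<in> lmeasurable" using m1 C(4) negligible_imp_measurable by blast
   have "measure lebesgue ?T \<le> measure lebesgue (\<Union>i\<in>C. ?B i) + measure lebesgue (S - (\<Union>i \<in> C. ?B i))"
    using m1 C(4) negligible_imp_measurable by (intro measure_Un_le) (auto simp: fmeasurableD)
   also have "\<dots> \<le> e" using C(4) negligible_imp_measure0 le e bs by (fastforce simp: measure_def enn2real_leI)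
   finally show "measure lebesgue ?T \<le> e" .
  qed
 qed
 then have "AE t in lebesgue. t \<notin> S"
  by (simp add: AE_not_in negligible_iff_null_sets)
 then show ?thesis unfolding S_def by (fastforce simp: AE_completion_iff)
qed

text \<open>A Lebesgue null set lies in an open set of length below \<open>d\<close>. Countably many
  nonoverlapping closed intervals inside that open set cover it, and the epsilon-delta condition
  bounds the \<open>F\<close>-increments over every finite subfamily. Constancy of \<open>F\<close>
  outside \<open>{0..T}\<close> leaves no mass there.\<close>

lemma absolutely_continuous_interval_measure:
 fixes F :: "real \<Rightarrow> real"
 assumes T: "0 < T" and ac: "abs_continuous_on 0 T F" and mono: "mono F" and cont: "continuous_on UNIV F"
  and out: "\<And>x. x \<le> 0 \<Longrightarrow> F x = F 0" "\<And>x. T \<le> x \<Longrightarrow> F x = F T"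
 shows "absolutely_continuous lborel (interval_measure F)" "finite_measure (interval_measure F)"
proof -
 let ?M = "interval_measure F"
 have Icc: "emeasure ?M {a..b} = F b - F a" if "a \<le> b" for a b
  using mono cont that
   by (intro emeasure_interval_measure_Icc) (auto simp: mono_def continuous_on_eq_continuous_at continuous_at_imp_continuous_within)
 have pos: "emeasure ?M {..0} = 0"
 proof -
  have "emeasure ?M {..0} = emeasure ?M (\<Union>n::nat. {-real n..0})"
  proof (rule arg_cong[where f="emeasure ?M"], intro equalityI subsetI)
   fix x :: real assume "x \<in> {..0}"
   moreover obtain n :: nat where "- x \<le> real n" using real_arch_simple by blast
   ultimately show "x \<in> (\<Union>n::nat. {-real n..0})" by (intro UN_I[of n]) auto
  qed auto
  also have "\<dots> = 0"
  proof (intro emeasure_UN_eq_0)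
   show "emeasure ?M {-real n..0} = 0" for n
    using Icc[of "- real n" 0] out(1)[of "- real n"] by simp
  qed auto
  finally show ?thesis .
 qed
 have neg: "emeasure ?M {T..} = 0"
 proof -
  have "emeasure ?M {T..} = emeasure ?M (\<Union>n::nat. {T..T + real n})"
  proof (rule arg_cong[where f="emeasure ?M"], intro equalityI subsetI)
   fix x :: real assume "x \<in> {T..}"
   moreover obtain n :: nat where "x - T \<le> real n" using real_arch_simple by blast
   ultimately show "x \<in> (\<Union>n::nat. {T..T + real n})" by (intro UN_I[of n]) auto
  qed auto
  also have "\<dots> = 0"
  proof (intro emeasure_UN_eq_0)
   show "emeasure ?M {T..T + real n} = 0" for n
    using Icc[of T "T + real n"] out(2)[of "T + real n"] by simp
  qed auto
  finally show ?thesis .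
 qed
 show fin: "finite_measure ?M"
 proof
  have "emeasure ?M (space ?M) \<le> emeasure ?M ({..0} \<union> {0..T} \<union> {T..})"
   using T by (intro emeasure_mono) auto
  also have "\<dots> \<le> F T - F 0" using pos neg Icc T by (auto intro!: order_trans[OF emeasure_subadditive] add_right_mono)
  finally show "emeasure ?M (space ?M) \<noteq> \<infinity>" by (auto simp: top_unique)
 qed
 show "absolutely_continuous lborel ?M"
  unfolding absolutely_continuous_def
 proof
  fix N0 :: "real set" assume N0: "N0 \<in> null_sets lborel"
  define N where "N = N0 \<inter> {0<..<T}"
  have N: "N \<in> sets borel" "emeasure lborel N = 0"
  proof -
   show "N \<in> sets borel" using N0 by (auto simp: N_def null_sets_def)
   have "emeasure lborel N \<le> emeasure lborel N0" using N0 by (intro emeasure_mono) (auto simp: N_def)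
   then show "emeasure lborel N = 0" using N0 by (simp add: null_sets_def)
  qed
  have "emeasure ?M N \<le> ennreal e" if e: "e > 0" for e
  proof -
   obtain d where d: "d > 0" and dd: "\<And>P. finite P \<Longrightarrow> (\<forall>(u, v)\<in>P. 0 \<le> u \<and> u < v \<and> v \<le> T) \<Longrightarrow>
    disjoint_family_on (\<lambda>(u, v). {u<..<v}) P \<Longrightarrow> (\<Sum>(u, v)\<in>P. v - u) < d
    \<Longrightarrow> (\<Sum>(u, v)\<in>P. \<bar>F v - F u\<bar>) < e"
    using ac e unfolding abs_continuous_on_def by meson
   obtain U where U: "open U" "N \<subseteq> U" "emeasure lborel (U - N) < d"
    using outer_regular_lborel[OF N(1) d] by metis
   have lU: "emeasure lborel U < d"
   proof -
    have "emeasure lborel U \<le> emeasure lborel (U - N) + emeasure lborel N"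
     using U N by (intro order_trans[OF emeasure_mono[of U "(U - N) \<union> N"] emeasure_subadditive]) auto
    then show ?thesis using U N by simp
   qed
   \<comment> \<open>With this gauge every interval of the covering lemma that is tagged by a point
     of \<open>N\<close> lies inside \<open>U\<close>.\<close>
   define g where "g = (\<lambda>x. if x \<in> U then U else UNIV)"
   have g: "gauge g" using U(1) by (auto simp: gauge_def g_def)
   have c1: "N \<subseteq> cbox 0 T" and c2: "box 0 T \<noteq> {}" using T by (auto simp: N_def)
   obtain \<D> where D: "countable \<D>"  "\<Union>\<D> \<subseteq> cbox 0 T"
    "\<And>K. K \<in> \<D> \<Longrightarrow> interior K \<noteq> {} \<and> (\<exists>c d. K = cbox c d)"
    "pairwise (\<lambda>A B. interior A \<inter> interior B = {}) \<D>"
    "\<And>K. K \<in> \<D> \<Longrightarrow> \<exists>x \<in> N \<inter> K. K \<subseteq> g x"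
    "\<And>u v. cbox u v \<in> \<D> \<Longrightarrow> \<exists>n. \<forall>i \<in> Basis. v \<bullet> i - u \<bullet> i = (T \<bullet> i - 0 \<bullet> i) / 2^n"
    "N \<subseteq> \<Union>\<D>"
   by (use covering_lemma[OF c1 c2 g] in \<open>auto\<close>)
   have DU: "K \<subseteq> U" if "K \<in> \<D>" for K
    using D(5)[OF that] U(2) by (auto simp: g_def split: if_splits)
   have ex: "\<exists>u v. u < v \<and> K = {u..v} \<and> 0 \<le> u \<and> v \<le> T" if "K \<in> \<D>" for K
   proof -
    obtain c d where cd: "K = {c..d}" using D(3)[OF \<open>K \<in> \<D>\<close>] by auto
    with D(3)[OF \<open>K \<in> \<D>\<close>] have "c < d" by (auto simp: interior_atLeastAtMost_real)
    have "K \<subseteq> cbox 0 T" using Union_upper[OF that] D(2) by (rule order_trans)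
    moreover have "c \<in> K" "d \<in> K" using cd \<open>c < d\<close> by simp_all
    ultimately have "c \<in> cbox 0 T" "d \<in> cbox 0 T" by (blast intro: subsetD)+
    then have "0 \<le> c" "d \<le> T" by (simp_all only: mem_box_real)
    with \<open>c < d\<close> cd show ?thesis by (intro exI[of _ c] exI[of _ d] conjI)
   qed
   define u v where "u = (Inf :: real set \<Rightarrow> real)" and "v = (Sup :: real set \<Rightarrow> real)"
   have uv: "u K < v K \<and> K = {u K..v K} \<and> 0 \<le> u K \<and> v K \<le> T" if "K \<in> \<D>" for K
    using ex[OF that] by (auto simp: u_def v_def)
   \<comment> \<open>The disjoint interiors have total length below \<open>d\<close> because they
     lie in \<open>U\<close>, so the epsilon-delta condition applies to the finite set
     \<open>Q\<close> of endpoint pairs.\<close>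
   have fin_le: "(\<Sum>K\<in>P. emeasure ?M K) \<le> ennreal e" if P: "finite P" "P \<subseteq> \<D>" for P
   proof -
    have uvP: "u K < v K" "u K \<le> v K" "0 \<le> u K" "v K \<le> T" "{u K..v K} = K" if "K \<in> P" for K
     using uv[of K] P that by auto
    define Q where "Q = (\<lambda>K. (u K, v K)) ` P"
    have inj: "inj_on (\<lambda>K. (u K, v K)) P"
     using uv P by (intro inj_onI) (metis Pair_inject subsetD)
    have disj: "disjoint_family_on (\<lambda>(u, v). {u<..<v}) Q"
     unfolding disjoint_family_on_def
    proof (intro ballI impI)
     fix p q assume "p \<in> Q" "q \<in> Q" and pq: "p \<noteq> q"
     then obtain K L where KL: "K \<in> P" "p = (u K, v K)" "L \<in> P" "q = (u L, v L)" by (auto simp: Q_def)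
     then have "interior K \<inter> interior L = {}" using pq pairwiseD[OF D(4)] P(2) KL by blast
     moreover have "interior K = {u K<..<v K}" "interior L = {u L<..<v L}"
      using uv KL P(2) by (metis interior_atLeastAtMost_real subsetD)+
     ultimately show "(case p of (u, v) \<Rightarrow> {u<..<v}) \<inter> (case q of (u, v) \<Rightarrow> {u<..<v}) = {}"
      using KL by auto
    qed
    have "ennreal (\<Sum>(u, v)\<in>Q. v - u) = (\<Sum>p\<in>Q. emeasure lborel (case p of (u, v) \<Rightarrow> {u<..<v}))"
     using uvP P by (subst sum_ennreal[symmetric]) (auto simp: Q_def intro!: sum.cong)
    also have "\<dots> = emeasure lborel (\<Union>p\<in>Q. (case p of (u, v) \<Rightarrow> {u<..<v}))"
     using disj P by (intro sum_emeasure) (auto simp: Q_def)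
    also have "\<dots> \<le> emeasure lborel U"
    proof (intro emeasure_mono)
     show "(\<Union>p\<in>Q. (case p of (u, v) \<Rightarrow> {u<..<v})) \<subseteq> U"
      by (use uvP(5) DU P in \<open>fastforce simp: Q_def\<close>)
    qed (use U in auto)
    also have "\<dots> < d" by (rule lU)
    finally have "(\<Sum>(u, v)\<in>Q. v - u) < d" by (metis ennreal_leI not_less)
    then have "(\<Sum>(u, v)\<in>Q. \<bar>F v - F u\<bar>) < e"
     using uvP P disj by (intro dd) (auto simp: Q_def)
    then have le: "(\<Sum>K\<in>P. \<bar>F (v K) - F (u K)\<bar>) < e"
     unfolding Q_def by (subst (asm) sum.reindex[OF inj]) simp
    have "(\<Sum>K\<in>P. emeasure ?M K) = (\<Sum>K\<in>P. ennreal \<bar>F (v K) - F (u K)\<bar>)"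
    proof (rule sum.cong[OF refl])
     fix K assume "K \<in> P"
     then have K: "u K < v K" "K = {u K..v K}" using uv P by auto
     have "emeasure ?M {u K..v K} = F (v K) - F (u K)" using K by (intro Icc) auto
     moreover have "F (u K) \<le> F (v K)" using K mono by (simp add: mono_def)
     ultimately show "emeasure ?M K = ennreal \<bar>F (v K) - F (u K)\<bar>" using K by simp
    qed
    also have "\<dots> = ennreal (\<Sum>K\<in>P. \<bar>F (v K) - F (u K)\<bar>)" by simp
    finally show ?thesis using le by (simp add: ennreal_leI)
   qed
   have Dm: "K \<in> sets borel" if "K \<in> \<D>" for K using uv[OF that] by (metis atLeastAtMost_borel)
   have "emeasure ?M N \<le> emeasure ?M (\<Union>\<D>)"
    using D(7) Dm D(1) by (intro emeasure_mono) (auto intro!: sets.countable_Union)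
   also have "\<dots> \<le> ennreal e"
   proof (cases "finite \<D>")
    case True
    then show ?thesis using emeasure_subadditive_finite[of \<D> "\<lambda>K. K" ?M] Dm fin_le[OF True] by (auto intro: order_trans)
   next
    case False
    then have bij: "bij_betw (from_nat_into \<D>) UNIV \<D>" using D(1) by (intro bij_betw_from_nat_into)
    have "emeasure ?M (\<Union>\<D>) = emeasure ?M (\<Union>n. from_nat_into \<D> n)"
     using bij by (simp add: bij_betw_def)
    also have "\<dots> \<le> (\<Sum>n. emeasure ?M (from_nat_into \<D> n))"
     using bij Dm by (intro emeasure_subadditive_countably) (auto simp: bij_betw_def)
    also have "\<dots> \<le> ennreal e"
    proof (rule suminf_le_const)
     fix n
     have "(\<Sum>i<n. emeasure ?M (from_nat_into \<D> i)) = (\<Sum>K\<in>from_nat_into \<D> ` {..<n}. emeasure ?M K)"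
      using bij by (subst sum.reindex) (auto simp: bij_betw_def inj_on_def)
     also have "\<dots> \<le> ennreal e" using bij by (intro fin_le) (auto simp: bij_betw_def)
     finally show "(\<Sum>i<n. emeasure ?M (from_nat_into \<D> i)) \<le> ennreal e" .
    qed simp
    finally show ?thesis .
   qed
   finally show ?thesis .
  qed
  then have "emeasure ?M N = 0" by (metis ennreal_le_epsilon add.left_neutral le_zero_eq)
  moreover have "emeasure ?M N0 \<le> emeasure ?M {..0} + emeasure ?M N + emeasure ?M {T..}"
   using N0 N by (intro order_trans[OF emeasure_mono[of N0 "{..0} \<union> N \<union> {T..}"]]
    order_trans[OF emeasure_subadditive] add_right_mono) (auto simp: N_def)
  ultimately show "N0 \<in> null_sets ?M" using pos neg N0 by (intro null_setsI) (auto simp: null_sets_def)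
 qed
qed

text \<open>Compare \<open>h\<close> with rational levels \<open>q\<close>. Near almost every point
  with \<open>h t < q\<close> the mass sitting on the complement of that set has density zero, so
  the slope of \<open>F\<close> is at most \<open>q\<close> up to an error. Near almost every point
  with \<open>h t > q\<close> the complement has Lebesgue density zero, so the slope is at least
  \<open>q\<close> up to an error. Countably many levels pin the derivative to
  \<open>h t\<close>.\<close>

lemma AE_derivative_interval_measure:
 fixes F h :: "real \<Rightarrow> real"
 assumes mono: "mono F" and cont: "continuous_on UNIV F"
  and fin: "finite_measure (interval_measure F)"
  and h[measurable]: "h \<in> borel_measurable borel" and h0: "\<And>t. 0 \<le> h t"
  and dens: "density lborel (\<lambda>t. ennreal (h t)) = interval_measure F"
 shows "AE t in lborel. (F has_real_derivative h t) (at t)"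
proof -
 let ?M = "interval_measure F"
 interpret finite_measure ?M by (rule fin)
 have Ioc: "emeasure ?M {a<..b} = ennreal (F b - F a)" if "a \<le> b" for a b
  using mono cont that
   by (intro emeasure_interval_measure_Ioc) (auto simp: mono_def continuous_on_eq_continuous_at continuous_at_imp_continuous_within)
 have Fle: "F a \<le> F b" if "a \<le> b" for a b using mono that by (simp add: mono_def)
 \<comment> \<open>An interval around \<open>t\<close> sits in a ball of twice its length as radius;
   this doubling is why the density lemma is invoked with the constants \<open>e/2\<close> and
   \<open>e/(2*q)\<close>.\<close>
 have ball: "{u<..v} \<subseteq> ball t (2 * (v - u))" if "u \<le> t" "t \<le> v" "u < v" for t u v :: real
  using that by (auto simp: ball_def dist_real_def)
 have up: "AE t in lborel. h t < q \<longrightarrow> (\<exists>d>0. \<forall>u v. u \<le> t \<and> t \<le> v \<and> u < v \<and> v - u < d \<longrightarrow>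
   F v - F u \<le> (q + e) * (v - u))" if e: "e > 0" for q e :: real
 proof -
  define E where "E = {t. h t < q}"
  have E[measurable]: "E \<in> sets borel" unfolding E_def by measurable
  define N where "N = density ?M (indicator (- E))"
  let ?B = "\<lambda>d t. \<exists>d>0. \<forall>s. 0 < s \<and> s < d \<longrightarrow> measure N (ball t s) \<le> (e/2) * s"
  have Nsets[simp, measurable_cong]: "sets N = sets borel" by (simp add: N_def)
  have Nem: "emeasure N A = emeasure ?M (A - E)" if A: "A \<in> sets borel" for A
  proof -
   have "emeasure N A = (\<integral>\<^sup>+x. indicator (- E) x * indicator A x \<partial>?M)"
    unfolding N_def using A by (subst emeasure_density) simp_all
   also have "\<dots> = (\<integral>\<^sup>+x. indicator (A - E) x \<partial>?M)"
    by (intro nn_integral_cong) (auto split: split_indicator)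
   finally have "emeasure N A = (\<integral>\<^sup>+x. indicator (A - E) x \<partial>?M)" .
   then show ?thesis using A by simp
  qed
  have Nfin: "finite_measure N"
   by (intro finite_measureI) (simp add: Nem emeasure_eq_measure sets_eq_imp_space_eq[OF Nsets])
  have "AE t in lborel. t \<in> E \<longrightarrow> (?B d t)"
   using e by (intro null_measure_density_zero Nfin) (auto simp: Nem)
  then show ?thesis
  proof (eventually_elim, intro impI)
   fix t assume *: "t \<in> E \<longrightarrow> (?B d t)" and "h t < q"
   then obtain d where d: "d > 0" "\<And>s. 0 < s \<Longrightarrow> s < d \<Longrightarrow> measure N (ball t s) \<le> (e/2) * s"
    by (auto simp: E_def)
   have q0: "q \<ge> 0" using h0[of t] \<open>h t < q\<close> by simp
   show "\<exists>d>0. \<forall>u v. u \<le> t \<and> t \<le> v \<and> u < v \<and> v - u < d \<longrightarrow> F v - F u \<le> (q + e) * (v - u)"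
   proof (intro exI[of _ "d/2"] conjI allI impI)
    show "d / 2 > 0" using d by simp
    fix u v assume uv: "u \<le> t \<and> t \<le> v \<and> u < v \<and> v - u < d / 2"
    have "emeasure ?M ({u<..v} \<inter> E) = (\<integral>\<^sup>+x. ennreal (h x) * indicator ({u<..v} \<inter> E) x \<partial>lborel)"
     by (subst dens[symmetric], subst emeasure_density) auto
    also have "\<dots> \<le> (\<integral>\<^sup>+x. ennreal q * indicator {u<..v} x \<partial>lborel)"
     by (intro nn_integral_mono) (auto simp: E_def split: split_indicator intro!: ennreal_leI)
    also have "\<dots> = ennreal (q * (v - u))"
     using uv q0 by (simp add: nn_integral_cmult_indicator ennreal_mult)
    finally have 1: "measure ?M ({u<..v} \<inter> E) \<le> q * (v - u)"
     using uv q0 by (simp add: emeasure_eq_measure)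
    have "measure ?M ({u<..v} - E) \<le> measure ?M (ball t (2 * (v - u)) - E)"
     using ball[of u t v] uv by (intro finite_measure_mono) auto
    also have "\<dots> = measure N (ball t (2 * (v - u)))" by (simp add: measure_def Nem)
    also have "\<dots> \<le> (e/2) * (2 * (v - u))" using uv by (intro d(2)) auto
    finally have 2: "measure ?M ({u<..v} - E) \<le> e * (v - u)" by (simp add: algebra_simps)
    have "F v - F u = measure ?M {u<..v}"
     using Ioc[of u v] uv Fle[of u v] by (simp add: emeasure_eq_measure)
    also have "\<dots> = measure ?M ({u<..v} \<inter> E) + measure ?M ({u<..v} - E)"
     by (subst finite_measure_Union[symmetric]) (auto intro!: arg_cong[where f="measure ?M"])
    also have "\<dots> \<le> (q + e) * (v - u)" using 1 2 by (simp add: algebra_simps)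
    finally show "F v - F u \<le> (q + e) * (v - u)" .
   qed
  qed
 qed
 have lo: "AE t in lborel. \<bar>t\<bar> < real k \<and> h t > q \<longrightarrow> (\<exists>d>0. \<forall>u v. u \<le> t \<and> t \<le> v \<and> u < v \<and> v - u < d \<longrightarrow>
   F v - F u \<ge> (q - e) * (v - u))" if e: "e > 0" for q e :: real and k :: nat
 proof (cases "q > 0")
  case False
  have "F v - F u \<ge> (q - e) * (v - u)" if "u < v" for u v
   using False e that Fle[of u v] mult_nonpos_nonneg[of "q - e" "v - u"] by (simp add: not_less)
  then show ?thesis by (auto intro!: AE_I2 exI[of _ 1])
 next
  case q: True
  define E where "E = {t. h t > q}"
  have E[measurable]: "E \<in> sets borel" unfolding E_def by measurable
  \<comment> \<open>Lebesgue measure is infinite, so the complement of \<open>E\<close> is cut down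
    to a bounded set; \<open>k\<close> is finally chosen beyond
    \<open>\<bar>t\<bar>\<close>.\<close>
  define B where "B = {- real k..real k}"
  have [measurable]: "B \<in> sets borel" by (simp add: B_def)
  define N where "N = density lborel (indicator (B - E))"
  have Nsets[simp, measurable_cong]: "sets N = sets borel" by (simp add: N_def)
  have Nem: "emeasure N A = emeasure lborel (A \<inter> B - E)" if A: "A \<in> sets borel" for A
  proof -
   have "emeasure N A = (\<integral>\<^sup>+x. indicator (B - E) x * indicator A x \<partial>lborel)"
    unfolding N_def using A by (subst emeasure_density) simp_all
   also have "\<dots> = (\<integral>\<^sup>+x. indicator (A \<inter> B - E) x \<partial>lborel)"
    by (intro nn_integral_cong) (auto split: split_indicator)
   finally have "emeasure N A = (\<integral>\<^sup>+x. indicator (A \<inter> B - E) x \<partial>lborel)" .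
   then show ?thesis using A by simp
  qed
  have fB: "emeasure lborel (A \<inter> B - E) < \<infinity>" for A
  proof -
   have "emeasure lborel (A \<inter> B - E) \<le> emeasure lborel B" by (intro emeasure_mono) auto
   also have "\<dots> < \<infinity>" by (simp add: B_def)
   finally show ?thesis .
  qed
  have Nfin: "finite_measure N"
   by ((intro finite_measureI), (use Nem[of UNIV] fB[of UNIV] in \<open>simp add: sets_eq_imp_space_eq[OF Nsets]\<close>))
  have "AE t in lborel. t \<in> E \<longrightarrow> (\<exists>d>0. \<forall>s. 0 < s \<and> s < d \<longrightarrow> measure N (ball t s) \<le> (e/(2*q)) * s)"
   using e q by (intro null_measure_density_zero Nfin) (auto simp: Nem Diff_eq Int_ac)
  then show ?thesis
  proof (eventually_elim, intro impI)
   fix t assume *: "t \<in> E \<longrightarrow> (\<exists>d>0. \<forall>s. 0 < s \<and> s < d \<longrightarrow> measure N (ball t s) \<le> (e/(2*q)) * s)"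
    and t: "\<bar>t\<bar> < real k \<and> h t > q"
   then obtain d where d: "d > 0" "\<And>s. 0 < s \<Longrightarrow> s < d \<Longrightarrow> measure N (ball t s) \<le> (e/(2*q)) * s"
    by (auto simp: E_def)
   show "\<exists>d>0. \<forall>u v. u \<le> t \<and> t \<le> v \<and> u < v \<and> v - u < d \<longrightarrow> F v - F u \<ge> (q - e) * (v - u)"
   proof (intro exI[of _ "min (d/2) (real k - \<bar>t\<bar>)"] conjI allI impI)
    show "min (d/2) (real k - \<bar>t\<bar>) > 0" using d t by simp
    fix u v assume uv: "u \<le> t \<and> t \<le> v \<and> u < v \<and> v - u < min (d/2) (real k - \<bar>t\<bar>)"
    let ?A = "{u<..v} \<inter> E"
    have uvB: "{u<..v} \<subseteq> B" using uv by (auto simp: B_def)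
    have fI: "emeasure lborel ?A < \<infinity>"
     using emeasure_mono[of "{u<..v} \<inter> E" "{u<..v}" lborel] uv by (auto simp: less_top intro: le_less_trans)
    have "ennreal (q * measure lborel ?A) = ennreal q * emeasure lborel ?A"
     using q fI by (simp add: ennreal_mult emeasure_eq_ennreal_measure)
    also have "\<dots> = (\<integral>\<^sup>+x. ennreal q * indicator ?A x \<partial>lborel)"
     by (subst nn_integral_cmult_indicator) auto
    also have "\<dots> \<le> (\<integral>\<^sup>+x. ennreal (h x) * indicator {u<..v} x \<partial>lborel)"
     by (intro nn_integral_mono) (auto simp: E_def split: split_indicator intro!: ennreal_leI)
    also have "\<dots> = emeasure ?M {u<..v}"
     by (subst dens[symmetric], subst emeasure_density) auto
    also have "\<dots> = ennreal (F v - F u)" using Ioc uv by simp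
    finally have 1: "q * measure lborel ?A \<le> F v - F u"
     using Fle[of u v] uv by simp
    have "measure lborel ({u<..v} - E) \<le> measure lborel (ball t (2 * (v - u)) \<inter> B - E)"
     using ball[of u t v] uv uvB fB[of "ball t (2 * (v - u))"] by (intro measure_mono_fmeasurable) (auto intro!: fmeasurableI)
    also have "\<dots> = measure N (ball t (2 * (v - u)))" by (simp add: measure_def Nem)
    also have "\<dots> \<le> (e/(2*q)) * (2 * (v - u))" using uv by (intro d(2)) auto
    finally have "q * measure lborel ({u<..v} - E) \<le> q * ((e/(2*q)) * (2 * (v - u)))"
     using q by (intro mult_left_mono) auto
    also have "\<dots> = e * (v - u)" using q by (simp add: field_simps)
    finally have 2: "q * measure lborel ({u<..v} - E) \<le> e * (v - u)" .
    have "v - u = measure lborel (?A \<union> ({u<..v} - E))" using uv by (simp add: Int_Diff_Un)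
    also have "\<dots> \<le> measure lborel ?A + measure lborel ({u<..v} - E)"
     by (intro measure_Un_le) auto
    finally have "q * (v - u) \<le> q * measure lborel ?A + q * measure lborel ({u<..v} - E)"
     using q by (simp add: distrib_left[symmetric])
    with 1 2 show "F v - F u \<ge> (q - e) * (v - u)" by (simp add: algebra_simps)
   qed
  qed
 qed
 have "AE t in lborel. \<forall>(q::rat) (n::nat). h t < of_rat q \<longrightarrow> (\<exists>d>0. \<forall>u v. u \<le> t \<and> t \<le> v \<and> u < v \<and> v - u < d \<longrightarrow>
   F v - F u \<le> (of_rat q + 1 / Suc n) * (v - u))"
  by (subst AE_all_countable, intro allI, subst AE_all_countable, intro allI up) simp
 moreover have "AE t in lborel. \<forall>(q::rat) (n::nat) (k::nat). \<bar>t\<bar> < real k \<and> h t > of_rat q \<longrightarrow> (\<exists>d>0. \<forall>u v. u \<le> t \<and> t \<le> v \<and> u < v \<and> v - u < d \<longrightarrow>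
   F v - F u \<ge> (of_rat q - 1 / Suc n) * (v - u))"
  by (subst AE_all_countable, intro allI, subst AE_all_countable, intro allI, subst AE_all_countable, intro allI lo) simp
 ultimately show ?thesis
 proof eventually_elim
  fix t
  assume U: "\<forall>(q::rat) (n::nat). h t < of_rat q \<longrightarrow> (\<exists>d>0. \<forall>u v. u \<le> t \<and> t \<le> v \<and> u < v \<and> v - u < d \<longrightarrow>
   F v - F u \<le> (of_rat q + 1 / Suc n) * (v - u))"
  and L: "\<forall>(q::rat) (n::nat) (k::nat). \<bar>t\<bar> < real k \<and> h t > of_rat q \<longrightarrow> (\<exists>d>0. \<forall>u v. u \<le> t \<and> t \<le> v \<and> u < v \<and> v - u < d \<longrightarrow>
   F v - F u \<ge> (of_rat q - 1 / Suc n) * (v - u))"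
  show "(F has_real_derivative h t) (at t)"
   unfolding has_field_derivative_iff LIM_def
  proof (intro allI impI)
   fix e :: real assume e: "0 < e"
   obtain n :: nat where n: "1 / Suc n < e / 2" using e nat_approx_posE[of "e/2"] by auto
   obtain k :: nat where k: "\<bar>t\<bar> < real k" using reals_Archimedean2 by blast
   obtain q1 :: rat where q1: "h t - e / 2 < of_rat q1" "of_rat q1 < h t" using of_rat_dense[of "h t - e/2" "h t"] e by auto
   obtain q2 :: rat where q2: "h t < of_rat q2" "of_rat q2 < h t + e/2" using of_rat_dense[of "h t" "h t + e/2"] e by auto
   obtain d1 where d1: "d1 > 0" "\<And>u v. u \<le> t \<Longrightarrow> t \<le> v \<Longrightarrow> u < v \<Longrightarrow> v - u < d1 \<Longrightarrow> F v - F u \<le> (of_rat q2 + 1 / Suc n) * (v - u)"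
    using U q2(1) by blast
   obtain d2 where d2: "d2 > 0" "\<And>u v. u \<le> t \<Longrightarrow> t \<le> v \<Longrightarrow> u < v \<Longrightarrow> v - u < d2 \<Longrightarrow> F v - F u \<ge> (of_rat q1 - 1 / Suc n) * (v - u)"
    using L q1(2) k by blast
   have main: "\<bar>(F v - F u) / (v - u) - h t\<bar> < e" if uv: "u \<le> t" "t \<le> v" "u < v" "v - u < min d1 d2" for u v
   proof -
    have "F v - F u \<le> (of_rat q2 + 1 / Suc n) * (v - u)" using uv by (intro d1) auto
    then have a: "(F v - F u) / (v - u) \<le> of_rat q2 + 1 / Suc n" using uv by (simp add: pos_divide_le_eq)
    have "F v - F u \<ge> (of_rat q1 - 1 / Suc n) * (v - u)" using uv by (intro d2) auto
    then have b: "(F v - F u) / (v - u) \<ge> of_rat q1 - 1 / Suc n" using uv by (simp add: pos_le_divide_eq)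
    show ?thesis using a b n q1 q2 by linarith
   qed
   show "\<exists>s>0. \<forall>x. x \<noteq> t \<and> dist x t < s \<longrightarrow> dist ((F x - F t) / (x - t)) (h t) < e"
    by (use d1 d2 minus_diff_eq minus_divide_divide main in \<open>smt (verit) dist_real_def\<close>)
  qed
 qed
qed

lemma abs_continuous_on_imp_continuous_on:
 assumes ac: "abs_continuous_on 0 T g"
 shows "continuous_on {0..T} g"
 unfolding continuous_on_iff
proof (intro ballI allI impI)
 fix x e :: real assume x: "x \<in> {0..T}" and e: "e > 0"
 obtain d where d: "d > 0" and dd: "\<And>P. finite P \<Longrightarrow> (\<forall>(u, v)\<in>P. 0 \<le> u \<and> u < v \<and> v \<le> T) \<Longrightarrow>
   disjoint_family_on (\<lambda>(u, v). {u<..<v}) P \<Longrightarrow> (\<Sum>(u, v)\<in>P. v - u) < d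
   \<Longrightarrow> (\<Sum>(u, v)\<in>P. \<bar>g v - g u\<bar>) < e"
  using ac e unfolding abs_continuous_on_def by meson
 have 1: "\<bar>g v - g u\<bar> < e" if "0 \<le> u" "u < v" "v \<le> T" "v - u < d" for u v
  using dd[of "{(u, v)}"] that by (auto simp: disjoint_family_on_def)
 show "\<exists>d>0. \<forall>x'\<in>{0..T}. dist x' x < d \<longrightarrow> dist (g x') (g x) < e"
 proof (intro exI[of _ d] conjI ballI impI d)
  fix x' assume "x' \<in> {0..T}" "dist x' x < d"
  then show "dist (g x') (g x) < e"
   using 1[of x x'] 1[of x' x] x e by (cases x x' rule: linorder_cases) (auto simp: dist_real_def)
 qed
qed

text \<open>Radon-Nikodym gives a density \<open>h\<close> of the Stieltjes measure, and
  differentiation of measures identifies it with the derivative. Both descriptions are wanted: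
  \<open>service_rate\<close> speaks of \<open>deriv\<close>, the tilted functionals of
  increments.\<close>

theorem abs_continuous_mono_deriv:
 fixes g :: "real \<Rightarrow> real"
 assumes T: "0 < T" and ac: "abs_continuous_on 0 T g" and mono: "mono_on {0..T} g"
 obtains h where "h \<in> borel_measurable borel" "\<forall>t. 0 \<le> h t"
  "AE t in lborel. t \<in> {0<..<T} \<longrightarrow> (g has_real_derivative h t) (at t)"
  "\<forall>u v. 0 \<le> u \<and> u \<le> v \<and> v \<le> T \<longrightarrow> (\<integral>\<^sup>+t\<in>{u<..v}. ennreal (h t) \<partial>lborel) = ennreal (g v - g u)"
proof -
 \<comment> \<open>Extending \<open>g\<close> by constants beyond \<open>{0..T}\<close> produces a
   distribution function on the whole line.\<close>
 define F where "F = (\<lambda>x. g (max 0 (min T x)))"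
 have Fg: "F x = g x" if "x \<in> {0..T}" for x using that by (simp add: F_def)
 have mF: "mono F"
  using mono T by (auto simp: F_def mono_def mono_on_def)
 have contg: "continuous_on {0..T} g" by (rule abs_continuous_on_imp_continuous_on[OF ac])
 have cF: "continuous_on UNIV F"
  unfolding F_def by (rule continuous_on_compose2[OF contg]) (use T in \<open>auto intro!: continuous_intros\<close>)
 have acF: "abs_continuous_on 0 T F"
  unfolding abs_continuous_on_def
 proof (intro allI impI)
  let ?A = "\<lambda>P. \<forall>(u, v)\<in>P. 0 \<le> u \<and> u < v \<and> v \<le> T"
  fix e :: real assume e: "e > 0"
  obtain d where d: "d > 0" and dd: "\<And>P. finite P \<Longrightarrow> (?A P) \<Longrightarrow>
    disjoint_family_on (\<lambda>(u, v). {u<..<v}) P \<Longrightarrow> (\<Sum>(u, v)\<in>P. v - u) < d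
    \<Longrightarrow> (\<Sum>(u, v)\<in>P. \<bar>g v - g u\<bar>) < e"
   using ac e unfolding abs_continuous_on_def by meson
  show "\<exists>d>0. \<forall>P. finite P \<and> (?A P) \<and>
    disjoint_family_on (\<lambda>(u, v). {u<..<v}) P \<and> (\<Sum>(u, v)\<in>P. v - u) < d
    \<longrightarrow> (\<Sum>(u, v)\<in>P. \<bar>F v - F u\<bar>) < e"
  proof (intro exI[of _ d] conjI allI impI d)
   fix P assume P: "finite P \<and> (?A P) \<and>
    disjoint_family_on (\<lambda>(u, v). {u<..<v}) P \<and> (\<Sum>(u, v)\<in>P. v - u) < d"
   have "(\<Sum>(u, v)\<in>P. \<bar>F v - F u\<bar>) = (\<Sum>(u, v)\<in>P. \<bar>g v - g u\<bar>)"
    using P by (intro sum.cong) (auto simp: Fg)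
   also have "\<dots> < e" using P by (intro dd) auto
   finally show "(\<Sum>(u, v)\<in>P. \<bar>F v - F u\<bar>) < e" .
  qed
 qed
 have out: "F x = F 0" if "x \<le> 0" for x using that T by (simp add: F_def)
 have out2: "F x = F T" if "T \<le> x" for x using that T by (simp add: F_def)
 note acm = absolutely_continuous_interval_measure[OF T acF mF cF out out2]
 let ?M = "interval_measure F"
 interpret finite_measure ?M by (rule acm(2))
 obtain f where f[measurable]: "f \<in> borel_measurable lborel" and fM: "density lborel f = ?M"
  using sigma_finite_measure.Radon_Nikodym[OF sigma_finite_lborel acm(1)] by auto
 have "(\<integral>\<^sup>+x. f x \<partial>lborel) = emeasure (density lborel f) UNIV"
  by (subst emeasure_density) auto
 also have "\<dots> \<noteq> \<infinity>" by (simp add: fM emeasure_eq_measure)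
 finally have "AE x in lborel. f x \<noteq> \<infinity>" by (intro nn_integral_PInf_AE) auto
 then have ae: "AE x in lborel. f x = ennreal (enn2real (f x))"
  by eventually_elim (simp add: less_top)
 define h where "h = (\<lambda>t. enn2real (f t))"
 let ?B = "\<lambda>u v. \<integral>\<^sup>+t\<in>{u<..v}. ennreal (h t) \<partial>lborel"
 have h[measurable]: "h \<in> borel_measurable borel" and h0: "\<And>t. 0 \<le> h t" by (auto simp: h_def)
 have dens: "density lborel (\<lambda>t. ennreal (h t)) = ?M"
  unfolding fM[symmetric] h_def using ae by (intro density_cong) auto
 have der: "AE t in lborel. (F has_real_derivative h t) (at t)"
  by (rule AE_derivative_interval_measure[OF mF cF acm(2) h h0 dens])
 show thesis
 proof (rule that[OF h])
  show "\<forall>t. 0 \<le> h t" using h0 by simp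
  show "AE t in lborel. t \<in> {0<..<T} \<longrightarrow> (g has_real_derivative h t) (at t)"
   using der
  proof (eventually_elim, intro impI)
   fix t assume d: "(F has_real_derivative h t) (at t)" and t: "t \<in> {0<..<T}"
   have "eventually (\<lambda>x. F x = g x) (nhds t)"
    using t by (intro eventually_nhds_in_open[of "{0<..<T}", THEN eventually_mono]) (auto intro: Fg)
   then show "(g has_real_derivative h t) (at t)"
    using d t by (subst DERIV_cong_ev[OF refl _ refl, of g F]) (auto simp: eq_commute)
  qed
  show "\<forall>u v. 0 \<le> u \<and> u \<le> v \<and> v \<le> T \<longrightarrow> (?B u v) = ennreal (g v - g u)"
  proof (intro allI impI)
  fix u v assume uv: "0 \<le> u \<and> u \<le> v \<and> v \<le> T"
  have "(?B u v) = emeasure ?M {u<..v}"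
   by (subst dens[symmetric], subst emeasure_density) auto
  also have "\<dots> = ennreal (F v - F u)"
   using mF cF uv
    by (intro emeasure_interval_measure_Ioc) (auto simp: mono_def continuous_on_eq_continuous_at continuous_at_imp_continuous_within)
  finally show "(?B u v) = ennreal (g v - g u)"
   using uv by (simp add: Fg)
  qed
 qed
qed

section \<open>Measurability in the Skorokhod topology\<close>

text \<open>Bisection: the property passes to the union of two adjacent intervals, and near any
  \<open>t\<close> the right limit and the left limit make the single interior point
  \<open>t\<close> sufficient. Points of \<open>D\<close> may be jumps, hence the half-open
  \<open>{s<..u}\<close>: \<open>s\<close> may belong to \<open>D\<close>, \<open>u\<close> may
  not.\<close>

lemma cadlag_partition:
 assumes x: "x \<in> cadlag_space T" and T: "0 < T" and e: "0 < e"
 obtains D where "finite D" "0 \<in> D" "T \<in> D" "D \<subseteq> {0..T}"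
  "\<forall>s u. 0 \<le> s \<and> s < u \<and> u < T \<and> D \<inter> {s<..u} = {} \<longrightarrow> \<bar>x s - x u\<bar> < e"
proof -
 define Q where "Q a b D \<longleftrightarrow> finite D \<and> a \<in> D \<and> b \<in> D \<and> D \<subseteq> {a..b} \<and>
  (\<forall>s u. a \<le> s \<and> s < u \<and> u < b \<and> D \<inter> {s<..u} = {} \<longrightarrow> \<bar>x s - x u\<bar> < e)" for a b D
 define P where "P a b \<longleftrightarrow> 0 \<le> a \<and> a \<le> b \<and> b \<le> T \<longrightarrow> (\<exists>D. Q a b D)" for a b
 have "P 0 T"
 proof (rule Bolzano)
  show "0 \<le> T" using T by simp
 next
  fix a b c assume Pab: "P a b" and Pbc: "P b c" and ab: "a \<le> b" "b \<le> c"
  show "P a c" unfolding P_def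
  proof
   assume ac: "0 \<le> a \<and> a \<le> c \<and> c \<le> T"
   obtain D1 D2 where D: "Q a b D1" "Q b c D2" using Pab Pbc ab ac unfolding P_def by fastforce
   have "Q a c (D1 \<union> D2)" unfolding Q_def
   proof (intro conjI allI impI)
    show "finite (D1 \<union> D2)" "a \<in> D1 \<union> D2" "c \<in> D1 \<union> D2" using D by (auto simp: Q_def)
    show "D1 \<union> D2 \<subseteq> {a..c}" using D ab by (fastforce simp: Q_def)
    fix s u assume su: "a \<le> s \<and> s < u \<and> u < c \<and> (D1 \<union> D2) \<inter> {s<..u} = {}"
    have "\<not> (s < b \<and> b \<le> u)" using D su by (auto simp: Q_def)
    then consider "b \<le> s" | "u < b" by linarith
    then show "\<bar>x s - x u\<bar> < e"
    proof cases
     case 1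
     then show ?thesis using D(2) su unfolding Q_def by blast
    next
     case 2
     then show ?thesis using D(1) su unfolding Q_def by blast
    qed
   qed
   then show "\<exists>D. Q a c D" by blast
  qed
 next
  fix t assume t: "0 \<le> t" "t \<le> T"
  have right: "\<exists>d>0. \<forall>s. t < s \<and> s < t + d \<longrightarrow> \<bar>x s - x t\<bar> < e / 2" if "t < T"
  proof -
   have "eventually (\<lambda>s. dist (x s) (x t) < e / 2) (at_right t)" using x t that e by (fastforce simp: cadlag_space_def intro: tendstoD)
   then obtain b where "b > t" "\<And>s. t < s \<Longrightarrow> s < b \<Longrightarrow> dist (x s) (x t) < e / 2"
    unfolding eventually_at_right_field by auto
   then show ?thesis by (intro exI[of _ "b - t"]) (auto simp: dist_real_def)
  qed
  have left: "\<exists>d>0. \<exists>l. \<forall>s. t - d < s \<and> s < t \<longrightarrow> \<bar>x s - l\<bar> < e / 2" if t0: "0 < t"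
  proof -
   obtain l where "(x \<longlongrightarrow> l) (at_left t)" using x t t0 by (fastforce simp: cadlag_space_def)
   then have "eventually (\<lambda>s. dist (x s) l < e / 2) (at_left t)" using e by (intro tendstoD) auto
   then obtain b where "b < t" "\<And>s. b < s \<Longrightarrow> s < t \<Longrightarrow> dist (x s) l < e / 2"
    unfolding eventually_at_left_field by auto
   then show ?thesis by (intro exI[of _ "t - b"]) (auto simp: dist_real_def)
  qed
  have "\<exists>d>0. \<forall>s. t < T \<and> t < s \<and> s < t + d \<longrightarrow> \<bar>x s - x t\<bar> < e / 2"
   using right by (cases "t < T") (auto intro: exI[of _ 1])
  then obtain d1 where d1: "d1 > 0" "\<And>s. t < T \<Longrightarrow> t < s \<Longrightarrow> s < t + d1 \<Longrightarrow> \<bar>x s - x t\<bar> < e / 2" by blast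
  have "\<exists>d>0. \<exists>l. \<forall>s. 0 < t \<and> t - d < s \<and> s < t \<longrightarrow> \<bar>x s - l\<bar> < e / 2"
   using left by (cases "0 < t") (auto intro: exI[of _ 1])
  then obtain d2 l where d2: "d2 > 0" "\<And>s. 0 < t \<Longrightarrow> t - d2 < s \<Longrightarrow> s < t \<Longrightarrow> \<bar>x s - l\<bar> < e / 2" by blast
  show "\<exists>d>0. \<forall>a b. a \<le> t \<and> t \<le> b \<and> b - a < d \<longrightarrow> P a b"
  proof (intro exI[of _ "min d1 d2"] conjI allI impI)
   show "min d1 d2 > 0" using d1 d2 by simp
   fix a b assume ab: "a \<le> t \<and> t \<le> b \<and> b - a < min d1 d2"
   show "P a b" unfolding P_def
   proof
    assume 0: "0 \<le> a \<and> a \<le> b \<and> b \<le> T"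
    have "Q a b {a, t, b}" unfolding Q_def
    proof (intro conjI allI impI)
     fix s u assume su: "a \<le> s \<and> s < u \<and> u < b \<and> {a, t, b} \<inter> {s<..u} = {}"
     then have "\<not> (s < t \<and> t \<le> u)" by auto
     then consider "t < s" | "t = s" | "u < t" by linarith
     then show "\<bar>x s - x u\<bar> < e"
     proof cases
      case 1
      then have "\<bar>x s - x t\<bar> < e / 2" "\<bar>x u - x t\<bar> < e / 2" using su ab 0 by (intro d1(2); linarith)+
      then show ?thesis by linarith
     next
      case 2
      then have "\<bar>x u - x t\<bar> < e / 2" using su ab 0 by (intro d1(2); linarith)
      then show ?thesis unfolding 2[symmetric] using e by linarith
     next
      case 3
      then have "\<bar>x s - l\<bar> < e / 2" "\<bar>x u - l\<bar> < e / 2" using su ab 0 by (intro d2(2); linarith)+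
      then show ?thesis by linarith
     qed
    qed (use ab in auto)
    then show "\<exists>D. Q a b D" by blast
   qed
  qed
 qed
 then obtain D where "Q 0 T D" using T by (auto simp: P_def)
 then show thesis by (intro that[of D]) (auto simp: Q_def)
qed

lemma cadlag_bounded:
 assumes x: "x \<in> cadlag_space T" and T: "0 < T"
 obtains C where "\<forall>t\<in>{0..T}. \<bar>x t\<bar> \<le> C"
proof -
 obtain D where D: "finite D" "0 \<in> D" "T \<in> D" "D \<subseteq> {0..T}"
  and D5: "\<forall>s u. 0 \<le> s \<and> s < u \<and> u < T \<and> D \<inter> {s<..u} = {} \<longrightarrow> \<bar>x s - x u\<bar> < 1"
  by (rule cadlag_partition[OF x T zero_less_one])
 have "\<bar>x t\<bar> \<le> (\<Sum>d\<in>D. \<bar>x d\<bar>) + 1" if t: "t \<in> {0..T}" for t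
 proof -
  have mem: "\<bar>x d\<bar> \<le> (\<Sum>d\<in>D. \<bar>x d\<bar>)" if "d \<in> D" for d
   using that D(1) by (intro member_le_sum) auto
  define d where "d = Max (D \<inter> {..t})"
  have "d \<in> D \<inter> {..t}" unfolding d_def using D t by (intro Max_in) auto
  then have d: "d \<in> D" "d \<le> t" by auto
  show ?thesis
  proof (cases "t = T \<or> d = t")
   case True
   then show ?thesis using d D mem[of t] by auto
  next
   case False
   have "D \<inter> {d<..t} = {}"
   proof (rule equals0I)
    fix c assume c: "c \<in> D \<inter> {d<..t}"
    then have "c \<le> d" unfolding d_def using D(1) by (intro Max_ge) auto
    then show False using c by simp
   qed
   then have "\<bar>x d - x t\<bar> < 1" using D d False t D5 by (metis IntD1 D(4) atLeastAtMost_iff less_eq_real_def subsetD)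
   then show ?thesis using mem[OF d(1)] by linarith
  qed
 qed
 then show thesis by (intro that[of "(\<Sum>d\<in>D. \<bar>x d\<bar>) + 1"]) blast
qed

section \<open>Time changes and the Skorokhod distance\<close>

lemma time_changes_range:
 assumes l: "l \<in> time_changes T" and t: "t \<in> {0..T}"
 shows "l t \<in> {0..T}"
proof -
 have m: "mono_on {0..T} l" and l0: "l 0 = 0" "l T = T"
  using l by (auto simp: time_changes_def strict_mono_on_imp_mono_on)
 have "l 0 \<le> l t" "l t \<le> l T" using t by (auto intro!: mono_onD[OF m])
 then show ?thesis using l0 by simp
qed

lemma time_changes_image:
 assumes l: "l \<in> time_changes T" and T: "0 \<le> T"
 shows "l ` {0..T} = {0..T}"
proof
 show "l ` {0..T} \<subseteq> {0..T}" using time_changes_range[OF l] by auto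
 show "{0..T} \<subseteq> l ` {0..T}"
 proof
  fix y assume y: "y \<in> {0..T}"
  have "\<exists>x\<ge>0. x \<le> T \<and> l x = y"
   using l y T by (intro IVT') (auto simp: time_changes_def)
  then show "y \<in> l ` {0..T}" by auto
 qed
qed

lemma id_time_change: "(\<lambda>t. t) \<in> time_changes T"
 by (auto simp: time_changes_def strict_mono_on_def)

lemma comp_time_changes:
 assumes "l \<in> time_changes T" "k \<in> time_changes T"
 shows "(\<lambda>t. k (l t)) \<in> time_changes T"
 unfolding time_changes_def mem_Collect_eq
proof (intro conjI)
 show "strict_mono_on {0..T} (\<lambda>t. k (l t))"
  using assms time_changes_range[OF assms(1)] by (auto simp: time_changes_def strict_mono_on_def)
 show "continuous_on {0..T} (\<lambda>t. k (l t))"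
  by (rule continuous_on_compose2[of "{0..T}" k _ l]) (use assms time_changes_range[OF assms(1)] in \<open>auto simp: time_changes_def\<close>)
qed (use assms in \<open>auto simp: time_changes_def\<close>)

lemma inverse_time_change:
 assumes l: "l \<in> time_changes T" and T: "0 \<le> T"
 obtains k where "k \<in> time_changes T" "\<And>t. t \<in> {0..T} \<Longrightarrow> k (l t) = t" "\<And>t. t \<in> {0..T} \<Longrightarrow> l (k t) = t"
proof -
 let ?k = "inv_into {0..T} l"
 have sm: "strict_mono_on {0..T} l" and c: "continuous_on {0..T} l" and e: "l 0 = 0" "l T = T"
  using l by (auto simp: time_changes_def)
 have inj: "inj_on l {0..T}" by (rule strict_mono_on_imp_inj_on[OF sm])
 have im: "l ` {0..T} = {0..T}" by (rule time_changes_image[OF l T])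
 have kl: "?k (l t) = t" if "t \<in> {0..T}" for t using inj that by (rule inv_into_f_f)
 have lk: "l (?k t) = t" if "t \<in> {0..T}" for t using that im by (intro f_inv_into_f) auto
 have kr: "?k t \<in> {0..T}" if "t \<in> {0..T}" for t using that im by (intro inv_into_into) auto
 have "?k \<in> time_changes T" unfolding time_changes_def mem_Collect_eq
 proof (intro conjI)
  show "strict_mono_on {0..T} ?k"
  proof (rule strict_mono_onI)
   fix r s :: real assume rs: "r \<in> {0..T}" "s \<in> {0..T}" "r < s"
   show "?k r < ?k s" by (use strict_mono_on_leD[OF sm] kr rs lk in \<open>smt (verit)\<close>)
  qed
  have "continuous_on (l ` {0..T}) ?k" by (rule continuous_on_inv[OF c]) (use kl in auto)
  then show "continuous_on {0..T} ?k" unfolding im .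
  show "?k 0 = 0" using kl[of 0] e T by simp
  show "?k T = T" using kl[of T] e T by simp
 qed
 then show thesis using kl lk by (rule that)
qed

text \<open>\<open>skorokhod_dist\<close> is built from real-valued \<open>SUP\<close> and
  \<open>INF\<close>, which have their usual meaning only on bounded sets; boundedness of cadlag
  paths secures this.\<close>

lemma skorokhod_bounds:
 assumes x: "x \<in> cadlag_space T" and y: "y \<in> cadlag_space T" and T: "0 < T" and l: "l \<in> time_changes T"
 shows "bdd_above ((\<lambda>t. \<bar>l t - t\<bar>) ` {0..T})" "bdd_above ((\<lambda>t. \<bar>x t - y (l t)\<bar>) ` {0..T})"
proof -
 show "bdd_above ((\<lambda>t. \<bar>l t - t\<bar>) ` {0..T})"
  using time_changes_range[OF l] by (intro bdd_aboveI2[where M=T]) force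
 obtain C where C: "\<forall>t\<in>{0..T}. \<bar>x t\<bar> \<le> C" by (rule cadlag_bounded[OF x T])
 obtain C' where C': "\<forall>t\<in>{0..T}. \<bar>y t\<bar> \<le> C'" by (rule cadlag_bounded[OF y T])
 show "bdd_above ((\<lambda>t. \<bar>x t - y (l t)\<bar>) ` {0..T})"
 proof (rule bdd_aboveI2)
  fix t assume t: "t \<in> {0..T}"
  show "\<bar>x t - y (l t)\<bar> \<le> C + C'" using bspec[OF C t] bspec[OF C' time_changes_range[OF l t]] by linarith
 qed
qed

lemma skorokhod_dist_le:
 assumes x: "x \<in> cadlag_space T" and y: "y \<in> cadlag_space T" and T: "0 < T" and l: "l \<in> time_changes T"
  and 1: "\<And>t. t \<in> {0..T} \<Longrightarrow> \<bar>l t - t\<bar> \<le> e" and 2: "\<And>t. t \<in> {0..T} \<Longrightarrow> \<bar>x t - y (l t)\<bar> \<le> e"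
 shows "skorokhod_dist T x y \<le> e"
proof -
 let ?f = "\<lambda>l. max (SUP t\<in>{0..T}. \<bar>l t - t\<bar>) (SUP t\<in>{0..T}. \<bar>x t - y (l t)\<bar>)"
 have "skorokhod_dist T x y \<le> ?f l"
  unfolding skorokhod_dist_def
 proof (rule cINF_lower[OF _ l])
  show "bdd_below (?f ` time_changes T)"
  proof (rule bdd_belowI2)
   fix k assume k: "k \<in> time_changes T"
   have "\<bar>k 0 - 0\<bar> \<le> (SUP t\<in>{0..T}. \<bar>k t - t\<bar>)"
    using skorokhod_bounds(1)[OF x y T k] T by (intro cSUP_upper) auto
   then show "0 \<le> ?f k" by linarith
  qed
 qed
 also have "\<dots> \<le> e" using T 1 2 by (intro max.boundedI cSUP_least) auto
 finally show ?thesis .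
qed

lemma skorokhod_dist_lessE:
 assumes x: "x \<in> cadlag_space T" and y: "y \<in> cadlag_space T" and T: "0 < T"
  and less: "skorokhod_dist T x y < e"
 obtains l e' where "l \<in> time_changes T" "e' < e" "\<And>t. t \<in> {0..T} \<Longrightarrow> \<bar>l t - t\<bar> \<le> e'" "\<And>t. t \<in> {0..T} \<Longrightarrow> \<bar>x t - y (l t)\<bar> \<le> e'"
proof -
 let ?f = "\<lambda>l. max (SUP t\<in>{0..T}. \<bar>l t - t\<bar>) (SUP t\<in>{0..T}. \<bar>x t - y (l t)\<bar>)"
 obtain l where l: "l \<in> time_changes T" "?f l < e" using id_time_change cInf_lessD[of "?f ` time_changes T" e] less unfolding skorokhod_dist_def by blast
 show thesis
 proof (rule that[OF l])
  fix t assume t: "t \<in> {0..T}"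
  have "\<bar>l t - t\<bar> \<le> (SUP t\<in>{0..T}. \<bar>l t - t\<bar>)"
   using skorokhod_bounds(1)[OF x y T l(1)] t by (intro cSUP_upper) auto
  then show "\<bar>l t - t\<bar> \<le> ?f l" by linarith
  have "\<bar>x t - y (l t)\<bar> \<le> (SUP t\<in>{0..T}. \<bar>x t - y (l t)\<bar>)"
   using skorokhod_bounds(2)[OF x y T l(1)] t by (intro cSUP_upper) auto
  then show "\<bar>x t - y (l t)\<bar> \<le> ?f l" by linarith
 qed
qed

lemma skorokhod_dist_le_sup:
 assumes x: "x \<in> cadlag_space T" and y: "y \<in> cadlag_space T" and T: "0 < T"
  and "\<And>t. t \<in> {0..T} \<Longrightarrow> \<bar>x t - y t\<bar> \<le> e"
 shows "skorokhod_dist T x y \<le> e"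
proof (rule skorokhod_dist_le[OF x y T id_time_change])
 fix t :: real
 show "\<bar>t - t\<bar> \<le> e" using assms(4)[of 0] T by auto
qed (use assms(4) in auto)

text \<open>The inverse of a time change is a time change. Symmetry and the triangle inequality are
  stated with strict upper bounds because such a bound is witnessed by a single time change, while
  the infimum need not be attained.\<close>

lemma skorokhod_dist_sym_less:
 assumes x: "x \<in> cadlag_space T" and y: "y \<in> cadlag_space T" and T: "0 < T"
  and less: "skorokhod_dist T x y < e"
 shows "skorokhod_dist T y x < e"
proof -
 obtain l e' where l: "l \<in> time_changes T" "e' < e" "\<And>t. t \<in> {0..T} \<Longrightarrow> \<bar>l t - t\<bar> \<le> e'" "\<And>t. t \<in> {0..T} \<Longrightarrow> \<bar>x t - y (l t)\<bar> \<le> e'"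
  using skorokhod_dist_lessE[OF x y T less] by metis
 obtain k where k: "k \<in> time_changes T" "\<And>t. t \<in> {0..T} \<Longrightarrow> l (k t) = t"
  using inverse_time_change[OF l(1)] T by (metis less_imp_le)
 have "skorokhod_dist T y x \<le> e'"
 proof (rule skorokhod_dist_le[OF y x T k(1)])
  fix t assume t: "t \<in> {0..T}"
  have kt: "k t \<in> {0..T}" by (rule time_changes_range[OF k(1) t])
  show "\<bar>k t - t\<bar> \<le> e'" using l(3)[OF kt] k(2)[OF t] by (simp add: abs_minus_commute)
  show "\<bar>y t - x (k t)\<bar> \<le> e'" using l(4)[OF kt] k(2)[OF t] by (simp add: abs_minus_commute)
 qed
 then show ?thesis using l(2) by simp
qed

lemma skorokhod_dist_triangle_less:
 assumes x: "x \<in> cadlag_space T" and y: "y \<in> cadlag_space T" and z: "z \<in> cadlag_space T" and T: "0 < T"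
  and 1: "skorokhod_dist T x y < a" and 2: "skorokhod_dist T y z < b"
 shows "skorokhod_dist T x z < a + b"
proof -
 obtain l a' where l: "l \<in> time_changes T" "a' < a" "\<And>t. t \<in> {0..T} \<Longrightarrow> \<bar>l t - t\<bar> \<le> a'" "\<And>t. t \<in> {0..T} \<Longrightarrow> \<bar>x t - y (l t)\<bar> \<le> a'"
  using skorokhod_dist_lessE[OF x y T 1] by metis
 obtain k b' where k: "k \<in> time_changes T" "b' < b" "\<And>t. t \<in> {0..T} \<Longrightarrow> \<bar>k t - t\<bar> \<le> b'" "\<And>t. t \<in> {0..T} \<Longrightarrow> \<bar>y t - z (k t)\<bar> \<le> b'"
  using skorokhod_dist_lessE[OF y z T 2] by metis
 have "skorokhod_dist T x z \<le> a' + b'"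
 proof (rule skorokhod_dist_le[OF x z T comp_time_changes[OF l(1) k(1)]])
  fix t assume t: "t \<in> {0..T}"
  have lt: "l t \<in> {0..T}" by (rule time_changes_range[OF l(1) t])
  show "\<bar>k (l t) - t\<bar> \<le> a' + b'" using l(3)[OF t] k(3)[OF lt] by linarith
  show "\<bar>x t - z (k (l t))\<bar> \<le> a' + b'" using l(4)[OF t] k(4)[OF lt] by linarith
 qed
 then show ?thesis using l(2) k(2) by simp
qed

section \<open>Discretisation on grids and measurability of open sets\<close>

definition grid_step :: "real \<Rightarrow> nat \<Rightarrow> (nat \<Rightarrow> real) \<Rightarrow> real \<Rightarrow> real" where
 "grid_step T m v = (\<lambda>t\<in>{0..T}. v (nat \<lfloor>t * real m / T\<rfloor>))"

lemma grid_step_cadlag: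
 assumes T: "0 < T" and m: "m > 0"
 shows "grid_step T m v \<in> cadlag_space T"
 unfolding cadlag_space_def mem_Collect_eq
proof (intro conjI ballI)
 show "grid_step T m v \<in> extensional {0..T}" by (simp add: grid_step_def)
 define c where "c = real m / T"
 have c: "c > 0" using T m by (simp add: c_def)
 fix t assume t: "t \<in> {0..<T}"
 let ?j = "\<lfloor>t * c\<rfloor>"
 have "eventually (\<lambda>s. s \<in> {t<..<min T ((?j + 1) / c)}) (at_right t)" using c t by (fastforce simp: pos_less_divide_eq intro: eventually_at_right_real)
 then have "eventually (\<lambda>s. grid_step T m v s = grid_step T m v t) (at_right t)"
 proof eventually_elim
  fix s assume s: "s \<in> {t<..<min T ((?j + 1) / c)}"
  have "\<lfloor>s * c\<rfloor> = ?j"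
  proof (rule floor_unique)
   have "t * c \<le> s * c" using s c by (intro mult_right_mono) auto
   then show "of_int ?j \<le> s * c" by linarith
   show "s * c < of_int ?j + 1" using s c by (simp add: pos_less_divide_eq)
  qed
  then show "grid_step T m v s = grid_step T m v t" using s t by (simp add: grid_step_def c_def)
 qed
 then show "(grid_step T m v \<longlongrightarrow> grid_step T m v t) (at_right t)" by (rule tendsto_eventually)
next
 define c where "c = real m / T"
 have c: "c > 0" using T m by (simp add: c_def)
 fix t assume t: "t \<in> {0<..T}"
 let ?j = "\<lceil>t * c\<rceil> - 1"
 have "?j / c < t" using c by (simp add: pos_divide_less_eq) linarith
 then have "eventually (\<lambda>s. s \<in> {max 0 (?j / c)<..<t}) (at_left t)"
  using t by (intro eventually_at_left_real) auto
 then have "eventually (\<lambda>s. grid_step T m v s = v (nat ?j)) (at_left t)"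
 proof eventually_elim
  fix s assume s: "s \<in> {max 0 (?j / c)<..<t}"
  have "\<lfloor>s * c\<rfloor> = ?j"
  proof (rule floor_unique)
   show "of_int ?j \<le> s * c" using s c by (simp add: pos_divide_less_eq)
   have "s * c < t * c" using s c by (intro mult_strict_right_mono) auto
   then show "s * c < of_int ?j + 1" by linarith
  qed
  then show "grid_step T m v s = v (nat ?j)" using s t by (simp add: grid_step_def c_def)
 qed
 then show "\<exists>l. (grid_step T m v \<longlongrightarrow> l) (at_left t)" by (intro exI tendsto_eventually)
qed

text \<open>Sampling on a grid misplaces jumps by up to one mesh, which the supremum norm does not
  forgive but a time change does. It moves each partition point \<open>d\<close> to the next grid
  point \<open>c d\<close>; afterwards a path value and the sampled value replacing it come from the
  same cell of the partition.\<close>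

lemma grid_step_approximates:
 assumes x: "x \<in> cadlag_space T" and T: "0 < T" and e: "0 < e"
 shows "eventually (\<lambda>m. skorokhod_dist T x (grid_step T m (\<lambda>j. x (real j * T / real m))) \<le> e) sequentially"
proof -
 obtain D where D: "finite D" "0 \<in> D" "T \<in> D" "D \<subseteq> {0..T}"
  and D5: "\<forall>s u. 0 \<le> s \<and> s < u \<and> u < T \<and> D \<inter> {s<..u} = {} \<longrightarrow> \<bar>x s - x u\<bar> < e"
  by (rule cadlag_partition[OF x T e])
 \<comment> \<open>The minimal gap of \<open>D\<close> becomes the radius of the tent functions
   \<open>hat\<close>, so that at a point of \<open>D\<close> only its own tent is nonzero.\<close>
 define w where "w = Min (insert T {\<bar>p - q\<bar> |p q. p \<in> D \<and> q \<in> D \<and> p \<noteq> q})"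
 have finw: "finite {\<bar>p - q\<bar> |p q. p \<in> D \<and> q \<in> D \<and> p \<noteq> q}"
  by (rule finite_subset[of _ "(\<lambda>(p, q). \<bar>p - q\<bar>) ` (D \<times> D)"]) (use D(1) in auto)
 have w: "w > 0" unfolding w_def using finw T by (subst Min_gr_iff) auto
 have wgap: "w \<le> \<bar>p - q\<bar>" if "p \<in> D" "q \<in> D" "p \<noteq> q" for p q
  unfolding w_def using finw that by (intro Min_le) auto
 define N where "N = real (card D)"
 have N: "N \<ge> 1" unfolding N_def using D(1,2) by (simp add: Suc_le_eq card_gt_0_iff) blast
 have "((\<lambda>m. N * T / real m) \<longlongrightarrow> 0) sequentially" by (rule lim_const_over_n)
 then have "eventually (\<lambda>m. N * T / real m < min w e) sequentially" using w e by (intro order_tendstoD) auto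
 then show ?thesis using eventually_gt_at_top[of 0]
 proof eventually_elim
  fix m :: nat assume m1: "N * T / real m < min w e" and m: "0 < m"
  define \<mu> where "\<mu> = T / real m"
  \<comment> \<open>\<open>N * \<mu> < w\<close> keeps the Lipschitz constant of the displacement
    \<open>p\<close> below one, so that \<open>l\<close> is increasing; \<open>N * \<mu> < e\<close>
    keeps the displacement itself small.\<close>
  have \<mu>: "\<mu> > 0" "N * \<mu> < w" "N * \<mu> < e" using m T m1 by (auto simp: \<mu>_def)
  define c where "c d = real_of_int \<lceil>d / \<mu>\<rceil> * \<mu>" for d
  have c1: "d \<le> c d" "c d < d + \<mu>" for d
  proof -
   have "d / \<mu> \<le> \<lceil>d / \<mu>\<rceil>" "\<lceil>d / \<mu>\<rceil> < d / \<mu> + 1" by linarith+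
   then have "d / \<mu> * \<mu> \<le> \<lceil>d / \<mu>\<rceil> * \<mu>" "\<lceil>d / \<mu>\<rceil> * \<mu> < (d / \<mu> + 1) * \<mu>"
    using \<mu>(1) by (intro mult_right_mono mult_strict_right_mono; simp)+
   then show "d \<le> c d" "c d < d + \<mu>" using \<mu>(1) by (simp_all add: c_def distrib_right)
  qed
  have T\<mu>: "T / \<mu> = real m" using T m by (simp add: \<mu>_def)
  have cT: "c T = T" unfolding c_def T\<mu> using m by (simp add: \<mu>_def)
  have c0: "c 0 = 0" by (simp add: c_def)
  define hat where "hat d t = max 0 (1 - \<bar>t - d\<bar> / w)" for d t :: real
  have hat_lip: "\<bar>hat d t - hat d s\<bar> \<le> \<bar>t - s\<bar> / w" for d t s
  proof -
   have "\<bar>hat d t - hat d s\<bar> \<le> \<bar>\<bar>t - d\<bar> / w - \<bar>s - d\<bar> / w\<bar>" unfolding hat_def by linarith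
   also have "\<dots> \<le> \<bar>t - s\<bar> / w" using w w by (auto simp: diff_divide_distrib[symmetric] intro!: divide_right_mono)
   finally show ?thesis .
  qed
  have hat01: "0 \<le> hat d t" "hat d t \<le> 1" for d t using w by (auto simp: hat_def)
  have hat_self: "hat d d = 1" for d by (simp add: hat_def)
  have hat_other: "hat d d' = 0" if "d \<in> D" "d' \<in> D" "d \<noteq> d'" for d d'
   by (use wgap[OF that(2,1)] that w in \<open>simp add: hat_def\<close>)
  define p where "p t = (\<Sum>d\<in>D. (c d - d) * hat d t)" for t
  define l where "l t = t + p t" for t
  have cd: "\<bar>c d - d\<bar> \<le> \<mu>" for d using c1[of d] by linarith
  have pD: "p d = c d - d" if "d \<in> D" for d
  proof -
   have "p d = (\<Sum>d'\<in>D. if d' = d then c d - d else 0)" unfolding p_def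
    using that hat_other hat_self by (intro sum.cong) auto
   then show ?thesis using that D(1) by simp
  qed
  have lD: "l d = c d" if "d \<in> D" for d using pD[OF that] by (simp add: l_def)
  have plip: "\<bar>p t - p s\<bar> \<le> (N * \<mu> / w) * \<bar>t - s\<bar>" for t s
  proof -
   have "\<bar>p t - p s\<bar> = \<bar>\<Sum>d\<in>D. (c d - d) * (hat d t - hat d s)\<bar>"
    by (simp add: p_def sum_subtractf right_diff_distrib)
   also have "\<dots> \<le> (\<Sum>d\<in>D. \<bar>(c d - d) * (hat d t - hat d s)\<bar>)" by (rule sum_abs)
   also have "\<dots> \<le> (\<Sum>d\<in>D. \<mu> * (\<bar>t - s\<bar> / w))"
    unfolding abs_mult using cd hat_lip \<mu>(1) by (intro sum_mono mult_mono) auto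
   also have "\<dots> = (N * \<mu> / w) * \<bar>t - s\<bar>" by (simp add: N_def)
   finally show ?thesis .
  qed
  have q1: "N * \<mu> / w < 1" using \<mu> w by simp
  have lmono: "l s < l t" if "s < t" for s t
  proof -
   have "\<bar>p t - p s\<bar> < t - s"
   proof -
    have "(N * \<mu> / w) * \<bar>t - s\<bar> < 1 * \<bar>t - s\<bar>" using q1 that by (intro mult_strict_right_mono) auto
    with plip[of t s] show ?thesis using that by simp
   qed
   then show ?thesis by (simp add: l_def)
  qed
  have ltc: "l \<in> time_changes T" unfolding time_changes_def mem_Collect_eq
   by (use lmono w lD[OF D(2)] c0 lD[OF D(3)] cT in \<open>auto simp: strict_mono_on_def l_def p_def hat_def intro!: conjI continuous_intros\<close>)
  have pb: "\<bar>p t\<bar> \<le> e" for t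
  proof -
   have "\<bar>p t\<bar> \<le> (\<Sum>d\<in>D. \<bar>(c d - d) * hat d t\<bar>)" unfolding p_def by (rule sum_abs)
   also have "\<dots> \<le> (\<Sum>d\<in>D. \<mu> * 1)" unfolding abs_mult using cd hat01 \<mu>(1) by (intro sum_mono mult_mono) auto
   also have "\<dots> = N * \<mu>" by (simp add: N_def)
   finally show ?thesis using \<mu>(3) by linarith
  qed
  show "skorokhod_dist T x (grid_step T m (\<lambda>j. x (real j * T / real m))) \<le> e"
  proof (rule skorokhod_dist_le[OF x grid_step_cadlag[OF T m] T ltc])
   fix t assume t: "t \<in> {0..T}"
   show "\<bar>l t - t\<bar> \<le> e" using pb[of t] by (simp add: l_def)
   have lt: "l t \<in> {0..T}" by (rule time_changes_range[OF ltc t])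
   \<comment> \<open>\<open>s\<close> is the time that the grid function samples at
     \<open>l t\<close>. No partition point \<open>d\<close> lies between \<open>s\<close> and
     \<open>t\<close>: since \<open>l d = c d\<close> is a grid point and \<open>l\<close> is
     increasing, \<open>d \<le> t\<close> forces \<open>c d \<le> s\<close>, and
     \<open>t < d\<close> forces \<open>s < d\<close>.\<close>
   define s where "s = real_of_int \<lfloor>l t / \<mu>\<rfloor> * \<mu>"
   have fl0: "\<lfloor>l t / \<mu>\<rfloor> \<ge> 0" using lt \<mu> by simp
   have s1: "s \<le> l t" "l t < s + \<mu>" "0 \<le> s"
   proof -
    have "\<lfloor>l t / \<mu>\<rfloor> \<le> l t / \<mu>" "l t / \<mu> < \<lfloor>l t / \<mu>\<rfloor> + 1" by linarith+
    then have "\<lfloor>l t / \<mu>\<rfloor> * \<mu> \<le> l t / \<mu> * \<mu>" "l t / \<mu> * \<mu> < (\<lfloor>l t / \<mu>\<rfloor> + 1) * \<mu>"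
     using \<mu>(1) by (intro mult_right_mono mult_strict_right_mono; simp)+
    then show "s \<le> l t" "l t < s + \<mu>" using \<mu>(1) by (simp_all add: s_def distrib_right)
    show "0 \<le> s" using fl0 \<mu> by (simp add: s_def)
   qed
   have gs: "grid_step T m (\<lambda>j. x (real j * T / real m)) (l t) = x s"
    by (use lt fl0 in \<open>simp add: grid_step_def s_def \<mu>_def\<close>)
   have sgrid2: "c d \<le> s" if "c d \<le> l t" for d
    by (use that \<mu>(1) \<mu>(1) in \<open>auto simp: c_def pos_le_divide_eq le_floor_iff c_def s_def\<close>)
   have sgrid3: "s < d" if "l t < c d" for d
   proof -
    have "\<lfloor>l t / \<mu>\<rfloor> < \<lceil>d / \<mu>\<rceil>"
    proof -
     have "l t / \<mu> < \<lceil>d / \<mu>\<rceil>" using that \<mu>(1) by (simp add: c_def pos_divide_less_eq)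
     then show ?thesis by linarith
    qed
    then show ?thesis using \<mu>(1) by (auto simp: less_ceiling_iff s_def pos_less_divide_eq)
   qed
   show "\<bar>x t - grid_step T m (\<lambda>j. x (real j * T / real m)) (l t)\<bar> \<le> e"
   proof (cases "t = T")
    case True
    show ?thesis using True lD[OF D(3)] cT T\<mu> m gs True e by (simp add: s_def) (simp add: \<mu>_def)
   next
    case False
    then have tT: "t < T" using t by simp
    have sT: "s < T" using lmono[OF tT] lD[OF D(3)] cT s1 by linarith
    consider "t = s" | "t < s" | "s < t" by linarith
    then show ?thesis
    proof cases
     case 1
     then show ?thesis using gs e by simp
    next
     case 2
     have "D \<inter> {t<..s} = {}" by (use equals0I lmono lD sgrid3 in \<open>fastforce\<close>)
     then show ?thesis using D5 t 2 sT gs by fastforce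
    next
     case 3
     have "D \<inter> {s<..t} = {}"
     proof (rule equals0I)
      fix d assume d: "d \<in> D \<inter> {s<..t}"
      then have "c d \<le> l t" using lmono[of d t] lD[of d] by (cases "d = t") auto
      then have "c d \<le> s" by (rule sgrid2)
      then show False using d c1[of d] by simp
     qed
     then show ?thesis using D5 s1 3 tT gs by fastforce
    qed
   qed
  qed
 qed
qed

text \<open>A path lies in \<open>U\<close> iff for some radius its grid samplings eventually have
  the ball of that radius inside \<open>U\<close>. On a fixed grid this is a closed condition on
  finitely many coordinates, hence Borel, and only countable operations remain. The completion
  absorbs the null event on which the path is not cadlag.\<close>

lemma J1_open_measurable:
 assumes T: "0 < T" and U: "openin (J1_topology T) U"
  and Xm: "\<And>t. t \<in> {0..T} \<Longrightarrow> (\<lambda>w. X w t) \<in> borel_measurable M"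
  and Xc: "AE w in M. X w \<in> cadlag_space T"
 shows "{w \<in> space M. X w \<in> U} \<in> sets (completion M)"
proof -
 let ?A = "{w \<in> space M. X w \<in> U}"
 have Usub: "U \<subseteq> cadlag_space T" and Uo: "\<And>x. x \<in> U \<Longrightarrow> \<exists>e>0. \<forall>y\<in>cadlag_space T. skorokhod_dist T x y < e \<longrightarrow> y \<in> U"
  using U unfolding openin_J1_topology by auto
 \<comment> \<open>By convention the radius \<open>1 / real k\<close> is zero for
   \<open>k = 0\<close>, so membership is tested at \<open>Suc k\<close> below.\<close>
 define Uk where "Uk k = {y \<in> cadlag_space T. \<forall>z\<in>cadlag_space T. skorokhod_dist T y z < 1 / real k \<longrightarrow> z \<in> U}" for k :: nat
 \<comment> \<open>Coordinates beyond \<open>m\<close> are never read by \<open>grid_step\<close> on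
   \<open>{0..T}\<close>; the value zero there makes \<open>V m\<close> a measurable map into the
   product space.\<close>
 define V where "V m w = (\<lambda>j. if j \<le> m then X w (real j * T / real m) else 0)" for m :: nat and w
 define p where "p m w = grid_step T m (V m w)" for m w
 have nat_le: "nat \<lfloor>t * real m / T\<rfloor> \<le> m" if "t \<in> {0..T}" for t and m :: nat
 proof -
  have "t * real m / T \<le> T * real m / T" using that T by (intro divide_right_mono mult_right_mono) auto
  then have "t * real m / T \<le> real m" using T by simp
  then show ?thesis by linarith
 qed
 have peq: "p m w = grid_step T m (\<lambda>j. X w (real j * T / real m))" for m w
  unfolding p_def grid_step_def V_def using nat_le by (intro restrict_ext) auto
 have Vm: "V m \<in> borel_measurable M" for m
 proof (rule measurable_coordinatewise_then_product)
  fix j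
  have "real j * T / real m \<in> {0..T}" if "j \<le> m"
   using that T by (cases "m = 0") (auto simp: divide_le_eq mult_right_mono)
  then show "(\<lambda>w. V m w j) \<in> borel_measurable M"
   unfolding V_def by (cases "j \<le> m") (auto intro: Xm)
 qed
 have closed: "closed {v. grid_step T m v \<in> Uk k}" if m: "m > 0" for m k
  unfolding closed_sequential_limits
 proof (intro allI impI, elim conjE)
  fix vs :: "nat \<Rightarrow> nat \<Rightarrow> real" and v assume vs: "\<forall>n. vs n \<in> {v. grid_step T m v \<in> Uk k}" and lim: "vs \<longlonglongrightarrow> v"
  have coord: "(\<lambda>n. vs n j) \<longlonglongrightarrow> v j" for j
   using continuous_on_tendsto_compose[OF continuous_on_product_coordinates[of j] lim] by simp
  have "grid_step T m v \<in> Uk k" unfolding Uk_def mem_Collect_eq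
  proof (intro conjI ballI impI)
   show c: "grid_step T m v \<in> cadlag_space T" by (rule grid_step_cadlag[OF T m])
   fix z assume z: "z \<in> cadlag_space T" and d: "skorokhod_dist T (grid_step T m v) z < 1 / real k"
   obtain r where r: "skorokhod_dist T (grid_step T m v) z < r" "r < 1 / real k" using dense[OF d] by blast
   \<comment> \<open>Half of the slack between \<open>r\<close> and \<open>1 / real k\<close>: one
     half pays for passing to \<open>vs n\<close>, the other makes the inequality strict.\<close>
   define h where "h = (1 / real k - r) / 2"
   have h: "h > 0" using r by (simp add: h_def)
   have "eventually (\<lambda>n. \<forall>j\<in>{..m}. dist (vs n j) (v j) < h) sequentially"
    using coord h by (intro eventually_ball_finite ballI tendstoD) auto
   then obtain n where n: "\<And>j. j \<le> m \<Longrightarrow> \<bar>vs n j - v j\<bar> < h"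
    by (auto simp: eventually_sequentially dist_real_def)
   have "skorokhod_dist T (grid_step T m (vs n)) (grid_step T m v) \<le> h"
    by ((rule skorokhod_dist_le_sup[OF grid_step_cadlag[OF T m] c T]), (use n[OF nat_le[OF ]] in \<open>simp add: grid_step_def less_imp_le\<close>))
   then have "skorokhod_dist T (grid_step T m (vs n)) z < 2 * h + r" using h r by (intro skorokhod_dist_triangle_less[OF grid_step_cadlag[OF T m] c z T]) auto
   also have "2 * h + r = 1 / real k" by (simp add: h_def field_simps)
   finally show "z \<in> U" using vs z unfolding Uk_def by auto
  qed
  then show "v \<in> {v. grid_step T m v \<in> Uk k}" by simp
 qed
 have meas: "{w \<in> space M. p m w \<in> Uk k} \<in> sets M" if m: "m > 0" for m k
 proof -
  have "{w \<in> space M. p m w \<in> Uk k} = V m -` {v. grid_step T m v \<in> Uk k} \<inter> space M" by (auto simp: p_def)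
  then show ?thesis using measurable_sets[OF Vm borel_closed[OF closed[OF m]]] by simp
 qed
 define W where "W = {w \<in> space M. \<exists>k. \<exists>m0. \<forall>m. p (Suc (m0 + m)) w \<in> Uk (Suc k)}"
 have Wm: "W \<in> sets M" by (use meas in \<open>auto simp: W_def\<close>)
 have key: "X w \<in> U \<longleftrightarrow> (\<exists>k. \<exists>m0. \<forall>m. p (Suc (m0 + m)) w \<in> Uk (Suc k))" if xc: "X w \<in> cadlag_space T" for w
 proof -
  have pc: "p m w \<in> cadlag_space T" if "m > 0" for m unfolding p_def by (rule grid_step_cadlag[OF T that])
  have ev: "eventually (\<lambda>m. skorokhod_dist T (X w) (p m w) < e) sequentially" if "e > 0" for e
  proof -
   have "eventually (\<lambda>m. skorokhod_dist T (X w) (p m w) \<le> e / 2) sequentially"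
    unfolding peq using grid_step_approximates[OF xc T, of "e / 2"] that by simp
   then show ?thesis by eventually_elim (use that in simp)
  qed
  show ?thesis
  proof
   assume "X w \<in> U"
   then obtain e where e: "e > 0" "\<forall>y\<in>cadlag_space T. skorokhod_dist T (X w) y < e \<longrightarrow> y \<in> U" using Uo by blast
   obtain k :: nat where k: "1 / real (Suc k) < e / 2" using nat_approx_posE[of "e / 2"] e(1) by auto
   obtain m0 where m0: "\<And>m. m \<ge> m0 \<Longrightarrow> skorokhod_dist T (X w) (p m w) < e / 2"
    using ev[of "e / 2"] e(1) by (auto simp: eventually_sequentially)
   have "p (Suc (m0 + m)) w \<in> Uk (Suc k)" for m unfolding Uk_def mem_Collect_eq
   proof (intro conjI ballI impI)
    show "p (Suc (m0 + m)) w \<in> cadlag_space T" by (rule pc) simp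
    fix z assume z: "z \<in> cadlag_space T" "skorokhod_dist T (p (Suc (m0 + m)) w) z < 1 / real (Suc k)"
    have "skorokhod_dist T (X w) (p (Suc (m0 + m)) w) < e / 2" by (rule m0) simp
    moreover have "skorokhod_dist T (p (Suc (m0 + m)) w) z < e / 2" using z(2) k by (rule less_trans)
    ultimately have "skorokhod_dist T (X w) z < e / 2 + e / 2"
     by (rule skorokhod_dist_triangle_less[OF xc pc[OF zero_less_Suc] z(1) T])
    then show "z \<in> U" using e(2) z(1) by simp
   qed
   then show "\<exists>k. \<exists>m0. \<forall>m. p (Suc (m0 + m)) w \<in> Uk (Suc k)" by blast
  next
   assume "\<exists>k. \<exists>m0. \<forall>m. p (Suc (m0 + m)) w \<in> Uk (Suc k)"
   then obtain k m0 where km: "\<And>m. p (Suc (m0 + m)) w \<in> Uk (Suc k)" by blast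
   obtain m1 where m1: "\<And>m. m \<ge> m1 \<Longrightarrow> skorokhod_dist T (X w) (p m w) < 1 / real (Suc k)"
    using ev[of "1 / real (Suc k)"] by (auto simp: eventually_sequentially)
   have "skorokhod_dist T (X w) (p (Suc (m0 + m1)) w) < 1 / real (Suc k)" by (rule m1) simp
   then show "X w \<in> U" using km[of m1] xc unfolding Uk_def by (auto intro!: skorokhod_dist_sym_less[OF xc pc T])
  qed
 qed
 obtain N where N: "N \<in> null_sets M" "{w \<in> space M. X w \<notin> cadlag_space T} \<subseteq> N"
  using Xc unfolding eventually_ae_filter by blast
 have "?A = (W - N) \<union> (?A \<inter> N)"
  using N(2) key Usub by (auto simp: W_def)
 moreover have "(W - N) \<union> (?A \<inter> N) \<in> sets (completion M)"
 proof (rule sets.Un)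
  show "W - N \<in> sets (completion M)" using Wm N(1) by (intro sets_completionI_sets) auto
  show "?A \<inter> N \<in> sets (completion M)"
   using N(1) by (intro sets_completionI[of _ "{}" _ N]) auto
 qed
 ultimately show ?thesis by simp
qed

section \<open>The lower bound in Cramer's theorem\<close>

lemma elog_exp [simp]: "elog (ennreal (exp b)) = ereal b"
 by (simp add: elog_def)

lemma elog_mono: "x \<le> y \<Longrightarrow> elog x \<le> elog y"
proof -
 assume xy: "x \<le> y"
 consider "x = 0" | "y = \<infinity>" | "x \<noteq> 0" "y \<noteq> \<infinity>" by blast
 then show ?thesis
  by (use xy in \<open>auto simp: top_unique less_top enn2real_positive_iff zero_less_iff_neq_zero elog_def intro!: enn2real_mono\<close>)
qed

lemma elog_ennreal: "x > 0 \<Longrightarrow> elog (ennreal x) = ereal (ln x)"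
 by (simp add: elog_def)

lemma elog_le_iff_exp: "elog x \<le> ereal b \<longleftrightarrow> x \<le> ennreal (exp b)"
proof
 show "x \<le> ennreal (exp b) \<Longrightarrow> elog x \<le> ereal b" using elog_mono[of x "ennreal (exp b)"] by simp
next
 assume b: "elog x \<le> ereal b"
 show "x \<le> ennreal (exp b)"
 proof (cases x)
  case (real r)
  show ?thesis
  proof (cases "r = 0")
   case False
   then have "ln r \<le> b" using b real by (simp add: elog_ennreal)
   then have "r \<le> exp b" using False real by (metis exp_le_cancel_iff exp_ln less_eq_real_def)
   then show ?thesis using real by (simp add: ennreal_leI)
  qed (use real in simp)
 qed (use b in \<open>simp add: elog_def\<close>)
qed

lemma elog_ge_iff_exp: "ereal b \<le> elog x \<longleftrightarrow> ennreal (exp b) \<le> x"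
proof
 show "ennreal (exp b) \<le> x \<Longrightarrow> ereal b \<le> elog x" using elog_mono[of "ennreal (exp b)" x] by simp
next
 assume b: "ereal b \<le> elog x"
 show "ennreal (exp b) \<le> x"
 proof (cases x)
  case (real r)
  have "r \<noteq> 0" using b real by (auto simp: elog_def)
  then have "b \<le> ln r" using b real by (simp add: elog_ennreal)
  then have "exp b \<le> r" using \<open>r \<noteq> 0\<close> real by (metis exp_le_cancel_iff exp_ln less_eq_real_def)
  then show ?thesis using real by (simp add: ennreal_leI)
 qed simp
qed

text \<open>Weighting by the product of the \<open>w (Y k \<omega>)\<close> is an unnormalised
  change of measure. The centring condition kills the off-diagonal terms of the squared sum, and
  each diagonal term is at most \<open>D\<^sup>2 * z ^ card I\<close>.\<close>

lemma (in prob_space) tilted_second_moment: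
 fixes Y :: "'i \<Rightarrow> 'a \<Rightarrow> 'n" and w d :: "'n \<Rightarrow> real"
 assumes I: "finite I" and ind: "indep_vars (\<lambda>_. N) Y I"
  and w[measurable]: "w \<in> borel_measurable N" and d[measurable]: "d \<in> borel_measurable N"
  and wB: "\<And>y. y \<in> space N \<Longrightarrow> 0 \<le> w y \<and> w y \<le> B" and dB: "\<And>y. y \<in> space N \<Longrightarrow> \<bar>d y\<bar> \<le> D"
  and z: "\<And>k. k \<in> I \<Longrightarrow> expectation (\<lambda>\<omega>. w (Y k \<omega>)) = z"
  and zd: "\<And>k. k \<in> I \<Longrightarrow> expectation (\<lambda>\<omega>. w (Y k \<omega>) * d (Y k \<omega>)) = 0"
 shows "integrable M (\<lambda>\<omega>. (\<Prod>k\<in>I. w (Y k \<omega>)) * (\<Sum>k\<in>I. d (Y k \<omega>))\<^sup>2)"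
  and "expectation (\<lambda>\<omega>. (\<Prod>k\<in>I. w (Y k \<omega>)) * (\<Sum>k\<in>I. d (Y k \<omega>))\<^sup>2) \<le> real (card I) * D\<^sup>2 * z ^ card I"
proof -
 let ?A = "\<lambda>\<omega>. (\<Prod>k\<in>I. w (Y k \<omega>)) * (\<Sum>k\<in>I. d (Y k \<omega>))\<^sup>2"
 have Ym[measurable]: "Y k \<in> measurable M N" if "k \<in> I" for k
  using ind that by (auto simp: indep_vars_def)
 have sp: "Y k \<omega> \<in> space N" if "k \<in> I" "\<omega> \<in> space M" for k \<omega>
  using Ym[OF that(1)] that(2) by (rule measurable_space)
 \<comment> \<open>The factor of index \<open>k\<close> in the term of the expanded square that
   belongs to the pair \<open>i\<close>, \<open>j\<close>; written this way each term is a product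
   over independent variables.\<close>
 define X where "X i j k = (\<lambda>y. w y * (if k = i then d y else 1) * (if k = j then d y else 1))" for i j k :: 'i
 let ?D = "\<lambda>i. \<Sum>j\<in>I. \<Prod>k\<in>I. expectation (\<lambda>\<omega>. X i j k (Y k \<omega>))"
 let ?C = "\<lambda>i k. \<lambda>\<omega>. X i i k (Y k \<omega>)"
 have Xm[measurable]: "X i j k \<in> borel_measurable N" for i j k
  unfolding X_def by (cases "k = i"; cases "k = j") auto
 have XB: "\<bar>X i j k y\<bar> \<le> B * max 1 D * max 1 D" if y: "y \<in> space N" for i j k y
  unfolding X_def abs_mult using wB[OF y] dB[OF y] by (intro mult_mono) auto
 have Xint: "integrable M (\<lambda>\<omega>. X i j k (Y k \<omega>))" if "k \<in> I" for i j k
  by (rule integrable_const_bound[where B="B * max 1 D * max 1 D"]) (use XB sp that in auto)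
 have Xind: "indep_vars (\<lambda>_. borel) (\<lambda>k \<omega>. X i j k (Y k \<omega>)) I" for i j
  using ind by (rule indep_vars_compose2) auto
 have split: "(\<Prod>k\<in>I. w (Y k \<omega>)) * (\<Sum>k\<in>I. d (Y k \<omega>))\<^sup>2 = (\<Sum>i\<in>I. \<Sum>j\<in>I. \<Prod>k\<in>I. X i j k (Y k \<omega>))" for \<omega>
  by (use I in \<open>simp add: X_def prod.distrib prod.delta power2_eq_square sum_product sum_distrib_left field_simps\<close>)
 have pint: "integrable M (\<lambda>\<omega>. \<Prod>k\<in>I. X i j k (Y k \<omega>))" for i j
  by (rule indep_vars_integrable[OF I Xind Xint])
 show "integrable M ?A"
  unfolding split using pint by (intro Bochner_Integration.integrable_sum) auto
 have pe: "expectation (\<lambda>\<omega>. \<Prod>k\<in>I. X i j k (Y k \<omega>)) = (\<Prod>k\<in>I. expectation (\<lambda>\<omega>. X i j k (Y k \<omega>)))" for i j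
  by (rule indep_vars_lebesgue_integral[OF I Xind Xint])
 have off: "(\<Prod>k\<in>I. expectation (\<lambda>\<omega>. X i j k (Y k \<omega>))) = 0" if "i \<in> I" "i \<noteq> j" for i j
  by (use that zd[of i] I that in \<open>force simp: X_def\<close>)
 have wint: "integrable M (\<lambda>\<omega>. w (Y k \<omega>))" if "k \<in> I" for k
  by (rule integrable_const_bound[where B="B"]) (use wB sp that in auto)
 have z0: "0 \<le> z" if "k \<in> I" for k
  using z[OF that] wB sp[OF that] by (metis integral_nonneg_AE AE_I2)
 have on: "(\<Prod>k\<in>I. expectation (?C i k)) \<le> D\<^sup>2 * z ^ card I" if "i \<in> I" for i
 proof -
  let ?B = "\<lambda>\<omega>. X i i i (Y i \<omega>)"
  have "expectation ?B \<le> expectation (\<lambda>\<omega>. D\<^sup>2 * w (Y i \<omega>))"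
  proof (intro integral_mono Xint that)
   show "integrable M (\<lambda>\<omega>. D\<^sup>2 * w (Y i \<omega>))" using wint[OF that] by simp
   fix \<omega> assume "\<omega> \<in> space M"
   then have y: "Y i \<omega> \<in> space N" using sp that by auto
   have "d (Y i \<omega>) * d (Y i \<omega>) \<le> D\<^sup>2" using dB[OF y] by (metis abs_le_square_iff abs_of_nonneg abs_ge_zero order_trans power2_eq_square)
   then have "w (Y i \<omega>) * (d (Y i \<omega>) * d (Y i \<omega>)) \<le> w (Y i \<omega>) * D\<^sup>2" using wB[OF y] by (intro mult_left_mono) auto
   then show "X i i i (Y i \<omega>) \<le> D\<^sup>2 * w (Y i \<omega>)" by (simp add: X_def ac_simps)
  qed
  then have le: "expectation ?B \<le> D\<^sup>2 * z" using z[OF that] by simp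
  have "(\<Prod>k\<in>I. expectation (?C i k)) = expectation ?B * (\<Prod>k\<in>I-{i}. expectation (?C i k))"
   using I that by (rule prod.remove)
  also have "(\<Prod>k\<in>I-{i}. expectation (?C i k)) = (\<Prod>k\<in>I-{i}. z)"
   by (rule prod.cong) (auto simp: X_def z)
  also have "expectation ?B * (\<Prod>k\<in>I-{i}. z) \<le> (D\<^sup>2 * z) * (\<Prod>k\<in>I-{i}. z)"
   using le z0[OF that] by (intro mult_right_mono prod_nonneg) auto
  also have "\<dots> = D\<^sup>2 * z ^ card I"
  proof -
   have "card I = Suc (card (I - {i}))" using I that by (metis card.remove)
   then show ?thesis by (simp del: card_Diff_insert card_Diff_singleton)
  qed
  finally show ?thesis .
 qed
 have "expectation ?A = (\<Sum>i\<in>I. \<Sum>j\<in>I. \<Prod>k\<in>I. expectation (\<lambda>\<omega>. X i j k (Y k \<omega>)))"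
  unfolding split using pint by (subst Bochner_Integration.integral_sum, simp)+ (simp add: pe)
 also have "\<dots> \<le> (\<Sum>i\<in>I. D\<^sup>2 * z ^ card I)"
 proof (rule sum_mono)
  fix i assume i: "i \<in> I"
  have "(?D i) = (\<Sum>j\<in>{i}. \<Prod>k\<in>I. expectation (\<lambda>\<omega>. X i j k (Y k \<omega>)))"
   using I i off[OF i] by (intro sum.mono_neutral_right ballI) (blast, blast, metis DiffE singleton_iff)
  then show "(?D i) \<le> D\<^sup>2 * z ^ card I" using on[OF i] by simp
 qed
 finally show "expectation ?A \<le> real (card I) * D\<^sup>2 * z ^ card I"
  by simp
qed

text \<open>A change of measure without a tilted probability space: the total mass
  \<open>z ^ card I\<close> of the weight is at most its bound on the target event times the
  probability of that event, plus a Chebyshev estimate elsewhere. The truncation to \<open>B\<close>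
  makes the tilted second moments finite, at most \<open>(2 * K)\<^sup>2\<close> per
  variable.\<close>

lemma (in prob_space) tilted_lower_bound:
 fixes f :: "nat \<Rightarrow> 'n \<Rightarrow> real"
 assumes I: "finite I" "I \<noteq> {}" and ind: "indep_vars (\<lambda>_. N) Y I" and L: "finite L"
  and dist: "\<And>k. k \<in> I \<Longrightarrow> distr M N (Y k) = \<mu>"
  and f[measurable]: "\<And>l. l \<in> L \<Longrightarrow> f l \<in> borel_measurable N"
  and B_def: "B = {y \<in> space N. \<forall>l\<in>L. \<bar>f l y\<bar> \<le> K}"
  and w_def: "w = (\<lambda>y. exp (\<Sum>l\<in>L. a l * f l y) * indicator B y)"
  and z_def: "z = (\<integral>y. w y \<partial>\<mu>)" and z0: "z > 0"
  and v: "\<And>l. l \<in> L \<Longrightarrow> (\<integral>y. w y * f l y \<partial>\<mu>) = v l * z"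
  and \<delta>: "\<delta> > 0"
 shows "exp (real (card I) * (ln z - (\<Sum>l\<in>L. a l * v l) - \<delta> * (\<Sum>l\<in>L. \<bar>a l\<bar>)))
   * (1 - real (card L) * (2 * K)\<^sup>2 / (real (card I) * \<delta>\<^sup>2))
  \<le> prob {\<omega> \<in> space M. \<forall>l\<in>L. \<bar>(\<Sum>k\<in>I. f l (Y k \<omega>)) / real (card I) - v l\<bar> < \<delta>}"
proof -
 let ?C = "\<Sum>l\<in>L. a l * v l"
 let ?A = "\<Sum>l\<in>L. \<bar>a l\<bar>"
 let ?n = "card I"
 have n: "real ?n > 0" using I by (simp add: card_gt_0_iff)
 have Ym[measurable]: "Y k \<in> measurable M N" if "k \<in> I" for k
  using ind that by (auto simp: indep_vars_def)
 have B[measurable]: "B \<in> sets N" unfolding B_def using L by measurable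
 have w[measurable]: "w \<in> borel_measurable N" unfolding w_def using L by measurable
 obtain k0 where k0: "k0 \<in> I" using I by auto
 have smu[measurable_cong]: "sets \<mu> = sets N" using dist[OF k0] by auto
 have spmu: "space \<mu> = space N" by (rule sets_eq_imp_space_eq[OF smu])
 interpret mu: prob_space \<mu> using dist[OF k0] prob_space_distr[OF Ym[OF k0]] by simp
 define A where "A = exp (?A * K)"
 have sumle: "(\<Sum>l\<in>L. a l * f l y) \<le> ?A * K" if "y \<in> B" for y
  unfolding sum_distrib_right
 proof (rule sum_mono)
  fix l assume "l \<in> L"
  then have "\<bar>a l\<bar> * \<bar>f l y\<bar> \<le> \<bar>a l\<bar> * K" using that by (auto simp: B_def intro!: mult_left_mono)
  then show "a l * f l y \<le> \<bar>a l\<bar> * K" by (metis abs_ge_self abs_mult order_trans)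
 qed
 have w0: "0 \<le> w y" for y by (simp add: w_def)
 have wA: "w y \<le> A" for y using sumle[of y] by (auto simp: w_def A_def indicator_def)
 \<comment> \<open>A positive \<open>z\<close> rules out an empty truncation set, hence a negative
   \<open>K\<close>, unless nothing is constrained.\<close>
 have K0: "K \<ge> 0 \<or> L = {}"
 proof (rule ccontr)
  assume "\<not> (K \<ge> 0 \<or> L = {})"
  then have "B = {}" by (force simp: B_def)
  then show False using z0 by (simp add: z_def w_def)
 qed
 have wint: "integrable \<mu> w"
  by (rule mu.integrable_const_bound[where B=A]) (use w0 wA in \<open>auto simp: spmu\<close>)
 have wf: "w y * \<bar>f l y\<bar> \<le> w y * K" if "l \<in> L" for l y
  using that by (auto simp: w_def B_def indicator_def)
 have wfint: "integrable \<mu> (\<lambda>y. w y * f l y)" if "l \<in> L" for l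
 proof (rule Bochner_Integration.integrable_bound[of \<mu> "\<lambda>y. w y * K"])
  show "integrable \<mu> (\<lambda>y. w y * K)" using wint by simp
  show "(\<lambda>y. w y * f l y) \<in> borel_measurable \<mu>" using that by measurable
  show "AE y in \<mu>. norm (w y * f l y) \<le> norm (w y * K)"
   using wf[OF that] w0 K0 that by (auto simp: abs_mult)
 qed
 have vK: "\<bar>v l\<bar> \<le> K" if "l \<in> L" for l
 proof -
  have "\<bar>v l\<bar> * z = \<bar>\<integral>y. w y * f l y \<partial>\<mu>\<bar>" using v[OF that] z0 by (simp add: abs_mult)
  also have "\<dots> \<le> (\<integral>y. \<bar>w y * f l y\<bar> \<partial>\<mu>)" by (rule integral_abs_bound)
  also have "\<dots> \<le> (\<integral>y. w y * K \<partial>\<mu>)"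
  proof (rule integral_mono)
   show "integrable \<mu> (\<lambda>y. \<bar>w y * f l y\<bar>)" using wfint[OF that] by (rule integrable_abs)
   show "integrable \<mu> (\<lambda>y. w y * K)" using wint by simp
   show "\<bar>w y * f l y\<bar> \<le> w y * K" for y using wf[OF that] w0 by (simp add: abs_mult)
  qed
  also have "\<dots> = K * z" using wint by (simp add: z_def)
  finally show ?thesis using z0 by simp
 qed
 define d where "d l y = (f l y - v l) * indicator B y" for l y
 have dm[measurable]: "d l \<in> borel_measurable N" if "l \<in> L" for l
  unfolding d_def using that by measurable
 have dB: "\<bar>d l y\<bar> \<le> 2 * K" if "l \<in> L" for l y
 proof (cases "y \<in> B")
  case True
  then show ?thesis using that vK[OF that] True by (auto simp: B_def d_def)
 next
  case False
  then show ?thesis using K0 that by (auto simp: d_def)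
 qed
 have EW: "expectation (\<lambda>\<omega>. w (Y k \<omega>)) = z" if "k \<in> I" for k
  unfolding z_def dist[OF that, symmetric] using that by (subst integral_distr) auto
 have EWd: "expectation (\<lambda>\<omega>. w (Y k \<omega>) * d l (Y k \<omega>)) = 0" if k: "k \<in> I" and l: "l \<in> L" for k l
 proof -
  have "expectation (\<lambda>\<omega>. w (Y k \<omega>) * d l (Y k \<omega>)) = (\<integral>y. w y * d l y \<partial>\<mu>)"
   unfolding dist[OF k, symmetric] using k l by (subst integral_distr) auto
  also have "\<dots> = (\<integral>y. w y * f l y - v l * w y \<partial>\<mu>)"
   by (intro Bochner_Integration.integral_cong) (auto simp: w_def d_def indicator_def algebra_simps)
  also have "\<dots> = 0" using wint wfint[OF l] v[OF l] by (simp add: z_def)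
  finally show ?thesis .
 qed
 define PW where "PW \<omega> = (\<Prod>k\<in>I. w (Y k \<omega>))" for \<omega>
 define Sd where "Sd l \<omega> = (\<Sum>k\<in>I. d l (Y k \<omega>))" for l \<omega>
 let ?B = "\<lambda>l. \<lambda>\<omega>. PW \<omega> * (Sd l \<omega>)\<^sup>2"
 have PWm[measurable]: "PW \<in> borel_measurable M" unfolding PW_def using I by measurable
 have Sdm[measurable]: "Sd l \<in> borel_measurable M" if "l \<in> L" for l unfolding Sd_def using I that by measurable
 have sm: "integrable M (?B l)"
  "expectation (?B l) \<le> real ?n * (2*K)\<^sup>2 * z ^ ?n" if l: "l \<in> L" for l
  unfolding PW_def Sd_def by (rule tilted_second_moment[OF I(1) ind w dm[OF l], where B=A]; use w0 wA dB[OF l] EW EWd l in auto)+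
 have PW0: "0 \<le> PW \<omega>" for \<omega> unfolding PW_def using w0 by (intro prod_nonneg) auto
 have wYind: "indep_vars (\<lambda>_. borel) (\<lambda>k \<omega>. w (Y k \<omega>)) I"
  using ind by (rule indep_vars_compose2) auto
 have wYint: "integrable M (\<lambda>\<omega>. w (Y k \<omega>))" if "k \<in> I" for k
  by (rule integrable_const_bound[where B=A]) (use w0 wA that in auto)
 have PWint: "integrable M PW" unfolding PW_def by (rule indep_vars_integrable[OF I(1) wYind wYint])
 have EPW: "expectation PW = z ^ ?n"
  unfolding PW_def by (subst indep_vars_lebesgue_integral[OF I(1) wYind wYint]) (auto simp: EW)
 define G where "G = {\<omega> \<in> space M. \<forall>l\<in>L. \<bar>(\<Sum>k\<in>I. f l (Y k \<omega>)) / real ?n - v l\<bar> < \<delta>}"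
 have G[measurable]: "G \<in> sets M" unfolding G_def using L I by measurable
 define c where "c = exp (real ?n * (?C + \<delta> * ?A))"
 \<comment> \<open>On the target event the weight is at most \<open>c\<close>. Off that event it is
   either zero, or some centred sum reaches \<open>n * \<delta>\<close> in modulus and Chebyshev's
   factor is at least one.\<close>
 have point: "PW \<omega> \<le> c * indicator G \<omega> + (\<Sum>l\<in>L. PW \<omega> * (Sd l \<omega>)\<^sup>2 / (real ?n * \<delta>)\<^sup>2)" if \<omega>: "\<omega> \<in> space M" for \<omega>
 proof (cases "\<forall>k\<in>I. Y k \<omega> \<in> B")
  case False
  then obtain k where "k \<in> I" "Y k \<omega> \<notin> B" by auto
  then have "\<exists>k\<in>I. w (Y k \<omega>) = 0" by (intro bexI[of _ k]) (auto simp: w_def)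
  then have "PW \<omega> = 0" unfolding PW_def using I by (intro prod_zero) auto
  then show ?thesis by (simp add: c_def)
 next
  case True
  then have Sd: "Sd l \<omega> = (\<Sum>k\<in>I. f l (Y k \<omega>)) - real ?n * v l" for l
   by (simp add: Sd_def d_def sum_subtractf)
  show ?thesis
  proof (cases "\<omega> \<in> G")
   case G: True
   have "PW \<omega> = (\<Prod>k\<in>I. exp (\<Sum>l\<in>L. a l * f l (Y k \<omega>)))" unfolding PW_def w_def using True by simp
   also have "\<dots> = exp (\<Sum>l\<in>L. a l * (\<Sum>k\<in>I. f l (Y k \<omega>)))"
    using I by (simp add: exp_sum[symmetric] sum_distrib_left) (rule sum.swap)
   also have "\<dots> \<le> c" unfolding c_def exp_le_cancel_iff
   proof -
    have "(\<Sum>l\<in>L. a l * (\<Sum>k\<in>I. f l (Y k \<omega>))) \<le> (\<Sum>l\<in>L. real ?n * (a l * v l + \<delta> * \<bar>a l\<bar>))"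
    proof (rule sum_mono)
     fix l assume l: "l \<in> L"
     let ?s = "\<Sum>k\<in>I. f l (Y k \<omega>)"
     have "\<bar>?s / real ?n - v l\<bar> < \<delta>" using G l by (simp add: G_def)
     then have "a l * (?s / real ?n - v l) \<le> \<bar>a l\<bar> * \<delta>"
     proof -
      have "a l * (?s / real ?n - v l) \<le> \<bar>a l\<bar> * \<bar>?s / real ?n - v l\<bar>" by (metis abs_ge_self abs_mult)
      also have "\<dots> \<le> \<bar>a l\<bar> * \<delta>" using \<open>\<bar>?s / real ?n - v l\<bar> < \<delta>\<close> by (intro mult_left_mono) auto
      finally show ?thesis .
     qed
     then have "real ?n * (a l * (?s / real ?n)) \<le> real ?n * (a l * v l + \<delta> * \<bar>a l\<bar>)" using n by (fastforce simp: algebra_simps intro: mult_left_mono)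
     then show "a l * ?s \<le> real ?n * (a l * v l + \<delta> * \<bar>a l\<bar>)" using n by simp
    qed
    also have "\<dots> = real ?n * (?C + \<delta> * ?A)"
     by (simp only: sum_distrib_left[symmetric] sum.distrib)
    finally show "(\<Sum>l\<in>L. a l * (\<Sum>k\<in>I. f l (Y k \<omega>))) \<le> real ?n * (?C + \<delta> * ?A)" .
   qed
   finally have "PW \<omega> \<le> c * indicator G \<omega>" using G by simp
   moreover have "0 \<le> (\<Sum>l\<in>L. PW \<omega> * (Sd l \<omega>)\<^sup>2 / (real ?n * \<delta>)\<^sup>2)" using PW0 by (intro sum_nonneg) auto
   ultimately show ?thesis by linarith
  next
   case G: False
   then obtain l where l: "l \<in> L" "\<not> \<bar>(\<Sum>k\<in>I. f l (Y k \<omega>)) / real ?n - v l\<bar> < \<delta>" using \<omega> by (auto simp: G_def)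
   have "real ?n * \<delta> \<le> \<bar>real ?n * ((\<Sum>k\<in>I. f l (Y k \<omega>)) / real ?n - v l)\<bar>" using l n n by (simp add: abs_mult)
   also have "real ?n * ((\<Sum>k\<in>I. f l (Y k \<omega>)) / real ?n - v l) = Sd l \<omega>" using n by (simp add: Sd right_diff_distrib)
   finally have "(real ?n * \<delta>)\<^sup>2 \<le> (Sd l \<omega>)\<^sup>2" using n \<delta> by (metis abs_le_square_iff abs_of_pos mult_pos_pos)
   then have "PW \<omega> * 1 \<le> PW \<omega> * ((Sd l \<omega>)\<^sup>2 / (real ?n * \<delta>)\<^sup>2)" using n \<delta> PW0 by (intro mult_left_mono) auto
   then have "PW \<omega> \<le> PW \<omega> * (Sd l \<omega>)\<^sup>2 / (real ?n * \<delta>)\<^sup>2" by simp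
   also have "\<dots> \<le> (\<Sum>l\<in>L. PW \<omega> * (Sd l \<omega>)\<^sup>2 / (real ?n * \<delta>)\<^sup>2)"
    using l L PW0 by (intro member_le_sum) auto
   finally show ?thesis using G by simp
  qed
 qed
 have iG: "integrable M (indicat_real G)" by (rule integrable_real_indicator) (auto simp: emeasure_eq_measure)
 have "z ^ ?n \<le> expectation (\<lambda>\<omega>. c * indicator G \<omega> + (\<Sum>l\<in>L. PW \<omega> * (Sd l \<omega>)\<^sup>2 / (real ?n * \<delta>)\<^sup>2))"
  unfolding EPW[symmetric] by (intro integral_mono PWint) (use sm point iG in \<open>auto intro!: Bochner_Integration.integrable_add Bochner_Integration.integrable_sum integrable_divide_zero\<close>)
 also have "\<dots> = c * prob G + (\<Sum>l\<in>L. expectation (?B l) / (real ?n * \<delta>)\<^sup>2)"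
  using sm iG by (subst Bochner_Integration.integral_add) (auto simp: Bochner_Integration.integral_sum intro!: Bochner_Integration.integrable_sum integrable_divide_zero)
 also have "\<dots> \<le> c * prob G + (\<Sum>l\<in>L. (real ?n * (2*K)\<^sup>2 * z ^ ?n) / (real ?n * \<delta>)\<^sup>2)"
  using sm(2) by (intro add_left_mono sum_mono divide_right_mono) auto
 also have "(\<Sum>l\<in>L. (real ?n * (2*K)\<^sup>2 * z ^ ?n) / (real ?n * \<delta>)\<^sup>2) = z ^ ?n * (real (card L) * (2 * K)\<^sup>2 / (real ?n * \<delta>\<^sup>2))"
  using n \<delta> by (simp add: power2_eq_square field_simps)
 finally have *: "z ^ ?n * (1 - real (card L) * (2 * K)\<^sup>2 / (real ?n * \<delta>\<^sup>2)) \<le> c * prob G" by (simp add: algebra_simps)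
 have "exp (real ?n * (ln z - ?C - \<delta> * ?A)) = exp (real ?n * ln z) / c"
  by (simp add: c_def exp_diff[symmetric] algebra_simps)
 also have "exp (real ?n * ln z) = z ^ ?n" using z0 by (simp add: exp_of_nat_mult)
 finally have "exp (real ?n * (ln z - ?C - \<delta> * ?A))
   * (1 - real (card L) * (2 * K)\<^sup>2 / (real ?n * \<delta>\<^sup>2)) = (z ^ ?n * (1 - real (card L) * (2 * K)\<^sup>2 / (real ?n * \<delta>\<^sup>2))) / c" by simp
 also have "\<dots> \<le> prob G" using * by (simp add: c_def pos_divide_le_eq mult.commute)
 finally show ?thesis unfolding G_def .
qed

lemma exp_le_quadratic:
 fixes u :: real
 assumes "\<bar>u\<bar> \<le> 1"
 shows "exp u \<le> 1 + u + u\<^sup>2"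
proof (cases "u \<ge> 0")
 case True
 then show ?thesis using assms exp_bound[of u] by simp
next
 case False
 \<comment> \<open>For negative arguments the quadratic Taylor lower bound of \<open>exp v\<close>
   is inverted and its reciprocal compared with the parabola.\<close>
 define v where "v = - u"
 have v: "0 \<le> v" "v \<le> 1" using False assms by (auto simp: v_def)
 have "exp (- v) \<le> 1 / (1 + v + v\<^sup>2 / 2)" using v(1) exp_lower_Taylor_quadratic v by (simp add: exp_minus inverse_eq_divide) (intro divide_left_mono, auto intro!: add_pos_nonneg mult_pos_pos)
 also have "\<dots> \<le> 1 - v + v\<^sup>2"
 proof -
  have "1 \<le> (1 - v + v\<^sup>2) * (1 + v + v\<^sup>2 / 2)"
   by (use v in \<open>simp add: field_simps power2_eq_square power3_eq_cube power4_eq_xxxx\<close>)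
  then show ?thesis using v by (simp add: pos_divide_le_eq add_pos_nonneg)
 qed
 finally show ?thesis by (simp add: v_def)
qed

text \<open>First-order condition at a maximum without derivatives: dividing by small
  \<open>s\<close> of either sign forces the linear coefficient to vanish.\<close>

lemma linear_le_quadratic_imp_zero:
 fixes c B s0 :: real
 assumes s0: "s0 > 0" and le: "\<And>s. \<bar>s\<bar> \<le> s0 \<Longrightarrow> s * c \<le> s\<^sup>2 * B"
 shows "c = 0"
proof (rule ccontr)
 assume c: "c \<noteq> 0"
 define s1 where "s1 = min s0 (\<bar>c\<bar> / (2 * (\<bar>B\<bar> + 1)))"
 have s1: "s1 > 0" using s0 c by (simp add: s1_def)
 have "sgn c * s1 * c \<le> (sgn c * s1)\<^sup>2 * B"
  using s1 c by (intro le) (auto simp: abs_mult s1_def abs_sgn_eq)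
 then have "s1 * \<bar>c\<bar> \<le> s1\<^sup>2 * B"
  using c by (auto simp: sgn_if power_mult_distrib split: if_splits)
 then have "\<bar>c\<bar> \<le> s1 * B" using s1 by (simp add: power2_eq_square)
 also have "\<dots> \<le> s1 * (\<bar>B\<bar> + 1)" using s1 by (intro mult_left_mono) auto
 also have "\<dots> \<le> (\<bar>c\<bar> / (2 * (\<bar>B\<bar> + 1))) * (\<bar>B\<bar> + 1)" by (intro mult_right_mono) (auto simp: s1_def)
 also have "\<dots> = \<bar>c\<bar> / 2" by (simp add: field_simps)
 finally show False using c by simp
qed

text \<open>Coordinates outside the finite \<open>L\<close> are pinned to zero, so that the box is
  compact in the product topology on \<open>nat \<Rightarrow> real\<close>, the type in which tilts
  live.\<close>

definition coord_box :: "nat set \<Rightarrow> real \<Rightarrow> (nat \<Rightarrow> real) set" where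
 "coord_box L R = {a. \<forall>l. a l \<in> (if l \<in> L then {- R..R} else {0})}"

lemma compact_coord_box: "compact (coord_box L R)"
proof -
 have "compactin (product_topology (\<lambda>_. euclidean) UNIV) (PiE UNIV (\<lambda>l. if l \<in> L then {- R..R} else {0::real}))"
  unfolding compactin_PiE by auto
 then show ?thesis
  by (simp add: euclidean_product_topology coord_box_def PiE_def Pi_def)
qed

text \<open>The supremum of \<open>a \<bullet> x - ln Z(a) - r \<bar>a\<bar>\<^sup>2\<close> over tilts \<open>a\<close> is attained because of the quadratic
 penalty, and at the maximiser the tilted mean is \<open>x - 2 r a\<close>. Truncating at level \<open>K\<close> makes
 every moment finite; the penalised suprema decrease to at most \<open>c\<close> as \<open>K\<close> grows.\<close>

lemma truncated_tilt_exists: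
 fixes f :: "nat \<Rightarrow> 'n \<Rightarrow> real" and x :: "nat \<Rightarrow> real"
 assumes "prob_space \<mu>" and L: "finite L"
  and f[measurable]: "\<And>l. l \<in> L \<Longrightarrow> f l \<in> borel_measurable \<mu>"
  and c: "\<And>a. ereal (\<Sum>l\<in>L. a l * x l) - log_exp_moment \<mu> (\<lambda>y. \<Sum>l\<in>L. a l * f l y) \<le> ereal c"
  and \<epsilon>: "\<epsilon> > 0" and \<eta>: "\<eta> > 0"
 obtains K :: real and a v :: "nat \<Rightarrow> real" and z :: real where
  "z = (\<integral>y. exp (\<Sum>l\<in>L. a l * f l y) * indicator {y \<in> space \<mu>. \<forall>l\<in>L. \<bar>f l y\<bar> \<le> K} y \<partial>\<mu>)" "z > 0"
  "\<And>l. l \<in> L \<Longrightarrow> (\<integral>y. exp (\<Sum>l\<in>L. a l * f l y) * indicator {y \<in> space \<mu>. \<forall>l\<in>L. \<bar>f l y\<bar> \<le> K} y * f l y \<partial>\<mu>) = v l * z"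
  "\<And>l. l \<in> L \<Longrightarrow> \<bar>v l - x l\<bar> < \<epsilon>" "(\<Sum>l\<in>L. a l * v l) - ln z \<le> c + \<eta>"
proof -
 let ?E = "\<lambda>L k. {y \<in> space \<mu>. \<forall>l\<in>L. \<bar>f l y\<bar> \<le> real k}"
 let ?C = "\<lambda>L a. \<Sum>l\<in>L. (a l)\<^sup>2"
 let ?B = "\<lambda>L a. \<Sum>l\<in>L. \<bar>a l\<bar>"
 interpret prob_space \<mu> by fact
 define B where "B k = ?E L k" for k :: nat
 have Bm[measurable]: "B k \<in> sets \<mu>" for k unfolding B_def using L by measurable
 define W where "W k a y = exp (\<Sum>l\<in>L. a l * f l y) * indicator (B k) y" for k :: nat and a y
 let ?F = "\<lambda>k a. \<integral>\<^sup>+y. ennreal (W k a y) \<partial>\<mu>"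
 have Wm[measurable]: "W k a \<in> borel_measurable \<mu>" for k a unfolding W_def using L by measurable
 define Z where "Z k a = (\<integral>y. W k a y \<partial>\<mu>)" for k a
 have W0: "0 \<le> W k a y" for k a y by (simp add: W_def)
 have absum: "\<bar>\<Sum>l\<in>L. a l * f l y\<bar> \<le> (?B L a) * real k" if "y \<in> B k" for a k y
 proof -
  have "\<bar>\<Sum>l\<in>L. a l * f l y\<bar> \<le> (\<Sum>l\<in>L. \<bar>a l * f l y\<bar>)" by (rule sum_abs)
  also have "\<dots> \<le> (\<Sum>l\<in>L. \<bar>a l\<bar> * real k)"
   using that by (intro sum_mono) (auto simp: abs_mult B_def intro!: mult_left_mono)
  finally show ?thesis by (simp add: sum_distrib_right)
 qed
 have Wle: "W k a y \<le> exp ((?B L a) * real k)" for k a y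
  using absum[of y k a] by (auto simp: W_def indicator_def)
 have Wge: "exp (- ((?B L a) * real k)) * indicator (B k) y \<le> W k a y" for k a y
  using absum[of y k a] by (auto simp: W_def indicator_def)
 have Wint: "integrable \<mu> (W k a)" for k a
  by (rule integrable_const_bound[where B="exp ((?B L a) * real k)"]) (use W0 Wle in auto)
 have Wmono: "W k a y \<le> W k' a y" if "k \<le> k'" for k k' a y
  using that by (auto simp: W_def B_def indicator_def)
 have Zmono: "Z k a \<le> Z k' a" if "k \<le> k'" for k k' a
  unfolding Z_def using Wmono[OF that] Wint by (intro integral_mono)
 have Zge: "exp (- ((?B L a) * real k)) * prob (B k) \<le> Z k a" for k a
 proof -
  have "exp (- ((?B L a) * real k)) * prob (B k) = (\<integral>y. exp (- ((?B L a) * real k)) * indicator (B k) y \<partial>\<mu>)" by simp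
  also have "\<dots> \<le> Z k a" unfolding Z_def using Wge Wint by (intro integral_mono) (auto simp: emeasure_eq_measure intro!: integrable_mult_right integrable_real_indicator)
  finally show ?thesis .
 qed
 have Z0le: "Z k (\<lambda>_. 0) \<le> 1" for k
 proof -
  have "Z k (\<lambda>_. 0) \<le> (\<integral>y. 1 \<partial>\<mu>)" unfolding Z_def using Wle[of k "\<lambda>_. 0"] Wint by (intro integral_mono) auto
  then show ?thesis by (simp add: prob_space)
 qed
 have UB: "(\<Union>k. B k) = space \<mu>"
 proof
  show "space \<mu> \<subseteq> (\<Union>k. B k)"
  proof
   fix y assume y: "y \<in> space \<mu>"
   obtain k :: nat where k: "(\<Sum>l\<in>L. \<bar>f l y\<bar>) \<le> real k" using real_arch_simple by blast
   have "\<bar>f l y\<bar> \<le> real k" if "l \<in> L" for l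
    using member_le_sum[of l L "\<lambda>l. \<bar>f l y\<bar>"] that L k by auto
   then show "y \<in> (\<Union>k. B k)" using y by (auto simp: B_def)
  qed
 qed (auto simp: B_def)
 have "(\<lambda>k. prob (B k)) \<longlonglongrightarrow> prob (\<Union>k. B k)" by (fastforce simp: incseq_def B_def intro: finite_Lim_measure_incseq)
 then have "(\<lambda>k. prob (B k)) \<longlonglongrightarrow> 1" unfolding UB prob_space .
 then have "eventually (\<lambda>k. prob (B k) > 1/2) sequentially" by (rule order_tendstoD) simp
 \<comment> \<open>From level \<open>K0\<close> on the truncation set has mass above one half, which
   bounds all \<open>Z k a\<close> from below.\<close>
 then obtain K0 where K0: "\<And>k. k \<ge> K0 \<Longrightarrow> prob (B k) > 1/2" by (auto simp: eventually_sequentially)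
 have Zpos: "Z k a > 0" if "k \<ge> K0" for k a
 proof -
  have "0 < exp (- ((?B L a) * real k)) * prob (B k)" using K0[OF that] by simp
  then show ?thesis using Zge[of a k] by linarith
 qed
 have Zcont: "(\<lambda>j. Z k (A j)) \<longlonglongrightarrow> Z k a" if A: "\<And>l. l \<in> L \<Longrightarrow> (\<lambda>j. A j l) \<longlonglongrightarrow> a l" and bd: "\<And>j l. l \<in> L \<Longrightarrow> \<bar>A j l\<bar> \<le> R"
  for A :: "nat \<Rightarrow> nat \<Rightarrow> real" and a R k
  unfolding Z_def
 proof (rule integral_dominated_convergence[where w="\<lambda>_. exp ((\<Sum>l\<in>L. R) * real k)"])
  show "AE y in \<mu>. (\<lambda>j. W k (A j) y) \<longlonglongrightarrow> W k a y"
   unfolding W_def using A by (auto intro!: tendsto_intros)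
  fix j
  have "W k (A j) y \<le> exp ((\<Sum>l\<in>L. R) * real k)" for y
  proof (rule order_trans[OF Wle])
   have "(\<Sum>l\<in>L. \<bar>A j l\<bar>) \<le> (\<Sum>l\<in>L. R)" using bd by (intro sum_mono)
   then show "exp ((\<Sum>l\<in>L. \<bar>A j l\<bar>) * real k) \<le> exp ((\<Sum>l\<in>L. R) * real k)"
    by (simp only: exp_le_cancel_iff) (intro mult_right_mono, auto)
  qed
  then show "AE y in \<mu>. norm (W k (A j) y) \<le> exp ((\<Sum>l\<in>L. R) * real k)" using W0 by auto
 qed auto
 define c' where "c' = max c 0 + \<eta>"
 have c': "c' > 0" using \<eta> by (simp add: c'_def)
 have c0: "c \<ge> 0"
 proof -
  have "log_exp_moment \<mu> (\<lambda>y. \<Sum>l\<in>L. 0 * f l y) = elog (ennreal (exp 0))" by (simp add: log_exp_moment_def emeasure_space_1)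
  then show ?thesis using c[of "\<lambda>_. 0"] unfolding elog_exp by simp
 qed
 define \<Phi> where "\<Phi> r k a = (\<Sum>l\<in>L. a l * x l) - ln (Z k a) - r * ?C L a" for r k a
 have sq: "(?B L a)\<^sup>2 \<le> real (card L) * ?C L a" for a :: "nat \<Rightarrow> real"
 proof -
  have "(\<Sum>l\<in>L. \<bar>a l\<bar> * 1)\<^sup>2 \<le> (\<Sum>l\<in>L. \<bar>a l\<bar>\<^sup>2) * (\<Sum>l\<in>L. 1\<^sup>2)" by (rule Cauchy_Schwarz_ineq_sum)
  then show ?thesis by (simp add: mult.commute)
 qed
 define X where "X = (\<Sum>l\<in>L. \<bar>x l\<bar>)"
 \<comment> \<open>For \<open>k \<ge> K0\<close>, \<open>ln (Z k a)\<close> falls at most linearly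
   in the l1-norm \<open>s\<close> of \<open>a\<close>, while the penalty grows quadratically;
   beyond \<open>R\<close> the penalty wins. The radius does not depend on \<open>k\<close>.\<close>
 have coercive: "\<exists>R>0. \<forall>k\<ge>K0. \<forall>a. (\<exists>l\<in>L. \<bar>a l\<bar> > R) \<longrightarrow> \<Phi> r k a < 0" if r: "r > 0" for r
 proof -
  define C where "C = X + real K0"
  define R where "R = (real (card L) * (C + ln 2) + 1) / r + 1"
  have R1: "R \<ge> 1" using r by (auto simp: C_def X_def sum_nonneg R_def)
  have "\<Phi> r k a < 0" if k: "k \<ge> K0" and l: "l \<in> L" "\<bar>a l\<bar> > R" for k a l
  proof -
   define s where "s = ?B L a"
   have sR: "s > R" using member_le_sum[of l L "\<lambda>l. \<bar>a l\<bar>"] l L by (auto simp: s_def)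
   have cL: "card L > 0" using l L card_gt_0_iff by blast
   have "(\<Sum>l\<in>L. a l * x l) \<le> s * X"
   proof -
    have "(\<Sum>l\<in>L. a l * x l) \<le> (\<Sum>l\<in>L. \<bar>a l\<bar> * X)"
    proof (rule sum_mono)
     fix i assume i: "i \<in> L"
     have "a i * x i \<le> \<bar>a i\<bar> * \<bar>x i\<bar>" by (metis abs_ge_self abs_mult)
     also have "\<dots> \<le> \<bar>a i\<bar> * X" using i L unfolding X_def by (intro mult_left_mono member_le_sum) auto
     finally show "a i * x i \<le> \<bar>a i\<bar> * X" .
    qed
    then show ?thesis by (simp add: s_def sum_distrib_right)
   qed
   moreover have "ln (Z k a) \<ge> - (s * real K0) - ln 2"
   proof -
    have "exp (- (s * real K0)) * (1/2) \<le> exp (- (s * real K0)) * prob (B K0)"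
     using K0[of K0] by (intro mult_left_mono) auto
    also have "\<dots> \<le> Z K0 a" using Zge[of a K0] by (simp add: s_def)
    also have "\<dots> \<le> Z k a" by (rule Zmono[OF k])
    finally have "ln (exp (- (s * real K0)) * (1/2)) \<le> ln (Z k a)" by (subst ln_le_cancel_iff) (auto simp: Zpos k)
    then show ?thesis by (simp add: ln_mult ln_div)
   qed
   moreover have "r * (?C L a) \<ge> r * (s\<^sup>2 / real (card L))"
    using sq[of a] r cL by (intro mult_left_mono) (auto simp: s_def pos_divide_le_eq mult.commute)
   ultimately have "\<Phi> r k a \<le> s * C + ln 2 - r * (s\<^sup>2 / real (card L))"
    unfolding \<Phi>_def C_def by (simp add: algebra_simps)
   also have "\<dots> < 0"
   proof -
    have *: "C + ln 2 < r * s / real (card L)" using sR r r r cL by (simp add: R_def field_simps)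
    have "s * (C + ln 2) < s * (r * s / real (card L))" using * sR R1 by (intro mult_strict_left_mono) auto
    moreover have "s * ln 2 \<ge> ln 2" using sR R1 by simp
    moreover have "r * (s\<^sup>2 / real (card L)) = s * (r * s / real (card L))" by (simp add: power2_eq_square)
    moreover have "s * (C + ln 2) = s * C + s * ln 2" by (rule distrib_left)
    ultimately show ?thesis by linarith
   qed
   finally show ?thesis .
  qed
  then show ?thesis using R1 by (intro exI[of _ R]) auto
 qed
 have coord: "(\<lambda>j. A j l) \<longlonglongrightarrow> a l" if "A \<longlonglongrightarrow> a" for A :: "nat \<Rightarrow> nat \<Rightarrow> real" and a l
  using continuous_on_tendsto_compose[OF continuous_on_product_coordinates[of l] that] by simp
 have \<Phi>cong: "\<Phi> r k a = \<Phi> r k b" if "\<And>l. l \<in> L \<Longrightarrow> a l = b l" for r k a b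
  unfolding \<Phi>_def Z_def W_def using that by (simp cong: sum.cong)
 \<comment> \<open>Calibrated for the last step: the maximiser obeys
   \<open>\<rho> * (a l)\<^sup>2 \<le> c'\<close>, so the square of the displacement
   \<open>4 * \<rho> * a l\<close> is at most \<open>16 * \<rho> * c'\<close>, which is half of
   \<open>\<epsilon>\<^sup>2\<close>.\<close>
 define \<rho> where "\<rho> = \<epsilon>\<^sup>2 / (32 * c')"
 have \<rho>: "\<rho> > 0" using \<epsilon> c' by (simp add: \<rho>_def)
 \<comment> \<open>Otherwise every level has a tilt beating \<open>c'\<close>. Coercivity keeps
   these tilts in a compact box. At a limit point \<open>a\<close>, monotonicity of \<open>Z\<close>
   in the level and monotone convergence make the untruncated log-moment at most \<open>b\<close>,
   and then \<open>a\<close> violates the hypothesis on \<open>c\<close>.\<close>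
 have "\<exists>k\<ge>K0. \<forall>a. \<Phi> \<rho> k a \<le> c'"
 proof (rule ccontr)
  assume "\<not> (\<exists>k\<ge>K0. \<forall>a. \<Phi> \<rho> k a \<le> c')"
  then have "\<forall>k. \<exists>a. \<Phi> \<rho> (K0 + k) a > c'" by (metis le_add1 not_le)
  then obtain A0 where A0: "\<And>k. \<Phi> \<rho> (K0 + k) (A0 k) > c'" by metis
  define A where "A k l = (if l \<in> L then A0 k l else 0)" for k l
  have A: "\<Phi> \<rho> (K0 + k) (A k) > c'" for k
   using A0[of k] \<Phi>cong[of "A k" "A0 k" \<rho> "K0 + k"] by (simp add: A_def)
  obtain R where R: "R > 0" "\<And>k a l. k \<ge> K0 \<Longrightarrow> l \<in> L \<Longrightarrow> \<bar>a l\<bar> > R \<Longrightarrow> \<Phi> \<rho> k a < 0"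
   using coercive[OF \<rho>] by blast
  have AR: "\<bar>A k l\<bar> \<le> R" if "l \<in> L" for k l
   by ((rule ccontr), (use R(2)[of "K0 + k" l "A k"] that A[of k] c' in \<open>linarith\<close>))
  have "\<forall>k. A k \<in> coord_box L R"
   unfolding coord_box_def mem_Collect_eq
  proof (intro allI)
   fix k l show "A k l \<in> (if l \<in> L then {- R..R} else {0})"
    using AR[of l k] by (auto simp: A_def abs_le_iff)
  qed
  then obtain a s where as: "strict_mono (s :: nat \<Rightarrow> nat)" "(A \<circ> s) \<longlonglongrightarrow> a"
   using compact_coord_box[of L R] unfolding compact_def by metis
  let ?D = "\<lambda>j. (\<Sum>l\<in>L. A (s j) l * x l) - \<rho> * (\<Sum>l\<in>L. (A (s j) l)\<^sup>2) - c'"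
  have Al: "(\<lambda>j. A (s j) l) \<longlonglongrightarrow> a l" for l using coord[OF as(2), of l] by (simp add: comp_def)
  define b where "b = (\<Sum>l\<in>L. a l * x l) - \<rho> * ?C L a - c'"
  have Zb: "Z k a \<le> exp b" for k
  proof -
   have lim1: "(\<lambda>j. Z k (A (s j))) \<longlonglongrightarrow> Z k a" using Al AR by (intro Zcont)
   have lim2: "(\<lambda>j. exp (?D j)) \<longlonglongrightarrow> exp b"
    unfolding b_def using Al by (intro tendsto_intros)
   have "Z k (A (s j)) \<le> exp (?D j)" if "j \<ge> k" for j
   proof -
    have "j \<le> s j" by (rule strict_mono_imp_increasing[OF as(1)])
    then have "Z k (A (s j)) \<le> Z (K0 + s j) (A (s j))" using that by (intro Zmono) auto
    moreover have "ln (Z (K0 + s j) (A (s j))) \<le> (\<Sum>l\<in>L. A (s j) l * x l) - \<rho> * (\<Sum>l\<in>L. (A (s j) l)\<^sup>2) - c'"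
     using A[of "s j"] by (simp add: \<Phi>_def)
    then have "Z (K0 + s j) (A (s j)) \<le> exp (?D j)"
     using Zpos[of "K0 + s j" "A (s j)"] by (metis exp_le_cancel_iff exp_ln le_add1)
    ultimately show ?thesis by linarith
   qed
   then show ?thesis by (intro LIMSEQ_le[OF lim1 lim2]) auto
  qed
  have "(\<integral>\<^sup>+y. ennreal (exp (\<Sum>l\<in>L. a l * f l y)) \<partial>\<mu>) = (\<integral>\<^sup>+y. (SUP k. ennreal (W k a y)) \<partial>\<mu>)"
  proof (rule nn_integral_cong)
   fix y assume "y \<in> space \<mu>"
   then obtain k where "y \<in> B k" using UB by auto
   then show "ennreal (exp (\<Sum>l\<in>L. a l * f l y)) = (SUP k. ennreal (W k a y))" by (auto simp: W_def indicator_def intro!: ennreal_leI SUP_upper2 antisym SUP_least)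
  qed
  also have "\<dots> = (SUP k. (?F k a))"
   by (intro nn_integral_monotone_convergence_SUP) (auto simp: incseq_def le_fun_def intro!: ennreal_leI Wmono)
  also have "\<dots> \<le> ennreal (exp b)"
  proof (rule SUP_least)
   fix k
   have "(?F k a) = ennreal (Z k a)"
    unfolding Z_def using Wint W0 by (intro nn_integral_eq_integral) auto
   then show "(?F k a) \<le> ennreal (exp b)" using Zb by (simp add: ennreal_leI)
  qed
  finally have "log_exp_moment \<mu> (\<lambda>y. \<Sum>l\<in>L. a l * f l y) \<le> ereal b"
   unfolding log_exp_moment_def elog_le_iff_exp .
  then have "ereal ((\<Sum>l\<in>L. a l * x l) - b) \<le> ereal (\<Sum>l\<in>L. a l * x l) - log_exp_moment \<mu> (\<lambda>y. \<Sum>l\<in>L. a l * f l y)"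
   unfolding ereal_minus(1)[symmetric] by (intro ereal_minus_mono order_refl)
  also have "\<dots> \<le> ereal c" by (rule c)
  finally have "(\<Sum>l\<in>L. a l * x l) - b \<le> c" by simp
  moreover have "0 \<le> \<rho> * ?C L a" using \<rho> by (intro mult_nonneg_nonneg sum_nonneg) auto
  ultimately show False using \<eta> c0 by (simp add: b_def c'_def)
 qed
 then obtain k where k: "k \<ge> K0" and kc: "\<And>a. \<Phi> \<rho> k a \<le> c'" by blast
 \<comment> \<open>The maximiser is taken for the doubled penalty. Its value is nonnegative, and
   with the single penalty it is still at most \<open>c'\<close>; the difference of the two bounds
   the squared norm of the maximiser.\<close>
 have r2: "2 * \<rho> > 0" using \<rho> by simp
 obtain R where R: "R > 0" "\<And>a l. l \<in> L \<Longrightarrow> \<bar>a l\<bar> > R \<Longrightarrow> \<Phi> (2*\<rho>) k a < 0"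
  using coercive[OF r2] k by blast
 have boxL: "\<bar>a l\<bar> \<le> R" if "a \<in> coord_box L R" "l \<in> L" for a l
  using that by (auto simp: coord_box_def abs_le_iff split: if_splits dest!: spec[of _ l])
 have cont: "continuous_on (coord_box L R) (\<Phi> (2*\<rho>) k)"
  unfolding continuous_on_sequentially
 proof (intro allI ballI impI)
  fix A a assume Aa: "a \<in> coord_box L R" "(\<forall>n. A n \<in> coord_box L R) \<and> A \<longlonglongrightarrow> a"
  have Al: "(\<lambda>j. A j l) \<longlonglongrightarrow> a l" for l using coord Aa by blast
  have "(\<lambda>j. Z k (A j)) \<longlonglongrightarrow> Z k a" using Al Aa(2) boxL by (intro Zcont) auto
  then show "(\<Phi> (2*\<rho>) k \<circ> A) \<longlonglongrightarrow> \<Phi> (2*\<rho>) k a"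
   unfolding \<Phi>_def comp_def using Al Zpos[OF k, of a] by (intro tendsto_intros) auto
 qed
 have zbox: "(\<lambda>_. 0) \<in> coord_box L R" using R(1) by (simp add: coord_box_def)
 obtain a where a: "a \<in> coord_box L R" and amax: "\<And>b. b \<in> coord_box L R \<Longrightarrow> \<Phi> (2*\<rho>) k b \<le> \<Phi> (2*\<rho>) k a"
  using continuous_attains_sup[OF compact_coord_box _ cont] zbox by blast
 have \<Phi>a0: "0 \<le> \<Phi> (2*\<rho>) k a"
 proof -
  have "0 \<le> \<Phi> (2*\<rho>) k (\<lambda>_. 0)" using Z0le[of k] Zpos[OF k, of "\<lambda>_. 0"] by (simp add: \<Phi>_def)
  then show ?thesis using amax[OF zbox] by linarith
 qed
 have max: "\<Phi> (2*\<rho>) k b \<le> \<Phi> (2*\<rho>) k a" for b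
 proof (cases "\<exists>l\<in>L. \<bar>b l\<bar> > R")
  case True
  then show ?thesis using R(2)[of _ b] \<Phi>a0 by fastforce
 next
  case False
  define b' where "b' l = (if l \<in> L then b l else 0)" for l
  have "b' \<in> coord_box L R" using False by (auto simp: coord_box_def b'_def abs_le_iff not_less)
  moreover have "\<Phi> (2*\<rho>) k b = \<Phi> (2*\<rho>) k b'" by (rule \<Phi>cong) (simp add: b'_def)
  ultimately show ?thesis using amax by simp
 qed
 define z where "z = Z k a"
 have z: "z > 0" unfolding z_def by (rule Zpos[OF k])
 define v where "v l = (\<integral>y. W k a y * f l y \<partial>\<mu>) / z" for l
 have Wf: "\<bar>W k a y * f l y\<bar> \<le> W k a y * real k" if "l \<in> L" for l y
  using that by (auto simp: W_def B_def indicator_def abs_mult)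
 have Wfint: "integrable \<mu> (\<lambda>y. W k a y * f l y)" if "l \<in> L" for l
 proof (rule Bochner_Integration.integrable_bound[of \<mu> "\<lambda>y. W k a y * real k"])
  show "integrable \<mu> (\<lambda>y. W k a y * real k)" using Wint by simp
  show "(\<lambda>y. W k a y * f l y) \<in> borel_measurable \<mu>" using that by measurable
  show "AE y in \<mu>. norm (W k a y * f l y) \<le> norm (W k a y * real k)"
   using Wf[OF that] W0 by auto
 qed
 \<comment> \<open>Perturb the maximiser by \<open>s\<close> in coordinate \<open>l\<close>. For
   \<open>\<bar>s\<bar> \<le> 1 / (real k + 1)\<close> the exponent stays within the range of the
   quadratic bound on \<open>exp\<close>, and optimality becomes a linear term in \<open>s\<close>
   dominated by a quadratic one.\<close>
 have grad: "v l = x l - 4 * \<rho> * a l" if l: "l \<in> L" for l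
 proof -
  have "s * (x l - v l - 4 * \<rho> * a l) \<le> s\<^sup>2 * ((real k)\<^sup>2 + 2 * \<rho>)" if s: "\<bar>s\<bar> \<le> 1 / (real k + 1)" for s
  proof -
   let ?A = "s * v l + s\<^sup>2 * (real k)\<^sup>2"
   define b where "b = a(l := a l + s)"
   have upd: "(\<Sum>i\<in>L. b i * g i) = (\<Sum>i\<in>L. a i * g i) + s * g l" for g :: "nat \<Rightarrow> real"
   proof -
    have "(\<Sum>i\<in>L. b i * g i) = b l * g l + (\<Sum>i\<in>L-{l}. b i * g i)" using L l by (rule sum.remove)
    also have "(\<Sum>i\<in>L-{l}. b i * g i) = (\<Sum>i\<in>L-{l}. a i * g i)" by (rule sum.cong) (auto simp: b_def)
    also have "b l * g l + \<dots> = s * g l + (a l * g l + (\<Sum>i\<in>L-{l}. a i * g i))" by (simp add: b_def algebra_simps)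
    also have "a l * g l + (\<Sum>i\<in>L-{l}. a i * g i) = (\<Sum>i\<in>L. a i * g i)" using L l by (rule sum.remove[symmetric])
    finally show ?thesis by simp
   qed
   have upd2: "(\<Sum>i\<in>L. (b i)\<^sup>2) = (\<Sum>i\<in>L. (a i)\<^sup>2) + (2 * s * a l + s\<^sup>2)"
   proof -
    have "(\<Sum>i\<in>L. (b i)\<^sup>2) = (b l)\<^sup>2 + (\<Sum>i\<in>L-{l}. (b i)\<^sup>2)" using L l by (rule sum.remove)
    also have "(\<Sum>i\<in>L-{l}. (b i)\<^sup>2) = (\<Sum>i\<in>L-{l}. (a i)\<^sup>2)" by (rule sum.cong) (auto simp: b_def)
    also have "(b l)\<^sup>2 + \<dots> = (2 * s * a l + s\<^sup>2) + ((a l)\<^sup>2 + (\<Sum>i\<in>L-{l}. (a i)\<^sup>2))" by (simp add: b_def power2_eq_square algebra_simps)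
    also have "(a l)\<^sup>2 + (\<Sum>i\<in>L-{l}. (a i)\<^sup>2) = (\<Sum>i\<in>L. (a i)\<^sup>2)" using L l by (rule sum.remove[symmetric])
    finally show ?thesis by simp
   qed
   have Wb: "W k b y \<le> W k a y * (1 + s\<^sup>2 * (real k)\<^sup>2) + s * (W k a y * f l y)" for y
   proof (cases "y \<in> B k")
    case True
    then have fk: "\<bar>f l y\<bar> \<le> real k" using l by (simp add: B_def)
    have "\<bar>s * f l y\<bar> \<le> (1 / (real k + 1)) * real k" unfolding abs_mult using s fk by (intro mult_mono) auto
    also have "\<dots> \<le> 1" by (simp add: field_simps)
    finally have "exp (s * f l y) \<le> 1 + s * f l y + (s * f l y)\<^sup>2" by (rule exp_le_quadratic)
    also have "(s * f l y)\<^sup>2 \<le> s\<^sup>2 * (real k)\<^sup>2"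
     using fk by (simp add: power_mult_distrib mult_left_mono abs_le_square_iff[symmetric])
    finally have "exp (s * f l y) \<le> 1 + s * f l y + s\<^sup>2 * (real k)\<^sup>2" by simp
    then have "W k a y * exp (s * f l y) \<le> W k a y * (1 + s * f l y + s\<^sup>2 * (real k)\<^sup>2)" using W0 by (intro mult_left_mono)
    moreover have "W k b y = W k a y * exp (s * f l y)" using upd[of "\<lambda>i. f i y"] by (simp add: W_def exp_add)
    ultimately show ?thesis by (simp add: algebra_simps)
   qed (simp add: W_def)
   have "Z k b \<le> (\<integral>y. W k a y * (1 + s\<^sup>2 * (real k)\<^sup>2) + s * (W k a y * f l y) \<partial>\<mu>)"
    unfolding Z_def using Wb Wint Wfint[OF l] by (intro integral_mono) auto
   also have "\<dots> = z * (1 + ?A)" using Wint Wfint[OF l] z by (auto simp: z_def[symmetric] Z_def[symmetric] v_def algebra_simps)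
   finally have Zb: "Z k b \<le> z * (1 + ?A)" .
   have "0 < z * (1 + ?A)" using Zb Zpos[OF k, of b] by linarith
   then have pos: "0 < 1 + ?A" using z by (simp add: zero_less_mult_iff)
   have "ln (Z k b) \<le> ln (z * (1 + ?A))" using Zb Zpos[OF k, of b] by simp
   also have "\<dots> \<le> ln z + ?A" using z pos ln_le_minus_one[OF pos] by (simp add: ln_mult)
   finally have "ln (Z k b) \<le> ln z + ?A" .
   moreover have "\<Phi> (2*\<rho>) k b \<le> \<Phi> (2*\<rho>) k a" by (rule max)
   ultimately show ?thesis unfolding \<Phi>_def upd upd2 z_def[symmetric] by (simp add: algebra_simps)
  qed
  moreover have "1 / (real k + 1) > 0" by (intro divide_pos_pos) auto
  ultimately have "x l - v l - 4 * \<rho> * a l = 0" by (intro linear_le_quadratic_imp_zero[of "1 / (real k + 1)"])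
  then show ?thesis by simp
 qed
 have a2: "\<rho> * ?C L a \<le> c'" using kc[of a] \<Phi>a0 by (simp add: \<Phi>_def)
 show thesis
 proof (rule that[of z a "real k" v])
  show "z = (\<integral>y. exp (\<Sum>l\<in>L. a l * f l y) * indicator (?E L k) y \<partial>\<mu>)"
   by (simp add: z_def Z_def W_def B_def)
  show "z > 0" by (rule z)
  show "(\<integral>y. exp (\<Sum>l\<in>L. a l * f l y) * indicator (?E L k) y * f l y \<partial>\<mu>) = v l * z" for l
   using z by (simp add: v_def W_def B_def)
  show "\<bar>v l - x l\<bar> < \<epsilon>" if l: "l \<in> L" for l
  proof -
   have "(a l)\<^sup>2 \<le> ?C L a" using l L by (intro member_le_sum) auto
   then have "\<rho> * (a l)\<^sup>2 \<le> c'" using a2 \<rho> by (meson less_eq_real_def mult_left_mono order_trans)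
   then have "16 * \<rho> * (\<rho> * (a l)\<^sup>2) \<le> 16 * \<rho> * c'" using \<rho> by (intro mult_left_mono) auto
   also have "\<dots> < \<epsilon>\<^sup>2" using c' \<epsilon> by (simp add: \<rho>_def field_simps)
   finally have "(4 * \<rho> * a l)\<^sup>2 < \<epsilon>\<^sup>2" by (simp add: power2_eq_square algebra_simps)
   then have "\<bar>4 * \<rho> * a l\<bar> < \<epsilon>" using \<epsilon> by (metis abs_of_pos power2_less_imp_less power2_abs less_imp_le)
   then show ?thesis using grad[OF l] by simp
  qed
  have "(\<Sum>l\<in>L. a l * v l) = (\<Sum>l\<in>L. a l * x l - 4 * \<rho> * (a l)\<^sup>2)"
   by (use sum.cong[OF refl] in \<open>auto simp: grad power2_eq_square algebra_simps\<close>)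
  also have "\<dots> = (\<Sum>l\<in>L. a l * x l) - 4 * \<rho> * ?C L a" by (simp add: sum_subtractf sum_distrib_left)
  finally have "(\<Sum>l\<in>L. a l * v l) - ln z = \<Phi> \<rho> k a - 3 * (\<rho> * (?C L a))" by (simp add: \<Phi>_def z_def)
  moreover have "0 \<le> \<rho> * ?C L a" using \<rho> by (intro mult_nonneg_nonneg sum_nonneg) auto
  ultimately show "(\<Sum>l\<in>L. a l * v l) - ln z \<le> c + \<eta>" using kc[of a] c0 by (simp add: c'_def)
 qed
qed

text \<open>The threshold \<open>n0\<close> concerns the size of \<open>I\<close> only. This
  uniformity in \<open>I\<close> allows the bound to be applied to blocks of service times whose
  position moves with \<open>n\<close>.\<close>

theorem (in prob_space) cramer_lower_bound:
 fixes f :: "nat \<Rightarrow> 'n \<Rightarrow> real" and x :: "nat \<Rightarrow> real"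
 assumes J: "J \<noteq> {}" and ind: "indep_vars (\<lambda>_. N) Y J" and L: "finite L"
  and dist: "\<And>k. k \<in> J \<Longrightarrow> distr M N (Y k) = \<mu>"
  and f: "\<And>l. l \<in> L \<Longrightarrow> f l \<in> borel_measurable N"
  and c: "\<And>a. ereal (\<Sum>l\<in>L. a l * x l) - log_exp_moment \<mu> (\<lambda>y. \<Sum>l\<in>L. a l * f l y) \<le> ereal c"
  and \<epsilon>: "\<epsilon> > 0" and \<eta>: "\<eta> > 0"
 obtains n0 where "\<And>I. finite I \<Longrightarrow> I \<subseteq> J \<Longrightarrow> card I \<ge> n0 \<Longrightarrow>
  exp (- (real (card I) * (c + \<eta>))) \<le> prob {w \<in> space M. \<forall>l\<in>L. \<bar>(\<Sum>k\<in>I. f l (Y k w)) / real (card I) - x l\<bar> < \<epsilon>}"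
proof -
 obtain k0 where k0: "k0 \<in> J" using J by auto
 have Yk0: "Y k0 \<in> measurable M N" using ind k0 by (auto simp: indep_vars_def)
 have smu: "sets \<mu> = sets N" using dist[OF k0] by auto
 have spmu: "space \<mu> = space N" by (rule sets_eq_imp_space_eq[OF smu])
 have pmu: "prob_space \<mu>" using dist[OF k0] prob_space_distr[OF Yk0] by simp
 have fmu: "f l \<in> borel_measurable \<mu>" if "l \<in> L" for l using f[OF that] smu by (simp cong: measurable_cong_sets)
 obtain K a v z where
  z: "z = (\<integral>y. exp (\<Sum>l\<in>L. a l * f l y) * indicator {y \<in> space \<mu>. \<forall>l\<in>L. \<bar>f l y\<bar> \<le> K} y \<partial>\<mu>)" "z > 0"
  and v: "\<And>l. l \<in> L \<Longrightarrow> (\<integral>y. exp (\<Sum>l\<in>L. a l * f l y) * indicator {y \<in> space \<mu>. \<forall>l\<in>L. \<bar>f l y\<bar> \<le> K} y * f l y \<partial>\<mu>) = v l * z"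
  and vx: "\<And>l. l \<in> L \<Longrightarrow> \<bar>v l - x l\<bar> < \<epsilon> / 2" and cz: "(\<Sum>l\<in>L. a l * v l) - ln z \<le> c + \<eta> / 3"
  by (rule truncated_tilt_exists[OF pmu L fmu c, of "\<epsilon> / 2" "\<eta> / 3"]) (use \<epsilon> \<eta> in auto)
 define S where "S = (\<Sum>l\<in>L. \<bar>a l\<bar>)"
 have S0: "S \<ge> 0" by (simp add: S_def sum_nonneg)
 \<comment> \<open>The slack \<open>\<eta>\<close> is spent in thirds: on the choice of the tilt, on
   \<open>\<delta> * S\<close>, and on the factor above one half that Chebyshev leaves.\<close>
 define \<delta> where "\<delta> = min (\<epsilon> / 2) (\<eta> / (3 * (S + 1)))"
 let ?A = "ln z - (\<Sum>l\<in>L. a l * v l) - \<delta> * S"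
 have \<delta>: "\<delta> > 0" using \<epsilon> \<eta> S0 by (simp add: \<delta>_def)
 have \<delta>S: "\<delta> * S \<le> \<eta> / 3"
 proof -
  have "\<delta> * S \<le> (\<eta> / (3 * (S + 1))) * (S + 1)" using S0 \<eta> by (intro mult_mono) (auto simp: \<delta>_def)
  also have "\<dots> = \<eta> / 3" using S0 by (simp add: field_simps)
  finally show ?thesis .
 qed
 define C where "C = real (card L) * (2 * K)\<^sup>2 / \<delta>\<^sup>2"
 have "((\<lambda>n. C / real n) \<longlongrightarrow> 0) sequentially" by (rule lim_const_over_n)
 then have e1: "eventually (\<lambda>n. C / real n < 1/2) sequentially" by (rule order_tendstoD) simp
 have "((\<lambda>n. exp (- (real n * (\<eta> / 3)))) \<longlongrightarrow> 0) sequentially"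
  using LIMSEQ_power_zero[of "exp (- (\<eta> / 3))"] \<eta> by (simp add: exp_of_nat_mult[symmetric])
 then have e2: "eventually (\<lambda>n. exp (- (real n * (\<eta> / 3))) < 1/2) sequentially" by (rule order_tendstoD) simp
 have "eventually (\<lambda>n. n \<ge> 1 \<and> C / real n < 1/2 \<and> exp (- (real n * (\<eta> / 3))) < 1/2) sequentially"
  using e1 e2 eventually_ge_at_top[of 1] by eventually_elim auto
 then obtain n0 where n0: "\<And>n. n \<ge> n0 \<Longrightarrow> n \<ge> 1 \<and> C / real n < 1/2 \<and> exp (- (real n * (\<eta> / 3))) < 1/2"
  by (auto simp: eventually_sequentially)
 show thesis
 proof (rule that[of n0])
  fix I assume I: "finite I" "I \<subseteq> J" "card I \<ge> n0"
  let ?n = "card I"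
  have n: "?n \<ge> 1" "C / real ?n < 1/2" "exp (- (real ?n * (\<eta> / 3))) < 1/2" using n0[OF I(3)] by auto
  then have I0: "I \<noteq> {}" by auto
  have indI: "indep_vars (\<lambda>_. N) Y I" using ind I(2) by (rule indep_vars_subset)
  have Ym[measurable]: "Y k \<in> measurable M N" if "k \<in> I" for k
   using indI that by (auto simp: indep_vars_def)
  have fm[measurable]: "f l \<in> borel_measurable N" if "l \<in> L" for l using f that .
  have "exp (- (real ?n * (c + \<eta>))) = exp (- (real ?n * (c + \<eta> / 3 + \<eta> / 3))) * exp (- (real ?n * (\<eta> / 3)))"
   by (simp add: exp_add[symmetric] algebra_simps)
  also have "\<dots> \<le> exp (real ?n * ?A) * (1 - C / real ?n)"
  proof (rule mult_mono)
   have "real ?n * - (c + \<eta> / 3 + \<eta> / 3) \<le> real ?n * ?A"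
    using cz \<delta>S by (intro mult_left_mono) auto
   then show "exp (- (real ?n * (c + \<eta> / 3 + \<eta> / 3))) \<le> exp (real ?n * ?A)"
    by (simp only: exp_le_cancel_iff mult_minus_right)
   show "exp (- (real ?n * (\<eta> / 3))) \<le> 1 - C / real ?n" using n(2,3) by linarith
  qed auto
  also have "\<dots> = exp (real ?n * (ln z - (\<Sum>l\<in>L. a l * v l) - \<delta> * (\<Sum>l\<in>L. \<bar>a l\<bar>)))
   * (1 - real (card L) * (2 * K)\<^sup>2 / (real ?n * \<delta>\<^sup>2))" by (simp add: S_def C_def mult.commute)
  also have "\<dots> \<le> prob {w \<in> space M. \<forall>l\<in>L. \<bar>(\<Sum>k\<in>I. f l (Y k w)) / real ?n - v l\<bar> < \<delta>}"
   by (rule tilted_lower_bound[OF I(1) I0 indI L _ _ refl refl, where \<mu>=\<mu>])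
     (use I dist f z v \<delta> spmu in auto)
  also have "\<dots> \<le> prob {w \<in> space M. \<forall>l\<in>L. \<bar>(\<Sum>k\<in>I. f l (Y k w)) / real ?n - x l\<bar> < \<epsilon>}"
  proof (intro finite_measure_mono)
   let ?B = "\<lambda>l w. \<Sum>k\<in>I. f l (Y k w)"
   show "{w \<in> space M. \<forall>l\<in>L. \<bar>(?B l w) / real ?n - x l\<bar> < \<epsilon>} \<in> sets M" using L I by measurable
   show "{w \<in> space M. \<forall>l\<in>L. \<bar>(?B l w) / real ?n - v l\<bar> < \<delta>}
    \<subseteq> {w \<in> space M. \<forall>l\<in>L. \<bar>(?B l w) / real ?n - x l\<bar> < \<epsilon>}"
   proof clarsimp
    fix w l assume *: "\<forall>l\<in>L. \<bar>(?B l w) / real ?n - v l\<bar> < \<delta>" and l: "l \<in> L"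
    have "\<bar>(?B l w) / real ?n - v l\<bar> < \<epsilon> / 2" using * l by (auto simp: \<delta>_def)
    then show "\<bar>(?B l w) / real ?n - x l\<bar> < \<epsilon>" using vx[OF l] by linarith
   qed
  qed
  finally show "exp (- (real ?n * (c + \<eta>))) \<le> prob {w \<in> space M. \<forall>l\<in>L. \<bar>(\<Sum>k\<in>I. f l (Y k w)) / real ?n - x l\<bar> < \<epsilon>}" .
 qed
qed

section \<open>The service rate as a supremum over partitions\<close>

text \<open>The traits of the log-moment generating function of a positive variable that the
  analysis needs; it may be infinite at every positive argument. \<open>\<Lambda>_lower\<close>
  reflects that the variable stays below some level with positive probability,
  \<open>\<Lambda>_at_bot\<close> that it is almost surely positive.\<close>

locale service_log_mgf =
 fixes \<Lambda> :: "real \<Rightarrow> ereal"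
 assumes \<Lambda>_zero: "\<Lambda> 0 = 0" and \<Lambda>_ninf: "\<Lambda> \<theta> \<noteq> - \<infinity>"
  and \<Lambda>_nonneg: "0 \<le> \<theta> \<Longrightarrow> 0 \<le> \<Lambda> \<theta>" and \<Lambda>_neg_finite: "\<theta> \<le> 0 \<Longrightarrow> \<Lambda> \<theta> < \<infinity>"
  and \<Lambda>_lower: "\<exists>c>0. \<exists>k\<ge>0. \<forall>\<theta>\<le>0. ereal (\<theta> * c - k) \<le> \<Lambda> \<theta>"
  and \<Lambda>_at_bot: "\<exists>\<theta>\<le>0. \<Lambda> \<theta> \<le> ereal (- K)"
begin

definition mgf_dom :: "real set" where "mgf_dom = {\<theta>. \<Lambda> \<theta> < \<infinity>}"

definition lmgf :: "real \<Rightarrow> real" where "lmgf \<theta> = real_of_ereal (\<Lambda> \<theta>)"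

lemma \<Lambda>_eq: "\<theta> \<in> mgf_dom \<Longrightarrow> \<Lambda> \<theta> = ereal (lmgf \<theta>)"
 using \<Lambda>_ninf[of \<theta>] by (cases "\<Lambda> \<theta>") (auto simp: mgf_dom_def lmgf_def)

lemma nonpos_in_mgf_dom: "\<theta> \<le> 0 \<Longrightarrow> \<theta> \<in> mgf_dom"
 using \<Lambda>_neg_finite by (auto simp: mgf_dom_def)

lemma zero_in_mgf_dom: "0 \<in> mgf_dom" by (rule nonpos_in_mgf_dom) simp

lemma lmgf_zero [simp]: "lmgf 0 = 0" by (simp add: lmgf_def \<Lambda>_zero)

lemma lmgf_nonneg: "\<theta> \<in> mgf_dom \<Longrightarrow> 0 \<le> \<theta> \<Longrightarrow> 0 \<le> lmgf \<theta>"
 using \<Lambda>_nonneg[of \<theta>] \<Lambda>_eq[of \<theta>] by simp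

lemma lmgf_lower: obtains c k where "c > 0" "k \<ge> 0" "\<forall>\<theta>\<le>0. \<theta> * c - k \<le> lmgf \<theta>"
proof -
 obtain c k where ck: "c > 0" "k \<ge> 0" "\<forall>\<theta>\<le>0. ereal (\<theta> * c - k) \<le> \<Lambda> \<theta>" using \<Lambda>_lower by blast
 then have "\<forall>\<theta>\<le>0. \<theta> * c - k \<le> lmgf \<theta>" using \<Lambda>_eq[OF nonpos_in_mgf_dom] by simp
 with ck show thesis by (intro that)
qed

lemma lmgf_at_bot: obtains \<theta> where "\<theta> \<le> 0" "lmgf \<theta> \<le> - K"
proof -
 obtain \<theta> where t: "\<theta> \<le> 0" "\<Lambda> \<theta> \<le> ereal (- K)" using \<Lambda>_at_bot by blast
 then have "lmgf \<theta> \<le> - K" using \<Lambda>_eq[OF nonpos_in_mgf_dom[OF t(1)]] by simp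
 with t show thesis by (intro that)
qed

text \<open>The perspective of the Legendre transform: for \<open>y > 0\<close> it is
  \<open>y\<close> times \<open>legendre \<Lambda> (1 / y)\<close>, and this form also makes sense
  at \<open>y = 0\<close>. Restricting to \<open>mgf_dom\<close> keeps every term finite.\<close>

definition rate_fun :: "real \<Rightarrow> ereal" where
 "rate_fun y = (SUP \<theta>\<in>mgf_dom. ereal (\<theta> - y * lmgf \<theta>))"

lemma rate_fun_ge: "\<theta> \<in> mgf_dom \<Longrightarrow> ereal (\<theta> - y * lmgf \<theta>) \<le> rate_fun y"
 unfolding rate_fun_def by (rule SUP_upper)

lemma rate_fun_nonneg: "0 \<le> rate_fun y"
 using rate_fun_ge[OF zero_in_mgf_dom, of y] by (simp add: zero_ereal_def)

lemma less_rate_fun_iff: "c < rate_fun y \<longleftrightarrow> (\<exists>\<theta>\<in>mgf_dom. c < ereal (\<theta> - y * lmgf \<theta>))"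
 unfolding rate_fun_def by (rule less_SUP_iff)

lemma mult_legendre:
 assumes y: "y > 0"
 shows "ereal y * legendre \<Lambda> (1 / y) = rate_fun y"
proof (rule antisym)
 show "ereal y * legendre \<Lambda> (1 / y) \<le> rate_fun y"
 proof -
  have "legendre \<Lambda> (1 / y) \<le> rate_fun y / ereal y"
   unfolding legendre_def
  proof (rule SUP_least)
   fix \<theta>
   show "ereal (\<theta> * (1 / y)) - \<Lambda> \<theta> \<le> rate_fun y / ereal y"
   proof (cases "\<theta> \<in> mgf_dom")
    case True
    have "ereal (\<theta> * (1 / y)) - \<Lambda> \<theta> = ereal (\<theta> - y * lmgf \<theta>) / ereal y"
     using y by (simp add: \<Lambda>_eq[OF True] field_simps)
    also have "\<dots> \<le> rate_fun y / ereal y"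
     using y rate_fun_ge[OF True] by (intro ereal_divide_right_mono) auto
    finally show ?thesis .
   next
    case False
    then show ?thesis by (simp add: mgf_dom_def)
   qed
  qed
  then show ?thesis using y by (subst (asm) ereal_le_divide_pos) auto
 qed
 show "rate_fun y \<le> ereal y * legendre \<Lambda> (1 / y)"
  unfolding rate_fun_def
 proof (rule SUP_least)
  fix \<theta> assume t: "\<theta> \<in> mgf_dom"
  have "ereal (\<theta> - y * lmgf \<theta>) = ereal y * (ereal (\<theta> * (1 / y)) - \<Lambda> \<theta>)"
   using y by (simp add: \<Lambda>_eq[OF t] field_simps)
  also have "\<dots> \<le> ereal y * legendre \<Lambda> (1 / y)"
   using y unfolding legendre_def by (intro ereal_mult_left_mono SUP_upper) auto
  finally show "ereal (\<theta> - y * lmgf \<theta>) \<le> ereal y * legendre \<Lambda> (1 / y)" .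
 qed
qed

text \<open>Evaluates the limit in \<open>service_integrand\<close>. A supremum of affine functions
  is lower semicontinuous; from above, nonnegative tilts contribute at most
  \<open>rate_fun 0\<close>, and negative ones at most \<open>z * k\<close> by the linear lower
  bound on \<open>\<Lambda>\<close>.\<close>

lemma rate_fun_at_0: "((\<lambda>z. ereal z * legendre \<Lambda> (1 / z)) \<longlongrightarrow> rate_fun 0) (at_right 0)"
proof -
 obtain c k where ck: "c > 0" "k \<ge> 0" "\<forall>\<theta>\<le>0. \<theta> * c - k \<le> lmgf \<theta>" by (rule lmgf_lower)
 have le: "rate_fun z \<le> max (rate_fun 0) (ereal (z * k))" if z: "0 < z" "z < 1 / c" for z
  unfolding rate_fun_def[of z]
 proof (rule SUP_least)
  fix \<theta> assume t: "\<theta> \<in> mgf_dom"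
  show "ereal (\<theta> - z * lmgf \<theta>) \<le> max (rate_fun 0) (ereal (z * k))"
  proof (cases "\<theta> \<ge> 0")
   case True
   then have "ereal (\<theta> - z * lmgf \<theta>) \<le> ereal (\<theta> - 0 * lmgf \<theta>)" using lmgf_nonneg[OF t] z by simp
   also have "\<dots> \<le> rate_fun 0" by (rule rate_fun_ge[OF t])
   finally show ?thesis by (simp add: le_max_iff_disj)
  next
   case False
   then have "z * (\<theta> * c - k) \<le> z * lmgf \<theta>" using ck z by (intro mult_left_mono) auto
   moreover have "\<theta> \<le> z * (\<theta> * c)" by (use z ck False in \<open>simp add: field_simps\<close>)
   ultimately show ?thesis by (auto simp: right_diff_distrib le_max_iff_disj)
  qed
 qed
 have lim: "(rate_fun \<longlongrightarrow> rate_fun 0) (at_right 0)"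
 proof (rule order_tendstoI)
  fix a assume "a < rate_fun 0"
  then obtain \<theta> where t: "\<theta> \<in> mgf_dom" "a < ereal (\<theta> - 0 * lmgf \<theta>)" unfolding less_rate_fun_iff by blast
  have "((\<lambda>z. ereal (\<theta> - z * lmgf \<theta>)) \<longlongrightarrow> ereal (\<theta> - 0 * lmgf \<theta>)) (at_right 0)"
   by (intro tendsto_intros)
  then have "eventually (\<lambda>z. a < ereal (\<theta> - z * lmgf \<theta>)) (at_right 0)" using t(2) by (rule order_tendstoD)
  then show "eventually (\<lambda>z. a < rate_fun z) (at_right 0)"
   by eventually_elim (use rate_fun_ge[OF t(1)] in \<open>auto intro: less_le_trans\<close>)
 next
  fix a assume a: "rate_fun 0 < a"
  have "((\<lambda>z. ereal (z * k)) \<longlongrightarrow> ereal (0 * k)) (at_right 0)" by (intro tendsto_intros)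
  moreover have "ereal (0 * k) < a" using le_less_trans[OF rate_fun_nonneg a] by (simp add: zero_ereal_def)
  ultimately have "eventually (\<lambda>z. ereal (z * k) < a) (at_right 0)" by (rule order_tendstoD)
  moreover have "eventually (\<lambda>z. z \<in> {0<..<1/c}) (at_right 0)" using ck(1) by (intro eventually_at_right_real) auto
  ultimately show "eventually (\<lambda>z. rate_fun z < a) (at_right 0)"
   by (eventually_elim, (use a in \<open>((intro le_less_trans[OF le]), auto)\<close>))
 qed
 have "eventually (\<lambda>z. rate_fun z = ereal z * legendre \<Lambda> (1 / z)) (at_right 0)"
  using eventually_at_right_less[of 0] by eventually_elim (simp add: mult_legendre)
 then show ?thesis using lim by (rule Lim_transform_eventually[rotated])
qed

lemma service_integrand_eq: "0 \<le> y \<Longrightarrow> service_integrand \<Lambda> y = rate_fun y"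
 using tendsto_Lim[OF _ rate_fun_at_0] by (simp add: service_integrand_def mult_legendre)

text \<open>The supremum runs over uncountably many tilts, so measurability comes from lower
  semicontinuity: superlevel sets are unions of open sets.\<close>

lemma borel_measurable_rate_fun [measurable]: "rate_fun \<in> borel_measurable borel"
proof (rule borel_measurableI_greater)
 fix c
 have "{y. c < rate_fun y} = (\<Union>\<theta>\<in>mgf_dom. {y. c < ereal (\<theta> - y * lmgf \<theta>)})"
  by (auto simp: less_rate_fun_iff)
 also have "open \<dots>"
  by (intro open_UN ballI open_Collect_less continuous_intros)
 finally show "{y \<in> space borel. c < rate_fun y} \<in> sets borel" by simp
qed

text \<open>The tilted values of all families have the service rate as their supremum.\<close>

definition tilted_family :: "real \<Rightarrow> (real \<times> real) set \<Rightarrow> (real \<times> real \<Rightarrow> real) \<Rightarrow> bool" where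
 "tilted_family T P \<theta> \<longleftrightarrow> finite P \<and> (\<forall>(u, v)\<in>P. 0 \<le> u \<and> u < v \<and> v \<le> T) \<and>
   disjoint_family_on (\<lambda>(u, v). {u<..<v}) P \<and> \<theta> ` P \<subseteq> mgf_dom"

definition tilted_value :: "(real \<times> real) set \<Rightarrow> (real \<times> real \<Rightarrow> real) \<Rightarrow> (real \<Rightarrow> real) \<Rightarrow> real" where
 "tilted_value P \<theta> \<psi> = (\<Sum>p\<in>P. \<theta> p * (snd p - fst p) - lmgf (\<theta> p) * (\<psi> (snd p) - \<psi> (fst p)))"

text \<open>One very negative tilt, the same on all intervals, is enough:
  \<open>- lmgf \<theta> \<ge> K\<close> weighs the increments, while the lengths contribute at most
  \<open>\<bar>\<theta>\<bar>\<close> times their sum.\<close>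

lemma abs_continuous_of_tilted_bound:
 assumes bd: "\<And>P \<theta>. tilted_family T P \<theta> \<Longrightarrow> tilted_value P \<theta> \<psi> \<le> a" and mono: "mono_on {0..T} \<psi>"
 shows "abs_continuous_on 0 T \<psi>"
 unfolding abs_continuous_on_def
proof (intro allI impI)
 let ?C = "\<lambda>p. \<psi> (snd p) - \<psi> (fst p)"
 let ?B = "\<lambda>P. \<Sum>(u, v)\<in>P. \<bar>\<psi> v - \<psi> u\<bar>"
 fix e :: real assume e: "e > 0"
 \<comment> \<open>Makes \<open>(\<bar>a\<bar> + 1) / K\<close> equal to \<open>e / 2\<close>; the
   summand one pays for \<open>\<bar>\<theta>\<bar> * d\<close>.\<close>
 define K where "K = 2 * (\<bar>a\<bar> + 1) / e"
 have K: "K > 0" using e by (simp add: K_def)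
 obtain \<theta> where t: "\<theta> \<le> 0" "lmgf \<theta> \<le> - K" by (rule lmgf_at_bot)
 define d where "d = 1 / (\<bar>\<theta>\<bar> + 1)"
 have d: "d > 0" by (simp add: d_def)
 show "\<exists>d>0. \<forall>P. finite P \<and> (\<forall>(u, v)\<in>P. 0 \<le> u \<and> u < v \<and> v \<le> T) \<and>
    disjoint_family_on (\<lambda>(u, v). {u<..<v}) P \<and> (\<Sum>(u, v)\<in>P. v - u) < d
    \<longrightarrow> (?B P) < e"
 proof (intro exI[of _ d] conjI allI impI d)
  fix P assume P: "finite P \<and> (\<forall>(u, v)\<in>P. 0 \<le> u \<and> u < v \<and> v \<le> T) \<and>
    disjoint_family_on (\<lambda>(u, v). {u<..<v}) P \<and> (\<Sum>(u, v)\<in>P. v - u) < d"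
  let ?A = "\<Sum>p\<in>P. snd p - fst p"
  have fam: "tilted_family T P (\<lambda>_. \<theta>)"
   using P nonpos_in_mgf_dom[OF t(1)] by (auto simp: tilted_family_def)
  have inc: "\<psi> (fst p) \<le> \<psi> (snd p)" if "p \<in> P" for p
   using P that by (intro mono_onD[OF mono]) auto
  have sumabs: "(?B P) = (\<Sum>p\<in>P. \<psi> (snd p) - \<psi> (fst p))"
   using inc by (intro sum.cong) (auto simp: split_beta)
  have len: "?A < d" using P by (simp add: split_beta)
  have len0: "0 \<le> ?A" using P by (intro sum_nonneg) auto
  have "\<theta> * ?A + K * (\<Sum>p\<in>P. \<psi> (snd p) - \<psi> (fst p)) \<le> tilted_value P (\<lambda>_. \<theta>) \<psi>"
   unfolding tilted_value_def sum_distrib_left sum.distrib[symmetric]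
  proof (rule sum_mono)
   fix p assume p: "p \<in> P"
   have "K * ?C p \<le> - lmgf \<theta> * ?C p"
    using t(2) inc[OF p] by (intro mult_right_mono) auto
   then show "\<theta> * (snd p - fst p) + K * ?C p \<le> \<theta> * (snd p - fst p) - lmgf \<theta> * ?C p" by simp
  qed
  also have "\<dots> \<le> a" by (rule bd[OF fam])
  finally have "K * (\<Sum>p\<in>P. \<psi> (snd p) - \<psi> (fst p)) \<le> a + \<bar>\<theta>\<bar> * ?A" using t(1) by simp
  also have "\<bar>\<theta>\<bar> * ?A \<le> \<bar>\<theta>\<bar> * d" using len by (intro mult_left_mono) auto
  also have "\<bar>\<theta>\<bar> * d \<le> 1" by (simp add: d_def)
  finally have "K * (\<Sum>p\<in>P. \<psi> (snd p) - \<psi> (fst p)) \<le> \<bar>a\<bar> + 1" by simp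
  then have "(\<Sum>p\<in>P. \<psi> (snd p) - \<psi> (fst p)) \<le> (\<bar>a\<bar> + 1) / K" using K by (simp add: pos_le_divide_eq mult.commute)
  also have "\<dots> = e / 2" by (use e in \<open>auto simp: field_simps K_def\<close>)
  also have "\<dots> < e" using e by simp
  finally show "(?B P) < e" unfolding sumabs .
 qed
qed

text \<open>Trades \<open>deriv\<close>, which is unspecified where the derivative does not exist,
  for the density \<open>h\<close>; the two endpoints form a null set.\<close>

lemma service_rate_eq:
 assumes T: "T > 0" and ac: "abs_continuous_on 0 T \<psi>" and mono: "mono_on {0..T} \<psi>" and z: "\<psi> 0 = 0"
  and h: "AE t in lborel. t \<in> {0<..<T} \<longrightarrow> (\<psi> has_real_derivative h t) (at t)" and h0: "\<And>t. 0 \<le> h t"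
 shows "service_rate \<Lambda> T \<psi> = enn2ereal (\<integral>\<^sup>+t\<in>{0<..<T}. e2ennreal (rate_fun (h t)) \<partial>lborel)"
proof -
 let ?A = "\<lambda>t. service_integrand \<Lambda> (deriv \<psi> t)"
 have "(\<integral>\<^sup>+t\<in>{0..T}. e2ennreal (?A t) \<partial>lborel) = (\<integral>\<^sup>+t\<in>{0<..<T}. e2ennreal (rate_fun (h t)) \<partial>lborel)"
 proof (rule nn_integral_cong_AE)
  have "AE t in lborel. t \<noteq> 0" "AE t in lborel. t \<noteq> T" by (rule AE_lborel_singleton)+
  with h show "AE t in lborel. e2ennreal (?A t) * indicator {0..T} t = e2ennreal (rate_fun (h t)) * indicator {0<..<T} t"
  proof eventually_elim
   fix t assume *: "t \<in> {0<..<T} \<longrightarrow> (\<psi> has_real_derivative h t) (at t)" "t \<noteq> 0" "t \<noteq> T"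
   show "e2ennreal (?A t) * indicator {0..T} t = e2ennreal (rate_fun (h t)) * indicator {0<..<T} t"
   proof (cases "t \<in> {0<..<T}")
    case True
    then have "deriv \<psi> t = h t" using * by (intro DERIV_imp_deriv) simp
    then show ?thesis using True service_integrand_eq[OF h0] by simp
   next
    case False
    then show ?thesis using * by (auto simp: indicator_def)
   qed
  qed
 qed
 then show ?thesis using ac mono z by (simp add: service_rate_def)
qed

text \<open>On each interval integrate the inequality between
  \<open>\<theta> - h t * lmgf \<theta>\<close> and \<open>rate_fun (h t)\<close>; disjointness of
  the intervals bounds the sum by the full integral.\<close>

lemma tilted_value_le_service_rate:
 assumes T: "T > 0" and fam: "tilted_family T P \<theta>"
 shows "ereal (tilted_value P \<theta> \<psi>) \<le> service_rate \<Lambda> T \<psi>"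
proof (cases "abs_continuous_on 0 T \<psi> \<and> mono_on {0..T} \<psi> \<and> \<psi> 0 = 0")
 case False
 then show ?thesis by (auto simp: service_rate_def)
next
 case True
 then have ac: "abs_continuous_on 0 T \<psi>" and mono: "mono_on {0..T} \<psi>" and z: "\<psi> 0 = 0" by auto
 obtain h where hm[measurable]: "h \<in> borel_measurable borel" and h0: "\<forall>t. 0 \<le> h t"
  and h: "AE t in lborel. t \<in> {0<..<T} \<longrightarrow> (\<psi> has_real_derivative h t) (at t)"
  and hint: "\<forall>u v. 0 \<le> u \<and> u \<le> v \<and> v \<le> T \<longrightarrow> (\<integral>\<^sup>+t\<in>{u<..v}. ennreal (h t) \<partial>lborel) = ennreal (\<psi> v - \<psi> u)"
  by (rule abs_continuous_mono_deriv[OF T ac mono])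
 define G where "G t = e2ennreal (rate_fun (h t))" for t
 have Gm[measurable]: "G \<in> borel_measurable borel" unfolding G_def by measurable
 have part: "ennreal (\<theta> p * (snd p - fst p) - lmgf (\<theta> p) * (\<psi> (snd p) - \<psi> (fst p))) \<le> (\<integral>\<^sup>+t\<in>{fst p<..snd p}. G t \<partial>lborel)"
  if p: "p \<in> P" for p
 proof -
  obtain u v where uv: "p = (u, v)" by (cases p)
  let ?C = "\<integral>\<^sup>+t\<in>{u<..v}. G t \<partial>lborel"
  have u: "0 \<le> u" "u < v" "v \<le> T" using fam p uv by (auto simp: tilted_family_def)
  have th: "\<theta> p \<in> mgf_dom" using fam p by (auto simp: tilted_family_def)
  define a where "a = \<theta> p"
  define l where "l = lmgf (\<theta> p)"
  let ?B = "\<integral>\<^sup>+t\<in>{u<..v}. (ennreal (max a 0) + ennreal (max (- l) 0) * ennreal (h t)) \<partial>lborel"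
  define \<Delta>\<psi> where "\<Delta>\<psi> = \<psi> v - \<psi> u"
  let ?E = "max (- a) 0 * (v - u) + max l 0 * \<Delta>\<psi>"
  have \<Delta>0: "\<Delta>\<psi> \<ge> 0" unfolding \<Delta>\<psi>_def using mono_onD[OF mono, of u v] u by simp
  have hi: "(\<integral>\<^sup>+t\<in>{u<..v}. ennreal (h t) \<partial>lborel) = ennreal \<Delta>\<psi>" unfolding \<Delta>\<psi>_def using hint u by auto
  \<comment> \<open>Nonnegative integrals cannot carry the signs of \<open>a\<close> and
    \<open>l\<close>. Both are split into positive and negative parts, and the negative terms are
    moved to the other side.\<close>
  have pt: "ennreal (max a 0) + ennreal (max (- l) 0) * ennreal (h t) \<le> G t + (ennreal (max (- a) 0) + ennreal (max l 0) * ennreal (h t))" for t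
  proof -
   let ?D = "max (- a) 0 + max l 0 * h t"
   have 1: "ennreal (a - h t * l) \<le> G t" unfolding G_def a_def l_def
    using e2ennreal_mono[OF rate_fun_ge[OF th, of "h t"]] by simp
   have "ennreal (max a 0) + ennreal (max (- l) 0) * ennreal (h t) = ennreal (max a 0 + max (- l) 0 * h t)"
    using h0 by (simp add: ennreal_mult ennreal_plus)
   also have "\<dots> = ennreal ((a - h t * l) + ?D)"
    by (rule arg_cong[where f=ennreal]) (auto simp: max_def algebra_simps)
   also have "\<dots> \<le> ennreal (a - h t * l) + ennreal ?D"
   proof (cases "a - h t * l \<ge> 0")
    case True
    then show ?thesis using h0 by (simp add: ennreal_plus)
   next
    case False
    then have "ennreal ((a - h t * l) + ?D) \<le> ennreal ?D" by (intro ennreal_leI) simp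
    then show ?thesis by (rule order_trans) simp
   qed
   also have "ennreal ?D = ennreal (max (- a) 0) + ennreal (max l 0) * ennreal (h t)"
    using h0 by (simp add: ennreal_mult ennreal_plus)
   finally show ?thesis using 1 by (meson add_right_mono order_trans)
  qed
  have "?B
    \<le> (\<integral>\<^sup>+t\<in>{u<..v}. (G t + (ennreal (max (- a) 0) + ennreal (max l 0) * ennreal (h t))) \<partial>lborel)"
   by (intro nn_integral_mono mult_right_mono pt) auto
  also have "\<dots> = ?C + (ennreal (max (- a) 0) * ennreal (v - u) + ennreal (max l 0) * ennreal \<Delta>\<psi>)"
   using u hi by (simp add: distrib_right nn_integral_add nn_integral_cmult mult.assoc nn_integral_cmult_indicator)
  also have "?B = ennreal (max a 0) * ennreal (v - u) + ennreal (max (- l) 0) * ennreal \<Delta>\<psi>"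
   using u hi by (simp add: distrib_right nn_integral_add nn_integral_cmult mult.assoc nn_integral_cmult_indicator)
  finally have le: "ennreal (max a 0 * (v - u) + max (- l) 0 * \<Delta>\<psi>) \<le> ?C + ennreal ?E"
   using u \<Delta>0 by (simp add: ennreal_mult ennreal_plus)
  have "ennreal (max a 0 * (v - u) + max (- l) 0 * \<Delta>\<psi> - ?E) \<le> ?C"
   using le u \<Delta>0 by (subst ennreal_minus[symmetric]) (auto simp: ennreal_minus_le_iff add.commute)
  also have "max a 0 * (v - u) + max (- l) 0 * \<Delta>\<psi> - ?E = a * (v - u) - l * \<Delta>\<psi>"
   by (auto simp: max_def algebra_simps)
  finally show ?thesis by (simp add: uv a_def l_def \<Delta>\<psi>_def)
 qed
 have finP: "finite P" using fam by (simp add: tilted_family_def)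
 \<comment> \<open>A common point of two half-open intervals would have common points of the open
   ones just to its left.\<close>
 have disj: "indicator {fst p<..snd p} t * indicator {fst q<..snd q} t = (0::ennreal)" if "p \<in> P" "q \<in> P" "p \<noteq> q" for p q t
  by (use dense fam that in \<open>force simp: indicator_def tilted_family_def disjoint_family_on_def split_beta\<close>)
 have ind: "(\<Sum>p\<in>P. indicator {fst p<..snd p} t) \<le> (indicator {0<..T} t :: ennreal)" for t
 proof (cases "\<exists>p\<in>P. t \<in> {fst p<..snd p}")
  case False
  then show ?thesis by simp
 next
  case True
  then obtain p where p: "p \<in> P" "t \<in> {fst p<..snd p}" by blast
  have "(\<Sum>q\<in>P. indicator {fst q<..snd q} t) = (\<Sum>q\<in>{p}. indicator {fst q<..snd q} t :: ennreal)"
   using finP p disj[OF p(1)] by (intro sum.mono_neutral_right) (auto simp: indicator_def)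
  also have "\<dots> \<le> indicator {0<..T} t" using p p fam by (auto simp: tilted_family_def indicator_def split_beta)
  finally show ?thesis .
 qed
 have "ennreal (tilted_value P \<theta> \<psi>) \<le> (\<Sum>p\<in>P. ennreal (\<theta> p * (snd p - fst p) - lmgf (\<theta> p) * (\<psi> (snd p) - \<psi> (fst p))))"
 proof -
  let ?A = "\<lambda>p. \<theta> p * (snd p - fst p) - lmgf (\<theta> p) * (\<psi> (snd p) - \<psi> (fst p))"
  have "tilted_value P \<theta> \<psi> \<le> (\<Sum>p\<in>P. max 0 (?A p))"
   unfolding tilted_value_def by (intro sum_mono) auto
  then have "ennreal (tilted_value P \<theta> \<psi>) \<le> ennreal (\<Sum>p\<in>P. max 0 (?A p))" by (rule ennreal_leI)
  also have "\<dots> = (\<Sum>p\<in>P. ennreal (max 0 (?A p)))"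
   by (rule sum_ennreal[symmetric]) simp
  also have "\<dots> = (\<Sum>p\<in>P. ennreal (?A p))"
   by (intro sum.cong refl) (auto simp: max_def ennreal_neg)
  finally show ?thesis .
 qed
 also have "\<dots> \<le> (\<Sum>p\<in>P. (\<integral>\<^sup>+t\<in>{fst p<..snd p}. G t \<partial>lborel))" by (intro sum_mono part)
 also have "\<dots> = (\<integral>\<^sup>+t. G t * (\<Sum>p\<in>P. indicator {fst p<..snd p} t) \<partial>lborel)"
  by (subst nn_integral_sum[symmetric]) (auto simp: sum_distrib_left)
 also have "\<dots> \<le> (\<integral>\<^sup>+t\<in>{0<..T}. G t \<partial>lborel)" by (intro nn_integral_mono mult_left_mono ind) auto
 also have "\<dots> = (\<integral>\<^sup>+t\<in>{0<..<T}. G t \<partial>lborel)"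
  by ((rule nn_integral_cong_AE), (use AE_lborel_singleton[of T] in \<open>(eventually_elim, (auto simp: indicator_def))\<close>))
 finally have "enn2ereal (ennreal (tilted_value P \<theta> \<psi>)) \<le> enn2ereal (\<integral>\<^sup>+t\<in>{0<..<T}. G t \<partial>lborel)"
  by (simp add: less_eq_ennreal.rep_eq)
 also have "\<dots> = service_rate \<Lambda> T \<psi>" unfolding G_def using service_rate_eq[OF T ac mono z h] h0 by simp
 finally have *: "enn2ereal (ennreal (tilted_value P \<theta> \<psi>)) \<le> service_rate \<Lambda> T \<psi>" .
 have "ereal (tilted_value P \<theta> \<psi>) \<le> enn2ereal (ennreal (tilted_value P \<theta> \<psi>))"
  by (cases "tilted_value P \<theta> \<psi> \<ge> 0") (auto simp: enn2ereal_ennreal ennreal_neg zero_ennreal.rep_eq)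
 then show ?thesis using * by (rule order_trans)
qed

text \<open>Grid cells shrink to \<open>t\<close> without having \<open>t\<close> as an endpoint;
  the linearisation errors at both ends add up to at most the slope error times the cell
  length.\<close>

lemma straddle_slope:
 fixes \<psi> :: "real \<Rightarrow> real"
 assumes d: "(\<psi> has_real_derivative D) (at t)" and u: "u \<longlonglongrightarrow> t" and v: "v \<longlonglongrightarrow> t"
  and uv: "\<And>n. u n \<le> t" "\<And>n. t \<le> v n" "\<And>n. u n < v n"
 shows "(\<lambda>n. (\<psi> (v n) - \<psi> (u n)) / (v n - u n)) \<longlonglongrightarrow> D"
proof (rule LIMSEQ_I)
 fix r :: real assume r: "0 < r"
 obtain s where s: "s > 0" "\<And>x. x \<noteq> t \<Longrightarrow> \<bar>x - t\<bar> < s \<Longrightarrow> \<bar>(\<psi> x - \<psi> t) / (x - t) - D\<bar> < r"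
  using d r unfolding has_field_derivative_iff LIM_def dist_real_def by blast
 have lin: "\<bar>\<psi> x - \<psi> t - D * (x - t)\<bar> \<le> r * \<bar>x - t\<bar>" if "\<bar>x - t\<bar> < s" for x
 proof (cases "x = t")
  case False
  have "\<bar>\<psi> x - \<psi> t - D * (x - t)\<bar> = \<bar>(\<psi> x - \<psi> t) / (x - t) - D\<bar> * \<bar>x - t\<bar>"
   by (use False left_diff_distrib in \<open>simp add: field_simps\<close>)
  also have "\<dots> \<le> r * \<bar>x - t\<bar>" using s(2)[OF False that] by (intro mult_right_mono) auto
  finally show ?thesis .
 qed simp
 have strict: "\<bar>(\<psi> x - \<psi> t) / (x - t) - D\<bar> < r" if "\<bar>x - t\<bar> < s" "x \<noteq> t" for x using s(2) that by blast
 have linstrict: "\<bar>\<psi> x - \<psi> t - D * (x - t)\<bar> < r * \<bar>x - t\<bar>" if "\<bar>x - t\<bar> < s" "x \<noteq> t" for x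
 proof -
  have "\<bar>\<psi> x - \<psi> t - D * (x - t)\<bar> = \<bar>(\<psi> x - \<psi> t) / (x - t) - D\<bar> * \<bar>x - t\<bar>"
  proof -
   have "((\<psi> x - \<psi> t) / (x - t) - D) * (x - t) = \<psi> x - \<psi> t - D * (x - t)"
    using that by (subst left_diff_distrib) simp
   then show ?thesis by (simp only: abs_mult[symmetric])
  qed
  also have "\<dots> < r * \<bar>x - t\<bar>" using strict[OF that] that by (intro mult_strict_right_mono) auto
  finally show ?thesis .
 qed
 obtain n1 where n1: "\<And>n. n \<ge> n1 \<Longrightarrow> \<bar>u n - t\<bar> < s" using LIMSEQ_D[OF u s(1)] by auto
 obtain n2 where n2: "\<And>n. n \<ge> n2 \<Longrightarrow> \<bar>v n - t\<bar> < s" using LIMSEQ_D[OF v s(1)] by auto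
 show "\<exists>no. \<forall>n\<ge>no. norm ((\<psi> (v n) - \<psi> (u n)) / (v n - u n) - D) < r"
 proof (intro exI[of _ "max n1 n2"] allI impI)
  fix n assume n: "max n1 n2 \<le> n"
  have a: "\<bar>u n - t\<bar> < s" "\<bar>v n - t\<bar> < s" using n1 n2 n by auto
  have "\<bar>\<psi> (v n) - \<psi> (u n) - D * (v n - u n)\<bar> \<le> \<bar>\<psi> (v n) - \<psi> t - D * (v n - t)\<bar> + \<bar>\<psi> (u n) - \<psi> t - D * (u n - t)\<bar>"
   by (simp add: algebra_simps)
  also have "\<dots> < r * \<bar>v n - t\<bar> + r * \<bar>u n - t\<bar>"
   by (use uv(3)[of n] lin[OF a(2)] linstrict[OF a(1)] lin[OF a(1)] linstrict[OF a(2)] in \<open>linarith\<close>)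
  also have "\<dots> = r * (v n - u n)" using uv(1,2)[of n] by (simp add: algebra_simps)
  finally have "\<bar>\<psi> (v n) - \<psi> (u n) - D * (v n - u n)\<bar> < r * (v n - u n)" .
  moreover have "(\<psi> (v n) - \<psi> (u n)) / (v n - u n) - D = (\<psi> (v n) - \<psi> (u n) - D * (v n - u n)) / (v n - u n)"
   using uv(3)[of n] by (simp add: diff_divide_distrib)
  ultimately show "norm ((\<psi> (v n) - \<psi> (u n)) / (v n - u n) - D) < r"
   using uv(3)[of n] by (simp add: abs_divide pos_divide_less_eq)
 qed
qed

text \<open>Fatou's lemma along uniform grids. On each cell a nearly optimal tilt for the slope of
  \<open>\<psi>\<close> is chosen. The resulting step functions \<open>F n\<close> have integral at
  most \<open>a + T / real (Suc n)\<close>, and at almost every \<open>t\<close> their lower limit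
  dominates \<open>rate_fun (h t)\<close>, since the slopes converge and \<open>rate_fun\<close> is
  lower semicontinuous.\<close>

lemma service_rate_le_of_tilted_bound:
 assumes T: "T > 0" and bd: "\<And>P \<theta>. tilted_family T P \<theta> \<Longrightarrow> tilted_value P \<theta> \<psi> \<le> a"
  and mono: "mono_on {0..T} \<psi>" and z: "\<psi> 0 = 0"
 shows "service_rate \<Lambda> T \<psi> \<le> ereal a"
proof -
 have ac: "abs_continuous_on 0 T \<psi>" by (rule abs_continuous_of_tilted_bound[OF bd mono])
 obtain h where hm[measurable]: "h \<in> borel_measurable borel" and h0: "\<forall>t. 0 \<le> h t"
  and h: "AE t in lborel. t \<in> {0<..<T} \<longrightarrow> (\<psi> has_real_derivative h t) (at t)"
  and hint: "\<forall>u v. 0 \<le> u \<and> u \<le> v \<and> v \<le> T \<longrightarrow> (\<integral>\<^sup>+t\<in>{u<..v}. ennreal (h t) \<partial>lborel) = ennreal (\<psi> v - \<psi> u)"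
  by (rule abs_continuous_mono_deriv[OF T ac mono])
 have a0: "0 \<le> a" using bd[of "{}" "\<lambda>_. 0"] by (simp add: tilted_family_def tilted_value_def disjoint_family_on_def)
 define g where "g n j = real j * T / real (Suc n)" for n j :: nat
 let ?A = "\<lambda>n j. \<psi> (g n (Suc j)) - \<psi> (g n j)"
 have gd: "g n (Suc j) - g n j = T / real (Suc n)" for n j
  unfolding g_def diff_divide_distrib[symmetric] left_diff_distrib[symmetric] by simp
 have gpos: "g n j < g n (Suc j)" for n j using gd[of n j] T by (smt (verit) divide_pos_pos of_nat_0_less_iff zero_less_Suc)
 have gT: "g n (Suc n) = T" by (simp add: g_def)
 have gmono: "g n i \<le> g n j" if "i \<le> j" for n i j unfolding g_def using that T by (intro divide_right_mono mult_right_mono) auto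
 define sl where "sl n j = (?A n j) / (g n (Suc j) - g n j)" for n j
 \<comment> \<open>The supremum may be infinite, so near-optimality is measured against the cap
   \<open>real n\<close>.\<close>
 have "\<exists>\<theta>\<in>mgf_dom. min (rate_fun (sl n j)) (ereal (real n)) \<le> ereal (\<theta> - sl n j * lmgf \<theta> + 1 / real (Suc n))" for n j
 proof -
  have "min (rate_fun (sl n j)) (ereal (real n)) - ereal (1 / real (Suc n)) < rate_fun (sl n j)"
  proof (cases "rate_fun (sl n j)")
   case (real r)
   have p: "0 < 1 / (1 + real n)" by simp
   show ?thesis
   proof (cases "r \<le> real n")
    case True
    then show ?thesis using real by (simp add: min_def)
   next
    case False
    then have "real n - 1 / (1 + real n) < r" using p by linarith
    then show ?thesis using real False by (simp add: min_def)
   qed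
  qed (use rate_fun_nonneg[of "sl n j"] in auto)
  then obtain \<theta> where t: "\<theta> \<in> mgf_dom" "min (rate_fun (sl n j)) (ereal (real n)) - ereal (1 / real (Suc n)) < ereal (\<theta> - sl n j * lmgf \<theta>)"
   unfolding less_rate_fun_iff by blast
  then have "min (rate_fun (sl n j)) (ereal (real n)) \<le> ereal (\<theta> - sl n j * lmgf \<theta> + 1 / real (Suc n))"
   by (cases "min (rate_fun (sl n j)) (ereal (real n))") auto
  then show ?thesis using t(1) by blast
 qed
 then obtain \<Theta> where \<Theta>: "\<And>n j. \<Theta> n j \<in> mgf_dom" "\<And>n j. min (rate_fun (sl n j)) (ereal (real n)) \<le> ereal (\<Theta> n j - sl n j * lmgf (\<Theta> n j) + 1 / real (Suc n))"
  by metis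
 define c where "c n j = \<Theta> n j - sl n j * lmgf (\<Theta> n j) + 1 / real (Suc n)" for n j
 have c0: "0 \<le> c n j" for n j
 proof -
  have "ereal 0 \<le> min (rate_fun (sl n j)) (ereal (real n))" using rate_fun_nonneg by (simp add: zero_ereal_def[symmetric])
  also have "\<dots> \<le> ereal (c n j)" unfolding c_def by (rule \<Theta>(2))
  finally show ?thesis by simp
 qed
 define I where "I n j = {g n j<..g n (Suc j)}" for n j
 define F where "F n t = (\<Sum>j<Suc n. ennreal (c n j) * indicator (I n j) t)" for n t
 let ?C = "\<lambda>n. \<integral>\<^sup>+t. F n t \<partial>lborel"
 have Fm[measurable]: "F n \<in> borel_measurable borel" for n unfolding F_def I_def by measurable
 have intF: "(?C n) \<le> ennreal (a + T / real (Suc n))" for n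
 proof -
  let ?B = "\<Sum>j<Suc n. c n j * (g n (Suc j) - g n j)"
  have "(?C n) = (\<Sum>j<Suc n. ennreal (c n j) * emeasure lborel (I n j))"
   unfolding F_def I_def by (subst nn_integral_sum) (auto simp: nn_integral_cmult_indicator)
  also have "\<dots> = (\<Sum>j<Suc n. ennreal (c n j * (g n (Suc j) - g n j)))"
   using c0 gpos by (intro sum.cong) (auto simp: I_def ennreal_mult less_imp_le)
  also have "\<dots> = ennreal ?B"
   using c0 gpos by (intro sum_ennreal mult_nonneg_nonneg) (auto intro: less_imp_le)
  also have "?B \<le> a + T / real (Suc n)"
  proof -
   define p where "p j = (g n j, g n (Suc j))" for j
   define P where "P = p ` {..<Suc n}"
   have gs: "g n i < g n j" if "i < j" for i j
    unfolding g_def using that T by (intro divide_strict_right_mono mult_strict_right_mono) auto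
   have inj: "inj_on p {..<Suc n}"
   proof (rule inj_onI)
    fix i j assume "p i = p j"
    then show "i = j" using gs[of i j] gs[of j i] by (fastforce simp: p_def)
   qed
   \<comment> \<open>Families index their tilts by intervals, so the cell number is recovered from
     the interval.\<close>
   define \<theta> where "\<theta> q = \<Theta> n (the_inv_into {..<Suc n} p q)" for q
   have th: "\<theta> (p j) = \<Theta> n j" if "j < Suc n" for j
    using the_inv_into_f_f[OF inj, of j] that by (simp add: \<theta>_def)
   have "tilted_family T P \<theta>" unfolding tilted_family_def
   proof (intro conjI)
    show "finite P" by (simp add: P_def)
    show "\<forall>(u, v)\<in>P. 0 \<le> u \<and> u < v \<and> v \<le> T"
    proof -
     have "0 \<le> g n j \<and> g n (Suc j) \<le> T" if "j < Suc n" for j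
      using gmono[of "Suc j" "Suc n" n] gmono[of 0 j n] that gT by (simp add: g_def)
     then show ?thesis using gpos by (auto simp: P_def p_def)
    qed
    show "disjoint_family_on (\<lambda>(u, v). {u<..<v}) P"
     unfolding disjoint_family_on_def
    proof (intro ballI impI)
     fix q r assume "q \<in> P" "r \<in> P" "q \<noteq> r"
     then obtain i j where ij: "q = p i" "r = p j" "i \<noteq> j" by (auto simp: P_def)
     show "(case q of (u, v) \<Rightarrow> {u<..<v}) \<inter> (case r of (u, v) \<Rightarrow> {u<..<v}) = {}" using ij(3) gmono[of "Suc i" j n] gmono[of "Suc j" i n] unfolding ij p_def by fastforce
    qed
    show "\<theta> ` P \<subseteq> mgf_dom" using \<Theta>(1) by (auto simp: \<theta>_def)
   qed
   then have "tilted_value P \<theta> \<psi> \<le> a" by (rule bd)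
   moreover have "tilted_value P \<theta> \<psi> = (\<Sum>j<Suc n. \<Theta> n j * (g n (Suc j) - g n j) - lmgf (\<Theta> n j) * (?A n j))"
    unfolding tilted_value_def P_def sum.reindex[OF inj] comp_def
   by (use sum.cong[OF refl] th in \<open>auto simp: p_def\<close>)
   moreover have "?B = (\<Sum>j<Suc n. \<Theta> n j * (g n (Suc j) - g n j) - lmgf (\<Theta> n j) * (?A n j)) + T / real (Suc n)"
   proof -
    have "c n j * (g n (Suc j) - g n j) = \<Theta> n j * (g n (Suc j) - g n j) - lmgf (\<Theta> n j) * ?A n j + T / real (Suc n) / real (Suc n)" for j
    proof -
     have "sl n j * (g n (Suc j) - g n j) = \<psi> (g n (Suc j)) - \<psi> (g n j)" using gpos[of n j] by (simp add: sl_def)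
     moreover have "c n j * D = \<Theta> n j * D - lmgf (\<Theta> n j) * (sl n j * D) + D / real (Suc n)" for D
      unfolding c_def distrib_right left_diff_distrib by (simp del: of_nat_Suc add: ac_simps)
     ultimately have "c n j * (g n (Suc j) - g n j) = \<Theta> n j * (g n (Suc j) - g n j) - lmgf (\<Theta> n j) * ?A n j + (g n (Suc j) - g n j) / real (Suc n)"
      by simp
     then show ?thesis using gd by simp
    qed
    then show ?thesis by (simp only: sum.distrib sum_constant) simp
   qed
   ultimately show ?thesis by linarith
  qed
  finally show ?thesis by (simp add: ennreal_leI)
 qed
 define L where "L = (\<integral>\<^sup>+t\<in>{0<..<T}. e2ennreal (rate_fun (h t)) \<partial>lborel)"
 have "L \<le> (\<integral>\<^sup>+t. liminf (\<lambda>n. F n t) \<partial>lborel)"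
  unfolding L_def
 proof (rule nn_integral_mono_AE)
  show "AE t in lborel. e2ennreal (rate_fun (h t)) * indicator {0<..<T} t \<le> liminf (\<lambda>n. F n t)"
   using h
  proof eventually_elim
   fix t assume ht: "t \<in> {0<..<T} \<longrightarrow> (\<psi> has_real_derivative h t) (at t)"
   show "e2ennreal (rate_fun (h t)) * indicator {0<..<T} t \<le> liminf (\<lambda>n. F n t)"
   proof (cases "t \<in> {0<..<T}")
    case False
    then show ?thesis by simp
   next
    case t: True
    \<comment> \<open>The cell containing \<open>t\<close> is open on the left and closed on the
      right, hence the ceiling minus one.\<close>
    define J where "J n = nat (\<lceil>t * real (Suc n) / T\<rceil> - 1)" for n
    have J: "g n (J n) < t" "t \<le> g n (Suc (J n))" "J n < Suc n" for n
    proof -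
     have pos: "t * real (Suc n) / T > 0" using t T by simp
     then have c1: "\<lceil>t * real (Suc n) / T\<rceil> \<ge> 1" by (simp add: le_ceiling_iff)
     then have J1: "real (J n) = \<lceil>t * real (Suc n) / T\<rceil> - 1" by (simp add: J_def)
     then have "real (J n) < t * real (Suc n) / T" "t * real (Suc n) / T \<le> real (Suc (J n))" by linarith+
     then show "g n (J n) < t" "t \<le> g n (Suc (J n))" using T by (simp_all add: g_def field_simps)
     have "t * real (Suc n) / T \<le> real (Suc n)" by (use t pos_divide_le_eq[OF T] in \<open>auto intro!: mult_right_mono\<close>)
     then have "\<lceil>t * real (Suc n) / T\<rceil> \<le> int (Suc n)" by (simp add: ceiling_le_iff)
     then show "J n < Suc n" using c1 by (simp add: J_def)
    qed
    have lim0: "(\<lambda>n. T / real (Suc n)) \<longlonglongrightarrow> 0" using LIMSEQ_Suc[OF lim_const_over_n[of T]] by simp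
    have lu: "(\<lambda>n. g n (J n)) \<longlonglongrightarrow> t"
    proof (rule real_tendsto_sandwich[of "\<lambda>n. t - T / real (Suc n)" _ _ "\<lambda>n. t"])
     show "eventually (\<lambda>n. t - T / real (Suc n) \<le> g n (J n)) sequentially"
      using J(2) gd by (intro always_eventually allI) (smt (verit))
     show "(\<lambda>n. t - T / real (Suc n)) \<longlonglongrightarrow> t" using tendsto_diff[OF tendsto_const lim0, of t] by simp
     show "eventually (\<lambda>n. g n (J n) \<le> t) sequentially" using J(1) by (intro always_eventually allI less_imp_le)
    qed simp
    have lv: "(\<lambda>n. g n (Suc (J n))) \<longlonglongrightarrow> t"
    proof (rule real_tendsto_sandwich[of "\<lambda>n. t" _ _ "\<lambda>n. t + T / real (Suc n)"])
     show "eventually (\<lambda>n. g n (Suc (J n)) \<le> t + T / real (Suc n)) sequentially"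
      using J(1) gd by (intro always_eventually allI) (smt (verit))
     show "(\<lambda>n. t + T / real (Suc n)) \<longlonglongrightarrow> t" using tendsto_add[OF tendsto_const lim0, of t] by simp
     show "eventually (\<lambda>n. t \<le> g n (Suc (J n))) sequentially" using J(2) by (intro always_eventually allI)
    qed simp
    have sl: "(\<lambda>n. sl n (J n)) \<longlonglongrightarrow> h t" unfolding sl_def
     using ht t lu lv J gpos by (intro straddle_slope[of \<psi> _ t]) (auto intro: less_imp_le)
    \<comment> \<open>A tilt that beats \<open>y\<close> at the slope \<open>h t\<close> still beats
      it at nearby slopes, and \<open>c n (J n)\<close> is at least the capped supremum at the slope
      of the cell.\<close>
    have "e2ennreal (rate_fun (h t)) \<le> liminf (\<lambda>n. F n t)"
    proof (rule le_Liminf_iff[THEN iffD2], intro allI impI)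
     fix y assume y: "y < e2ennreal (rate_fun (h t))"
     then have "enn2ereal y < rate_fun (h t)"
      using rate_fun_nonneg[of "h t"] by (simp add: less_ennreal.rep_eq enn2ereal_e2ennreal)
     then obtain \<theta> where th: "\<theta> \<in> mgf_dom" "enn2ereal y < ereal (\<theta> - h t * lmgf \<theta>)" unfolding less_rate_fun_iff by blast
     have "(\<lambda>n. ereal (\<theta> - sl n (J n) * lmgf \<theta>)) \<longlonglongrightarrow> ereal (\<theta> - h t * lmgf \<theta>)" using sl by (intro tendsto_intros)
     then have e1: "eventually (\<lambda>n. enn2ereal y < ereal (\<theta> - sl n (J n) * lmgf \<theta>)) sequentially" using th(2) by (rule order_tendstoD)
     obtain r where r: "enn2ereal y = ereal r" using th(2) enn2ereal_nonneg[of y] by (cases "enn2ereal y") auto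
     obtain n0 :: nat where "r < real n0" using reals_Archimedean2 by blast
     then have e2: "eventually (\<lambda>n. enn2ereal y < ereal (real n)) sequentially"
      unfolding r by (intro eventually_sequentiallyI[of n0]) auto
     show "eventually (\<lambda>n. y < F n t) sequentially" using e1 e2
     proof eventually_elim
      fix n assume n: "enn2ereal y < ereal (\<theta> - sl n (J n) * lmgf \<theta>)" "enn2ereal y < ereal (real n)"
      have "enn2ereal y < min (rate_fun (sl n (J n))) (ereal (real n))"
       using n rate_fun_ge[OF th(1), of "sl n (J n)"] by (auto intro: less_le_trans)
      also have "\<dots> \<le> ereal (c n (J n))" unfolding c_def by (rule \<Theta>(2))
      finally have "y < ennreal (c n (J n))" using c0 by (simp add: less_ennreal.rep_eq enn2ereal_ennreal)
      also have "\<dots> = ennreal (c n (J n)) * indicator (I n (J n)) t" using J by (simp add: I_def)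
      also have "\<dots> \<le> F n t" unfolding F_def using J(3) by (intro member_le_sum) auto
      finally show "y < F n t" .
     qed
    qed
    then show ?thesis using t by simp
   qed
  qed
 qed
 also have "\<dots> \<le> liminf (\<lambda>n. (?C n))" by (rule nn_integral_liminf) measurable
 also have "\<dots> \<le> liminf (\<lambda>n. ennreal (a + T / real (Suc n)))" by (intro Liminf_mono always_eventually allI intF)
 also have "\<dots> = ennreal a"
 proof (rule lim_imp_Liminf)
  have "(\<lambda>n. a + T / real (Suc n)) \<longlonglongrightarrow> a + 0"
   using LIMSEQ_Suc[OF lim_const_over_n[of T]] by (intro tendsto_intros) simp
  then show "(\<lambda>n. ennreal (a + T / real (Suc n))) \<longlonglongrightarrow> ennreal a" by (intro tendsto_ennrealI) simp
 qed simp
 finally have "enn2ereal L \<le> enn2ereal (ennreal a)" by (simp add: less_eq_ennreal.rep_eq)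
 then show ?thesis unfolding L_def using service_rate_eq[OF T ac mono z h] h0 a0 by (simp add: enn2ereal_ennreal)
qed

end

section \<open>The reflection map\<close>

lemma restrict_cadlag:
 assumes r: "\<And>t. t \<in> {0..<T} \<Longrightarrow> (g \<longlongrightarrow> g t) (at_right t)"
  and l: "\<And>t. t \<in> {0<..T} \<Longrightarrow> \<exists>l. (g \<longlongrightarrow> l) (at_left t)"
 shows "(\<lambda>t\<in>{0..T}. g t) \<in> cadlag_space T"
 unfolding cadlag_space_def mem_Collect_eq
proof (intro conjI ballI)
 fix t assume t: "t \<in> {0..<T}"
 have "eventually (\<lambda>s. s \<in> {t<..<T}) (at_right t)" using t by (intro eventually_at_right_real) auto
 then have "eventually (\<lambda>s. g s = restrict g {0..T} s) (at_right t)"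
  by eventually_elim (use t in auto)
 then have "(restrict g {0..T} \<longlongrightarrow> g t) (at_right t)" using r[OF t] by (rule Lim_transform_eventually[rotated])
 then show "(restrict g {0..T} \<longlongrightarrow> restrict g {0..T} t) (at_right t)" using t by simp
next
 fix t assume t: "t \<in> {0<..T}"
 obtain l where lim: "(g \<longlongrightarrow> l) (at_left t)" using l[OF t] by blast
 have "eventually (\<lambda>s. s \<in> {0<..<t}) (at_left t)" using t by (intro eventually_at_left_real) auto
 then have "eventually (\<lambda>s. g s = restrict g {0..T} s) (at_left t)"
  by eventually_elim (use t in auto)
 then have "(restrict g {0..T} \<longlongrightarrow> l) (at_left t)" using lim by (rule Lim_transform_eventually[rotated])
 then show "\<exists>l. (restrict g {0..T} \<longlongrightarrow> l) (at_left t)" by blast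
qed simp

lemma cadlag_right: "x \<in> cadlag_space T \<Longrightarrow> t \<in> {0..<T} \<Longrightarrow> (x \<longlongrightarrow> x t) (at_right t)"
 and cadlag_left: "x \<in> cadlag_space T \<Longrightarrow> t \<in> {0<..T} \<Longrightarrow> \<exists>l. (x \<longlongrightarrow> l) (at_left t)"
 by (auto simp: cadlag_space_def)

lemma continuous_imp_cadlag:
 assumes "continuous_on {0..T} g"
 shows "(\<lambda>t\<in>{0..T}. g t) \<in> cadlag_space T"
proof (rule restrict_cadlag)
 fix t assume t: "t \<in> {0..<T}"
 have "(g \<longlongrightarrow> g t) (at t within {0..T})" using assms t by (auto simp: continuous_on_def)
 then have "(g \<longlongrightarrow> g t) (at t within {t..T})" by (rule tendsto_within_subset) (use t in auto)
 then show "(g \<longlongrightarrow> g t) (at_right t)" using t by (simp add: at_within_Icc_at_right)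
next
 fix t assume t: "t \<in> {0<..T}"
 have "(g \<longlongrightarrow> g t) (at t within {0..T})" using assms t by (auto simp: continuous_on_def)
 then have "(g \<longlongrightarrow> g t) (at t within {0..t})" by (rule tendsto_within_subset) (use t in auto)
 then show "\<exists>l. (g \<longlongrightarrow> l) (at_left t)" using t by (auto simp: at_within_Icc_at_left)
qed

lemma sum_cadlag:
 assumes "\<And>i. i \<in> I \<Longrightarrow> x i \<in> cadlag_space T"
 shows "(\<lambda>t\<in>{0..T}. c * (\<Sum>i\<in>I. x i t)) \<in> cadlag_space T"
proof (rule restrict_cadlag)
 fix t assume t: "t \<in> {0..<T}"
 show "((\<lambda>t. c * (\<Sum>i\<in>I. x i t)) \<longlongrightarrow> c * (\<Sum>i\<in>I. x i t)) (at_right t)"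
  using assms t by (intro tendsto_intros cadlag_right) auto
next
 fix t assume t: "t \<in> {0<..T}"
 then have "\<forall>i\<in>I. \<exists>l. (x i \<longlongrightarrow> l) (at_left t)" using assms cadlag_left by blast
 then obtain l where "\<forall>i\<in>I. (x i \<longlongrightarrow> l i) (at_left t)" by metis
 then have "((\<lambda>t. c * (\<Sum>i\<in>I. x i t)) \<longlongrightarrow> c * (\<Sum>i\<in>I. l i)) (at_left t)" by (intro tendsto_intros) auto
 then show "\<exists>l. ((\<lambda>t. c * (\<Sum>i\<in>I. x i t)) \<longlongrightarrow> l) (at_left t)" by blast
qed

lemma path_diff_cadlag:
 assumes x: "x \<in> cadlag_space T" and y: "y \<in> cadlag_space T"
 shows "path_diff T x y \<in> cadlag_space T"
 unfolding path_diff_def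
proof (rule restrict_cadlag)
 fix t assume t: "t \<in> {0..<T}"
 show "((\<lambda>t. x t - y t) \<longlongrightarrow> x t - y t) (at_right t)"
  by (intro tendsto_intros cadlag_right[OF x t] cadlag_right[OF y t])
next
 fix t assume t: "t \<in> {0<..T}"
 obtain l k where "(x \<longlongrightarrow> l) (at_left t)" "(y \<longlongrightarrow> k) (at_left t)"
  using cadlag_left[OF x t] cadlag_left[OF y t] by blast
 then have "((\<lambda>t. x t - y t) \<longlongrightarrow> l - k) (at_left t)" by (intro tendsto_intros)
 then show "\<exists>l. ((\<lambda>t. x t - y t) \<longlongrightarrow> l) (at_left t)" by blast
qed

lemma mono_at_left_limit:
 fixes g :: "real \<Rightarrow> real"
 assumes mono: "mono_on {0..T} g" and t: "t \<in> {0<..T}"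
 shows "(g \<longlongrightarrow> Sup (g ` {0..<t})) (at_left t)"
proof (rule order_tendstoI)
 have bdd: "bdd_above (g ` {0..<t})"
  by (rule bdd_aboveI2[where M="g t"]) (use mono_onD[OF mono] t in auto)
 have ne: "g ` {0..<t} \<noteq> {}" using t by auto
 have ev: "eventually (\<lambda>s. s \<in> {0<..<t}) (at_left t)" using t by (intro eventually_at_left_real) auto
 fix a
 {
  assume "a < Sup (g ` {0..<t})"
  then obtain s where s: "s \<in> {0..<t}" "a < g s" using less_cSup_iff[OF ne bdd] by auto
  have "eventually (\<lambda>r. r \<in> {s<..<t}) (at_left t)" using s by (intro eventually_at_left_real) auto
  then show "eventually (\<lambda>r. a < g r) (at_left t)"
  proof eventually_elim
   fix r assume "r \<in> {s<..<t}"
   then have "g s \<le> g r" using s t by (intro mono_onD[OF mono]) auto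
   then show "a < g r" using s by simp
  qed
 }
 {
  assume a: "Sup (g ` {0..<t}) < a"
  show "eventually (\<lambda>r. g r < a) (at_left t)" using ev
  proof eventually_elim
   fix r assume "r \<in> {0<..<t}"
   then have "g r \<le> Sup (g ` {0..<t})" using bdd by (intro cSup_upper) auto
   then show "g r < a" using a by simp
  qed
 }
qed

text \<open>The regulator of Skorokhod's reflection. Splitting it off leaves a nondecreasing
  function, whose left limits exist for free.\<close>

definition running_sup :: "(real \<Rightarrow> real) \<Rightarrow> real \<Rightarrow> real" where
 "running_sup x t = (SUP s\<in>{0..t}. - x s)"

lemma running_sup_bdd:
 fixes x :: "real \<Rightarrow> real"
 assumes "\<forall>t\<in>{0..T}. \<bar>x t\<bar> \<le> C" and "t \<le> T"
 shows "bdd_above ((\<lambda>s. - x s) ` {0..t})"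
proof (rule bdd_aboveI2[where M=C])
 fix s assume "s \<in> {0..t}"
 then have "\<bar>x s\<bar> \<le> C" using assms by auto
 then show "- x s \<le> C" by simp
qed

lemma reflection_map_eq:
 assumes C: "\<forall>t\<in>{0..T}. \<bar>x t\<bar> \<le> C" and t: "t \<in> {0..T}"
 shows "reflection_map T x t = x t + running_sup x t"
proof -
 let ?A = "SUP s\<in>{0..t}. x t - x s"
 have bdd: "bdd_above ((\<lambda>s. - x s) ` {0..t})" using t by (intro running_sup_bdd[OF C]) auto
 have ne: "{0..t} \<noteq> {}" using t by auto
 have bdd2: "bdd_above ((\<lambda>s. x t - x s) ` {0..t})"
 proof (rule bdd_aboveI2[where M="x t + running_sup x t"])
  fix s assume "s \<in> {0..t}"
  then show "x t - x s \<le> x t + running_sup x t"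
   using cSUP_upper[OF _ bdd, of s] by (simp add: running_sup_def)
 qed
 have "?A = x t + running_sup x t"
 proof (rule antisym)
  show "?A \<le> x t + running_sup x t"
  proof (rule cSUP_least[OF ne])
   fix s assume "s \<in> {0..t}"
   then show "x t - x s \<le> x t + running_sup x t"
    using cSUP_upper[OF _ bdd, of s] by (simp add: running_sup_def)
  qed
  have "running_sup x t \<le> ?A - x t" unfolding running_sup_def
  proof (rule cSUP_least[OF ne])
   fix s assume "s \<in> {0..t}"
   then show "- x s \<le> ?A - x t"
    using cSUP_upper[OF _ bdd2, of s] by simp
  qed
  then show "x t + running_sup x t \<le> ?A" by simp
 qed
 then show ?thesis using t by (simp add: reflection_map_def)
qed

lemma running_sup_mono:
 assumes C: "\<forall>t\<in>{0..T}. \<bar>x t\<bar> \<le> C"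
 shows "mono_on {0..T} (running_sup x)"
proof (rule mono_onI)
 fix r s assume rs: "r \<in> {0..T}" "s \<in> {0..T}" "r \<le> s"
 show "running_sup x r \<le> running_sup x s" unfolding running_sup_def
  by (rule cSUP_subset_mono) (use rs running_sup_bdd[OF C, of s] in auto)
qed

text \<open>Only right-continuity of the regulator needs an argument: just after \<open>t\<close>
  the values of \<open>- x\<close> stay below any \<open>b\<close> that exceeds the supremum up to
  \<open>t\<close>, because \<open>x\<close> is right-continuous there.\<close>

lemma reflection_map_cadlag:
 assumes x: "x \<in> cadlag_space T" and T: "0 < T"
 shows "reflection_map T x \<in> cadlag_space T"
proof -
 obtain C where C: "\<forall>t\<in>{0..T}. \<bar>x t\<bar> \<le> C" by (rule cadlag_bounded[OF x T])
 have eq: "reflection_map T x = (\<lambda>t\<in>{0..T}. x t + running_sup x t)"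
 proof
  fix t show "reflection_map T x t = (\<lambda>t\<in>{0..T}. x t + running_sup x t) t"
   using reflection_map_eq[OF C, of t] by (cases "t \<in> {0..T}") (auto simp: reflection_map_def)
 qed
 note mono = running_sup_mono[OF C]
 show ?thesis unfolding eq
 proof (rule restrict_cadlag)
  fix t assume t: "t \<in> {0..<T}"
  have "(running_sup x \<longlongrightarrow> running_sup x t) (at_right t)"
  proof (rule order_tendstoI)
   have evT: "eventually (\<lambda>s. s \<in> {t<..<T}) (at_right t)" using t by (intro eventually_at_right_real) auto
   fix a
   {
    assume a: "a < running_sup x t"
    show "eventually (\<lambda>s. a < running_sup x s) (at_right t)" using evT
    proof eventually_elim
     fix s assume "s \<in> {t<..<T}"
     then have "running_sup x t \<le> running_sup x s" using t by (intro mono_onD[OF mono]) auto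
     then show "a < running_sup x s" using a by simp
    qed
   }
   {
    assume a: "running_sup x t < a"
    have "- x t \<le> running_sup x t" unfolding running_sup_def
     using t running_sup_bdd[OF C, of t] by (intro cSUP_upper) auto
    then have "- x t < a" using a by simp
    obtain b where b: "running_sup x t < b" "b < a" using dense[OF a] by blast
    have "- b < x t" using \<open>- x t \<le> running_sup x t\<close> b by simp
    then have "eventually (\<lambda>s. - b < x s) (at_right t)" using cadlag_right[OF x t] by (intro order_tendstoD)
    then obtain d where d: "d > t" "\<And>s. t < s \<Longrightarrow> s < d \<Longrightarrow> - b < x s"
     unfolding eventually_at_right_field by auto
    have "eventually (\<lambda>s. s \<in> {t<..<min d T}) (at_right t)" using t d by (intro eventually_at_right_real) auto
    then show "eventually (\<lambda>s. running_sup x s < a) (at_right t)"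
    proof eventually_elim
     fix s assume s: "s \<in> {t<..<min d T}"
     have "running_sup x s \<le> b" unfolding running_sup_def
     proof (rule cSUP_least)
      fix r assume r: "r \<in> {0..s}"
      show "- x r \<le> b"
      proof (cases "r \<le> t")
       case True
       then have "- x r \<le> running_sup x t" unfolding running_sup_def
        using r t running_sup_bdd[OF C, of t] by (intro cSUP_upper) auto
       then show ?thesis using b by simp
      next
       case False
       then show ?thesis using d(2)[of r] r s by auto
      qed
     qed (use t s in auto)
     then show "running_sup x s < a" using b by simp
    qed
   }
  qed
  then show "((\<lambda>t. x t + running_sup x t) \<longlongrightarrow> x t + running_sup x t) (at_right t)"
   by (intro tendsto_intros cadlag_right[OF x t])
 next
  fix t assume t: "t \<in> {0<..T}"
  obtain l where "(x \<longlongrightarrow> l) (at_left t)" using cadlag_left[OF x t] by blast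
  then have "((\<lambda>t. x t + running_sup x t) \<longlongrightarrow> l + Sup (running_sup x ` {0..<t})) (at_left t)"
   by (intro tendsto_intros mono_at_left_limit[OF mono t])
  then show "\<exists>l. ((\<lambda>t. x t + running_sup x t) \<longlongrightarrow> l) (at_left t)" by blast
 qed
qed

text \<open>The factor two: one for the path and one for its running supremum.\<close>

lemma reflection_map_lipschitz:
 assumes x: "x \<in> cadlag_space T" and y: "y \<in> cadlag_space T" and T: "0 < T"
  and e: "\<forall>t\<in>{0..T}. \<bar>x t - y t\<bar> \<le> e" and t: "t \<in> {0..T}"
 shows "\<bar>reflection_map T x t - reflection_map T y t\<bar> \<le> 2 * e"
proof -
 obtain C where C: "\<forall>t\<in>{0..T}. \<bar>x t\<bar> \<le> C" by (rule cadlag_bounded[OF x T])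
 obtain C' where C': "\<forall>t\<in>{0..T}. \<bar>y t\<bar> \<le> C'" by (rule cadlag_bounded[OF y T])
 have half: "running_sup u t \<le> running_sup w t + e"
  if D: "\<forall>t\<in>{0..T}. \<bar>w t\<bar> \<le> D" and uw: "\<forall>t\<in>{0..T}. \<bar>u t - w t\<bar> \<le> e" for u w :: "real \<Rightarrow> real" and D
  unfolding running_sup_def[of u]
 proof (rule cSUP_least)
  fix s assume s: "s \<in> {0..t}"
  have "- w s \<le> running_sup w t" unfolding running_sup_def
   using s t running_sup_bdd[OF D, of t] by (intro cSUP_upper) auto
  moreover have "\<bar>u s - w s\<bar> \<le> e" using uw s t by auto
  ultimately show "- u s \<le> running_sup w t + e" by linarith
 qed (use t in auto)
 have "running_sup x t \<le> running_sup y t + e" by (rule half[OF C' e])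
 moreover have "running_sup y t \<le> running_sup x t + e"
  by (rule half[OF C]) (use e in \<open>auto simp: abs_minus_commute\<close>)
 moreover have "\<bar>x t - y t\<bar> \<le> e" using e t by blast
 ultimately show ?thesis unfolding reflection_map_eq[OF C t] reflection_map_eq[OF C' t] by linarith
qed

text \<open>Right-continuity reduces the running supremum to rational times, which gives measurability.\<close>

lemma reflection_map_measurable:
 fixes X :: "'a \<Rightarrow> real \<Rightarrow> real"
 assumes T: "0 < T" and X: "\<And>w. w \<in> space M \<Longrightarrow> X w \<in> cadlag_space T"
  and Xm: "\<And>t. t \<in> {0..T} \<Longrightarrow> (\<lambda>w. X w t) \<in> borel_measurable M" and t: "t \<in> {0..T}"
 shows "(\<lambda>w. reflection_map T (X w) t) \<in> borel_measurable M"
proof -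
 \<comment> \<open>\<open>t\<close> itself is added because no rational times inside
   \<open>{0..t}\<close> approach it from the right.\<close>
 define D where "D = insert t (\<rat> \<inter> {0..t})"
 have D: "countable D" "D \<subseteq> {0..t}" "D \<noteq> {}" using t by (auto simp: D_def countable_rat)
 have "(\<lambda>w. X w t + (SUP s\<in>D. - X w s)) \<in> borel_measurable M"
 proof (intro borel_measurable_add Xm t borel_measurable_cSUP D(1))
  fix s assume "s \<in> D"
  then show "(\<lambda>w. - X w s) \<in> borel_measurable M" using D(2) t by (intro borel_measurable_uminus Xm) auto
 next
  fix w assume "w \<in> space M"
  then obtain C where "\<forall>t\<in>{0..T}. \<bar>X w t\<bar> \<le> C" using cadlag_bounded[OF X T] by blast
  from running_sup_bdd[OF this, of t] t have "bdd_above ((\<lambda>s. - X w s) ` {0..t})" by simp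
  then show "bdd_above ((\<lambda>s. - X w s) ` D)"
   by (rule bdd_above_mono[OF _ image_mono[OF D(2)]])
 qed
 moreover have "reflection_map T (X w) t = X w t + (SUP s\<in>D. - X w s)" if w: "w \<in> space M" for w
 proof -
  let ?A = "SUP s\<in>D. - X w s"
  obtain C where C: "\<forall>t\<in>{0..T}. \<bar>X w t\<bar> \<le> C" using cadlag_bounded[OF X[OF w] T] by blast
  have bdd: "bdd_above ((\<lambda>s. - X w s) ` {0..t})" using t by (intro running_sup_bdd[OF C]) auto
  have bddD: "bdd_above ((\<lambda>s. - X w s) ` D)" by (rule bdd_above_mono[OF bdd image_mono[OF D(2)]])
  have "running_sup (X w) t = ?A" unfolding running_sup_def
  proof (rule antisym)
   show "?A \<le> (SUP s\<in>{0..t}. - X w s)" using D bdd by (intro cSUP_subset_mono) auto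
   show "(SUP s\<in>{0..t}. - X w s) \<le> ?A"
   proof (rule cSUP_least)
    fix s assume s: "s \<in> {0..t}"
    show "- X w s \<le> ?A"
    proof (cases "s = t")
     case True
     then show ?thesis using bddD by (intro cSUP_upper) (auto simp: D_def)
    next
     case False
     then have st: "s < t" using s by simp
     show ?thesis
     proof (rule ccontr)
      assume "\<not> - X w s \<le> ?A"
      then have "X w s < - ?A" by simp
      moreover have "(X w \<longlongrightarrow> X w s) (at_right s)" using s st t by (intro cadlag_right[OF X[OF w]]) auto
      ultimately have "eventually (\<lambda>r. X w r < - ?A) (at_right s)" by (rule order_tendstoD(2)[rotated])
      then obtain b where b: "b > s" "\<And>r. s < r \<Longrightarrow> r < b \<Longrightarrow> X w r < - ?A"
       unfolding eventually_at_right_field by auto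
      have "s < min b t" using b st by simp
      then obtain r where r: "r \<in> \<rat>" "s < r" "r < min b t" using Rats_dense_in_real by blast
      have "r \<in> D" using r s by (auto simp: D_def)
      then have "- X w r \<le> ?A" using bddD by (intro cSUP_upper)
      then show False using b(2)[of r] r by simp
     qed
    qed
   qed (use t in auto)
  qed
  then show ?thesis using reflection_map_eq[OF C t] by simp
 qed
 ultimately show ?thesis by (simp cong: measurable_cong)
qed

lemma prod_mono_ennreal:
 fixes f g :: "'i \<Rightarrow> ennreal"
 shows "(\<And>i. i \<in> I \<Longrightarrow> f i \<le> g i) \<Longrightarrow> prod f I \<le> prod g I"
 by (induction I rule: infinite_finite_induct) (auto intro!: mult_mono)

section \<open>Arrivals\<close>

text \<open>\<open>C\<close> bounds the intensity of arrivals on the horizon; finite index sets keep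
  infinite sums out of the assumption.\<close>

locale jittered_arrivals = prob_space N for N :: "'b measure" +
 fixes \<tau> :: "int \<Rightarrow> 'b \<Rightarrow> real" and f :: "real \<Rightarrow> real" and \<Delta> T C :: real
 assumes T_pos: "0 < T" and \<tau>_indep: "indep_vars (\<lambda>_. borel) \<tau> UNIV" and f_nonneg: "0 \<le> f x"
  and \<tau>_dist: "distributed N lborel (\<tau> k) (\<lambda>x. ennreal (f x))"
  and C_nonneg: "0 \<le> C"
  and density_bound: "u \<in> {0..T} \<Longrightarrow> finite F \<Longrightarrow> (\<Sum>k\<in>F. f (u - real_of_int k * \<Delta>)) \<le> C"
begin

abbreviation "arr \<equiv> arrival_count \<Delta> \<tau>"

definition hits :: "real \<Rightarrow> real \<Rightarrow> 'b \<Rightarrow> int set" where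
 "hits s t w = {k. s < real_of_int k * \<Delta> + \<tau> k w \<and> real_of_int k * \<Delta> + \<tau> k w \<le> t}"

lemma \<tau>_measurable [measurable]: "\<tau> k \<in> borel_measurable N"
 using \<tau>_indep by (auto simp: indep_vars_def)

lemma hit_measurable [measurable]: "{w \<in> space N. k \<in> hits s t w} \<in> sets N"
 unfolding hits_def by measurable

lemma arr_eq: "arr w t = real (card (hits 0 t w))"
 by (simp add: arrival_count_def hits_def)

lemma card_hits_measurable: "(\<lambda>w. card (hits s t w)) \<in> measurable N (count_space UNIV)"
proof -
 have "card (hits s t w) = card {n. int_decode n \<in> hits s t w}" for w
 proof -
  have "bij_betw int_decode {n. int_decode n \<in> hits s t w} (hits s t w)"
   using bij_int_decode by (auto simp: bij_betw_def inj_on_def surj_def)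
  then show ?thesis by (simp add: bij_betw_same_card)
 qed
 moreover have "(\<lambda>w. card {n. int_decode n \<in> hits s t w}) \<in> measurable N (count_space UNIV)"
  by (rule measurable_card) simp
 ultimately show ?thesis by simp
qed

lemma arr_measurable [measurable]: "(\<lambda>w. arr w t) \<in> borel_measurable N"
 unfolding arr_eq by (rule measurable_compose[OF card_hits_measurable]) simp

text \<open>Shifting each density by its scheduled time turns the sum of probabilities into one
  integral over \<open>{s<..t}\<close> of the summed densities.\<close>

lemma sum_prob_hits:
 assumes st: "0 \<le> s" "s \<le> t" "t \<le> T" and F: "finite F"
 shows "(\<Sum>k\<in>F. prob {w \<in> space N. k \<in> hits s t w}) \<le> C * (t - s)"
proof -
 let ?B = "\<lambda>u k. u - real_of_int k * \<Delta>"
 let ?A = "\<lambda>k. {w \<in> space N. k \<in> hits s t w}"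
 have fm[measurable]: "(\<lambda>x. ennreal (f x)) \<in> borel_measurable borel"
  using distributed_borel_measurable[OF \<tau>_dist[of 0]] by simp
 have "emeasure N (?A k) = (\<integral>\<^sup>+u. ennreal (f (?B u k)) * indicator {s<..t} u \<partial>lborel)" for k
 proof -
  let ?d = "real_of_int k * \<Delta>"
  have "(?A k) = \<tau> k -` {s - ?d<..t - ?d} \<inter> space N"
   by (auto simp: hits_def)
  then have "emeasure N (?A k) = (\<integral>\<^sup>+x. ennreal (f x) * indicator {s - ?d<..t - ?d} x \<partial>lborel)"
   using distributed_emeasure[OF \<tau>_dist[of k], of "{s - ?d<..t - ?d}"] by simp
  also have "\<dots> = (\<integral>\<^sup>+u. ennreal (f (- ?d + 1 * u)) * indicator {s - ?d<..t - ?d} (- ?d + 1 * u) \<partial>lborel)"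
   by (subst nn_integral_real_affine[where c=1 and t="- ?d"]) auto
  also have "\<dots> = (\<integral>\<^sup>+u. ennreal (f (u - ?d)) * indicator {s<..t} u \<partial>lborel)"
   by (intro nn_integral_cong) (auto simp: indicator_def)
  finally show ?thesis .
 qed
 then have "(\<Sum>k\<in>F. emeasure N (?A k)) = (\<Sum>k\<in>F. (\<integral>\<^sup>+u. ennreal (f (?B u k)) * indicator {s<..t} u \<partial>lborel))" by simp
 also have "\<dots> = (\<integral>\<^sup>+u. (\<Sum>k\<in>F. ennreal (f (?B u k)) * indicator {s<..t} u) \<partial>lborel)"
  by (rule nn_integral_sum[symmetric]) measurable
 also have "\<dots> \<le> (\<integral>\<^sup>+u. ennreal C * indicator {s<..t} u \<partial>lborel)"
 proof (rule nn_integral_mono)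
  fix u
  have "(\<Sum>k\<in>F. ennreal (f (?B u k))) = ennreal (\<Sum>k\<in>F. f (?B u k))"
   using f_nonneg by (intro sum_ennreal) auto
  moreover have "\<dots> \<le> ennreal C" if "u \<in> {s<..t}"
   using density_bound[of u F] F st that by (intro ennreal_leI) auto
  ultimately show "(\<Sum>k\<in>F. ennreal (f (?B u k)) * indicator {s<..t} u) \<le> ennreal C * indicator {s<..t} u"
   by (cases "u \<in> {s<..t}") auto
 qed
 also have "\<dots> = ennreal (C * (t - s))"
  using st C_nonneg by (simp add: nn_integral_cmult_indicator ennreal_mult)
 finally have "ennreal (\<Sum>k\<in>F. prob (?A k)) \<le> ennreal (C * (t - s))"
  by (simp add: emeasure_eq_measure sum_ennreal)
 then show ?thesis using st C_nonneg by (simp add: ennreal_le_iff)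
qed

text \<open>The hit probabilities are summable, so Borel-Cantelli applies along an enumeration of
  the integers. Off a null set \<open>card\<close> is then a true count.\<close>

lemma AE_finite_hits: "AE w in N. finite (hits 0 T w)"
proof -
 let ?A = "\<lambda>n. {w \<in> space N. int_decode n \<in> hits 0 T w}"
 have "summable (\<lambda>n. prob (?A n))"
 proof (rule summableI_nonneg_bounded)
  fix n
  have "(\<Sum>i<n. prob (?A i)) = (\<Sum>k\<in>int_decode ` {..<n}. prob {w \<in> space N. k \<in> hits 0 T w})"
   using inj_int_decode[of "{..<n}"] by (subst sum.reindex) (auto simp: inj_on_def)
  also have "\<dots> \<le> C * (T - 0)" using T_pos by (intro sum_prob_hits) auto
  finally show "(\<Sum>i<n. prob (?A i)) \<le> C * (T - 0)" .
 qed simp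
 then have "AE w in N. eventually (\<lambda>n. w \<in> space N - ?A n) sequentially"
  by (intro borel_cantelli_AE1) (auto simp: emeasure_eq_measure)
 then show ?thesis
 proof eventually_elim
  fix w assume "eventually (\<lambda>n. w \<in> space N - ?A n) sequentially"
  then obtain n0 where n0: "\<And>n. n \<ge> n0 \<Longrightarrow> int_decode n \<notin> hits 0 T w"
   by (auto simp: eventually_sequentially)
  have "hits 0 T w \<subseteq> int_decode ` {..<n0}"
  proof
   fix k assume k: "k \<in> hits 0 T w"
   have "int_decode (int_encode k) = k" by simp
   then show "k \<in> int_decode ` {..<n0}" using n0[of "int_encode k"] k by (metis imageI lessThan_iff not_le)
  qed
  then show "finite (hits 0 T w)" by (rule finite_subset) simp
 qed
qed

lemma hits_mono: "0 \<le> s \<Longrightarrow> t \<le> T \<Longrightarrow> hits s t w \<subseteq> hits 0 T w"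
 by (auto simp: hits_def)

lemma AE_arr_increment: "AE w in N. \<forall>s t. 0 \<le> s \<and> s \<le> t \<and> t \<le> T \<longrightarrow> arr w t - arr w s = real (card (hits s t w))"
 using AE_finite_hits
proof eventually_elim
 fix w assume fin: "finite (hits 0 T w)"
 show "\<forall>s t. 0 \<le> s \<and> s \<le> t \<and> t \<le> T \<longrightarrow> arr w t - arr w s = real (card (hits s t w))"
 proof (intro allI impI)
  fix s t :: real assume st: "0 \<le> s \<and> s \<le> t \<and> t \<le> T"
  have "hits 0 t w = hits 0 s w \<union> hits s t w" "hits 0 s w \<inter> hits s t w = {}"
   using st by (auto simp: hits_def)
  moreover have "finite (hits 0 s w)" "finite (hits s t w)"
   using st by (auto intro!: finite_subset[OF hits_mono fin])
  ultimately show "arr w t - arr w s = real (card (hits s t w))" by (auto simp: card_Un_disjoint arr_eq)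
 qed
qed

text \<open>Comparison with a Poisson variable: for independent indicators each factor
  \<open>1 + p * (exp \<theta> - 1)\<close> is at most \<open>exp (p * (exp \<theta> - 1))\<close>.
  Fatou's lemma passes from finitely many indices to all of them.\<close>

lemma exp_moment_hits:
 assumes st: "0 \<le> s" "s \<le> t" "t \<le> T" and \<theta>: "0 \<le> \<theta>"
 shows "(\<integral>\<^sup>+w. ennreal (exp (\<theta> * real (card (hits s t w)))) \<partial>N) \<le> ennreal (exp (C * (t - s) * (exp \<theta> - 1)))"
proof -
 let ?D = "\<lambda>F. \<integral>\<^sup>+w. ennreal (exp (\<theta> * real (card (F \<inter> hits s t w)))) \<partial>N"
 let ?C = "exp \<theta> - 1"
 let ?B = "\<lambda>m w. exp (\<theta> * real (card (int_decode ` {..<m} \<inter> hits s t w)))"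
 let ?A = "\<lambda>k. {w \<in> space N. k \<in> hits s t w}"
 define X where "X k w = ennreal (exp (if k \<in> hits s t w then \<theta> else 0))" for k w
 have Xm: "X k \<in> borel_measurable N" for k unfolding X_def by measurable
 have Xi: "indep_vars (\<lambda>_. borel) X UNIV"
 proof -
  have Xeq: "X = (\<lambda>k w. (\<lambda>x. ennreal (exp (if s < real_of_int k * \<Delta> + x \<and> real_of_int k * \<Delta> + x \<le> t then \<theta> else 0))) (\<tau> k w))"
   by (intro ext) (simp add: X_def hits_def)
  show ?thesis by (subst Xeq) (rule indep_vars_compose2[OF \<tau>_indep], measurable)
 qed
 have fin: "(?D F) \<le> ennreal (exp (C * (t - s) * ?C))"
  if F: "finite F" for F
 proof -
  have "ennreal (exp (\<theta> * real (card (F \<inter> hits s t w)))) = (\<Prod>k\<in>F. X k w)" for w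
  proof -
   have "(\<Prod>k\<in>F. X k w) = ennreal (exp (\<Sum>k\<in>F. if k \<in> hits s t w then \<theta> else 0))"
    unfolding X_def by (simp add: prod_ennreal exp_sum F)
   also have "(\<Sum>k\<in>F. if k \<in> hits s t w then \<theta> else 0) = \<theta> * real (card (F \<inter> hits s t w))"
    using F by (simp add: sum.If_cases Int_def)
   finally show ?thesis by simp
  qed
  then have "(?D F) = (\<integral>\<^sup>+w. (\<Prod>k\<in>F. X k w) \<partial>N)" by simp
  also have "\<dots> = (\<Prod>k\<in>F. \<integral>\<^sup>+w. X k w \<partial>N)"
   by (rule indep_vars_nn_integral[OF F indep_vars_subset[OF Xi]]) auto
  also have "\<dots> = (\<Prod>k\<in>F. ennreal (1 + prob (?A k) * ?C))"
  proof (rule prod.cong[OF refl])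
   fix k
   have "(\<integral>\<^sup>+w. X k w \<partial>N) = (\<integral>\<^sup>+w. 1 + ennreal ?C * indicator (?A k) w \<partial>N)"
   proof (rule nn_integral_cong)
    fix w assume "w \<in> space N"
    moreover have "ennreal (exp \<theta>) = 1 + ennreal ?C" using \<theta> by (simp add: ennreal_plus[symmetric] del: ennreal_plus flip: ennreal_1)
    ultimately show "X k w = 1 + ennreal ?C * indicator (?A k) w"
     by (simp add: X_def)
   qed
   also have "\<dots> = 1 + ennreal ?C * emeasure N (?A k)"
    by (subst nn_integral_add) (auto simp: nn_integral_cmult_indicator emeasure_space_1)
   also have "\<dots> = ennreal (1 + prob (?A k) * ?C)"
    using \<theta> by (simp add: emeasure_eq_measure ennreal_mult mult.commute)
   finally show "(\<integral>\<^sup>+w. X k w \<partial>N) = ennreal (1 + prob (?A k) * ?C)" .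
  qed
  also have "\<dots> \<le> (\<Prod>k\<in>F. ennreal (exp (prob (?A k) * ?C)))"
   by (intro prod_mono_ennreal ennreal_leI exp_ge_add_one_self)
  also have "\<dots> = ennreal (exp ((\<Sum>k\<in>F. prob (?A k)) * ?C))"
   by (simp add: prod_ennreal exp_sum F sum_distrib_right)
  also have "\<dots> \<le> ennreal (exp (C * (t - s) * ?C))"
   using sum_prob_hits[OF st F] \<theta> by (intro ennreal_leI) (simp add: mult_right_mono)
  finally show ?thesis .
 qed
 have "(\<integral>\<^sup>+w. ennreal (exp (\<theta> * real (card (hits s t w)))) \<partial>N)
   \<le> (\<integral>\<^sup>+w. liminf (\<lambda>m. ennreal (?B m w)) \<partial>N)"
 proof (rule nn_integral_mono_AE)
  show "AE w in N. ennreal (exp (\<theta> * real (card (hits s t w)))) \<le> liminf (\<lambda>m. ennreal (?B m w))"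
   using AE_finite_hits
  proof eventually_elim
   fix w assume "finite (hits 0 T w)"
   then have fin: "finite (hits s t w)" using hits_mono[OF st(1,3)] by (rule rev_finite_subset)
   define m0 where "m0 = Suc (Max (insert 0 (int_encode ` hits s t w)))"
   have "int_decode ` {..<m} \<inter> hits s t w = hits s t w" if "m \<ge> m0" for m
   proof -
    have "k \<in> int_decode ` {..<m}" if "k \<in> hits s t w" for k
    proof -
     have "int_encode k \<le> Max (insert 0 (int_encode ` hits s t w))" using fin that by (intro Max_ge) auto
     then have "int_encode k < m" using \<open>m \<ge> m0\<close> by (simp add: m0_def)
     then show ?thesis by (metis imageI int_encode_inverse lessThan_iff)
    qed
    then show ?thesis by blast
   qed
   then show "ennreal (exp (\<theta> * real (card (hits s t w)))) \<le> liminf (\<lambda>m. ennreal (?B m w))"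
    by (intro Liminf_bounded eventually_sequentiallyI[of m0]) simp
  qed
 qed
 also have "\<dots> \<le> liminf (\<lambda>m. (\<integral>\<^sup>+w. ennreal (?B m w) \<partial>N))"
 proof (rule nn_integral_liminf)
  fix m
  have "(\<lambda>w. \<Prod>k\<in>int_decode ` {..<m}. X k w) \<in> borel_measurable N" using Xm by measurable
  moreover have "(\<Prod>k\<in>int_decode ` {..<m}. X k w) = ennreal (?B m w)" for w
  proof -
   have "(\<Prod>k\<in>int_decode ` {..<m}. X k w) = ennreal (exp (\<Sum>k\<in>int_decode ` {..<m}. if k \<in> hits s t w then \<theta> else 0))"
    unfolding X_def by (simp add: prod_ennreal exp_sum)
   also have "(\<Sum>k\<in>int_decode ` {..<m}. if k \<in> hits s t w then \<theta> else 0) = \<theta> * real (card (int_decode ` {..<m} \<inter> hits s t w))"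
    by (simp add: sum.If_cases Int_def)
   finally show ?thesis .
  qed
  ultimately show "(\<lambda>w. ennreal (?B m w)) \<in> borel_measurable N" by simp
 qed
 also have "\<dots> \<le> liminf (\<lambda>m. ennreal (exp (C * (t - s) * ?C)))"
  by (intro Liminf_mono always_eventually allI fin) simp
 also have "\<dots> = ennreal (exp (C * (t - s) * ?C))" by (simp add: Liminf_const)
 finally show ?thesis .
qed

text \<open>For negative \<open>\<theta>\<close> the moment is at most one, which is what
  \<open>max \<theta> 0\<close> yields on the right.\<close>

lemma exp_moment_increment:
 assumes st: "0 \<le> s" "s \<le> t" "t \<le> T"
 shows "log_exp_moment N (\<lambda>w. \<theta> * (arr w t - arr w s)) \<le> ereal (C * (t - s) * (exp (max \<theta> 0) - 1))"
proof -
 have "(\<integral>\<^sup>+w. ennreal (exp (\<theta> * (arr w t - arr w s))) \<partial>N) \<le> (\<integral>\<^sup>+w. ennreal (exp (max \<theta> 0 * real (card (hits s t w)))) \<partial>N)"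
  by ((rule nn_integral_mono_AE), (use AE_arr_increment in \<open>(eventually_elim, (use st in \<open>auto intro!: ennreal_leI mult_right_mono\<close>))\<close>))
 also have "\<dots> \<le> ennreal (exp (C * (t - s) * (exp (max \<theta> 0) - 1)))" by (rule exp_moment_hits[OF st]) simp
 finally show ?thesis unfolding log_exp_moment_def elog_le_iff_exp .
qed

lemma arr_zero [simp]: "arr w 0 = 0"
proof -
 have "hits 0 0 w = {}" by (auto simp: hits_def)
 then show ?thesis by (simp add: arr_eq)
qed

text \<open>The term subtracted in \<open>arrival_rate\<close> is a real number, so a strict
  inequality against that rate leaves a real margin.\<close>

lemma log_exp_moment_arr_finite:
 assumes L: "finite L" and t: "\<And>l. l \<in> L \<Longrightarrow> t l \<in> {0..T}"
 shows "\<exists>c. log_exp_moment N (\<lambda>w. \<Sum>l\<in>L. \<alpha> l * arr w (t l)) = ereal c"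
proof -
 define \<theta> where "\<theta> = (\<Sum>l\<in>L. \<bar>\<alpha> l\<bar>)"
 have \<theta>0: "0 \<le> \<theta>" by (simp add: \<theta>_def sum_nonneg)
 let ?I = "\<integral>\<^sup>+w. ennreal (exp (\<Sum>l\<in>L. \<alpha> l * arr w (t l))) \<partial>N"
 have "?I \<le> (\<integral>\<^sup>+w. ennreal (exp (\<theta> * real (card (hits 0 T w)))) \<partial>N)"
 proof (rule nn_integral_mono_AE)
  show "AE w in N. ennreal (exp (\<Sum>l\<in>L. \<alpha> l * arr w (t l))) \<le> ennreal (exp (\<theta> * real (card (hits 0 T w))))"
   using AE_finite_hits
  proof eventually_elim
   fix w assume fin: "finite (hits 0 T w)"
   have "\<alpha> l * arr w (t l) \<le> \<bar>\<alpha> l\<bar> * real (card (hits 0 T w))" if l: "l \<in> L" for l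
   proof -
    have "arr w (t l) \<le> real (card (hits 0 T w))" unfolding arr_eq
     using t[OF l] by (intro of_nat_mono card_mono fin hits_mono) auto
    moreover have "0 \<le> arr w (t l)" by (simp add: arr_eq)
    ultimately show ?thesis by (intro mult_mono) auto
   qed
   then show "ennreal (exp (\<Sum>l\<in>L. \<alpha> l * arr w (t l))) \<le> ennreal (exp (\<theta> * real (card (hits 0 T w))))"
    unfolding \<theta>_def sum_distrib_right by (intro ennreal_leI) (simp add: sum_mono)
  qed
 qed
 also have "\<dots> \<le> ennreal (exp (C * (T - 0) * (exp \<theta> - 1)))" using T_pos \<theta>0 by (intro exp_moment_hits) auto
 finally have "?I \<noteq> \<infinity>" by (auto simp: top_unique)
 moreover have "?I \<noteq> 0"
  by (standard, ((subst (asm) nn_integral_0_iff_AE), (auto intro!: measurable_compose[OF _ measurable_ennreal] borel_measurable_exp borel_measurable_sum borel_measurable_times)))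
 ultimately show ?thesis by (simp add: log_exp_moment_def elog_def)
qed

lemma arrival_rate_ge:
 fixes m :: nat
 assumes "m \<ge> 1" "strict_mono_on {1..m} t" "t ` {1..m} \<subseteq> {0<..T}"
 shows "ereal (\<Sum>l=1..m. \<alpha> l * \<phi> (t l)) - log_exp_moment N (\<lambda>w. \<Sum>l=1..m. \<alpha> l * arr w (t l)) \<le> arrival_rate N arr T \<phi>"
 unfolding arrival_rate_def
proof (rule SUP_upper2[where i=m])
 let ?A = "\<lambda>\<alpha> t. \<lambda>w. \<Sum>l=1..m. \<alpha> l * arr w (t l)"
 show "m \<in> {1..}" using assms(1) by simp
 show "ereal (\<Sum>l=1..m. \<alpha> l * \<phi> (t l)) - log_exp_moment N (?A \<alpha> t)
  \<le> (SUP t\<in>{t. strict_mono_on {1..m} t \<and> t ` {1..m} \<subseteq> {0<..T}}. SUP \<alpha>. ereal (\<Sum>l=1..m. \<alpha> l * \<phi> (t l)) -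
     log_exp_moment N (?A \<alpha> t))"
 proof (rule SUP_upper2[where i=t])
  show "t \<in> {t. strict_mono_on {1..m} t \<and> t ` {1..m} \<subseteq> {0<..T}}" using assms(2,3) by simp
  show "ereal (\<Sum>l=1..m. \<alpha> l * \<phi> (t l)) - log_exp_moment N (?A \<alpha> t)
   \<le> (SUP \<alpha>. ereal (\<Sum>l=1..m. \<alpha> l * \<phi> (t l)) - log_exp_moment N (?A \<alpha> t))"
   by (rule SUP_upper2[where i=\<alpha>]) simp_all
 qed
qed

text \<open>Test the supremum with two times and weights \<open>- \<theta>\<close> and
  \<open>\<theta>\<close>, so that it sees only the increment.\<close>

lemma arrival_rate_increment:
 assumes I: "arrival_rate N arr T \<phi> \<le> ereal a" and st: "0 < s" "s < t" "t \<le> T"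
 shows "\<theta> * (\<phi> t - \<phi> s) \<le> a + C * (t - s) * (exp (max \<theta> 0) - 1)"
proof -
 define u where "u l = (if l = Suc 0 then s else t)" for l :: nat
 define \<alpha> where "\<alpha> l = (if l = Suc 0 then - \<theta> else \<theta>)" for l :: nat
 have sum2: "(\<Sum>l=1..2. \<alpha> l * g (u l)) = \<theta> * (g t - g s)" for g :: "real \<Rightarrow> real"
  by (simp add: numeral_2_eq_2 \<alpha>_def u_def right_diff_distrib)
 have "ereal (\<Sum>l=1..2. \<alpha> l * \<phi> (u l)) - log_exp_moment N (\<lambda>w. \<Sum>l=1..2. \<alpha> l * arr w (u l)) \<le> ereal a"
  by (rule order_trans[OF arrival_rate_ge I]) (use st in \<open>auto simp: u_def strict_mono_on_def\<close>)
 then have 1: "ereal (\<theta> * (\<phi> t - \<phi> s)) - log_exp_moment N (\<lambda>w. \<theta> * (arr w t - arr w s)) \<le> ereal a"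
  unfolding sum2 .
 have 2: "log_exp_moment N (\<lambda>w. \<theta> * (arr w t - arr w s)) \<le> ereal (C * (t - s) * (exp (max \<theta> 0) - 1))"
  using st by (intro exp_moment_increment) auto
 have "ereal (\<theta> * (\<phi> t - \<phi> s)) - ereal (C * (t - s) * (exp (max \<theta> 0) - 1)) \<le> ereal a"
  by (rule order_trans[OF ereal_minus_mono[OF order_refl 2] 1])
 then show ?thesis by simp
qed

lemma arrival_rate_value:
 assumes I: "arrival_rate N arr T \<phi> \<le> ereal a" and t: "0 < t" "t \<le> T"
 shows "\<theta> * \<phi> t \<le> a + C * t * (exp (max \<theta> 0) - 1)"
proof -
 have "ereal (\<Sum>l=1..(1::nat). \<theta> * \<phi> t) - log_exp_moment N (\<lambda>w. \<Sum>l=1..(1::nat). \<theta> * arr w t) \<le> ereal a"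
  by (rule order_trans[OF arrival_rate_ge[where m=1 and t="\<lambda>_. t" and \<alpha>="\<lambda>_. \<theta>"] I]) (use t in \<open>auto simp: strict_mono_on_def\<close>)
 then have 1: "ereal (\<theta> * \<phi> t) - log_exp_moment N (\<lambda>w. \<theta> * (arr w t - arr w 0)) \<le> ereal a"
  by simp
 have 2: "log_exp_moment N (\<lambda>w. \<theta> * (arr w t - arr w 0)) \<le> ereal (C * (t - 0) * (exp (max \<theta> 0) - 1))"
  using t by (intro exp_moment_increment) auto
 have "ereal (\<theta> * \<phi> t) - ereal (C * (t - 0) * (exp (max \<theta> 0) - 1)) \<le> ereal a"
  by (rule order_trans[OF ereal_minus_mono[OF order_refl 2] 1])
 then show ?thesis by simp
qed

text \<open>The modulus of continuity of paths of finite rate. The target \<open>e\<close> fixes the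
  tilt \<open>(a + 1) / e\<close>; then \<open>d\<close> makes the exponential term less than
  one.\<close>

lemma small_increment_bound:
 assumes a: "0 \<le> a" and e: "0 < e"
 obtains d where "d > 0" "\<forall>x y. 0 \<le> y \<and> y < d \<and> (\<forall>\<theta>. \<theta> * x \<le> a + C * y * (exp (max \<theta> 0) - 1)) \<longrightarrow> x < (e::real)"
proof -
 define \<theta> where "\<theta> = (a + 1) / e"
 have \<theta>: "\<theta> > 0" using a e by (simp add: \<theta>_def)
 define d where "d = 1 / ((C + 1) * (exp \<theta>))"
 have d: "d > 0" using C_nonneg by (simp add: d_def add_nonneg_pos)
 show thesis
 proof (rule that[OF d], intro allI impI)
  fix x y assume xy: "0 \<le> y \<and> y < d \<and> (\<forall>\<theta>. \<theta> * x \<le> a + C * y * (exp (max \<theta> 0) - 1))"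
  have "\<theta> * x \<le> a + C * y * (exp \<theta> - 1)" using xy \<theta> by (metis less_imp_le max.absorb1)
  also have "C * y * (exp \<theta> - 1) \<le> (C * y) * exp \<theta>" using xy C_nonneg by (intro mult_left_mono) auto
  also have "(C * y) * exp \<theta> < 1"
  proof -
   have "(C * y) * exp \<theta> \<le> ((C + 1) * exp \<theta>) * y" using xy by (simp add: algebra_simps)
   also have "\<dots> < ((C + 1) * exp \<theta>) * d" using xy C_nonneg by (intro mult_strict_left_mono) (auto intro!: mult_pos_pos add_nonneg_pos)
   also have "\<dots> = 1" using C_nonneg by (simp add: d_def add_nonneg_eq_0_iff)
   finally show ?thesis .
  qed
  finally have "\<theta> * x < a + 1" by simp
  then have "x < (a + 1) / \<theta>" using \<theta> by (simp add: pos_less_divide_eq mult.commute)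
  also have "\<dots> = e" using a e by (simp add: \<theta>_def)
  finally show "x < e" .
 qed
qed

lemma nonneg_of_linear_bound:
 fixes x a :: real
 assumes "\<And>\<theta>. \<theta> \<le> 0 \<Longrightarrow> \<theta> * x \<le> a"
 shows "0 \<le> x"
proof (rule ccontr)
 assume "\<not> 0 \<le> x"
 then have "(- ((\<bar>a\<bar> + 1) / - x)) * x = \<bar>a\<bar> + 1" by (simp add: field_simps)
 moreover have "(- ((\<bar>a\<bar> + 1) / - x)) * x \<le> a" using \<open>\<not> 0 \<le> x\<close> by (intro assms) (simp add: divide_nonneg_neg)
 ultimately show False by linarith
qed

text \<open>With nonpositive \<open>\<theta>\<close> the exponential term vanishes, and a negative
  increment would be multiplied by arbitrarily large factors while the bound stays at
  \<open>a\<close>.\<close>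

lemma arrival_rate_finite_mono:
 assumes I: "arrival_rate N arr T \<phi> \<le> ereal a"
 shows "\<And>s t. 0 < s \<Longrightarrow> s \<le> t \<Longrightarrow> t \<le> T \<Longrightarrow> \<phi> s \<le> \<phi> t" "\<And>t. 0 < t \<Longrightarrow> t \<le> T \<Longrightarrow> 0 \<le> \<phi> t"
proof -
 show "0 \<le> \<phi> t" if t: "0 < t" "t \<le> T" for t
  using arrival_rate_value[OF I t] by (intro nonneg_of_linear_bound[of _ a]) (metis add.right_neutral exp_zero diff_self max.absorb2 mult_zero_right)
 show "\<phi> s \<le> \<phi> t" if st: "0 < s" "s \<le> t" "t \<le> T" for s t
 proof (cases "s = t")
  case False
  then have "s < t" using st by simp
  have "0 \<le> \<phi> t - \<phi> s"
   using arrival_rate_increment[OF I st(1) \<open>s < t\<close> st(3)]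
    by (intro nonneg_of_linear_bound[of _ a]) (metis add.right_neutral exp_zero diff_self max.absorb2 mult_zero_right)
  then show ?thesis by simp
 qed simp
qed

lemma arrival_rate_finite_continuous:
 assumes I: "arrival_rate N arr T \<phi> \<le> ereal a" and z: "\<phi> 0 = 0"
 shows "mono_on {0..T} \<phi>" "continuous_on {0..T} \<phi>"
proof -
 have a0: "0 \<le> a" using arrival_rate_value[OF I T_pos, of 0] by simp
 have mono: "\<phi> s \<le> \<phi> t" if "0 \<le> s" "s \<le> t" "t \<le> T" for s t
  using arrival_rate_finite_mono[OF I] that z by (cases "s = 0"; cases "t = 0") auto
 then show "mono_on {0..T} \<phi>" by (auto intro: mono_onI)
 show "continuous_on {0..T} \<phi>"
  unfolding continuous_on_iff
 proof (intro ballI allI impI)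
  fix x e :: real assume x: "x \<in> {0..T}" and e: "0 < e"
  obtain d where d: "d > 0" and dd: "\<forall>x y. 0 \<le> y \<and> y < d \<and> (\<forall>\<theta>. \<theta> * x \<le> a + C * y * (exp (max \<theta> 0) - 1)) \<longrightarrow> x < e"
   by (rule small_increment_bound[OF a0 e])
  have inc: "\<phi> t - \<phi> s < e" if "0 \<le> s" "s < t" "t \<le> T" "t - s < d" for s t
   by (use arrival_rate_value[OF I, of t] that z dd[rule_format, of "t - s"] arrival_rate_increment[OF I, of s t] in \<open>fastforce\<close>)
  show "\<exists>d>0. \<forall>x'\<in>{0..T}. dist x' x < d \<longrightarrow> dist (\<phi> x') (\<phi> x) < e"
  proof (intro exI[of _ d] conjI ballI impI d)
   fix x' assume x': "x' \<in> {0..T}" "dist x' x < d"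
   show "dist (\<phi> x') (\<phi> x) < e"
   proof (cases x x' rule: linorder_cases)
    case less
    then show ?thesis using inc[of x x'] mono[of x x'] x x' by (simp add: dist_real_def)
   next
    case greater
    then show ?thesis using inc[of x' x] mono[of x' x] x x' by (simp add: dist_real_def)
   qed (use e in simp)
  qed
 qed
qed

text \<open>The rate samples positive times only; the value at zero follows from right-continuity
  and the smallness of \<open>\<phi> t\<close> for small \<open>t\<close>.\<close>

lemma arrival_rate_finite_zero:
 assumes I: "arrival_rate N arr T \<phi> \<le> ereal a" and \<phi>: "\<phi> \<in> cadlag_space T"
 shows "\<phi> 0 = 0"
proof -
 have a0: "0 \<le> a" using arrival_rate_value[OF I T_pos, of 0] by simp
 have lim: "(\<phi> \<longlongrightarrow> \<phi> 0) (at_right 0)" using \<phi> T_pos by (auto simp: cadlag_space_def)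
 have ev: "eventually (\<lambda>t. t \<in> {0<..<T}) (at_right 0)" using T_pos by (intro eventually_at_right_real)
 have "0 \<le> \<phi> 0"
 proof (rule tendsto_lowerbound[OF lim])
  show "eventually (\<lambda>t. 0 \<le> \<phi> t) (at_right 0)"
   using ev by eventually_elim (intro arrival_rate_finite_mono(2)[OF I], auto)
 qed simp
 moreover have "\<phi> 0 \<le> e" if e: "0 < e" for e
 proof (rule tendsto_upperbound[OF lim])
  obtain d where d: "d > 0" and dd: "\<forall>x y. 0 \<le> y \<and> y < d \<and> (\<forall>\<theta>. \<theta> * x \<le> a + C * y * (exp (max \<theta> 0) - 1)) \<longrightarrow> x < e"
   by (rule small_increment_bound[OF a0 e])
  have "eventually (\<lambda>t. t \<in> {0<..<d}) (at_right 0)" using d by (intro eventually_at_right_real)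
  with ev show "eventually (\<lambda>t. \<phi> t \<le> e) (at_right 0)"
  proof eventually_elim
   fix t assume t: "t \<in> {0<..<T}" "t \<in> {0<..<d}"
   have *: "\<forall>\<theta>. \<theta> * \<phi> t \<le> a + C * t * (exp (max \<theta> 0) - 1)" using arrival_rate_value[OF I, of t] t by simp
   have "\<phi> t < e" by (rule dd[rule_format, of t]) (use t * in auto)
   then show "\<phi> t \<le> e" by simp
  qed
 qed simp
 ultimately show ?thesis by (metis dense_ge order_antisym)
qed

lemma arrival_rate_nonneg: "0 \<le> arrival_rate N arr T \<phi>"
proof -
 have "ereal (\<Sum>l=1..(1::nat). 0 * \<phi> T) - log_exp_moment N (\<lambda>w. \<Sum>l=1..(1::nat). 0 * arr w T) \<le> arrival_rate N arr T \<phi>"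
  by (rule arrival_rate_ge[where m=1 and t="\<lambda>_. T" and \<alpha>="\<lambda>_. 0"]) (use T_pos in \<open>auto simp: strict_mono_on_def\<close>)
 moreover have "log_exp_moment N (\<lambda>w. \<Sum>l=1..(1::nat). 0 * arr w T) = 0"
  by (simp add: log_exp_moment_def emeasure_space_1 elog_def)
 ultimately show ?thesis by (simp add: zero_ereal_def[symmetric])
qed

end

section \<open>Empirical means of independent arrival processes\<close>

locale arrival_copies = jittered_arrivals N \<tau> f \<Delta> T C + M: prob_space M
 for N :: "'b measure" and \<tau> f \<Delta> T C and M :: "'a measure" +
 fixes A :: "nat \<Rightarrow> 'a \<Rightarrow> real \<Rightarrow> real"
 assumes A_indep: "M.indep_vars (\<lambda>_. path_algebra T) A {1..}"
  and A_cadlag: "i \<ge> 1 \<Longrightarrow> AE w in M. A i w \<in> cadlag_space T"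
  and A_law: "i \<ge> 1 \<Longrightarrow> distr M (path_algebra T) (A i) = distr N (path_algebra T) (\<lambda>w. \<lambda>t\<in>{0..T}. arr w t)"
begin

abbreviation "Abar n w \<equiv> empirical_mean T A n w"

lemma A_measurable [measurable]: "i \<ge> 1 \<Longrightarrow> A i \<in> measurable M (path_algebra T)"
 using A_indep by (auto simp: M.indep_vars_def)

lemma A_coord_measurable: "i \<ge> 1 \<Longrightarrow> t \<in> {0..T} \<Longrightarrow> (\<lambda>w. A i w t) \<in> borel_measurable M"
 by (rule measurable_compose[OF A_measurable measurable_component_singleton])

lemma arr_path_measurable: "(\<lambda>w. \<lambda>t\<in>{0..T}. arr w t) \<in> measurable N (path_algebra T)"
 by (rule measurable_restrict) measurable

text \<open>Only the law of \<open>A i\<close> on \<open>path_algebra T\<close> is given, so an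
  almost sure property must be a measurable set of paths before it can be carried over from
  \<open>arr\<close>.\<close>

lemma A_AE_transfer:
 assumes i: "i \<ge> 1" and P: "{w \<in> space (path_algebra T). P w} \<in> sets (path_algebra T)"
  and ae: "AE \<omega> in N. P (\<lambda>t\<in>{0..T}. arr \<omega> t)"
 shows "AE \<omega> in M. P (A i \<omega>)"
proof -
 have "AE w in distr M (path_algebra T) (A i). P w"
  unfolding A_law[OF i] using ae by (subst AE_distr_iff[OF arr_path_measurable P])
 then show ?thesis by (subst (asm) AE_distr_iff[OF A_measurable[OF i] P])
qed

lemma A_le_AE:
 assumes i: "i \<ge> 1" and st: "s \<in> {0..T}" "t \<in> {0..T}" "s \<le> t"
 shows "AE \<omega> in M. A i \<omega> s \<le> A i \<omega> t"
proof (rule A_AE_transfer[OF i])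
 have [measurable]: "(\<lambda>w. w s) \<in> borel_measurable (path_algebra T)" "(\<lambda>w. w t) \<in> borel_measurable (path_algebra T)"
  using st by (auto intro!: measurable_component_singleton)
 show "{w \<in> space (path_algebra T). w s \<le> w t} \<in> sets (path_algebra T)" by measurable
 show "AE \<omega> in N. (\<lambda>t\<in>{0..T}. arr \<omega> t) s \<le> (\<lambda>t\<in>{0..T}. arr \<omega> t) t"
  using AE_arr_increment
 by (eventually_elim, (use st st in \<open>fastforce\<close>))
qed

lemma A_zero_AE: "i \<ge> 1 \<Longrightarrow> AE \<omega> in M. A i \<omega> 0 = 0"
proof (rule A_AE_transfer)
 have [measurable]: "(\<lambda>w. w 0) \<in> borel_measurable (path_algebra T)"
  using T_pos by (auto intro!: measurable_component_singleton)
 show "{w \<in> space (path_algebra T). w 0 = 0} \<in> sets (path_algebra T)" by measurable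
qed (use T_pos in auto)

text \<open>Monotonicity involves uncountably many coordinates; it is transferred at countably many
  times and extended by right-continuity. \<open>T\<close> belongs to the countable set because
  nothing lies to its right.\<close>

lemma A_regular_AE: "AE w in M. \<forall>i\<ge>1. A i w \<in> cadlag_space T \<and> mono_on {0..T} (A i w) \<and> A i w 0 = 0"
proof -
 define D where "D = insert T (\<rat> \<inter> {0..T})"
 have D: "countable D" "D \<subseteq> {0..T}" using T_pos by (auto simp: D_def countable_rat)
 have "AE w in M. \<forall>i\<in>{1..}. \<forall>s\<in>D. \<forall>t\<in>D. s \<le> t \<longrightarrow> A i w s \<le> A i w t"
 proof (subst AE_ball_countable, simp, intro ballI, subst AE_ball_countable[OF D(1)], intro ballI, subst AE_ball_countable[OF D(1)], intro ballI)
  fix i s t assume "i \<in> {1::nat..}" "s \<in> D" "t \<in> D"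
  then have "1 \<le> i" "s \<in> {0..T}" "t \<in> {0..T}" using D(2) by auto
  then show "AE w in M. s \<le> t \<longrightarrow> A i w s \<le> A i w t"
   using A_le_AE[of i s t] by (cases "s \<le> t") simp_all
 qed
 moreover have "AE w in M. \<forall>i\<in>{1..}. A i w \<in> cadlag_space T"
  using A_cadlag by (subst AE_ball_countable) auto
 moreover have "AE w in M. \<forall>i\<in>{1..}. A i w 0 = 0"
  using A_zero_AE by (subst AE_ball_countable) auto
 ultimately show ?thesis
 proof eventually_elim
  fix w assume m: "\<forall>i\<in>{1..}. \<forall>s\<in>D. \<forall>t\<in>D. s \<le> t \<longrightarrow> A i w s \<le> A i w t"
   and c: "\<forall>i\<in>{1..}. A i w \<in> cadlag_space T" and z: "\<forall>i\<in>{1..}. A i w 0 = 0"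
  show "\<forall>i\<ge>1. A i w \<in> cadlag_space T \<and> mono_on {0..T} (A i w) \<and> A i w 0 = 0"
  proof (intro allI impI conjI)
   fix i :: nat assume i: "1 \<le> i"
   show cad: "A i w \<in> cadlag_space T" "A i w 0 = 0" using c z i by auto
   have rc: "(A i w \<longlongrightarrow> A i w s) (at_right s)" if "0 \<le> s" "s < T" for s
    using cad that by (auto simp: cadlag_space_def)
   have frq: "\<exists>q\<in>D. s < q \<and> q < e" if "0 \<le> s" "s < T" "s < e" for s e
    by (use that Rats_dense_in_real in \<open>fastforce simp: D_def intro: bexI\<close>)
   have step1: "A i w s \<le> A i w q" if s: "0 \<le> s" "s < q" and q: "q \<in> D" for s q
   proof (rule ccontr)
    have qT: "q \<le> T" using D(2) q by auto
    assume "\<not> A i w s \<le> A i w q"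
    then have "eventually (\<lambda>r. A i w r > A i w q) (at_right s)"
     using rc[of s] s qT by (intro order_tendstoD) auto
    then obtain b where b: "b > s" "\<And>r. s < r \<Longrightarrow> r < b \<Longrightarrow> A i w r > A i w q"
     unfolding eventually_at_right_field by auto
    obtain r where r: "r \<in> D" "s < r" "r < min b q" using frq[of s "min b q"] s qT b by auto
    then show False using m i q b(2)[of r] r by force
   qed
   show "mono_on {0..T} (A i w)"
   proof (rule mono_onI)
    fix s t assume st: "s \<in> {0..T}" "t \<in> {0..T}" "s \<le> t"
    show "A i w s \<le> A i w t"
    proof (cases "s = t")
     case False
     show ?thesis
     proof (cases "t = T")
      case True
      then show ?thesis using step1[of s T] st False by (auto simp: D_def)
     next
      case tT: False
      show ?thesis
      proof (rule ccontr)
       assume "\<not> A i w s \<le> A i w t"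
       then have "eventually (\<lambda>r. A i w r < A i w s) (at_right t)"
        using rc[of t] st tT by (intro order_tendstoD) auto
       then obtain b where b: "b > t" "\<And>r. t < r \<Longrightarrow> r < b \<Longrightarrow> A i w r < A i w s"
        unfolding eventually_at_right_field by auto
       obtain r where r: "r \<in> D" "t < r" "r < b" using frq[of t b] st tT b by auto
       then have "A i w s \<le> A i w r" using st by (intro step1) auto
       then show False using b(2)[of r] r by auto
      qed
     qed
    qed simp
   qed
  qed
 qed
qed

lemma A_log_exp_moment:
 assumes i: "i \<ge> 1" and L: "finite L" and t: "\<And>l. l \<in> L \<Longrightarrow> t l \<in> {0..T}"
 shows "log_exp_moment (distr M (path_algebra T) (A i)) (\<lambda>w. \<Sum>l\<in>L. \<alpha> l * w (t l)) = log_exp_moment N (\<lambda>\<omega>. \<Sum>l\<in>L. \<alpha> l * arr \<omega> (t l))"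
proof -
 have m: "(\<lambda>w. ennreal (exp (\<Sum>l\<in>L. \<alpha> l * w (t l)))) \<in> borel_measurable (path_algebra T)"
  using t by (intro measurable_compose[OF _ measurable_ennreal] borel_measurable_exp borel_measurable_sum borel_measurable_times) (auto intro!: measurable_component_singleton)
 show ?thesis unfolding log_exp_moment_def A_law[OF i]
  by (subst nn_integral_distr[OF arr_path_measurable]) (use m t in \<open>auto intro!: arg_cong[where f=elog] nn_integral_cong sum.cong arg_cong[where f=exp] arg_cong[where f=ennreal]\<close>)
qed

lemma A_nn_log_exp_moment:
 assumes i: "i \<ge> 1" and L: "finite L" and t: "\<And>l. l \<in> L \<Longrightarrow> t l \<in> {0..T}"
  and c: "log_exp_moment N (\<lambda>\<omega>. \<Sum>l\<in>L. \<alpha> l * arr \<omega> (t l)) \<le> ereal c"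
 shows "(\<integral>\<^sup>+\<omega>. ennreal (exp (\<Sum>l\<in>L. \<alpha> l * A i \<omega> (t l))) \<partial>M) \<le> ennreal (exp c)"
proof -
 have m: "(\<lambda>w. ennreal (exp (\<Sum>l\<in>L. \<alpha> l * w (t l)))) \<in> borel_measurable (path_algebra T)"
  using t by (intro measurable_compose[OF _ measurable_ennreal] borel_measurable_exp borel_measurable_sum borel_measurable_times) (auto intro!: measurable_component_singleton)
 have "(\<integral>\<^sup>+\<omega>. ennreal (exp (\<Sum>l\<in>L. \<alpha> l * A i \<omega> (t l))) \<partial>M) = (\<integral>\<^sup>+w. ennreal (exp (\<Sum>l\<in>L. \<alpha> l * w (t l))) \<partial>distr M (path_algebra T) (A i))"
  by (subst nn_integral_distr[OF A_measurable[OF i]]) (use m in auto)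
 also have "\<dots> \<le> ennreal (exp c)"
 proof -
  have "log_exp_moment (distr M (path_algebra T) (A i)) (\<lambda>w. \<Sum>l\<in>L. \<alpha> l * w (t l)) \<le> ereal c"
   using c by (subst A_log_exp_moment[OF i L t])
  then show ?thesis unfolding log_exp_moment_def elog_le_iff_exp .
 qed
 finally show ?thesis .
qed

lemma Abar_eq: "t \<in> {0..T} \<Longrightarrow> Abar n w t = (\<Sum>i=1..n. A i w t) / real n"
 by (simp add: empirical_mean_def)

lemma Abar_coord_measurable: "t \<in> {0..T} \<Longrightarrow> (\<lambda>w. Abar n w t) \<in> borel_measurable M"
 unfolding Abar_eq by (intro borel_measurable_divide borel_measurable_sum A_coord_measurable) auto

lemma Abar_chernoff:
 assumes n: "n \<ge> 1" and L: "finite L" and t: "\<And>l. l \<in> L \<Longrightarrow> t l \<in> {0..T}"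
  and c: "log_exp_moment N (\<lambda>\<omega>. \<Sum>l\<in>L. \<alpha> l * arr \<omega> (t l)) \<le> ereal c"
 shows "M.prob {\<omega> \<in> space M. (\<Sum>l\<in>L. \<alpha> l * Abar n \<omega> (t l)) \<ge> b} \<le> exp (- (real n * (b - c)))"
proof -
 let ?A = "\<lambda>i \<omega>. exp (\<Sum>l\<in>L. \<alpha> l * A i \<omega> (t l))"
 have [measurable]: "(\<lambda>\<omega>. Abar n \<omega> (t l)) \<in> borel_measurable M" if "l \<in> L" for l
  by (rule Abar_coord_measurable[OF t[OF that]])
 let ?E = "{\<omega> \<in> space M. (\<Sum>l\<in>L. \<alpha> l * Abar n \<omega> (t l)) \<ge> b}"
 have E: "?E \<in> sets M" by measurable
 have i: "M.indep_vars (\<lambda>_. borel) (\<lambda>i \<omega>. ennreal (?A i \<omega>)) {1..n}"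
  by (use M.indep_vars_compose2[where M'="\<lambda>_. path_algebra T" and X=A and Y="\<lambda>_ w. ennreal (exp (\<Sum>l\<in>L. \<alpha> l * w (t l)))"] M.indep_vars_subset[OF A_indep] t in \<open>auto intro!: measurable_component_singleton measurable_compose[OF _ measurable_ennreal] borel_measurable_exp borel_measurable_sum borel_measurable_times\<close>)
 have "ennreal (exp (real n * b)) * emeasure M ?E = (\<integral>\<^sup>+\<omega>. ennreal (exp (real n * b)) * indicator ?E \<omega> \<partial>M)"
  using E by (simp add: nn_integral_cmult_indicator)
 also have "\<dots> \<le> (\<integral>\<^sup>+\<omega>. (\<Prod>i=1..n. ennreal (?A i \<omega>)) \<partial>M)"
 proof (rule nn_integral_mono)
  fix \<omega> assume "\<omega> \<in> space M"
  have "(\<Prod>i=1..n. ennreal (?A i \<omega>)) = ennreal (exp (\<Sum>i=1..n. \<Sum>l\<in>L. \<alpha> l * A i \<omega> (t l)))"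
   by (simp add: prod_ennreal exp_sum)
  also have "(\<Sum>i=1..n. \<Sum>l\<in>L. \<alpha> l * A i \<omega> (t l)) = (\<Sum>l\<in>L. \<alpha> l * (\<Sum>i=1..n. A i \<omega> (t l)))"
   by (subst sum.swap) (simp add: sum_distrib_left)
  also have "\<dots> = real n * (\<Sum>l\<in>L. \<alpha> l * Abar n \<omega> (t l))"
  proof -
   have "\<alpha> l * (\<Sum>i=1..n. A i \<omega> (t l)) = real n * (\<alpha> l * Abar n \<omega> (t l))" if "l \<in> L" for l
    using n t[OF that] by (simp add: Abar_eq)
   then show ?thesis by (simp add: sum_distrib_left)
  qed
  finally show "ennreal (exp (real n * b)) * indicator ?E \<omega> \<le> (\<Prod>i=1..n. ennreal (?A i \<omega>))"
   using n by (auto simp: indicator_def intro!: ennreal_leI)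
 qed
 also have "\<dots> = (\<Prod>i=1..n. \<integral>\<^sup>+\<omega>. ennreal (?A i \<omega>) \<partial>M)"
  by (rule M.indep_vars_nn_integral[OF _ i]) auto
 also have "\<dots> \<le> (\<Prod>i=1..n. ennreal (exp c))"
  by (intro prod_mono_ennreal A_nn_log_exp_moment[OF _ L t c]) auto
 also have "\<dots> = ennreal (exp (real n * c))" by (simp add: ennreal_power exp_of_nat_mult)
 finally have "ennreal (exp (real n * b) * M.prob ?E) \<le> ennreal (exp (real n * c))"
  by (simp add: M.emeasure_eq_measure ennreal_mult)
 then have "M.prob ?E \<le> exp (real n * c) / exp (real n * b)" by (simp add: pos_le_divide_eq mult.commute)
 also have "\<dots> = exp (- (real n * (b - c)))" by (simp add: exp_diff[symmetric] algebra_simps)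
 finally show ?thesis .
qed

text \<open>Chernoff with tilt one: the level is \<open>a\<close> plus the bound on the log-moment
  at that tilt.\<close>

lemma Abar_tail:
 obtains R where "\<forall>n\<ge>1. M.prob {w \<in> space M. Abar n w T > R} \<le> exp (- (real n * a))"
proof (rule that[of "a + C * T * (exp 1 - 1)"], intro allI impI)
 fix n :: nat assume n: "1 \<le> n"
 have c: "log_exp_moment N (\<lambda>w. \<Sum>l\<in>{0::nat}. 1 * arr w T) \<le> ereal (C * T * (exp 1 - 1))"
  using exp_moment_increment[of 0 T 1] T_pos by simp
 have "M.prob {w \<in> space M. Abar n w T > a + C * T * (exp 1 - 1)} \<le> M.prob {w \<in> space M. (\<Sum>l\<in>{0::nat}. 1 * Abar n w T) \<ge> a + C * T * (exp 1 - 1)}"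
  using Abar_coord_measurable[of T n] T_pos by (intro M.finite_measure_mono) auto
 also have "\<dots> \<le> exp (- (real n * (a + C * T * (exp 1 - 1) - C * T * (exp 1 - 1))))"
  by (rule Abar_chernoff[OF n _ _ c]) (use T_pos in auto)
 finally show "M.prob {w \<in> space M. Abar n w T > a + C * T * (exp 1 - 1)} \<le> exp (- (real n * a))" by simp
qed

text \<open>If the rate at \<open>\<phi>\<close> exceeds \<open>b\<close>, finitely many coordinates already witness it.\<close>

lemma Abar_local_upper:
 assumes b: "ereal b < arrival_rate N arr T \<phi>"
 obtains F \<epsilon> where "finite F" "F \<subseteq> {0..T}" "\<epsilon> > 0"
  "\<forall>n\<ge>1. M.prob {w \<in> space M. \<forall>t\<in>F. \<bar>Abar n w t - \<phi> t\<bar> < \<epsilon>} \<le> exp (- (real n * b))"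
proof -
 obtain m t \<alpha> where m: "m \<ge> (1::nat)" and t: "strict_mono_on {1..m} t" "t ` {1..m} \<subseteq> {0<..T}"
  and gt: "ereal b < ereal (\<Sum>l=1..m. \<alpha> l * \<phi> (t l)) - log_exp_moment N (\<lambda>w. \<Sum>l=1..m. \<alpha> l * arr w (t l))"
  using b unfolding arrival_rate_def less_SUP_iff by blast
 have t': "t l \<in> {0..T}" if "l \<in> {1..m}" for l using t(2) that by fastforce
 obtain c where c: "log_exp_moment N (\<lambda>w. \<Sum>l=1..m. \<alpha> l * arr w (t l)) = ereal c"
  using log_exp_moment_arr_finite[of "{1..m}" t \<alpha>] t' by auto
 define D where "D = (\<Sum>l=1..m. \<alpha> l * \<phi> (t l)) - c - b"
 have D: "D > 0" using gt unfolding c D_def by simp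
 define s where "s = (\<Sum>l=1..m. \<bar>\<alpha> l\<bar>)"
 have s: "s \<ge> 0" by (simp add: s_def sum_nonneg)
 \<comment> \<open>Deviations below \<open>\<epsilon>\<close> in all sampled coordinates change the
   linear functional by at most \<open>\<epsilon> * s\<close>, which stays within the margin
   \<open>D\<close>.\<close>
 define \<epsilon> where "\<epsilon> = D / (s + 1)"
 let ?A = "\<lambda>n. {w \<in> space M. \<forall>t\<in>t ` {1..m}. \<bar>Abar n w t - \<phi> t\<bar> < \<epsilon>}"
 have \<epsilon>: "\<epsilon> > 0" using D s by (simp add: \<epsilon>_def)
 have \<epsilon>s: "\<epsilon> * s \<le> D" using D s by (simp add: \<epsilon>_def pos_divide_le_eq mult_left_mono)
 show thesis
 proof (rule that[of "t ` {1..m}" \<epsilon>])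
  show "t ` {1..m} \<subseteq> {0..T}" using t' by blast
  show "\<forall>n\<ge>1. M.prob (?A n) \<le> exp (- (real n * b))"
  proof (intro allI impI)
   fix n :: nat assume n: "1 \<le> n"
   let ?B = "\<lambda>w. \<Sum>l=1..m. \<alpha> l * Abar n w (t l)"
   have [measurable]: "(\<lambda>w. Abar n w (t l)) \<in> borel_measurable M" if "l \<in> {1..m}" for l
    by (rule Abar_coord_measurable[OF t'[OF that]])
   have "M.prob (?A n)
    \<le> M.prob {w \<in> space M. (?B w) \<ge> b + c}"
   proof (rule M.finite_measure_mono)
    show "(?A n) \<subseteq> {w \<in> space M. (?B w) \<ge> b + c}"
    proof clarsimp
     fix w assume *: "\<forall>l\<in>{Suc 0..m}. \<bar>Abar n w (t l) - \<phi> (t l)\<bar> < \<epsilon>"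
     have "(\<Sum>l=1..m. \<alpha> l * \<phi> (t l) - \<bar>\<alpha> l\<bar> * \<epsilon>) \<le> ?B w"
     proof (rule sum_mono)
      fix l assume "l \<in> {1..m}"
      then have "\<bar>\<alpha> l\<bar> * \<bar>\<phi> (t l) - Abar n w (t l)\<bar> \<le> \<bar>\<alpha> l\<bar> * \<epsilon>" using * by (auto simp: abs_minus_commute less_imp_le intro!: mult_left_mono)
      then have "\<alpha> l * (\<phi> (t l) - Abar n w (t l)) \<le> \<bar>\<alpha> l\<bar> * \<epsilon>" by (metis abs_ge_self abs_mult order_trans)
      then show "\<alpha> l * \<phi> (t l) - \<bar>\<alpha> l\<bar> * \<epsilon> \<le> \<alpha> l * Abar n w (t l)" by (simp add: right_diff_distrib)
     qed
     then have "(\<Sum>l=1..m. \<alpha> l * \<phi> (t l)) - s * \<epsilon> \<le> ?B w"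
      by (simp add: sum_subtractf s_def sum_distrib_right)
     then show "b + c \<le> (\<Sum>l = Suc 0..m. \<alpha> l * Abar n w (t l))" using \<epsilon>s by (simp add: D_def mult.commute)
    qed
   qed measurable
   also have "\<dots> \<le> exp (- (real n * (b + c - c)))"
    by (rule Abar_chernoff[OF n]) (use t' c in auto)
   finally show "M.prob (?A n) \<le> exp (- (real n * b))" by simp
  qed
 qed (use \<epsilon> in auto)
qed

lemma Abar_local_lower:
 assumes I: "arrival_rate N arr T \<phi> \<le> ereal a" and z: "\<phi> 0 = 0" and F: "finite F" "F \<subseteq> {0..T}"
  and \<epsilon>: "\<epsilon> > 0" and \<eta>: "\<eta> > 0"
 shows "eventually (\<lambda>n. exp (- (real n * (a + \<eta>))) \<le> M.prob {\<omega> \<in> space M. \<forall>t\<in>F. \<bar>Abar n \<omega> t - \<phi> t\<bar> < \<epsilon>}) sequentially"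
proof -
 \<comment> \<open>Time zero is dropped because the rate does not sample it, and both paths vanish
   there; \<open>T\<close> is added so that at least one time remains.\<close>
 define F' where "F' = insert T (F - {0})"
 have F': "finite F'" "F' \<subseteq> {0<..T}" "F' \<noteq> {}" using F T_pos by (auto simp: F'_def)
 define m where "m = card F'"
 have m: "m \<ge> 1" using F' by (simp add: m_def Suc_le_eq card_gt_0_iff)
 define t where "t l = sorted_list_of_set F' ! (l - 1)" for l
 have tF: "t ` {1..m} = F'"
 proof -
  have "t ` {1..m} = set (sorted_list_of_set F')" by (force simp: image_iff t_def image_image set_conv_nth m_def)
  also have "\<dots> = F'" using F' by simp
  finally show ?thesis .
 qed
 have tm: "strict_mono_on {1..m} t"
 proof (rule strict_mono_onI)
  fix r s assume "r \<in> {1..m}" "s \<in> {1..m}" "r < s"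
  then show "t r < t s" unfolding t_def
   using strict_sorted_list_of_set[of F'] by (intro sorted_wrt_nth_less[of "(<)"]) (auto simp: m_def)
 qed
 have t': "t l \<in> {0..T}" if "l \<in> {1..m}" for l using tF F' that by force
 have cc: "ereal (\<Sum>l\<in>{1..m}. \<alpha> l * \<phi> (t l)) - log_exp_moment (distr M (path_algebra T) (A 1)) (\<lambda>w. \<Sum>l\<in>{1..m}. \<alpha> l * w (t l)) \<le> ereal a" for \<alpha>
 proof -
  have "ereal (\<Sum>l=1..m. \<alpha> l * \<phi> (t l)) - log_exp_moment N (\<lambda>\<omega>. \<Sum>l=1..m. \<alpha> l * arr \<omega> (t l)) \<le> ereal a"
   by (rule order_trans[OF arrival_rate_ge[OF m tm] I]) (use tF F' in auto)
  then show ?thesis by (subst A_log_exp_moment) (use t' in auto)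
 qed
 obtain n0 where n0: "\<And>I. finite I \<Longrightarrow> I \<subseteq> {1..} \<Longrightarrow> card I \<ge> n0 \<Longrightarrow>
  exp (- (real (card I) * (a + \<eta>))) \<le> M.prob {\<omega> \<in> space M. \<forall>l\<in>{1..m}. \<bar>(\<Sum>k\<in>I. A k \<omega> (t l)) / real (card I) - \<phi> (t l)\<bar> < \<epsilon>}"
 proof (rule M.cramer_lower_bound[where J="{1..}" and N="path_algebra T" and Y=A and L="{1..m}" and \<mu>="distr M (path_algebra T) (A 1)"
   and f="\<lambda>l w. w (t l)" and x="\<lambda>l. \<phi> (t l)" and c=a and \<epsilon>=\<epsilon> and \<eta>=\<eta>])
  show "distr M (path_algebra T) (A k) = distr M (path_algebra T) (A 1)" if "k \<in> {1..}" for k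
   using that A_law by simp
  show "(\<lambda>w. w (t l)) \<in> borel_measurable (path_algebra T)" if "l \<in> {1..m}" for l
   using t'[OF that] by (intro measurable_component_singleton)
 qed (use A_indep cc \<epsilon> \<eta> in auto)
 have z0: "AE \<omega> in M. \<forall>i\<in>{1..}. A i \<omega> 0 = 0"
  using A_zero_AE by (subst AE_ball_countable) auto
 show ?thesis
 proof (rule eventually_sequentiallyI[of "max 1 n0"])
  fix n assume n: "max 1 n0 \<le> n"
  let ?B = "{\<omega> \<in> space M. \<forall>t\<in>F. \<bar>Abar n \<omega> t - \<phi> t\<bar> < \<epsilon>}"
  let ?A = "\<lambda>t. {\<omega> \<in> space M. \<forall>l\<in>{1..m}. \<bar>(\<Sum>k\<in>{1..n}. A k \<omega> (t l)) / real n - \<phi> (t l)\<bar> < \<epsilon>}"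
  have "exp (- (real n * (a + \<eta>))) \<le> M.prob (?A t)"
   using n0[of "{1..n}"] n by auto
  also have "\<dots> \<le> M.prob ?B"
  proof (rule M.finite_measure_mono_AE)
   have [measurable]: "(\<lambda>\<omega>. Abar n \<omega> t) \<in> borel_measurable M" if "t \<in> F" for t
    using F that by (intro Abar_coord_measurable) auto
   show "?B \<in> sets M" using F by measurable
   show "AE \<omega> in M. \<omega> \<in> (?A t) \<longrightarrow>
     \<omega> \<in> ?B"
    using z0
   proof eventually_elim
    fix \<omega> assume z0: "\<forall>i\<in>{1..}. A i \<omega> 0 = 0"
    show "\<omega> \<in> (?A t) \<longrightarrow>
     \<omega> \<in> ?B"
    proof (intro impI CollectI conjI ballI)
     fix s assume *: "\<omega> \<in> (?A t)" and s: "s \<in> F"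
     have s': "s \<in> {0..T}" using s F by auto
     show "\<bar>Abar n \<omega> s - \<phi> s\<bar> < \<epsilon>"
     proof (cases "s = 0")
      case True
      then show ?thesis using z0 z \<epsilon> s' by (simp add: Abar_eq)
     next
      case False
      then have "s \<in> F'" using s by (simp add: F'_def)
      then obtain l where l: "l \<in> {1..m}" "s = t l" using tF by (metis imageE)
      then show ?thesis using * s' by (simp add: Abar_eq l(2))
     qed
    qed auto
   qed
  qed
  finally show "exp (- (real n * (a + \<eta>))) \<le> M.prob ?B" .
 qed
qed

end

section \<open>Renewal processes\<close>

locale renewal = prob_space M for M :: "'a measure" +
 fixes S :: "nat \<Rightarrow> 'a \<Rightarrow> real"
 assumes S_indep: "indep_vars (\<lambda>_. borel) S {1..}"
  and S_law: "i \<ge> 1 \<Longrightarrow> distr M borel (S i) = distr M borel (S 1)"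
  and S_pos: "i \<ge> 1 \<Longrightarrow> AE w in M. 0 < S i w"
begin

lemma S_measurable [measurable]: "i \<ge> 1 \<Longrightarrow> S i \<in> borel_measurable M"
 using S_indep by (auto simp: indep_vars_def)

lemma S_measurable_Suc [measurable]: "S (Suc i) \<in> borel_measurable M"
 by (rule S_measurable) simp

lemma S_nn_integral:
 assumes i: "i \<ge> 1" and g: "g \<in> borel_measurable borel"
 shows "(\<integral>\<^sup>+w. g (S i w) \<partial>M) = (\<integral>\<^sup>+w. g (S 1 w) \<partial>M)"
proof -
 have "(\<integral>\<^sup>+w. g (S i w) \<partial>M) = (\<integral>\<^sup>+x. g x \<partial>distr M borel (S i))"
  using i g by (subst nn_integral_distr) auto
 also have "\<dots> = (\<integral>\<^sup>+w. g (S 1 w) \<partial>M)" unfolding S_law[OF i]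
  using g by (subst nn_integral_distr) auto
 finally show ?thesis .
qed

definition mgf :: "real \<Rightarrow> ennreal" where "mgf \<theta> = (\<integral>\<^sup>+w. ennreal (exp (\<theta> * S 1 w)) \<partial>M)"

definition \<Lambda>S :: "real \<Rightarrow> ereal" where "\<Lambda>S = log_mgf M (S 1)"

lemma \<Lambda>S_eq: "\<Lambda>S \<theta> = elog (mgf \<theta>)"
 by (simp add: \<Lambda>S_def log_mgf_def log_exp_moment_def mgf_def)

lemma mgf_nonzero: "mgf \<theta> \<noteq> 0"
proof
 assume "mgf \<theta> = 0"
 then show False unfolding mgf_def by (subst (asm) nn_integral_0_iff_AE) auto
qed

lemma mgf_nonpos_le_1: "\<theta> \<le> 0 \<Longrightarrow> mgf \<theta> \<le> 1"
proof -
 assume t: "\<theta> \<le> 0"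
 have "mgf \<theta> \<le> (\<integral>\<^sup>+w. 1 \<partial>M)" unfolding mgf_def
  by ((rule nn_integral_mono_AE), (use S_pos[OF order_refl] in \<open>auto simp: mult_nonpos_nonneg t less_imp_le\<close>))
 then show ?thesis by (simp add: emeasure_space_1)
qed

lemma mgf_nonneg_ge_1: "\<theta> \<ge> 0 \<Longrightarrow> 1 \<le> mgf \<theta>"
proof -
 assume t: "\<theta> \<ge> 0"
 have "(\<integral>\<^sup>+w. 1 \<partial>M) \<le> mgf \<theta>" unfolding mgf_def
  by ((rule nn_integral_mono_AE), (use S_pos[OF order_refl] in \<open>auto simp: t less_imp_le\<close>))
 then show ?thesis by (simp add: emeasure_space_1)
qed

lemma mgf_at_bot: "(\<lambda>j. mgf (- real j)) \<longlonglongrightarrow> 0"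
proof -
 have "(\<lambda>j. \<integral>\<^sup>+\<omega>. ennreal (exp (- real j * S 1 \<omega>)) \<partial>M) \<longlonglongrightarrow> (\<integral>\<^sup>+\<omega>. 0 \<partial>M)"
 proof (rule nn_integral_dominated_convergence[where w="\<lambda>_. 1"])
  show "AE \<omega> in M. (\<lambda>j. ennreal (exp (- real j * S 1 \<omega>))) \<longlonglongrightarrow> 0" using S_pos[OF order_refl]
  proof (eventually_elim)
   fix \<omega> assume "0 < S 1 \<omega>"
   then have "(\<lambda>j. ennreal (exp (- S 1 \<omega>) ^ j)) \<longlonglongrightarrow> ennreal 0" by (fastforce intro: LIMSEQ_power_zero tendsto_ennrealI)
   then show "(\<lambda>j. ennreal (exp (- real j * S 1 \<omega>))) \<longlonglongrightarrow> 0"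
    by (simp add: exp_of_nat_mult[symmetric] ennreal_0)
  qed
  show "AE \<omega> in M. ennreal (exp (- real j * S 1 \<omega>)) \<le> 1" for j using S_pos[OF order_refl]
   by (auto simp: less_imp_le)
 qed (auto simp: emeasure_space_1)
 then show ?thesis by (simp add: mgf_def)
qed

text \<open>Some level carries probability above one half, and below it the exponential is at least
  its value at that level.\<close>

lemma mgf_lower: "\<exists>c>0. \<forall>\<theta>\<le>0. ennreal (exp (\<theta> * c) / 2) \<le> mgf \<theta>"
proof -
 let ?A = "\<lambda>n. {w \<in> space M. S 1 w \<le> real n}"
 have "(\<lambda>n. prob (?A n)) \<longlonglongrightarrow> prob (\<Union>n. (?A n))"
  by (intro finite_Lim_measure_incseq) (auto simp: incseq_def)
 also have "(\<Union>n. (?A n)) = space M" by (auto intro: real_arch_simple)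
 finally have "eventually (\<lambda>n. prob (?A n) > 1/2) sequentially"
  unfolding prob_space by (rule order_tendstoD) simp
 then have "eventually (\<lambda>n. n \<ge> 1 \<and> prob (?A n) > 1/2) sequentially"
  using eventually_ge_at_top[of 1] by eventually_elim auto
 then obtain n :: nat where n: "n \<ge> 1" "prob (?A n) > 1/2" by (auto simp: eventually_sequentially)
 have "ennreal (exp (\<theta> * real n) / 2) \<le> mgf \<theta>" if t: "\<theta> \<le> 0" for \<theta>
 proof -
  have "ennreal (exp (\<theta> * real n) / 2) \<le> ennreal (exp (\<theta> * real n) * prob (?A n))"
   using n by (intro ennreal_leI) simp
  also have "\<dots> = (\<integral>\<^sup>+w. ennreal (exp (\<theta> * real n)) * indicator (?A n) w \<partial>M)"
   by (subst nn_integral_cmult_indicator) (auto simp: emeasure_eq_measure ennreal_mult)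
  also have "\<dots> \<le> mgf \<theta>" unfolding mgf_def
   using t by (intro nn_integral_mono) (auto simp: indicator_def intro!: ennreal_leI mult_left_mono_neg)
  finally show ?thesis .
 qed
 then show ?thesis using n by (intro exI[of _ "real n"]) auto
qed

lemma service_log_mgf_\<Lambda>S: "service_log_mgf \<Lambda>S"
proof
 show "\<Lambda>S 0 = 0" unfolding \<Lambda>S_eq mgf_def by (simp add: emeasure_space_1 elog_def)
 show "\<Lambda>S \<theta> \<noteq> - \<infinity>" for \<theta> using mgf_nonzero[of \<theta>] unfolding \<Lambda>S_eq by (simp add: elog_def)
 show "0 \<le> \<Lambda>S \<theta>" if "0 \<le> \<theta>" for \<theta>
  by (use elog_mono[OF mgf_nonneg_ge_1[OF that]] in \<open>auto simp: \<Lambda>S_eq elog_def\<close>)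
 show "\<Lambda>S \<theta> < \<infinity>" if "\<theta> \<le> 0" for \<theta>
  using mgf_nonpos_le_1[OF that] unfolding \<Lambda>S_eq by (auto simp: elog_def top_unique)
 obtain c where c: "c > 0" "\<And>\<theta>. \<theta> \<le> 0 \<Longrightarrow> ennreal (exp (\<theta> * c) / 2) \<le> mgf \<theta>" using mgf_lower by blast
 have "ereal (\<theta> * c - ln 2) \<le> \<Lambda>S \<theta>" if "\<theta> \<le> 0" for \<theta>
  unfolding \<Lambda>S_eq elog_ge_iff_exp using c(2)[OF that] by (simp add: exp_diff)
 then show "\<exists>c>0. \<exists>k\<ge>0. \<forall>\<theta>\<le>0. ereal (\<theta> * c - k) \<le> \<Lambda>S \<theta>"
  using c(1) by (intro exI[of _ c] conjI exI[of _ "ln 2"]) auto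
 show "\<exists>\<theta>\<le>0. \<Lambda>S \<theta> \<le> ereal (- K)" for K
 proof -
  have "eventually (\<lambda>j. mgf (- real j) < ennreal (exp (- K))) sequentially"
   by (rule order_tendstoD[OF mgf_at_bot]) simp
  then obtain j where "mgf (- real j) < ennreal (exp (- K))" by (auto simp: eventually_sequentially)
  then show ?thesis unfolding \<Lambda>S_eq elog_le_iff_exp by (intro exI[of _ "- real j"]) simp
 qed
qed

sublocale slm: service_log_mgf \<Lambda>S by (rule service_log_mgf_\<Lambda>S)

abbreviation "sdom \<equiv> slm.mgf_dom"
abbreviation "lm \<equiv> slm.lmgf"

lemma mgf_eq: "\<theta> \<in> sdom \<Longrightarrow> mgf \<theta> = ennreal (exp (lm \<theta>))"
proof -
 assume "\<theta> \<in> sdom"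
 then have e: "elog (mgf \<theta>) = ereal (lm \<theta>)" using slm.\<Lambda>_eq unfolding \<Lambda>S_eq by blast
 show ?thesis
 proof (rule antisym)
  show "mgf \<theta> \<le> ennreal (exp (lm \<theta>))" using e by (simp add: elog_le_iff_exp[symmetric])
  show "ennreal (exp (lm \<theta>)) \<le> mgf \<theta>" using e by (simp add: elog_ge_iff_exp[symmetric])
 qed
qed

definition V :: "nat \<Rightarrow> 'a \<Rightarrow> real" where "V k w = (\<Sum>i=1..k. S i w)"

lemma V_measurable [measurable]: "V k \<in> borel_measurable M"
 unfolding V_def by (intro borel_measurable_sum S_measurable) auto

lemma V_0 [simp]: "V 0 w = 0" and V_Suc: "V (Suc k) w = V k w + S (Suc k) w"
 by (simp_all add: V_def)

lemma mgf_block: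
 assumes I: "finite I" "I \<subseteq> {1..}" and t: "\<theta> \<in> sdom"
 shows "(\<integral>\<^sup>+w. ennreal (exp (\<theta> * (\<Sum>i\<in>I. S i w))) \<partial>M) = ennreal (exp (real (card I) * lm \<theta>))"
proof -
 have ind: "indep_vars (\<lambda>_. borel) (\<lambda>i w. ennreal (exp (\<theta> * S i w))) I"
  by (rule indep_vars_compose2[OF indep_vars_subset[OF S_indep I(2)]]) measurable
 have "(\<integral>\<^sup>+w. ennreal (exp (\<theta> * (\<Sum>i\<in>I. S i w))) \<partial>M) = (\<integral>\<^sup>+w. (\<Prod>i\<in>I. ennreal (exp (\<theta> * S i w))) \<partial>M)"
  by (simp add: prod_ennreal exp_sum I sum_distrib_left)
 also have "\<dots> = (\<Prod>i\<in>I. \<integral>\<^sup>+w. ennreal (exp (\<theta> * S i w)) \<partial>M)"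
  by (rule indep_vars_nn_integral[OF I(1) ind]) auto
 also have "\<dots> = (\<Prod>i\<in>I. ennreal (exp (lm \<theta>)))"
 proof (rule prod.cong[OF refl])
  fix i assume "i \<in> I"
  then show "(\<integral>\<^sup>+w. ennreal (exp (\<theta> * S i w)) \<partial>M) = ennreal (exp (lm \<theta>))" using I S_nn_integral[of i "\<lambda>x. ennreal (exp (\<theta> * x))"] mgf_eq[OF t] by (auto simp: mgf_def)
 qed
 also have "\<dots> = ennreal (exp (real (card I) * lm \<theta>))" by (simp add: ennreal_power exp_of_nat_mult)
 finally show ?thesis .
qed

text \<open>Exponential Chebyshev with a nonpositive tilt: a short block means fast service, and
  this direction needs no moment assumption.\<close>

lemma block_small_prob:
 assumes I: "finite I" "I \<subseteq> {1..}" and t: "\<theta> \<le> 0"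
 shows "prob {w \<in> space M. (\<Sum>i\<in>I. S i w) \<le> x} \<le> exp (- \<theta> * x + real (card I) * lm \<theta>)"
proof -
 have [measurable]: "(\<lambda>w. \<Sum>i\<in>I. S i w) \<in> borel_measurable M" using I by (intro borel_measurable_sum S_measurable) auto
 let ?E = "{w \<in> space M. (\<Sum>i\<in>I. S i w) \<le> x}"
 have "ennreal (exp (\<theta> * x)) * emeasure M ?E = (\<integral>\<^sup>+w. ennreal (exp (\<theta> * x)) * indicator ?E w \<partial>M)"
  by (simp add: nn_integral_cmult_indicator)
 also have "\<dots> \<le> (\<integral>\<^sup>+w. ennreal (exp (\<theta> * (\<Sum>i\<in>I. S i w))) \<partial>M)"
  using t by (intro nn_integral_mono) (auto simp: indicator_def intro!: ennreal_leI mult_left_mono_neg)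
 also have "\<dots> = ennreal (exp (real (card I) * lm \<theta>))" by (rule mgf_block[OF I slm.nonpos_in_mgf_dom[OF t]])
 finally have "exp (\<theta> * x) * prob ?E \<le> exp (real (card I) * lm \<theta>)"
  by (simp add: emeasure_eq_measure ennreal_mult[symmetric])
 then have "prob ?E \<le> exp (real (card I) * lm \<theta>) / exp (\<theta> * x)" by (simp add: pos_le_divide_eq mult.commute)
 then show ?thesis by (simp add: exp_diff[symmetric])
qed

text \<open>At these sample points the renewal epochs increase strictly and without bound, so the
  \<open>Sup\<close> in \<open>renewal_count\<close> is a maximum of a finite set.\<close>

definition good :: "'a \<Rightarrow> bool" where
 "good w \<longleftrightarrow> (\<forall>i\<ge>1. 0 < S i w) \<and> (\<forall>x. \<exists>k. x < V k w)"

lemma AE_good: "AE w in M. good w"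
proof -
 have 1: "AE w in M. \<forall>i\<in>{1..}. 0 < S i w" using S_pos by (subst AE_ball_countable) auto
 have "AE w in M. \<forall>m::nat. \<exists>k. real m < V k w"
 proof (subst AE_all_countable, intro allI)
  fix m :: nat
  \<comment> \<open>With \<open>lm \<theta> \<le> - 1\<close> every further renewal before time
    \<open>m\<close> costs a factor \<open>exp (- 1)\<close>, so infinitely many of them have
    probability zero.\<close>
  obtain \<theta> where t: "\<theta> \<le> 0" "lm \<theta> \<le> - 1" by (rule slm.lmgf_at_bot)
  let ?A = "- \<theta> * real m"
  define E where "E = {w \<in> space M. \<forall>k. V k w \<le> real m}"
  have E: "E \<in> sets M" unfolding E_def by measurable
  have "prob E \<le> exp ?A * exp (- 1) ^ k" for k
  proof -
   have "prob E \<le> prob {w \<in> space M. (\<Sum>i\<in>{1..k}. S i w) \<le> real m}"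
    unfolding E_def V_def by (intro finite_measure_mono) (auto intro!: borel_measurable_sum S_measurable measurable_sets_Collect)
   also have "\<dots> \<le> exp (- \<theta> * real m + real (card {1..k}) * lm \<theta>)" by (rule block_small_prob) (use t in auto)
   also have "\<dots> \<le> exp ?A * exp (- 1) ^ k" using t mult_left_mono[of "lm \<theta>" "- 1" "real k"] by (simp add: exp_add[symmetric] exp_of_nat_mult[symmetric])
   finally show ?thesis .
  qed
  moreover have "(\<lambda>k. exp ?A * exp (- 1) ^ k) \<longlonglongrightarrow> exp ?A * 0"
   by (intro tendsto_intros LIMSEQ_power_zero) simp
  ultimately have "E \<in> null_sets M" using E by (auto simp: null_sets_def emeasure_eq_measure intro!: LIMSEQ_le_const[of "\<lambda>k. exp ?A * exp (- 1) ^ k"] antisym measure_nonneg)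
  then have "AE w in M. w \<notin> E" by (rule AE_not_in)
  then show "AE w in M. \<exists>k. real m < V k w"
   using AE_space by eventually_elim (auto simp: E_def not_le)
 qed
 with 1 show ?thesis
 proof eventually_elim
  fix w assume *: "\<forall>i\<in>{1..}. 0 < S i w" "\<forall>m::nat. \<exists>k. real m < V k w"
  have "\<exists>k. x < V k w" for x by (use real_arch_simple *(2) le_less_trans in \<open>metis\<close>)
  then show "good w" using *(1) by (auto simp: good_def)
 qed
qed

lemma V_strict_mono: "good w \<Longrightarrow> j < k \<Longrightarrow> V j w < V k w"
proof (induction k)
 case (Suc k)
 have "V k w < V (Suc k) w" using Suc.prems by (auto simp: V_Suc good_def)
 then show ?case using Suc by (cases "j = k") (auto intro: less_trans)
qed simp

lemma V_mono: "good w \<Longrightarrow> j \<le> k \<Longrightarrow> V j w \<le> V k w"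
 using V_strict_mono[of w j k] by (cases "j = k") auto

lemma V_nonneg: "good w \<Longrightarrow> 0 \<le> V k w"
 using V_mono[of w 0 k] by simp

abbreviation "R \<equiv> renewal_count S"

text \<open>Duality between counts and epochs, through which statements about \<open>R\<close> are
  reduced to partial sums.\<close>

lemma le_renewal_count_iff:
 assumes g: "good w" and x: "0 \<le> x"
 shows "k \<le> R w x \<longleftrightarrow> V k w \<le> x"
proof -
 let ?A = "{n. V n w \<le> x}"
 obtain k0 where k0: "x < V k0 w" using g by (auto simp: good_def)
 have "?A \<subseteq> {..k0}"
 proof
  fix n assume n: "n \<in> ?A"
  show "n \<in> {..k0}"
  proof (rule ccontr)
   assume "n \<notin> {..k0}"
   then have "V k0 w \<le> V n w" using g by (intro V_mono) auto
   then show False using n k0 by simp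
  qed
 qed
 then have fin: "finite ?A" by (rule finite_subset) simp
 have R: "R w x = Max ?A"
  unfolding renewal_count_def V_def[symmetric] using x fin by (intro cSup_eq_Max) (auto intro: exI[of _ 0])
 have ne: "?A \<noteq> {}" using x by (auto intro: exI[of _ 0])
 have mem: "V (R w x) w \<le> x" using Max_in[OF fin ne] unfolding R by simp
 show ?thesis by (use g V_mono[rotated] mem fin in \<open>fastforce simp: R intro: Max_ge\<close>)
qed

lemma renewal_count_less_iff: "good w \<Longrightarrow> 0 \<le> x \<Longrightarrow> R w x < k \<longleftrightarrow> x < V k w"
 using le_renewal_count_iff[of w x k] by auto

lemma renewal_count_mono: "good w \<Longrightarrow> 0 \<le> x \<Longrightarrow> x \<le> y \<Longrightarrow> R w x \<le> R w y"
 using le_renewal_count_iff[of w x "R w x"] le_renewal_count_iff[of w y "R w x"] by simp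

lemma renewal_count_0: "good w \<Longrightarrow> R w 0 = 0"
 using renewal_count_less_iff[of w 0 1] by (auto simp: V_def good_def)

lemma V_diff: "j \<le> k \<Longrightarrow> (\<Sum>i\<in>{Suc j..k}. S i w) = V k w - V j w"
proof -
 assume jk: "j \<le> k"
 have "V k w = (\<Sum>i\<in>{1..j} \<union> {Suc j..k}. S i w)"
  unfolding V_def using jk by (intro arg_cong[where f="sum (\<lambda>i. S i w)"]) auto
 also have "\<dots> = V j w + (\<Sum>i\<in>{Suc j..k}. S i w)"
  unfolding V_def by (intro sum.union_disjoint) auto
 finally show ?thesis by simp
qed

text \<open>Stepwise predictable tilts with normalising factors form a supermartingale.\<close>

lemma nn_integral_tilted_steps:
 assumes G[measurable]: "case_prod G \<in> borel_measurable (borel \<Otimes>\<^sub>M borel)"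
  and le: "\<And>a. (\<integral>\<^sup>+w. G a (S 1 w) \<partial>M) \<le> (1::ennreal)"
 shows "(\<integral>\<^sup>+w. (\<Prod>j<k. G (V j w) (S (Suc j) w)) \<partial>M) \<le> 1"
proof (cases "k = 0")
 case True
 then show ?thesis by (simp add: emeasure_space_1)
next
 case False
 define \<nu> where "\<nu> = distr M borel (S 1)"
 interpret nu: prob_space \<nu> unfolding \<nu>_def by (rule prob_space_distr) simp
 interpret P: product_sigma_finite "\<lambda>_::nat. \<nu>" by standard
 have snu[measurable_cong]: "sets \<nu> = sets borel" by (simp add: \<nu>_def)
 \<comment> \<open>The product as a function of the first \<open>k\<close> service times. Their
   joint law is a product measure, so the last coordinate is integrated out first and the induction
   removes one factor at a time.\<close>
 define f where "f k x = (\<Prod>j<k. G (\<Sum>i=1..j. x i) (x (Suc j)))" for k :: nat and x :: "nat \<Rightarrow> real"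
 have Gm2: "(\<lambda>x. G (g x) (h x)) \<in> borel_measurable N" if "g \<in> borel_measurable N" "h \<in> borel_measurable N" for g h :: "'z \<Rightarrow> real" and N
  using measurable_compose[OF measurable_Pair[OF that] G] by simp
 have fm[measurable]: "f k \<in> borel_measurable (Pi\<^sub>M I (\<lambda>_. \<nu>))" if "{1..k} \<subseteq> I" for k I
  unfolding f_def
 proof (intro borel_measurable_prod_ennreal Gm2 borel_measurable_sum)
  fix j assume j: "j \<in> {..<k}"
  have c: "(\<lambda>x. x i) \<in> borel_measurable (Pi\<^sub>M I (\<lambda>_. \<nu>))" if "i \<in> I" for i
   using measurable_component_singleton[OF that, of "\<lambda>_. \<nu>"] unfolding measurable_cong_sets[OF refl snu] .
  show "(\<lambda>x. x (Suc j)) \<in> borel_measurable (Pi\<^sub>M I (\<lambda>_. \<nu>))" using j that by (intro c) auto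
  show "(\<lambda>x. x i) \<in> borel_measurable (Pi\<^sub>M I (\<lambda>_. \<nu>))" if "i \<in> {1..j}" for i
   using j that \<open>{1..k} \<subseteq> I\<close> by (intro c) auto
 qed
 have Gint: "(\<integral>\<^sup>+y. G a y \<partial>\<nu>) \<le> 1" for a
  using le[of a] unfolding \<nu>_def by (subst nn_integral_distr) (auto intro!: Gm2)
 have main: "(\<integral>\<^sup>+x. f k x \<partial>Pi\<^sub>M {1..k} (\<lambda>_. \<nu>)) \<le> 1" for k
 proof (induction k)
  case 0
  then show ?case by (simp add: f_def PiM_empty)
 next
  case (Suc k)
  have ins: "{1..Suc k} = insert (Suc k) {1..k}" by auto
  have "(\<integral>\<^sup>+x. f (Suc k) x \<partial>Pi\<^sub>M {1..Suc k} (\<lambda>_. \<nu>)) = (\<integral>\<^sup>+x. (\<integral>\<^sup>+y. f (Suc k) (x(Suc k := y)) \<partial>\<nu>) \<partial>Pi\<^sub>M {1..k} (\<lambda>_. \<nu>))"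
   unfolding ins by (rule P.product_nn_integral_insert) (auto intro!: fm)
  also have "\<dots> = (\<integral>\<^sup>+x. (\<integral>\<^sup>+y. f k x * G (\<Sum>i=1..k. x i) y \<partial>\<nu>) \<partial>Pi\<^sub>M {1..k} (\<lambda>_. \<nu>))"
   by (auto simp: f_def intro!: sum.cong prod.cong refl arg_cong2[where f=G])
  also have "\<dots> = (\<integral>\<^sup>+x. f k x * (\<integral>\<^sup>+y. G (\<Sum>i=1..k. x i) y \<partial>\<nu>) \<partial>Pi\<^sub>M {1..k} (\<lambda>_. \<nu>))"
   by (intro nn_integral_cong nn_integral_cmult Gm2) (auto cong: measurable_cong_sets)
  also have "\<dots> \<le> (\<integral>\<^sup>+x. f k x * 1 \<partial>Pi\<^sub>M {1..k} (\<lambda>_. \<nu>))"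
   by (intro nn_integral_mono mult_left_mono Gint) auto
  also have "\<dots> \<le> 1" using Suc.IH by simp
  finally show ?case .
 qed
 have law: "distr M (Pi\<^sub>M {1..k} (\<lambda>_. borel)) (\<lambda>w. \<lambda>i\<in>{1..k}. S i w) = Pi\<^sub>M {1..k} (\<lambda>i. distr M borel (S i))"
  using False indep_vars_subset[OF S_indep, of "{1..k}"] by (subst indep_vars_iff_distr_eq_PiM'[symmetric]) auto
 also have "\<dots> = Pi\<^sub>M {1..k} (\<lambda>_. \<nu>)" unfolding \<nu>_def by ((rule PiM_cong[OF refl]), ((intro S_law), simp))
 finally have law: "distr M (Pi\<^sub>M {1..k} (\<lambda>_. borel)) (\<lambda>w. \<lambda>i\<in>{1..k}. S i w) = Pi\<^sub>M {1..k} (\<lambda>_. \<nu>)" .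
 have Sm: "(\<lambda>w. \<lambda>i\<in>{1..k}. S i w) \<in> measurable M (Pi\<^sub>M {1..k} (\<lambda>_. borel))"
  by (intro measurable_restrict S_measurable) auto
 have "(\<integral>\<^sup>+w. (\<Prod>j<k. G (V j w) (S (Suc j) w)) \<partial>M) = (\<integral>\<^sup>+w. f k (\<lambda>i\<in>{1..k}. S i w) \<partial>M)"
  unfolding f_def V_def by (intro nn_integral_cong prod.cong arg_cong2[where f=G] sum.cong refl) auto
 also have "\<dots> = (\<integral>\<^sup>+x. f k x \<partial>Pi\<^sub>M {1..k} (\<lambda>_. \<nu>))"
 proof -
  show ?thesis using fm[of k "{1..k}"] unfolding law[symmetric] by (subst nn_integral_distr[OF Sm]) auto
 qed
 also have "\<dots> \<le> 1" by (rule main)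
 finally show ?thesis .
qed

text \<open>Dominated convergence under a tilt in the domain. It is used to neglect service times so
  long that they leave the interval in which the tilt is constant.\<close>

lemma mgf_tail:
 assumes t: "\<theta> \<in> sdom" and \<delta>: "\<delta> > 0"
 obtains x0 where "\<forall>x\<ge>x0. (\<integral>\<^sup>+\<omega>. ennreal (exp (\<theta> * S 1 \<omega>)) * indicator {x<..} (S 1 \<omega>) \<partial>M) \<le> ennreal \<delta>"
proof -
 let ?B = "\<lambda>\<omega>. exp (\<theta> * S 1 \<omega>)"
 let ?A = "\<lambda>m. \<integral>\<^sup>+\<omega>. ennreal (?B \<omega>) * indicator {real m<..} (S 1 \<omega>) \<partial>M"
 have "(\<lambda>m. \<integral>\<^sup>+\<omega>. ennreal (?B \<omega>) * indicator {real m<..} (S 1 \<omega>) \<partial>M) \<longlonglongrightarrow> (\<integral>\<^sup>+\<omega>. 0 \<partial>M)"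
 proof (rule nn_integral_dominated_convergence[where w="\<lambda>\<omega>. ennreal (?B \<omega>)"])
  show "AE \<omega> in M. (\<lambda>m. ennreal (?B \<omega>) * indicator {real m<..} (S 1 \<omega>)) \<longlonglongrightarrow> 0"
  proof (rule AE_I2)
   fix \<omega>
   obtain m0 :: nat where "S 1 \<omega> \<le> real m0" using real_arch_simple by blast
   then have "eventually (\<lambda>m. ennreal (?B \<omega>) * indicator {real m<..} (S 1 \<omega>) = 0) sequentially"
    by (intro eventually_sequentiallyI[of m0]) (auto simp: indicator_def)
   then show "(\<lambda>m. ennreal (?B \<omega>) * indicator {real m<..} (S 1 \<omega>)) \<longlonglongrightarrow> 0" by (rule tendsto_eventually)
  qed
  show "(\<integral>\<^sup>+\<omega>. ennreal (?B \<omega>) \<partial>M) < \<infinity>" using mgf_eq[OF t] by (simp add: mgf_def)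
  show "AE \<omega> in M. ennreal (?B \<omega>) * indicator {real m<..} (S 1 \<omega>) \<le> ennreal (?B \<omega>)" for m
   by (auto simp: indicator_def)
 qed auto
 then have "eventually (\<lambda>m. (?A m) < ennreal \<delta>) sequentially"
  by (rule order_tendstoD) (use \<delta> in simp)
 then obtain m :: nat where m: "(?A m) < ennreal \<delta>"
  by (auto simp: eventually_sequentially)
 show thesis
 proof (rule that[of "real m"], intro allI impI)
  fix x assume "real m \<le> x"
  then have "(\<integral>\<^sup>+\<omega>. ennreal (?B \<omega>) * indicator {x<..} (S 1 \<omega>) \<partial>M) \<le> ?A m"
   by (intro nn_integral_mono) (auto simp: indicator_def)
  then show "(\<integral>\<^sup>+\<omega>. ennreal (?B \<omega>) * indicator {x<..} (S 1 \<omega>) \<partial>M) \<le> ennreal \<delta>" using m by simp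
 qed
qed

end

text \<open>For \<open>x \<le> y\<close>, the length of the intersection of \<open>{x..y}\<close>
  with the interval \<open>p\<close>; the form as a difference lets increments of the cumulative
  tilt be written as sums of overlaps.\<close>

definition overlap :: "real \<Rightarrow> real \<Rightarrow> real \<times> real \<Rightarrow> real" where
 "overlap x y p = (min y (snd p) - min y (fst p)) - (min x (snd p) - min x (fst p))"

lemma overlap_eq: "x \<le> y \<Longrightarrow> fst p < snd p \<Longrightarrow> overlap x y p = max 0 (min y (snd p) - max x (fst p))"
 unfolding overlap_def by (simp add: min_def max_def)

lemma overlap_nonneg: "x \<le> y \<Longrightarrow> fst p < snd p \<Longrightarrow> 0 \<le> overlap x y p"
 by (simp add: overlap_eq)

lemma sum_overlap_le:
 assumes P: "finite P" "\<And>p. p \<in> P \<Longrightarrow> fst p < snd p" and d: "disjoint_family_on (\<lambda>(u, v). {u<..<v}) P" and xy: "x \<le> y"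
 shows "(\<Sum>p\<in>P. overlap x y p) \<le> y - x"
proof -
 let ?I = "\<lambda>p. {max x (fst p)<..<min y (snd p)}"
 have disj: "disjoint_family_on ?I P"
  unfolding disjoint_family_on_def
 by ((intro ballI impI), (use d in \<open>fastforce simp: disjoint_family_on_def split_beta set_eq_iff\<close>))
 have "ennreal (\<Sum>p\<in>P. overlap x y p) = (\<Sum>p\<in>P. ennreal (overlap x y p))"
  using P xy by (intro sum_ennreal[symmetric] overlap_nonneg)
 also have "\<dots> = (\<Sum>p\<in>P. emeasure lborel (?I p))"
 proof (rule sum.cong[OF refl])
  fix p assume "p \<in> P"
  then have ov: "overlap x y p = max 0 (min y (snd p) - max x (fst p))" using P xy by (intro overlap_eq)
  show "ennreal (overlap x y p) = emeasure lborel (?I p)"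
  proof (cases "max x (fst p) \<le> min y (snd p)")
   case True
   then show ?thesis unfolding ov by (subst emeasure_lborel_Ioo) (simp_all add: max.absorb2)
  next
   case False
   then have "?I p = {}" by (intro greaterThanLessThan_empty) linarith
   moreover have "max 0 (min y (snd p) - max x (fst p)) = 0" using False by (intro max_absorb1) linarith
   ultimately show ?thesis unfolding ov by simp
  qed
 qed
 also have "\<dots> = emeasure lborel (\<Union>p\<in>P. ?I p)" by (rule sum_emeasure) (use disj P in auto)
 also have "\<dots> \<le> emeasure lborel {x<..<y}" by (intro emeasure_mono) auto
 also have "\<dots> = ennreal (y - x)" using xy by simp
 finally show ?thesis using xy by (simp add: ennreal_le_iff)
qed

section \<open>Upper estimates for the scaled renewal process\<close>

locale renewal_service = renewal +
 fixes T :: real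
 assumes T_pos: "0 < T" and Sbar_path_measurable: "n \<ge> 1 \<Longrightarrow> scaled_renewal T S n \<in> measurable M (path_algebra T)"
begin

abbreviation "Sbar n w \<equiv> scaled_renewal T S n w"

lemma Sbar_eq: "t \<in> {0..T} \<Longrightarrow> Sbar n w t = real (R w (real n * t)) / real n"
 by (simp add: scaled_renewal_def)

lemma Sbar_measurable: "n \<ge> 1 \<Longrightarrow> t \<in> {0..T} \<Longrightarrow> (\<lambda>w. Sbar n w t) \<in> borel_measurable M"
 by (rule measurable_compose[OF Sbar_path_measurable measurable_component_singleton])

lemma Sbar_tail:
 obtains R0 where "R0 \<ge> 0" "\<forall>n\<ge>1. prob {w \<in> space M. Sbar n w T > R0} \<le> exp (- (real n * a))"
proof -
 obtain \<theta> where t: "\<theta> \<le> 0" "lm \<theta> \<le> - 1" by (rule slm.lmgf_at_bot)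
 \<comment> \<open>More than \<open>n * R0\<close> renewals by time \<open>n * T\<close> cost at
   least one unit of exponent each, against a gain of \<open>- \<theta> * (n * T)\<close>; the
   difference is \<open>n * \<bar>a\<bar>\<close>.\<close>
 define R0 where "R0 = \<bar>a\<bar> - \<theta> * T"
 have "\<theta> * T \<le> 0" using t T_pos by (intro mult_nonpos_nonneg) auto
 then have R0: "R0 \<ge> 0" by (simp add: R0_def)
 show thesis
 proof (rule that[OF R0], intro allI impI)
  fix n :: nat assume n: "1 \<le> n"
  let ?B = "{w \<in> space M. Sbar n w T > R0}"
  define k where "k = nat \<lceil>real n * R0\<rceil>"
  let ?A = "{w \<in> space M. (\<Sum>i\<in>{1..k}. S i w) \<le> real n * T}"
  have k: "real n * R0 \<le> real k" unfolding k_def by (rule real_nat_ceiling_ge)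
  have "prob ?B \<le> prob ?A"
  proof (rule finite_measure_mono_AE)
   show "AE w in M. w \<in> ?B \<longrightarrow> w \<in> ?A"
    using AE_good
   proof eventually_elim
    fix w assume g: "good w"
    show "w \<in> ?B \<longrightarrow> w \<in> ?A"
    proof (intro impI CollectI conjI)
     assume *: "w \<in> ?B"
     then have "k \<le> R w (real n * T)" using n T_pos by (auto simp: Sbar_eq pos_less_divide_eq mult.commute k_def nat_le_iff ceiling_le_iff)
     then have "V k w \<le> real n * T" using g T_pos by (subst (asm) le_renewal_count_iff) auto
     then show "(\<Sum>i\<in>{1..k}. S i w) \<le> real n * T" by (simp add: V_def)
    qed auto
   qed
   show "?A \<in> sets M"
    using V_measurable[of k] unfolding V_def by measurable
  qed
  also have "\<dots> \<le> exp (- \<theta> * (real n * T) + real (card {1..k}) * lm \<theta>)"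
   by (rule block_small_prob) (use t in auto)
  also have "\<dots> \<le> exp (- (real n * a))"
  proof -
   have "real k * lm \<theta> \<le> real k * - 1" using t by (intro mult_left_mono) auto
   moreover have "real n * R0 = real n * \<bar>a\<bar> - \<theta> * (real n * T)" by (simp add: R0_def algebra_simps)
   moreover have "real n * a \<le> real n * \<bar>a\<bar>" by (intro mult_left_mono) auto
   ultimately show ?thesis using k by simp
  qed
  finally show "prob ?B \<le> exp (- (real n * a))" .
 qed
qed

text \<open>Excludes jumps in the limit: \<open>n * c\<close> renewals in a window of length below
  \<open>n * d\<close> mean an unusually short block of service times. The count at the left end is
  random, so a union bound over its at most \<open>n * Rb + 1\<close> values is taken; this is why
  \<open>Sbar n w T \<le> Rb\<close> is part of the event.\<close>

lemma Sbar_window: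
 assumes c: "c > 0" and Rb: "Rb \<ge> 0"
 obtains d where "d > 0" "\<forall>u v. 0 \<le> u \<and> u \<le> v \<and> v \<le> T \<and> v - u < d \<longrightarrow>
  eventually (\<lambda>n. prob {w \<in> space M. Sbar n w v - Sbar n w u \<ge> c \<and> Sbar n w T \<le> Rb} \<le> exp (- (real n * a))) sequentially"
proof -
 \<comment> \<open>\<open>K * c = \<bar>a\<bar> + 2\<close>: one unit pays for the window length
   through \<open>- \<theta> * d \<le> 1\<close>, the other for the linearly many terms of the union
   bound.\<close>
 define K where "K = (\<bar>a\<bar> + 2) / c"
 have K: "K > 0" using c by (simp add: K_def add_nonneg_pos)
 have Kc: "K * c = \<bar>a\<bar> + 2" using c by (simp add: K_def)
 obtain \<theta> where t: "\<theta> \<le> 0" "lm \<theta> \<le> - K" by (rule slm.lmgf_at_bot)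
 define d where "d = 1 / (1 - \<theta>)"
 have d: "d > 0" using t by (simp add: d_def)
 have td: "- \<theta> * d \<le> 1" by (use t pos_divide_le_eq in \<open>simp add: d_def field_simps\<close>)
 have "((\<lambda>x. Rb * exp K * (x ^ 1 / exp x) + exp K * (x ^ 0 / exp x)) \<longlongrightarrow> Rb * exp K * 0 + exp K * 0) at_top"
  by (intro tendsto_intros tendsto_power_div_exp_0)
 then have "((\<lambda>n. Rb * exp K * (real n ^ 1 / exp (real n)) + exp K * (real n ^ 0 / exp (real n))) \<longlongrightarrow> 0) sequentially"
  by (auto intro: filterlim_compose[OF _ filterlim_real_sequentially])
 then have ev: "eventually (\<lambda>n. Rb * exp K * (real n ^ 1 / exp (real n)) + exp K * (real n ^ 0 / exp (real n)) < 1) sequentially"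
  by (rule order_tendstoD) simp
 show thesis
 proof (rule that[OF d], intro allI impI)
  fix u v assume uv: "0 \<le> u \<and> u \<le> v \<and> v \<le> T \<and> v - u < d"
  let ?A = "\<lambda>n. {w \<in> space M. Sbar n w v - Sbar n w u \<ge> c \<and> Sbar n w T \<le> Rb}"
  show "eventually (\<lambda>n. prob (?A n) \<le> exp (- (real n * a))) sequentially"
   using ev eventually_ge_at_top[of 1]
  proof eventually_elim
   fix n :: nat assume small: "Rb * exp K * (real n ^ 1 / exp (real n)) + exp K * (real n ^ 0 / exp (real n)) < 1" and n: "1 \<le> n"
   let ?C = "real n + K - real n * (\<bar>a\<bar> + 2)"
   define m where "m = nat \<lfloor>real n * Rb\<rfloor>"
   define q where "q = nat \<lceil>real n * c\<rceil>"
   have q: "real n * c \<le> real q" unfolding q_def by (rule real_nat_ceiling_ge)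
   have "real q > 0" using q n c by (smt (verit) mult_pos_pos of_nat_0_less_iff less_le_trans zero_less_one)
   then have q1: "q \<ge> 1" by simp
   \<comment> \<open>The service in progress at time \<open>n * u\<close> is left out, since only
     its completion \<open>V (Suc i) w\<close> is known to exceed \<open>n * u\<close>; hence the
     block starts at \<open>Suc (Suc i)\<close>.\<close>
   let ?B = "\<lambda>i. {w \<in> space M. (\<Sum>l\<in>{Suc (Suc i)..i + q}. S l w) \<le> real n * (v - u)}"
   have Bm: "?B i \<in> sets M" for i by (auto intro!: borel_measurable_sum S_measurable)
   have "prob (?A n) \<le> prob (\<Union>i\<in>{..m}. ?B i)"
   proof (rule finite_measure_mono_AE)
    show "AE w in M. w \<in> (?A n) \<longrightarrow> w \<in> (\<Union>i\<in>{..m}. ?B i)"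
     using AE_good
    proof eventually_elim
     fix w assume g: "good w"
     show "w \<in> (?A n) \<longrightarrow> w \<in> (\<Union>i\<in>{..m}. ?B i)"
     proof
      assume *: "w \<in> (?A n)"
      define i where "i = R w (real n * u)"
      have 1: "real n * c \<le> real (R w (real n * v)) - real i"
       using * uv n by (simp add: Sbar_eq i_def diff_divide_distrib[symmetric] pos_le_divide_eq mult.commute)
      have "real (R w (real n * T)) \<le> real n * Rb"
       using * n T_pos by (simp add: Sbar_eq pos_divide_le_eq mult.commute)
      moreover have "i \<le> R w (real n * T)" unfolding i_def
       using uv by (intro renewal_count_mono[OF g]) (auto intro: mult_left_mono)
      ultimately have im: "i \<le> m" unfolding m_def by (simp add: le_nat_iff le_floor_iff)
      have "\<lceil>real n * c\<rceil> \<le> int (R w (real n * v)) - int i" using 1 by (simp only: ceiling_le_iff)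
      then have "i + q \<le> R w (real n * v)" unfolding q_def using q1 q_def by linarith
      then have Vv: "V (i + q) w \<le> real n * v" using g uv by (subst (asm) le_renewal_count_iff) auto
      have Vu: "real n * u < V (Suc i) w" using renewal_count_less_iff[OF g, of "real n * u" "Suc i"] uv by (simp add: i_def)
      have "(\<Sum>l\<in>{Suc (Suc i)..i + q}. S l w) = V (i + q) w - V (Suc i) w" using q1 by (intro V_diff) auto
      also have "\<dots> \<le> real n * (v - u)" using Vv Vu by (simp add: right_diff_distrib)
      finally show "w \<in> (\<Union>i\<in>{..m}. ?B i)" using im * by auto
     qed
    qed
    show "(\<Union>i\<in>{..m}. ?B i) \<in> sets M" using Bm by auto
   qed
   also have "\<dots> \<le> (\<Sum>i\<in>{..m}. prob (?B i))" using Bm by (intro finite_measure_subadditive_finite) auto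
   also have "\<dots> \<le> (\<Sum>i\<in>{..m}. exp ?C)"
   proof (rule sum_mono)
    fix i
    let ?D = "card {Suc (Suc i)..i + q}"
    have "prob (?B i) \<le> exp (- \<theta> * (real n * (v - u)) + real ?D * lm \<theta>)"
     by (rule block_small_prob) (use t in auto)
    also have "\<dots> \<le> exp ?C"
    proof -
     have "- \<theta> * (real n * (v - u)) \<le> real n * (- \<theta> * d)"
     proof -
      have "(- \<theta> * real n) * (v - u) \<le> (- \<theta> * real n) * d" using uv t by (intro mult_left_mono) (auto simp: mult_nonpos_nonneg)
      then show ?thesis by (simp add: algebra_simps)
     qed
     also have "\<dots> \<le> real n * 1" using td by (intro mult_left_mono) auto
     finally have 1: "- \<theta> * (real n * (v - u)) \<le> real n" by simp
     have card: "real ?D \<ge> real n * c - 1" using q q1 by simp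
     have "real ?D * lm \<theta> \<le> real ?D * (- K)" using t by (intro mult_left_mono) auto
     also have "\<dots> \<le> (real n * c - 1) * (- K)" using card K by (intro mult_right_mono_neg) auto
     also have "\<dots> = K - real n * (\<bar>a\<bar> + 2)" unfolding Kc[symmetric] by (simp add: algebra_simps)
     finally show ?thesis using 1 by simp
    qed
    finally show "prob (?B i) \<le> exp ?C" .
   qed
   also have "\<dots> = (real m + 1) * exp ?C" by simp
   also have "\<dots> \<le> (real n * Rb + 1) * exp ?C" by (use Rb in \<open>auto simp: m_def of_nat_nat intro!: mult_right_mono\<close>)
   also have "\<dots> = ((real n * Rb + 1) * exp K / exp (real n)) * exp (- (real n * \<bar>a\<bar>))"
    by (simp add: exp_diff[symmetric] exp_add[symmetric] mult.assoc) (simp add: exp_add exp_diff exp_minus field_simps)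
   also have "\<dots> \<le> 1 * exp (- (real n * \<bar>a\<bar>))"
    using small by (intro mult_right_mono) (auto simp: field_simps)
   also have "\<dots> \<le> exp (- (real n * a))" by (simp add: mult_left_mono)
   finally show "prob (?A n) \<le> exp (- (real n * a))" .
  qed
 qed
qed

end

context renewal_service
begin

text \<open>The one-step supermartingale estimate. \<open>\<Theta>\<close> has slope
  \<open>\<theta> p\<close> on \<open>p\<close>; from a position well inside \<open>p\<close> a
  short step produces the factor \<open>exp (\<theta> p * S 1 w)\<close>, which \<open>h\<close>
  compensates up to \<open>\<epsilon>'\<close>. Within \<open>\<eta>\<close> to the left of an
  endpoint the step may cross it, and the crude compensation \<open>K\<close> is charged there.
  Steps longer than \<open>n * \<eta>\<close> are negligible by \<open>mgf_tail\<close>.\<close>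

lemma exp_moment_step:
 assumes fam: "slm.tilted_family T P \<theta>" and \<theta>s: "0 \<le> \<theta>s" "\<And>p. p \<in> P \<Longrightarrow> \<theta> p \<le> \<theta>s" "\<theta>s \<in> sdom"
  and \<eta>: "\<eta> > 0" and \<epsilon>': "\<epsilon>' > 0"
  and K_def: "K = lm \<theta>s + (\<Sum>p\<in>P. \<bar>lm (\<theta> p)\<bar>)"
  and W_def: "W = (\<Union>p\<in>P. {fst p - \<eta><..fst p} \<union> {snd p - \<eta><..snd p})"
  and h_def: "h = (\<lambda>x. (\<Sum>p\<in>P. lm (\<theta> p) * indicator {fst p<..snd p} x) + \<epsilon>' + K * indicator W x)"
  and \<Theta>_def: "\<Theta> = (\<lambda>t. \<Sum>p\<in>P. \<theta> p * (min t (snd p) - min t (fst p)))"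
 shows "eventually (\<lambda>n. \<forall>a\<ge>0. (\<integral>\<^sup>+w. ennreal (exp (real n * (\<Theta> ((a + S 1 w) / real n) - \<Theta> (a / real n)) - h (a / real n))) \<partial>M) \<le> 1) sequentially"
proof -
 have finP: "finite P" using fam by (simp add: slm.tilted_family_def)
 have Pp: "0 \<le> fst p" "fst p < snd p" "snd p \<le> T" if "p \<in> P" for p
  using fam that by (auto simp: slm.tilted_family_def split_beta)
 have disj: "disjoint_family_on (\<lambda>(u, v). {u<..<v}) P" using fam by (simp add: slm.tilted_family_def)
 have \<theta>dom: "\<theta> p \<in> sdom" if "p \<in> P" for p using fam that by (auto simp: slm.tilted_family_def)
 define L1 where "L1 = (\<Sum>p\<in>P. \<bar>lm (\<theta> p)\<bar>)"
 have L1: "\<bar>lm (\<theta> p)\<bar> \<le> L1" if "p \<in> P" for p unfolding L1_def using finP that by (intro member_le_sum) auto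
 have L10: "0 \<le> L1" by (simp add: L1_def sum_nonneg)
 have lms: "0 \<le> lm \<theta>s" using slm.lmgf_nonneg[OF \<theta>s(3,1)] .
 have K0: "K \<ge> 0" using lms L10 by (simp add: K_def L1_def)
 have Kge: "K \<ge> lm \<theta>s + L1" by (simp add: K_def L1_def)
 \<comment> \<open>Small enough that adding \<open>\<delta>\<close> to
   \<open>exp (lm \<theta>')\<close> is absorbed by the extra \<open>\<epsilon>'\<close> in the
   exponent whenever \<open>\<bar>lm \<theta>'\<bar> \<le> L1\<close>.\<close>
 define \<delta> where "\<delta> = exp (- L1) * (exp \<epsilon>' - 1)"
 have \<delta>: "\<delta> > 0" using \<epsilon>' by (simp add: \<delta>_def)
 obtain x0 where x0: "\<forall>x\<ge>x0. (\<integral>\<^sup>+w. ennreal (exp (\<theta>s * S 1 w)) * indicator {x<..} (S 1 w) \<partial>M) \<le> ennreal \<delta>"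
  by (rule mgf_tail[OF \<theta>s(3) \<delta>])
 have absorb: "exp (lm \<theta>') + \<delta> \<le> exp (lm \<theta>' + \<epsilon>')" if "\<bar>lm \<theta>'\<bar> \<le> L1" for \<theta>'
 proof -
  have "\<delta> \<le> exp (lm \<theta>') * (exp \<epsilon>' - 1)" unfolding \<delta>_def using that \<epsilon>' by (intro mult_right_mono) auto
  then show ?thesis by (simp add: exp_add algebra_simps)
 qed
 have \<Theta>diff: "\<Theta> y - \<Theta> x = (\<Sum>p\<in>P. \<theta> p * overlap x y p)" for x y
  by (simp add: \<Theta>_def overlap_def sum_subtractf[symmetric] right_diff_distrib)
 have ov0: "0 \<le> overlap x y p" if "p \<in> P" "x \<le> y" for x y p using Pp[OF that(1)] that by (intro overlap_nonneg)
 have ovsum: "(\<Sum>p\<in>P. overlap x y p) \<le> y - x" if "x \<le> y" for x y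
  using finP Pp disj that by (intro sum_overlap_le)
 \<comment> \<open>Three estimates for increments of \<open>\<Theta>\<close>: in general at most
   \<open>\<theta>s\<close> times the length, exactly \<open>\<theta> p\<close> times the length
   inside \<open>p\<close>, and zero away from all intervals.\<close>
 have dA: "\<Theta> y - \<Theta> x \<le> \<theta>s * (y - x)" if xy: "x \<le> y" for x y
 proof -
  have "\<Theta> y - \<Theta> x \<le> (\<Sum>p\<in>P. \<theta>s * overlap x y p)" unfolding \<Theta>diff
   using \<theta>s ov0 xy by (intro sum_mono mult_right_mono) auto
  also have "\<dots> = \<theta>s * (\<Sum>p\<in>P. overlap x y p)" by (simp add: sum_distrib_left)
  also have "\<dots> \<le> \<theta>s * (y - x)" using ovsum[OF xy] \<theta>s by (intro mult_left_mono)
  finally show ?thesis .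
 qed
 have dB: "\<Theta> y - \<Theta> x = \<theta> p * (y - x)" if p: "p \<in> P" and x: "fst p < x" "x \<le> snd p - \<eta>" and xy: "x \<le> y" "y \<le> x + \<eta>" for x y p
 proof -
  have ovp: "overlap x y p = y - x" using Pp[OF p] x xy by (simp add: overlap_eq)
  have "\<forall>q\<in>P - {p}. overlap x y q = 0" using ovsum[OF xy(1)] sum.remove[OF finP p, of "overlap x y"] ovp finP ov0 xy by (subst sum_nonneg_eq_0_iff[symmetric]) (auto intro!: antisym sum_nonneg)
  then have "(\<Sum>q\<in>P - {p}. \<theta> q * overlap x y q) = 0" by (intro sum.neutral) auto
  then show ?thesis unfolding \<Theta>diff using sum.remove[OF finP p, of "\<lambda>q. \<theta> q * overlap x y q"] ovp by simp
 qed
 have dC: "\<Theta> y - \<Theta> x = 0" if x: "\<forall>p\<in>P. \<not> (fst p - \<eta> < x \<and> x \<le> snd p)" and xy: "x \<le> y" "y \<le> x + \<eta>" for x y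
  by (use x Pp xy in \<open>auto simp: overlap_eq max_def min_def \<Theta>diff intro!: sum.neutral\<close>)
 obtain n0 :: nat where n0: "x0 / \<eta> \<le> real n0" using real_arch_simple by blast
 show ?thesis
 proof (rule eventually_sequentiallyI[of "max 1 n0"], intro allI impI)
  fix n :: nat and a :: real assume n: "max 1 n0 \<le> n" and a: "0 \<le> a"
  let ?B = "\<integral>\<^sup>+w. ennreal (exp (real n * (\<Theta> ((a + S 1 w) / real n) - \<Theta> (a / real n)) - h (a / real n))) \<partial>M"
  define x where "x = a / real n"
  have np: "real n > 0" using n by simp
  have nx0: "x0 \<le> real n * \<eta>"
  proof -
   have "x0 / \<eta> \<le> real n" using n0 n by linarith
   then show ?thesis using \<eta> by (simp add: pos_divide_le_eq)
  qed
  define Z where "Z w = real n * (\<Theta> ((a + S 1 w) / real n) - \<Theta> (a / real n))" for w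
  let ?A = "\<integral>\<^sup>+w. ennreal (exp (Z w)) \<partial>M"
  define E0 where "E0 w = ennreal (exp (\<theta>s * S 1 w)) * indicator {real n * \<eta><..} (S 1 w)" for w
  have E0m[measurable]: "E0 \<in> borel_measurable M" unfolding E0_def by measurable
  have E0: "(\<integral>\<^sup>+w. E0 w \<partial>M) \<le> ennreal \<delta>" unfolding E0_def using x0 nx0 by blast
  have \<Theta>m[measurable]: "\<Theta> \<in> borel_measurable borel" unfolding \<Theta>_def by measurable
  have Zm[measurable]: "Z \<in> borel_measurable M" unfolding Z_def by measurable
  have xy: "x \<le> (a + S 1 w) / real n" "(a + S 1 w) / real n - x = S 1 w / real n" if "0 < S 1 w" for w
   using that np by (simp_all add: x_def divide_right_mono add_divide_distrib)
  have Zs: "Z w \<le> \<theta>s * S 1 w" if s: "0 < S 1 w" for w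
   by (use dA[OF xy(1)[OF s]] xy(2)[OF s] np in \<open>simp add: Z_def x_def field_simps\<close>)
  have mom: "?A \<le> ennreal (exp (h x))"
  proof -
   have onep: "(\<Sum>q\<in>P. lm (\<theta> q) * indicator {fst q<..snd q} x) = lm (\<theta> p)"
    if p: "p \<in> P" "fst p < x" "x \<le> snd p" for p
   proof -
    have "lm (\<theta> q) * indicator {fst q<..snd q} x = 0" if q: "q \<in> P - {p}" for q
     by (use dense[of "max (fst p) (fst q)" x] p disj p(1) q in \<open>fastforce simp: indicator_def disjoint_family_on_def split_beta\<close>)
    then show ?thesis using sum.remove[OF finP p(1), of "\<lambda>q. lm (\<theta> q) * indicator {fst q<..snd q} x"] p by (fastforce intro: sum.neutral)
   qed
   \<comment> \<open>Well inside an interval, within \<open>\<eta>\<close> to the left of an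
     endpoint, or too far from every interval for a short step to enter one.\<close>
   consider (inside) p where "p \<in> P" "fst p < x" "x \<le> snd p - \<eta>"
    | (bad) "x \<in> W" | (out) "\<forall>p\<in>P. \<not> (fst p - \<eta> < x \<and> x \<le> snd p)"
   proof -
    have "x \<in> W" if "p \<in> P" "fst p - \<eta> < x" "x \<le> snd p" "\<not> (fst p < x \<and> x \<le> snd p - \<eta>)" for p
     using that unfolding W_def by (intro UN_I[of p]) auto
    then show thesis using inside bad out by blast
   qed
   then show ?thesis
   proof cases
    case inside
    have "?A \<le> (\<integral>\<^sup>+w. ennreal (exp (\<theta> p * S 1 w)) + E0 w \<partial>M)"
    proof (rule nn_integral_mono_AE)
     show "AE w in M. ennreal (exp (Z w)) \<le> ennreal (exp (\<theta> p * S 1 w)) + E0 w" using S_pos[OF order_refl]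
     proof eventually_elim
      fix w assume s: "0 < S 1 w"
      show "ennreal (exp (Z w)) \<le> ennreal (exp (\<theta> p * S 1 w)) + E0 w"
      proof (cases "S 1 w \<le> real n * \<eta>")
       case True
       then show ?thesis using xy(2)[OF s] np dB[OF inside xy(1)[OF s]] xy(2)[OF s] np by (auto simp: pos_divide_le_eq algebra_simps Z_def x_def)
      next
       case False
       then have "ennreal (exp (Z w)) \<le> E0 w" using Zs[OF s] by (simp add: E0_def ennreal_leI)
       then show ?thesis by (rule order_trans) simp
      qed
     qed
    qed
    also have "\<dots> = mgf (\<theta> p) + (\<integral>\<^sup>+w. E0 w \<partial>M)" unfolding mgf_def by (rule nn_integral_add) measurable
    also have "\<dots> \<le> ennreal (exp (lm (\<theta> p)) + \<delta>)" using E0 \<delta> by (simp add: mgf_eq[OF \<theta>dom[OF inside(1)]])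
    also have "\<dots> \<le> ennreal (exp (lm (\<theta> p) + \<epsilon>'))" by (intro ennreal_leI absorb L1 inside(1))
    also have "\<dots> \<le> ennreal (exp (h x))"
     using onep[OF inside(1,2)] inside(3) \<eta> K0 by (intro ennreal_leI) (simp add: h_def)
    finally show ?thesis .
   next
    case bad
    have "?A \<le> mgf \<theta>s" unfolding mgf_def
     by ((rule nn_integral_mono_AE), (use S_pos[OF order_refl] in \<open>(eventually_elim, (use Zs in \<open>auto intro: ennreal_leI\<close>))\<close>))
    also have "\<dots> = ennreal (exp (lm \<theta>s))" by (rule mgf_eq[OF \<theta>s(3)])
    also have "\<dots> \<le> ennreal (exp (h x))"
    proof -
     have "- L1 \<le> (\<Sum>q\<in>P. lm (\<theta> q) * indicator {fst q<..snd q} x)"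
      unfolding L1_def sum_negf[symmetric] by (rule sum_mono) (auto simp: indicator_def)
     then show ?thesis using bad Kge \<epsilon>' by (simp add: h_def)
    qed
    finally show ?thesis .
   next
    case out
    have "?A \<le> (\<integral>\<^sup>+w. 1 + E0 w \<partial>M)"
    proof (rule nn_integral_mono_AE)
     show "AE w in M. ennreal (exp (Z w)) \<le> 1 + E0 w" using S_pos[OF order_refl]
     proof eventually_elim
      fix w assume s: "0 < S 1 w"
      show "ennreal (exp (Z w)) \<le> 1 + E0 w"
      proof (cases "S 1 w \<le> real n * \<eta>")
       case True
       then show ?thesis using xy(2)[OF s] np dC[OF out xy(1)[OF s]] by (auto simp: pos_divide_le_eq algebra_simps Z_def x_def)
      next
       case False
       then have "ennreal (exp (Z w)) \<le> E0 w" using Zs[OF s] by (simp add: E0_def ennreal_leI)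
       then show ?thesis by (rule order_trans) simp
      qed
     qed
    qed
    also have "\<dots> \<le> ennreal (exp (lm 0) + \<delta>)" using E0 \<delta> by (subst nn_integral_add) (auto simp: emeasure_space_1)
    also have "\<dots> \<le> ennreal (exp (lm 0 + \<epsilon>'))" by (intro ennreal_leI absorb) (simp add: L10)
    also have "\<dots> \<le> ennreal (exp (h x))" by (use out \<eta> K0 in \<open>auto simp: h_def intro!: ennreal_leI\<close>)
    finally show ?thesis .
   qed
  qed
  have "?B
   = (\<integral>\<^sup>+w. ennreal (exp (- h x)) * ennreal (exp (Z w)) \<partial>M)"
   by (intro nn_integral_cong) (simp add: Z_def x_def ennreal_mult[symmetric] exp_add[symmetric])
  also have "\<dots> = ennreal (exp (- h x)) * ?A" by (rule nn_integral_cmult) measurable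
  also have "\<dots> \<le> ennreal (exp (- h x)) * ennreal (exp (h x))" by (intro mult_left_mono mom) simp
  also have "\<dots> = 1" by (simp add: ennreal_mult[symmetric] exp_add[symmetric])
  finally show "?B \<le> 1" .
 qed
qed

lemma renewals_between:
 assumes g: "good w" and n: "n \<ge> 1" and uv: "0 \<le> u" "u \<le> v" and k: "R w (real n * v) < k"
 shows "card {j\<in>{..<k}. u < V j w / real n \<and> V j w / real n \<le> v} = R w (real n * v) - R w (real n * u)"
proof -
 let ?A = "{j\<in>{..<k}. u < V j w / real n \<and> V j w / real n \<le> v}"
 have np: "real n > 0" using n by simp
 have "?A = {R w (real n * u)<..R w (real n * v)}"
 proof (rule set_eqI)
  fix j
  have "u < V j w / real n \<longleftrightarrow> real n * u < V j w" using np by (simp add: pos_less_divide_eq mult.commute)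
  also have "\<dots> \<longleftrightarrow> R w (real n * u) < j" using uv by (subst renewal_count_less_iff[OF g]) auto
  finally have 1: "u < V j w / real n \<longleftrightarrow> R w (real n * u) < j" .
  have "V j w / real n \<le> v \<longleftrightarrow> V j w \<le> real n * v" using np by (simp add: pos_divide_le_eq mult.commute)
  also have "\<dots> \<longleftrightarrow> j \<le> R w (real n * v)" using uv by (subst le_renewal_count_iff[OF g]) auto
  finally show "j \<in> ?A \<longleftrightarrow> j \<in> {R w (real n * u)<..R w (real n * v)}"
   using 1 k by auto
 qed
 then show ?thesis by simp
qed

text \<open>The extra one accounts for the epoch \<open>V 0 \<omega> = 0\<close>, which lies in the
  window when \<open>v < \<eta>\<close> but is not a renewal.\<close>

lemma renewals_in_window:
 assumes g: "good \<omega>" and n: "n \<ge> 1" and v: "0 \<le> v" and \<eta>: "\<eta> > 0" and k: "R \<omega> (real n * v) < k"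
 shows "real (card {j\<in>{..<k}. V j \<omega> / real n \<in> {v - \<eta><..v}}) \<le> 1 + (real (R \<omega> (real n * v)) - real (R \<omega> (real n * max 0 (v - \<eta>))))"
proof -
 let ?A = "{j\<in>{..<k}. V j \<omega> / real n \<in> {v - \<eta><..v}}"
 let ?w = "max 0 (v - \<eta>)"
 have np: "real n > 0" using n by simp
 have "?A \<subseteq> insert 0 {j\<in>{..<k}. ?w < V j \<omega> / real n \<and> V j \<omega> / real n \<le> v}"
 proof
  fix j assume j: "j \<in> ?A"
  have "0 < V j \<omega> / real n" if "j \<noteq> 0" using V_strict_mono[OF g, of 0 j] that np by simp
  then show "j \<in> insert 0 {j\<in>{..<k}. ?w < V j \<omega> / real n \<and> V j \<omega> / real n \<le> v}" using j by auto
 qed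
 then have "card ?A \<le> card (insert 0 {j\<in>{..<k}. ?w < V j \<omega> / real n \<and> V j \<omega> / real n \<le> v})"
  by (intro card_mono) auto
 also have "\<dots> \<le> Suc (card {j\<in>{..<k}. ?w < V j \<omega> / real n \<and> V j \<omega> / real n \<le> v})" by (rule card_insert_le_m1) auto
 also have "\<dots> = Suc (R \<omega> (real n * v) - R \<omega> (real n * ?w))"
  using v \<eta> by (subst renewals_between[OF g n _ _ k]) auto
 finally have 1: "card ?A \<le> Suc (R \<omega> (real n * v) - R \<omega> (real n * ?w))" .
 have "R \<omega> (real n * ?w) \<le> R \<omega> (real n * v)" using v \<eta> by (intro renewal_count_mono[OF g]) (auto intro: mult_left_mono)
 then show ?thesis using 1 by linarith
qed

text \<open>On the event \<open>k\<close> steps carry the scaled epochs past \<open>T\<close>, so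
  the exponents telescope to the length part of \<open>tilted_value\<close>. The compensators count
  renewals in each interval, which are close to \<open>n\<close> times the increments of
  \<open>\<psi>\<close>. The restriction to \<open>Sbar n \<omega> T \<le> Rb\<close> makes a
  deterministic \<open>k\<close> possible.\<close>

lemma Sbar_local_upper:
 assumes fam: "slm.tilted_family T P \<theta>" and mono: "mono_on {0..T} \<psi>" and cont: "continuous_on {0..T} \<psi>"
  and Rb: "Rb \<ge> 0" and \<epsilon>0: "\<epsilon>0 > 0"
 obtains F \<epsilon> where "finite F" "F \<subseteq> {0..T}" "\<epsilon> > 0"
  "eventually (\<lambda>n. prob {\<omega> \<in> space M. (\<forall>t\<in>F. \<bar>Sbar n \<omega> t - \<psi> t\<bar> < \<epsilon>) \<and> Sbar n \<omega> T \<le> Rb}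
    \<le> exp (- (real n * (slm.tilted_value P \<theta> \<psi> - \<epsilon>0)))) sequentially"
proof -
 let ?H = "\<Sum>p\<in>P. \<theta> p * (snd p - fst p)"
 let ?G = "\<lambda>p. \<psi> (snd p) - \<psi> (fst p)"
 have finP: "finite P" using fam by (simp add: slm.tilted_family_def)
 have Pp: "0 \<le> fst p" "fst p < snd p" "snd p \<le> T" if "p \<in> P" for p
  using fam that by (auto simp: slm.tilted_family_def split_beta)
 define \<theta>s where "\<theta>s = Max (insert 0 (\<theta> ` P))"
 have \<theta>s: "0 \<le> \<theta>s" "\<And>p. p \<in> P \<Longrightarrow> \<theta> p \<le> \<theta>s" unfolding \<theta>s_def using finP by (auto intro: Max_ge)
 have "\<theta>s \<in> insert 0 (\<theta> ` P)" unfolding \<theta>s_def using finP by (intro Max_in) auto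
 then have \<theta>sd: "\<theta>s \<in> sdom" using fam slm.zero_in_mgf_dom by (auto simp: slm.tilted_family_def)
 define K where "K = lm \<theta>s + (\<Sum>p\<in>P. \<bar>lm (\<theta> p)\<bar>)"
 have K0: "K \<ge> 0" using slm.lmgf_nonneg[OF \<theta>sd \<theta>s(1)] by (simp add: K_def sum_nonneg)
 define L1 where "L1 = (\<Sum>p\<in>P. \<bar>lm (\<theta> p)\<bar>)"
 have L10: "L1 \<ge> 0" by (simp add: L1_def sum_nonneg)
 \<comment> \<open>Error budget: \<open>\<epsilon>'\<close> over at most \<open>n * (Rb + 1)\<close>
   steps costs a quarter of \<open>n * \<epsilon>0\<close>, the coordinate error
   \<open>\<epsilon>\<close> another quarter through \<open>L1\<close>, and the epochs near
   endpoints three eighths, through \<open>K\<close>, \<open>\<kappa>\<close> and the extra one per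
   window.\<close>
 define B where "B = 2 * K * real (card P) + 1"
 have B: "B \<ge> 1" using K0 by (simp add: B_def)
 define \<epsilon>' where "\<epsilon>' = \<epsilon>0 / (4 * (Rb + 1))"
 have \<epsilon>': "\<epsilon>' > 0" using \<epsilon>0 Rb by (simp add: \<epsilon>'_def)
 define \<kappa> where "\<kappa> = \<epsilon>0 / (8 * B)"
 have \<kappa>: "\<kappa> > 0" using \<epsilon>0 B by (simp add: \<kappa>_def)
 define \<epsilon> where "\<epsilon> = min (\<epsilon>0 / (8 * (L1 + 1))) (\<kappa> / 2)"
 have \<epsilon>: "\<epsilon> > 0" using \<epsilon>0 L10 \<kappa> by (simp add: \<epsilon>_def)
 have "uniformly_continuous_on {0..T} \<psi>" using cont by (intro compact_uniformly_continuous) auto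
 then obtain \<eta> where \<eta>: "\<eta> > 0" and \<eta>c: "\<And>s t. s \<in> {0..T} \<Longrightarrow> t \<in> {0..T} \<Longrightarrow> dist t s < 2 * \<eta> \<Longrightarrow> dist (\<psi> t) (\<psi> s) < \<kappa>"
 proof -
  assume u: "uniformly_continuous_on {0..T} \<psi>"
   and that: "\<And>\<eta>. 0 < \<eta> \<Longrightarrow> (\<And>s t. s \<in> {0..T} \<Longrightarrow> t \<in> {0..T} \<Longrightarrow> dist t s < 2 * \<eta> \<Longrightarrow> dist (\<psi> t) (\<psi> s) < \<kappa>) \<Longrightarrow> thesis"
  obtain d where d: "d > 0" "\<forall>x\<in>{0..T}. \<forall>x'\<in>{0..T}. dist x' x < d \<longrightarrow> dist (\<psi> x') (\<psi> x) < \<kappa>"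
   using u \<kappa> unfolding uniformly_continuous_on_def by blast
  show thesis by (rule that[of "d / 2"]) (use d in auto)
 qed
 have osc: "\<psi> v - \<psi> (max 0 (v - \<eta>)) \<le> \<kappa>" if "v \<in> {0..T}" for v
 proof -
  define w where "w = max 0 (v - \<eta>)"
  have w: "w \<in> {0..T}" "w \<le> v" "v - w \<le> \<eta>" using that \<eta> by (auto simp: w_def)
  have "dist (\<psi> v) (\<psi> w) < \<kappa>" using w \<eta> w that by (fastforce simp: dist_real_def intro: \<eta>c)
  then show ?thesis unfolding w_def[symmetric] dist_real_def by simp
 qed
 define W where "W = (\<Union>p\<in>P. {fst p - \<eta><..fst p} \<union> {snd p - \<eta><..snd p})"
 define h where "h = (\<lambda>x. (\<Sum>p\<in>P. lm (\<theta> p) * indicator {fst p<..snd p} x) + \<epsilon>' + K * indicator W x)"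
 define \<Theta> where "\<Theta> = (\<lambda>t. \<Sum>p\<in>P. \<theta> p * (min t (snd p) - min t (fst p)))"
 have step: "eventually (\<lambda>n. \<forall>a\<ge>0. (\<integral>\<^sup>+\<omega>. ennreal (exp (real n * (\<Theta> ((a + S 1 \<omega>) / real n) - \<Theta> (a / real n)) - h (a / real n))) \<partial>M) \<le> 1) sequentially"
  by (rule exp_moment_step[OF fam \<theta>s \<theta>sd \<eta> \<epsilon>' K_def W_def h_def \<Theta>_def])
 \<comment> \<open>The endpoints control the counts in the intervals; the points
   \<open>\<eta>\<close> to their left control the number of epochs in \<open>W\<close>.\<close>
 define F where "F = (\<Union>p\<in>P. {fst p, snd p, max 0 (fst p - \<eta>), max 0 (snd p - \<eta>)})"
 let ?A = "\<lambda>n. {\<omega> \<in> space M. (\<forall>t\<in>F. \<bar>Sbar n \<omega> t - \<psi> t\<bar> < \<epsilon>) \<and> Sbar n \<omega> T \<le> Rb}"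
 have F: "finite F" "F \<subseteq> {0..T}"
 proof -
  show "finite F" using finP by (simp add: F_def)
  show "F \<subseteq> {0..T}"
  proof
   fix t assume "t \<in> F"
   then obtain p where p: "p \<in> P" "t \<in> {fst p, snd p, max 0 (fst p - \<eta>), max 0 (snd p - \<eta>)}" by (auto simp: F_def)
   then show "t \<in> {0..T}" using Pp[OF p(1)] \<eta> T_pos by auto
  qed
 qed
 define tv where "tv = slm.tilted_value P \<theta> \<psi>"
 obtain n1 :: nat where n1: "8 * B / \<epsilon>0 \<le> real n1" using real_arch_simple by blast
 have \<Theta>m[measurable]: "\<Theta> \<in> borel_measurable borel" unfolding \<Theta>_def by measurable
 have Wm[measurable]: "W \<in> sets borel" unfolding W_def using finP by auto
 have hm[measurable]: "h \<in> borel_measurable borel" unfolding h_def by measurable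
 show thesis
 proof (rule that[OF F \<epsilon>])
  show "eventually (\<lambda>n. prob (?A n)
    \<le> exp (- (real n * (slm.tilted_value P \<theta> \<psi> - \<epsilon>0)))) sequentially"
   using step eventually_ge_at_top[of 1] eventually_ge_at_top[of n1]
  proof eventually_elim
   fix n :: nat assume st: "\<forall>a\<ge>0. (\<integral>\<^sup>+\<omega>. ennreal (exp (real n * (\<Theta> ((a + S 1 \<omega>) / real n) - \<Theta> (a / real n)) - h (a / real n))) \<partial>M) \<le> 1"
    and n: "1 \<le> n" and nn1: "n1 \<le> n"
   have np: "real n > 0" using n by simp
   have nB: "B / real n \<le> \<epsilon>0 / 8"
   proof -
    have "8 * B / \<epsilon>0 \<le> real n" using n1 nn1 by linarith
    then show ?thesis using \<epsilon>0 np by (simp add: field_simps)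
   qed
   \<comment> \<open>One more than the largest number of renewals allowed by \<open>Rb\<close> up to
     time \<open>n * T\<close>, so that on the event the epoch of index \<open>k\<close> lies beyond
     the horizon.\<close>
   define k where "k = Suc (nat \<lfloor>real n * Rb\<rfloor>)"
   have kle: "real k \<le> real n * (Rb + 1)"
   proof -
    have "real k \<le> real n * Rb + 1" unfolding k_def using Rb by (simp add: of_nat_nat)
    also have "\<dots> \<le> real n * (Rb + 1)" using n by (simp add: distrib_left)
    finally show ?thesis .
   qed
   \<comment> \<open>The step estimate is available at nonnegative positions; the value zero at the
     others extends it to every real \<open>a\<close>.\<close>
   define G where "G a s = (if a < 0 then 0 else ennreal (exp (real n * (\<Theta> ((a + s) / real n) - \<Theta> (a / real n)) - h (a / real n))))" for a s :: real
   let ?J = "\<lambda>\<omega>. \<Prod>j<k. G (V j \<omega>) (S (Suc j) \<omega>)"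
   let ?E = "1 + real n * (\<kappa> + 2 * \<epsilon>)"
   let ?D = "real n * (tv - \<epsilon>0)"
   have Gm: "case_prod G \<in> borel_measurable (borel \<Otimes>\<^sub>M borel)" unfolding G_def split_beta' by measurable
   have Gle: "(\<integral>\<^sup>+\<omega>. G a (S 1 \<omega>) \<partial>M) \<le> 1" for a
    using st unfolding G_def by (cases "a < 0") auto
   define U where "U = ?A n"
   have [measurable]: "(\<lambda>\<omega>. Sbar n \<omega> t) \<in> borel_measurable M" if "t \<in> F" for t
    using F that by (intro Sbar_measurable[OF n]) auto
   have [measurable]: "(\<lambda>\<omega>. Sbar n \<omega> T) \<in> borel_measurable M" using T_pos by (intro Sbar_measurable[OF n]) auto
   have Um: "U \<in> sets M" unfolding U_def using F by measurable
   have "ennreal (exp ?D) * emeasure M U = (\<integral>\<^sup>+\<omega>. ennreal (exp ?D) * indicator U \<omega> \<partial>M)"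
    using Um by (simp add: nn_integral_cmult_indicator)
   also have "\<dots> \<le> (\<integral>\<^sup>+\<omega>. (?J \<omega>) \<partial>M)"
   proof (rule nn_integral_mono_AE)
    show "AE \<omega> in M. ennreal (exp ?D) * indicator U \<omega> \<le> ?J \<omega>"
     using AE_good
    proof eventually_elim
     fix \<omega> assume g: "good \<omega>"
     let ?K = "\<Sum>j<k. \<Sum>p\<in>P. lm (\<theta> p) * indicator {fst p<..snd p} (V j \<omega> / real n)"
     let ?I = "\<Sum>j<k. h (V j \<omega> / real n)"
     let ?F = "\<lambda>j. \<Theta> (V (Suc j) \<omega> / real n) - \<Theta> (V j \<omega> / real n)"
     let ?C = "\<lambda>p. {j\<in>{..<k}. V j \<omega> / real n \<in> {snd p - \<eta><..snd p}}"
     let ?B = "\<lambda>p. {j\<in>{..<k}. V j \<omega> / real n \<in> {fst p - \<eta><..fst p}}"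
     show "ennreal (exp ?D) * indicator U \<omega> \<le> ?J \<omega>"
     proof (cases "\<omega> \<in> U")
      case True
      then have UF: "\<And>t. t \<in> F \<Longrightarrow> \<bar>Sbar n \<omega> t - \<psi> t\<bar> < \<epsilon>" and UT: "Sbar n \<omega> T \<le> Rb" by (auto simp: U_def)
      have RT: "R \<omega> (real n * T) < k"
      proof -
       have "R \<omega> (real n * T) \<le> nat \<lfloor>real n * Rb\<rfloor>" using UT T_pos np by (auto simp: Sbar_eq pos_divide_le_eq mult.commute le_nat_iff le_floor_iff)
       then show ?thesis by (simp add: k_def)
      qed
      have Rk: "R \<omega> (real n * t) < k" if "t \<in> {0..T}" for t
       using renewal_count_mono[OF g, of "real n * t" "real n * T"] that RT np by auto
      have Vk: "T < V k \<omega> / real n"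
       using RT renewal_count_less_iff[OF g, of "real n * T" k] T_pos np by (simp add: pos_less_divide_eq mult.commute)
      have RF: "\<bar>real (R \<omega> (real n * t)) - real n * \<psi> t\<bar> \<le> real n * \<epsilon>" if t: "t \<in> F" for t
       by (use t F UF[OF t] np abs_mult abs_of_nat in \<open>auto simp: Sbar_eq right_diff_distrib field_simps intro!: mult_left_mono\<close>)
      have prodG: "(?J \<omega>) = ennreal (exp (\<Sum>j<k. real n * ?F j - h (V j \<omega> / real n)))"
       using V_nonneg[OF g] by (simp add: G_def not_less[symmetric] V_Suc prod_ennreal exp_sum)
      have tele: "(\<Sum>j<k. real n * (?F j)) = real n * ?H"
      proof -
       have "(\<Sum>j<k. real n * (?F j)) = real n * (\<Theta> (V k \<omega> / real n) - \<Theta> (V 0 \<omega> / real n))"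
        unfolding sum_distrib_left[symmetric] by (subst sum_lessThan_telescope) simp
       also have "\<Theta> (V k \<omega> / real n) = ?H" unfolding \<Theta>_def
        by (use sum.cong[OF refl] Pp Vk in \<open>smt (verit) min.absorb2\<close>)
       also have "\<Theta> (V 0 \<omega> / real n) = 0" unfolding \<Theta>_def
       proof (rule sum.neutral, rule ballI)
        fix p assume "p \<in> P"
        then have "0 \<le> fst p" "0 \<le> snd p" using Pp[of p] by auto
        then show "\<theta> p * (min (V 0 \<omega> / real n) (snd p) - min (V 0 \<omega> / real n) (fst p)) = 0" by simp
       qed
       finally show ?thesis by simp
      qed
      define N where "N p = real (card {j\<in>{..<k}. fst p < V j \<omega> / real n \<and> V j \<omega> / real n \<le> snd p})" for p
      define NW where "NW = real (card {j\<in>{..<k}. V j \<omega> / real n \<in> W})"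
      have sumind: "(\<Sum>j<k. indicator A (f j) :: real) = real (card {j\<in>{..<k}. f j \<in> A})" for A and f :: "nat \<Rightarrow> real"
       by (simp add: indicator_def sum.If_cases Int_def)
      have sumh: "?I = (\<Sum>p\<in>P. lm (\<theta> p) * N p) + real k * \<epsilon>' + K * NW"
      proof -
       have "?I = ?K + real k * \<epsilon>' + K * (\<Sum>j<k. indicator W (V j \<omega> / real n))"
        unfolding h_def by (simp only: sum.distrib sum_distrib_left[symmetric] sum_constant card_lessThan)
       also have "?K = (\<Sum>p\<in>P. lm (\<theta> p) * (\<Sum>j<k. indicator {fst p<..snd p} (V j \<omega> / real n)))"
        by (subst sum.swap) (simp add: sum_distrib_left)
       finally show ?thesis unfolding sumind N_def NW_def by (simp only: greaterThanAtMost_iff)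
      qed
      have pF: "fst p \<in> F" "snd p \<in> F" "max 0 (fst p - \<eta>) \<in> F" "max 0 (snd p - \<eta>) \<in> F" if "p \<in> P" for p
       using that by (auto simp: F_def)
      have Nb: "lm (\<theta> p) * N p \<le> real n * (lm (\<theta> p) * ?G p + \<bar>lm (\<theta> p)\<bar> * (2 * \<epsilon>))" if p: "p \<in> P" for p
      proof -
       have "N p = real (R \<omega> (real n * snd p) - R \<omega> (real n * fst p))" unfolding N_def
        using Pp[OF p] Rk[of "snd p"] by (subst renewals_between[OF g n]) auto
       also have "\<dots> = real (R \<omega> (real n * snd p)) - real (R \<omega> (real n * fst p))"
        using Pp[OF p] np by (intro of_nat_diff renewal_count_mono[OF g]) auto
       finally have Np: "N p = real (R \<omega> (real n * snd p)) - real (R \<omega> (real n * fst p))" .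
       have "\<bar>N p - real n * (?G p)\<bar> \<le> real n * (2 * \<epsilon>)"
        unfolding Np right_diff_distrib using RF[OF pF(1)[OF p]] RF[OF pF(2)[OF p]] by linarith
       then have "\<bar>lm (\<theta> p)\<bar> * \<bar>N p - real n * (?G p)\<bar> \<le> \<bar>lm (\<theta> p)\<bar> * (real n * (2 * \<epsilon>))"
        by (intro mult_left_mono) auto
       moreover have "lm (\<theta> p) * y \<le> \<bar>lm (\<theta> p)\<bar> * \<bar>y\<bar>" for y by (metis abs_ge_self abs_mult)
       ultimately have "lm (\<theta> p) * (N p - real n * (?G p)) \<le> \<bar>lm (\<theta> p)\<bar> * (real n * (2 * \<epsilon>))"
        by (rule order_trans[rotated])
       then show ?thesis by (simp add: algebra_simps)
      qed
      have sumN: "(\<Sum>p\<in>P. lm (\<theta> p) * N p) \<le> real n * ((\<Sum>p\<in>P. lm (\<theta> p) * (?G p)) + L1 * (2 * \<epsilon>))"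
       unfolding L1_def sum_distrib_right sum.distrib[symmetric] sum_distrib_left by (rule sum_mono) (use Nb in \<open>simp add: sum_distrib_left\<close>)
      have win: "real (card {j\<in>{..<k}. V j \<omega> / real n \<in> {v - \<eta><..v}}) \<le> 1 + real n * (\<kappa> + 2 * \<epsilon>)"
       if v: "v \<in> F" "max 0 (v - \<eta>) \<in> F" for v
      proof -
       have vT: "v \<in> {0..T}" using v F by auto
       have "real (card {j\<in>{..<k}. V j \<omega> / real n \<in> {v - \<eta><..v}}) \<le> 1 + (real (R \<omega> (real n * v)) - real (R \<omega> (real n * max 0 (v - \<eta>))))"
        using vT by (intro renewals_in_window[OF g n _ \<eta> Rk]) auto
       also have "\<dots> \<le> 1 + (real n * (\<psi> v - \<psi> (max 0 (v - \<eta>))) + real n * (2 * \<epsilon>))"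
        using RF[OF v(1)] RF[OF v(2)] unfolding right_diff_distrib by linarith
       also have "\<dots> \<le> 1 + (real n * \<kappa> + real n * (2 * \<epsilon>))"
        using osc[OF vT] np by (intro add_mono mult_left_mono) auto
       finally show ?thesis by (simp add: distrib_left)
      qed
      have NWb: "NW \<le> real (card P) * (2 * ?E)"
      proof -
       have "card {j\<in>{..<k}. V j \<omega> / real n \<in> W} \<le> card (\<Union>p\<in>P. (?B p) \<union> (?C p))"
        using finP by (intro card_mono) (auto simp: W_def)
       also have "\<dots> \<le> (\<Sum>p\<in>P. card ((?B p) \<union> (?C p)))"
        by (rule card_UN_le[OF finP])
       also have "\<dots> \<le> (\<Sum>p\<in>P. card (?B p) + card (?C p))"
        by (intro sum_mono card_Un_le)
       finally have "NW \<le> (\<Sum>p\<in>P. real (card (?B p)) + real (card (?C p)))"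
        unfolding NW_def by (simp only: of_nat_le_iff of_nat_sum[symmetric] of_nat_add[symmetric])
       also have "\<dots> \<le> (\<Sum>p\<in>P. 2 * ?E)"
        by ((rule sum_mono), (use add_mono[OF win[OF pF(1)[OF ] pF(3)[OF ]] win[OF pF(2)[OF ] pF(4)[OF ]]] in \<open>simp only: mult_2\<close>))
       finally show ?thesis by simp
      qed
      have e1: "real k * \<epsilon>' \<le> real n * (\<epsilon>0 / 4)"
      proof -
       have "real k * \<epsilon>' \<le> real n * ((Rb + 1) * \<epsilon>')" using kle \<epsilon>' by (auto intro!: mult_right_mono)
       also have "(Rb + 1) * \<epsilon>' = \<epsilon>0 / 4" using Rb by (simp add: \<epsilon>'_def field_simps)
       finally show ?thesis .
      qed
      have e2: "L1 * (2 * \<epsilon>) \<le> \<epsilon>0 / 4"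
      proof -
       have "L1 * (2 * \<epsilon>) \<le> (L1 + 1) * (2 * (\<epsilon>0 / (8 * (L1 + 1))))" using L10 \<epsilon> by (intro mult_mono) (auto simp: \<epsilon>_def)
       also have "\<dots> = \<epsilon>0 / 4" using L10 by (simp add: field_simps)
       finally show ?thesis .
      qed
      have e3: "K * NW \<le> real n * (3 * \<epsilon>0 / 8)"
      proof -
       have nn: "0 \<le> 1 + real n * (\<kappa> + 2 * \<epsilon>)" using \<kappa> \<epsilon> np by simp
       have "K * NW \<le> K * (real (card P) * (2 * ?E))" using NWb K0 by (intro mult_left_mono)
       also have "\<dots> = (2 * K * real (card P)) * ?E" by simp
       also have "\<dots> \<le> B * ?E" unfolding B_def using nn by (intro mult_right_mono) auto
       also have "\<dots> \<le> real n * (B / real n) + real n * (2 * (B * \<kappa>))" using B np np by (auto simp: \<epsilon>_def algebra_simps intro!: mult_left_mono add_left_mono)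
       also have "B * \<kappa> = \<epsilon>0 / 8" using B by (simp add: \<kappa>_def)
       also have "real n * (B / real n) \<le> real n * (\<epsilon>0 / 8)" using nB np by (intro mult_left_mono) auto
       finally show ?thesis by (simp add: algebra_simps)
      qed
      have "real n * (tv - \<epsilon>0) \<le> real n * ?H - ?I"
      proof -
       define X where "X = ?H"
       define Y where "Y = (\<Sum>p\<in>P. lm (\<theta> p) * (?G p))"
       have "real n * (L1 * (2 * \<epsilon>)) \<le> real n * (\<epsilon>0 / 4)" using e2 np by (intro mult_left_mono) auto
       then have "?I \<le> real n * Y + real n * (\<epsilon>0 / 4) + real n * (\<epsilon>0 / 4) + real n * (3 * \<epsilon>0 / 8)"
        unfolding sumh using sumN e1 e3 unfolding distrib_left Y_def[symmetric] by linarith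
       moreover have "real n * (\<epsilon>0 / 4) + real n * (\<epsilon>0 / 4) + real n * (3 * \<epsilon>0 / 8) \<le> real n * \<epsilon>0"
        using \<epsilon>0 np by (simp add: field_simps)
       moreover have tvXY: "tv = X - Y"
        unfolding tv_def slm.tilted_value_def X_def Y_def by (simp only: sum_subtractf)
       ultimately show ?thesis unfolding tvXY X_def[symmetric] unfolding right_diff_distrib by linarith
      qed
      then show ?thesis unfolding prodG sum_subtractf tele using True by (simp add: ennreal_leI)
     qed simp
    qed
   qed
   also have "\<dots> \<le> 1" by (rule nn_integral_tilted_steps[OF Gm Gle])
   finally have "ennreal (exp ?D * prob U) \<le> ennreal 1" by (simp add: emeasure_eq_measure ennreal_mult)
   then have "prob U \<le> 1 / exp ?D" by (simp add: pos_le_divide_eq mult.commute)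
   also have "\<dots> = exp (- ?D)" by (simp add: exp_minus inverse_eq_divide)
   finally show "prob (?A n)
    \<le> exp (- (real n * (slm.tilted_value P \<theta> \<psi> - \<epsilon>0)))" unfolding U_def tv_def .
  qed
 qed
qed

end

section \<open>Lower bound for the scaled renewal process\<close>

context renewal
begin

lemma block_sums_prob:
 assumes J: "finite J" "J \<noteq> {}" and I: "disjoint_family_on I J" "\<And>j. j \<in> J \<Longrightarrow> finite (I j) \<and> I j \<subseteq> {1..}"
  and B: "\<And>j. j \<in> J \<Longrightarrow> B j \<in> sets borel"
 shows "prob {\<omega> \<in> space M. \<forall>j\<in>J. (\<Sum>i\<in>I j. S i \<omega>) \<in> B j} = (\<Prod>j\<in>J. prob {\<omega> \<in> space M. (\<Sum>i\<in>I j. S i \<omega>) \<in> B j})"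
proof -
 have "indep_vars (\<lambda>j. PiM (I j) (\<lambda>_. borel)) (\<lambda>j \<omega>. restrict (\<lambda>i. S i \<omega>) (I j)) J"
  by (rule indep_vars_restrict[OF S_indep]) (use I in auto)
 then have "indep_vars (\<lambda>_. borel) (\<lambda>j \<omega>. (\<lambda>w. \<Sum>i\<in>I j. w i) (restrict (\<lambda>i. S i \<omega>) (I j))) J"
  by (rule indep_vars_compose2) (intro borel_measurable_sum measurable_component_singleton)
 then have ind: "indep_vars (\<lambda>_. borel) (\<lambda>j \<omega>. \<Sum>i\<in>I j. S i \<omega>) J" by simp
 have "{\<omega> \<in> space M. \<forall>j\<in>J. (\<Sum>i\<in>I j. S i \<omega>) \<in> B j} = (\<Inter>j\<in>J. (\<lambda>\<omega>. \<Sum>i\<in>I j. S i \<omega>) -` B j \<inter> space M)"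
  using J(2) by auto
 also have "prob \<dots> = (\<Prod>j\<in>J. prob ((\<lambda>\<omega>. \<Sum>i\<in>I j. S i \<omega>) -` B j \<inter> space M))"
  by (rule indep_varsD_finite[OF ind J(2) J(1)]) (use B in auto)
 also have "\<dots> = (\<Prod>j\<in>J. prob {\<omega> \<in> space M. (\<Sum>i\<in>I j. S i \<omega>) \<in> B j})"
  by (intro prod.cong refl arg_cong[where f=prob]) auto
 finally show ?thesis .
qed

text \<open>Slowness at a fixed price: a block takes time at least \<open>c1\<close> per service
  with probability at least a fixed factor \<open>p\<close> per service. This later stops the count
  from overshooting at the end of the horizon.\<close>

lemma positive_level: obtains c1 p where "c1 > 0" "0 < p" "p \<le> 1"
  "\<forall>I. finite I \<and> I \<subseteq> {1..} \<longrightarrow> p ^ card I \<le> prob {w \<in> space M. (\<Sum>i\<in>I. S i w) \<ge> c1 * real (card I)}"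
proof -
 let ?B = "\<lambda>I c1. {w \<in> space M. (\<Sum>i\<in>I. S i w) \<ge> c1 * real (card I)}"
 let ?A = "\<lambda>n. {w \<in> space M. S 1 w \<ge> 1 / real (Suc n)}"
 have "(\<lambda>n. prob (?A n)) \<longlonglongrightarrow> prob (\<Union>n. (?A n))"
 proof (rule finite_Lim_measure_incseq)
  show "range (\<lambda>n. (?A n)) \<subseteq> events" using S_measurable[of 1] by auto
  show "incseq (\<lambda>n. (?A n))"
  proof (rule incseq_SucI, rule subsetI)
   fix n w assume "w \<in> (?A n)"
   moreover have "1 / real (Suc (Suc n)) \<le> 1 / real (Suc n)" by (intro divide_left_mono) auto
   ultimately show "w \<in> {w \<in> space M. S 1 w \<ge> 1 / real (Suc (Suc n))}" by auto
  qed
 qed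
 also have "prob (\<Union>n. (?A n)) = 1"
 proof (rule prob_eq_1[THEN iffD2])
  show "(\<Union>n. (?A n)) \<in> events" using S_measurable[of 1] by auto
  show "AE w in M. w \<in> (\<Union>n. (?A n))"
   using S_pos[OF order_refl] AE_space
  proof eventually_elim
   fix w assume s: "0 < S 1 w" "w \<in> space M"
   obtain n where "1 / real (Suc n) < S 1 w" using nat_approx_posE[OF s(1)] by auto
   then show "w \<in> (\<Union>n. (?A n))" using s(2) by (auto intro!: exI[of _ n])
  qed
 qed
 finally have "eventually (\<lambda>n. 1/2 < prob (?A n)) sequentially"
  by (rule order_tendstoD) simp
 then obtain n where n: "1/2 < prob (?A n)" by (auto simp: eventually_sequentially)
 define c1 where "c1 = 1 / real (Suc n)"
 define p where "p = prob {w \<in> space M. S 1 w \<ge> c1}"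
 have c1: "c1 > 0" by (simp add: c1_def)
 have p: "0 < p" using n by (simp add: p_def c1_def)
 have "p ^ card I \<le> prob (?B I c1)" if I: "finite I" "I \<subseteq> {1..}" for I
 proof (cases "I = {}")
  case True
  then show ?thesis by (simp add: prob_space)
 next
  case False
  have single: "prob {w \<in> space M. (\<Sum>i\<in>{j}. S i w) \<in> {c1..}} = p" if "j \<in> I" for j
  proof -
   have j: "j \<ge> 1" using that I by auto
   have "prob {w \<in> space M. (\<Sum>i\<in>{j}. S i w) \<in> {c1..}} = measure (distr M borel (S j)) {c1..}"
    using j by (subst measure_distr) (auto intro!: arg_cong[where f=prob])
   also have "\<dots> = p" unfolding S_law[OF j] p_def
    by (subst measure_distr) (auto intro!: arg_cong[where f=prob])
   finally show ?thesis .
  qed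
  have "p ^ card I = (\<Prod>j\<in>I. prob {w \<in> space M. (\<Sum>i\<in>{j}. S i w) \<in> {c1..}})"
   using single by simp
  also have "\<dots> = prob {w \<in> space M. \<forall>j\<in>I. (\<Sum>i\<in>{j}. S i w) \<in> {c1..}}"
   by (rule block_sums_prob[symmetric]) (use I False in \<open>auto simp: disjoint_family_on_def\<close>)
  also have "\<dots> \<le> prob (?B I c1)"
  proof (rule finite_measure_mono)
   have [measurable]: "(\<lambda>w. \<Sum>i\<in>I. S i w) \<in> borel_measurable M" using I by (intro borel_measurable_sum S_measurable) auto
   show "(?B I c1) \<in> events" by measurable
   show "{w \<in> space M. \<forall>j\<in>I. (\<Sum>i\<in>{j}. S i w) \<in> {c1..}} \<subseteq> (?B I c1)"
   proof clarsimp
    fix w assume "\<forall>j\<in>I. c1 \<le> S j w"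
    then have "(\<Sum>i\<in>I. c1) \<le> (\<Sum>i\<in>I. S i w)" by (intro sum_mono) auto
    then show "c1 * real (card I) \<le> (\<Sum>i\<in>I. S i w)" by (simp add: mult.commute)
   qed
  qed
  finally show ?thesis .
 qed
 then show thesis using c1 p by (intro that[of c1 p]) (auto simp: p_def)
qed

lemma log_exp_moment_law: "log_exp_moment (distr M borel (S 1)) (\<lambda>y. \<theta> * y) = \<Lambda>S \<theta>"
 unfolding \<Lambda>S_eq log_exp_moment_def mgf_def by (subst nn_integral_distr) auto

text \<open>Cramer's bound for one coordinate. The hypothesis ranges over \<open>sdom\<close>
  because elsewhere \<open>\<Lambda>S\<close> is infinite and the corresponding term is minus
  infinity.\<close>

lemma block_lower:
 assumes x: "\<And>\<theta>. \<theta> \<in> sdom \<Longrightarrow> \<theta> * x - lm \<theta> \<le> c" and e: "\<epsilon> > 0" and \<eta>: "\<eta> > 0"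
 obtains n0 where "\<forall>I. finite I \<and> I \<subseteq> {1..} \<and> card I \<ge> n0 \<longrightarrow>
  exp (- (real (card I) * (c + \<eta>))) \<le> prob {w \<in> space M. \<bar>(\<Sum>i\<in>I. S i w) / real (card I) - x\<bar> < \<epsilon>}"
proof -
 have cc: "ereal (\<Sum>l\<in>{0::nat}. a l * x) - log_exp_moment (distr M borel (S 1)) (\<lambda>y. \<Sum>l\<in>{0::nat}. a l * y) \<le> ereal c" for a
 proof (cases "a 0 \<in> sdom")
  case True
  then show ?thesis using x[OF True] log_exp_moment_law[of "a 0"] slm.\<Lambda>_eq[OF True] by simp
 next
  case False
  then have "\<Lambda>S (a 0) = \<infinity>" by (simp add: slm.mgf_dom_def)
  then show ?thesis using log_exp_moment_law[of "a 0"] by simp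
 qed
 obtain n0 where n0: "\<And>I. finite I \<Longrightarrow> I \<subseteq> {1..} \<Longrightarrow> n0 \<le> card I \<Longrightarrow>
   exp (- (real (card I) * (c + \<eta>))) \<le> prob {w \<in> space M. \<forall>l\<in>{0::nat}. \<bar>(\<Sum>k\<in>I. S k w) / real (card I) - x\<bar> < \<epsilon>}"
 proof (rule cramer_lower_bound[where J="{1..}" and N=borel and Y=S and L="{0}" and \<mu>="distr M borel (S 1)"
   and f="\<lambda>_ y. y" and x="\<lambda>_. x" and c=c and \<epsilon>=\<epsilon> and \<eta>=\<eta>])
  show "distr M borel (S k) = distr M borel (S 1)" if "k \<in> {1..}" for k
   by (rule S_law) (use that in simp)
  show "ereal (\<Sum>l\<in>{0::nat}. a l * x) - log_exp_moment (distr M borel (S 1)) (\<lambda>y. \<Sum>l\<in>{0::nat}. a l * y) \<le> ereal c" for a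
   by (rule cc)
 qed (use S_indep e \<eta> in auto)
 show thesis by (rule that[of n0]) (use n0 in auto)
qed

end

context renewal_service
begin

text \<open>Durations are prescribed instead of counts: consecutive blocks of about
  \<open>n * zz j\<close> service times, each of total duration about \<open>n * \<delta>\<close>,
  are independent and make the epochs pass the grid times at the right indices. A further block must
  be slow enough that the count at \<open>T\<close> does not overshoot.\<close>

lemma Sbar_local_lower:
 assumes mono: "mono_on {0..T} \<psi>" and cont: "continuous_on {0..T} \<psi>" and z: "\<psi> 0 = 0"
  and bd: "\<And>P \<theta>. slm.tilted_family T P \<theta> \<Longrightarrow> slm.tilted_value P \<theta> \<psi> \<le> lv"
  and F: "finite F" "F \<subseteq> {0..T}" and \<epsilon>: "\<epsilon> > 0" and \<eta>: "\<eta> > 0"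
 shows "eventually (\<lambda>n. exp (- (real n * (lv + \<eta>))) \<le> prob {w \<in> space M. \<forall>t\<in>F. \<bar>Sbar n w t - \<psi> t\<bar> < \<epsilon>}) sequentially"
proof -
 have "uniformly_continuous_on {0..T} \<psi>" using cont by (intro compact_uniformly_continuous) auto
 then obtain d where d: "d > 0" and dc': "\<forall>s\<in>{0..T}. \<forall>t\<in>{0..T}. dist t s < d \<longrightarrow> dist (\<psi> t) (\<psi> s) < \<epsilon> / 4"
  unfolding uniformly_continuous_on_def using \<epsilon> by (metis divide_pos_pos zero_less_numeral)
 have dc: "dist (\<psi> t) (\<psi> s) < \<epsilon> / 4" if "s \<in> {0..T}" "t \<in> {0..T}" "dist t s < d" for s t using dc' that by blast
 \<comment> \<open>The sandwich below compares a time with grid times at most two cells away; a mesh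
   below \<open>d / 3\<close> leaves room for this.\<close>
 obtain m0 :: nat where m0: "3 * T / d < real m0" using reals_Archimedean2 by blast
 define m where "m = Suc m0"
 have m: "real m > 0" "m \<ge> 1" by (simp_all add: m_def)
 define \<delta> where "\<delta> = T / real m"
 have \<delta>: "\<delta> > 0" using T_pos m by (simp add: \<delta>_def)
 have \<delta>d: "3 * \<delta> < d" by (use m0 d m in \<open>auto simp: m_def \<delta>_def field_simps\<close>)
 have m\<delta>: "real m * \<delta> = T" using m by (simp add: \<delta>_def)
 define t where "t j = real j * \<delta>" for j :: nat
 have tm: "t m = T" by (simp add: t_def m\<delta>)
 have tT: "t j \<in> {0..T}" if "j \<le> m" for j
 proof -
  have "real j * \<delta> \<le> real m * \<delta>" using that \<delta> by (intro mult_right_mono) auto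
  then show ?thesis using \<delta> by (simp add: t_def m\<delta>)
 qed
 have tS: "t (Suc j) = t j + \<delta>" for j by (simp add: t_def distrib_right)
 have t0: "t 0 = 0" by (simp add: t_def)
 define y where "y j = \<psi> (t (Suc j)) - \<psi> (t j)" for j
 have y0: "0 \<le> y j" if "j < m" for j
  using mono_onD[OF mono, of "t j" "t (Suc j)"] tT[of j] tT[of "Suc j"] that \<delta> by (simp add: y_def tS)
 have sumy: "(\<Sum>j<k. y j) = \<psi> (t k)" for k unfolding y_def by (subst sum_lessThan_telescope) (simp add: t0 z)
 text \<open>\<open>b j\<close> is the cost of the increment over the \<open>j\<close>-th cell.\<close>
 define b where "b j = (SUP \<theta>\<in>sdom. \<theta> * \<delta> - lm \<theta> * y j)" for j
 have fam1: "slm.tilted_family T ((\<lambda>j. (t j, t (Suc j))) ` J) \<theta>"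
  "slm.tilted_value ((\<lambda>j. (t j, t (Suc j))) ` J) \<theta> \<psi> = (\<Sum>j\<in>J. \<theta> (t j, t (Suc j)) * \<delta> - lm (\<theta> (t j, t (Suc j))) * y j)"
  if J: "J \<subseteq> {..<m}" and th: "\<And>j. j \<in> J \<Longrightarrow> \<theta> (t j, t (Suc j)) \<in> sdom" for J \<theta>
 proof -
  let ?B = "\<lambda>j. (t j, t (Suc j))"
  have tinj: "t i < t j" if "i < j" for i j using that \<delta> by (simp add: t_def)
  have inj: "inj_on ?B J"
   by (rule inj_onI) (metis Pair_inject less_irrefl linorder_cases tinj)
  have finJ: "finite J" using J finite_subset by blast
  show "slm.tilted_family T (?B ` J) \<theta>" unfolding slm.tilted_family_def
  proof (intro conjI)
   show "finite (?B ` J)" using finJ by simp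
   show "\<forall>(u, v)\<in>?B ` J. 0 \<le> u \<and> u < v \<and> v \<le> T" by (use J tT tinj in \<open>auto\<close>)
   show "disjoint_family_on (\<lambda>(u, v). {u<..<v}) (?B ` J)" unfolding disjoint_family_on_def
   proof (intro ballI impI)
    fix q r assume "q \<in> ?B ` J" "r \<in> ?B ` J" "q \<noteq> r"
    then obtain i j where ij: "q = (t i, t (Suc i))" "r = (t j, t (Suc j))" "i \<noteq> j" by auto
    have tle: "t i \<le> t j" if "i \<le> j" for i j using that \<delta> by (simp add: t_def)
    have "t (Suc i) \<le> t j \<or> t (Suc j) \<le> t i"
     using ij(3) tle[of "Suc i" j] tle[of "Suc j" i] by linarith
    then show "(case q of (u, v) \<Rightarrow> {u<..<v}) \<inter> (case r of (u, v) \<Rightarrow> {u<..<v}) = {}" unfolding ij by auto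
   qed
   show "\<theta> ` ?B ` J \<subseteq> sdom" using th by auto
  qed
  show "slm.tilted_value (?B ` J) \<theta> \<psi> = (\<Sum>j\<in>J. \<theta> (t j, t (Suc j)) * \<delta> - lm (\<theta> (t j, t (Suc j))) * y j)"
   unfolding slm.tilted_value_def by (subst sum.reindex[OF inj]) (simp add: y_def tS)
 qed
 have bdd: "bdd_above ((\<lambda>\<theta>. \<theta> * \<delta> - lm \<theta> * y j) ` sdom)" if "j < m" for j
 proof (rule bdd_aboveI2[where M=lv])
  fix \<theta> assume "\<theta> \<in> sdom"
  then show "\<theta> * \<delta> - lm \<theta> * y j \<le> lv" using fam1[of "{j}" "\<lambda>_. \<theta>"] bd that by fastforce
 qed
 have bge: "\<theta> * \<delta> - lm \<theta> * y j \<le> b j" if "j < m" "\<theta> \<in> sdom" for j \<theta>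
  unfolding b_def using that bdd by (intro cSUP_upper)
 have b0: "0 \<le> b j" if "j < m" for j using bge[OF that slm.zero_in_mgf_dom] by simp
 have sumb: "(\<Sum>j<m. b j) \<le> lv"
 proof (rule field_le_epsilon)
  fix e :: real assume e: "0 < e"
  have "\<exists>\<theta>\<in>sdom. b j - e / real m < \<theta> * \<delta> - lm \<theta> * y j" if "j < m" for j
  proof -
   have "b j - e / real m < (SUP \<theta>\<in>sdom. \<theta> * \<delta> - lm \<theta> * y j)" using e m by (simp add: b_def)
   then show ?thesis using less_cSUP_iff[OF _ bdd[OF that]] slm.zero_in_mgf_dom by blast
  qed
  then have "\<forall>j. \<exists>\<theta>. j < m \<longrightarrow> \<theta> \<in> sdom \<and> b j - e / real m < \<theta> * \<delta> - lm \<theta> * y j" by blast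
  then obtain \<Theta> where \<Theta>': "\<forall>j. j < m \<longrightarrow> \<Theta> j \<in> sdom \<and> b j - e / real m < \<Theta> j * \<delta> - lm (\<Theta> j) * y j"
   by (rule choice[THEN exE])
  then have \<Theta>: "\<And>j. j < m \<Longrightarrow> \<Theta> j \<in> sdom" "\<And>j. j < m \<Longrightarrow> b j - e / real m < \<Theta> j * \<delta> - lm (\<Theta> j) * y j" by auto
  \<comment> \<open>Recovers the cell number from the left endpoint
    \<open>t j = real j * \<delta>\<close> by rounding.\<close>
  define \<theta> where "\<theta> q = \<Theta> (nat \<lfloor>fst q / \<delta> + 1/2\<rfloor>)" for q :: "real \<times> real"
  have th: "\<theta> (t j, s) = \<Theta> j" for j s by (use \<delta> in \<open>auto simp: t_def floor_eq_iff \<theta>_def\<close>)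
  have "(\<Sum>j<m. b j) - e = (\<Sum>j<m. b j - e / real m)" using m by (simp add: sum_subtractf)
  also have "\<dots> \<le> (\<Sum>j<m. \<Theta> j * \<delta> - lm (\<Theta> j) * y j)" using \<Theta>(2) by (intro sum_mono) (auto intro: less_imp_le)
  also have "\<dots> = slm.tilted_value ((\<lambda>j. (t j, t (Suc j))) ` {..<m}) \<theta> \<psi>"
   by (subst fam1(2)) (auto simp: th \<Theta>(1))
  also have "\<dots> \<le> lv" by (intro bd fam1(1)) (auto simp: th \<Theta>(1))
  finally show "(\<Sum>j<m. b j) \<le> lv + e" by simp
 qed
 obtain c0 k0 where ck: "c0 > 0" "k0 \<ge> 0" "\<forall>\<theta>\<le>0. \<theta> * c0 - k0 \<le> lm \<theta>" by (rule slm.lmgf_lower)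
 obtain c1 p where c1: "c1 > 0" and p: "0 < p" "p \<le> 1"
  and plow: "\<forall>I. finite I \<and> I \<subseteq> {1..} \<longrightarrow> p ^ card I \<le> prob {w \<in> space M. (\<Sum>i\<in>I. S i w) \<ge> c1 * real (card I)}"
  by (rule positive_level)
 define lp where "lp = - ln p"
 have lp: "lp \<ge> 0" using p by (simp add: lp_def)
 text \<open>Cells without increment receive a small positive amount \<open>\<kappa>\<close>; the other cells must not be
  perturbed, because the cost may be infinite to the right of the given slope.\<close>
 define \<kappa> where "\<kappa> = min (min (\<delta> / c0) (\<epsilon> / (8 * (real m + 1)))) (\<eta> / (8 * (real m * k0 + lp + 1)))"
 have den: "real m * k0 + lp + 1 > 0" using ck lp by (simp add: add_nonneg_pos)
 have \<kappa>: "\<kappa> > 0" using \<delta> ck \<epsilon> \<eta> den by (simp add: \<kappa>_def)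
 have \<kappa>c: "\<kappa> * c0 \<le> \<delta>" by (use ck in \<open>smt (verit) \<kappa>_def pos_le_divide_eq\<close>)
 have \<kappa>\<epsilon>: "(real m + 1) * \<kappa> \<le> \<epsilon> / 8"
 proof -
  have "\<kappa> \<le> \<epsilon> / (8 * (real m + 1))" by (simp add: \<kappa>_def)
  then have "(real m + 1) * \<kappa> \<le> (real m + 1) * (\<epsilon> / (8 * (real m + 1)))" by (intro mult_left_mono) auto
  also have "\<dots> = \<epsilon> / 8" by (simp add: field_simps)
  finally show ?thesis .
 qed
 have \<kappa>\<eta>: "real m * (\<kappa> * k0) + \<kappa> * lp \<le> \<eta> / 8"
 proof -
  have "\<kappa> \<le> \<eta> / (8 * (real m * k0 + lp + 1))" by (simp add: \<kappa>_def)
  then have "\<kappa> * (real m * k0 + lp + 1) \<le> \<eta> / 8" using den by (simp add: pos_le_divide_eq field_simps)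
  then show ?thesis using \<kappa> by (simp add: algebra_simps)
 qed
 define zz where "zz j = (if y j = 0 then \<kappa> else y j)" for j
 have zpos: "zz j > 0" if "j < m" for j using y0[OF that] \<kappa> by (auto simp: zz_def)
 have zy: "y j \<le> zz j" "zz j \<le> y j + \<kappa>" for j using \<kappa> by (auto simp: zz_def)
 \<comment> \<open>Raising a zero increment to \<open>\<kappa>\<close> costs at most
   \<open>\<kappa> * k0\<close>: for negative tilts by the linear lower bound on \<open>lm\<close>
   together with \<open>\<kappa> * c0 \<le> \<delta>\<close>, while nonnegative tilts only
   lose.\<close>
 define b' where "b' j = b j + \<kappa> * k0" for j
 have b'0: "0 \<le> b' j" if "j < m" for j using b0[OF that] \<kappa> ck by (simp add: b'_def)
 have b'ge: "\<theta> * \<delta> - lm \<theta> * zz j \<le> b' j" if j: "j < m" and th: "\<theta> \<in> sdom" for j \<theta>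
 proof (cases "y j = 0")
  case False
  have "0 \<le> \<kappa> * k0" using \<kappa> ck by simp
  then show ?thesis using False bge[OF j th] by (simp add: zz_def b'_def)
 next
  case True
  then have bj: "\<theta> * \<delta> \<le> b j" using bge[OF j th] by simp
  show ?thesis
  proof (cases "\<theta> \<ge> 0")
   case pos: True
   have "0 \<le> lm \<theta> * \<kappa>" using slm.lmgf_nonneg[OF th pos] \<kappa> by simp
   moreover have "0 \<le> \<kappa> * k0" using \<kappa> ck by simp
   ultimately show ?thesis using True bj by (simp add: zz_def b'_def)
  next
   case neg: False
   have "\<kappa> * (\<theta> * c0 - k0) \<le> \<kappa> * lm \<theta>" using ck neg \<kappa> by (intro mult_left_mono) auto
   then have "\<theta> * \<delta> - lm \<theta> * \<kappa> \<le> \<theta> * \<delta> - \<theta> * (\<kappa> * c0) + \<kappa> * k0" by (simp add: algebra_simps)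
   also have "\<dots> = \<theta> * (\<delta> - \<kappa> * c0) + \<kappa> * k0" by (simp add: algebra_simps)
   also have "\<dots> \<le> 0 + \<kappa> * k0" using neg \<kappa>c by (intro add_right_mono mult_nonpos_nonneg) auto
   also have "\<dots> \<le> b' j" using b0[OF j] by (simp add: b'_def)
   finally show ?thesis using True by (simp add: zz_def)
  qed
 qed
 define Z where "Z j = (\<Sum>i<j. zz i)" for j
 have ZS: "Z (Suc j) = Z j + zz j" for j by (simp add: Z_def)
 have Z0: "Z 0 = 0" by (simp add: Z_def)
 have Zlow: "\<psi> (t j) \<le> Z j" for j unfolding Z_def sumy[symmetric] using zy by (intro sum_mono)
 have Zup: "Z j \<le> \<psi> (t j) + real j * \<kappa>" for j
 proof -
  have "Z j \<le> (\<Sum>i<j. y i + \<kappa>)" unfolding Z_def using zy by (intro sum_mono)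
  then show ?thesis by (simp add: sum.distrib sumy)
 qed
 have Znn: "0 \<le> Z j" if "j \<le> m" for j unfolding Z_def using zpos that by (intro sum_nonneg) (auto intro: less_imp_le)
 have Zmono: "Z i \<le> Z j" if "i \<le> j" "j \<le> m" for i j
  unfolding Z_def using that zpos by (intro sum_mono2) (auto intro: less_imp_le)
 define Zm where "Zm = Z m"
 have Zm: "Zm \<ge> 0" unfolding Zm_def by (rule Znn) simp
 \<comment> \<open>Tolerance for the epochs at block ends: below one mesh, so that counts shift by
   at most one cell, and small enough to be made up by the slow last block.\<close>
 define e2 where "e2 = min (\<delta> / 2) (c1 * \<kappa> / 2)"
 have e2: "e2 > 0" using \<delta> c1 \<kappa> by (simp add: e2_def)
 \<comment> \<open>The errors of all blocks, weighted by their sizes, then accumulate to at most a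
   quarter of \<open>e2\<close>.\<close>
 define \<epsilon>1 where "\<epsilon>1 = e2 / (4 * (Zm + 1))"
 have \<epsilon>1: "\<epsilon>1 > 0" using e2 Zm by (simp add: \<epsilon>1_def)
 define \<eta>1 where "\<eta>1 = \<eta> / (8 * (Zm + 1))"
 have \<eta>1: "\<eta>1 > 0" using \<eta> Zm by (simp add: \<eta>1_def)
 have "\<exists>n0. \<forall>I. finite I \<and> I \<subseteq> {1..} \<and> card I \<ge> n0 \<longrightarrow>
  exp (- (real (card I) * (b' j / zz j + \<eta>1))) \<le> prob {w \<in> space M. \<bar>(\<Sum>i\<in>I. S i w) / real (card I) - \<delta> / zz j\<bar> < \<epsilon>1}" if j: "j < m" for j
 proof -
  have "\<theta> * (\<delta> / zz j) - lm \<theta> \<le> b' j / zz j" if "\<theta> \<in> sdom" for \<theta>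
  proof -
   have "(\<theta> * \<delta> - lm \<theta> * zz j) / zz j \<le> b' j / zz j" using b'ge[OF j that] zpos[OF j] by (intro divide_right_mono) auto
   then show ?thesis using zpos[OF j] by (simp add: diff_divide_distrib)
  qed
  from block_lower[OF this \<epsilon>1 \<eta>1] show ?thesis by blast
 qed
 then have "\<exists>n0. \<forall>j. j < m \<longrightarrow> (\<forall>I. finite I \<and> I \<subseteq> {1..} \<and> card I \<ge> n0 j \<longrightarrow>
  exp (- (real (card I) * (b' j / zz j + \<eta>1))) \<le> prob {w \<in> space M. \<bar>(\<Sum>i\<in>I. S i w) / real (card I) - \<delta> / zz j\<bar> < \<epsilon>1})"
  by (intro choice allI) blast
 then obtain n0 where n0: "\<forall>j. j < m \<longrightarrow> (\<forall>I. finite I \<and> I \<subseteq> {1..} \<and> card I \<ge> n0 j \<longrightarrow>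
  exp (- (real (card I) * (b' j / zz j + \<eta>1))) \<le> prob {w \<in> space M. \<bar>(\<Sum>i\<in>I. S i w) / real (card I) - \<delta> / zz j\<bar> < \<epsilon>1})"
  by (rule exE)
 define C1 where "C1 = (\<Sum>j<m. b' j / zz j + \<eta>1) + lp"
 define C2 where "C2 = (\<Sum>j<m. \<epsilon>1 + \<delta> / zz j)"
 have ev: "eventually (\<lambda>n. real n * r \<ge> s) sequentially" if "r > 0" for r s :: real
 proof -
  obtain n1 :: nat where n1: "s / r \<le> real n1" using real_arch_simple by blast
  show ?thesis
  proof (rule eventually_sequentiallyI[of n1])
   fix n assume "n1 \<le> n"
   then have "s / r \<le> real n" using n1 by linarith
   then show "s \<le> real n * r" using that by (simp add: pos_divide_le_eq)
  qed
 qed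
 have evb: "eventually (\<lambda>n. \<forall>j\<in>{..<m}. real n * zz j \<ge> real (n0 j) + 2) sequentially"
  using zpos by (intro eventually_ball_finite ballI ev) auto
 have ev1: "eventually (\<lambda>n. real n * (\<eta> / 8) \<ge> C1) sequentially" using \<eta> by (intro ev) auto
 have ev2: "eventually (\<lambda>n. real n * (e2 / 4) \<ge> C2) sequentially" using e2 by (intro ev) auto
 have ev3: "eventually (\<lambda>n. real n * (\<epsilon> / 8) \<ge> 2) sequentially" using \<epsilon> by (intro ev) auto
 show ?thesis using evb ev1 ev2 ev3 eventually_ge_at_top[of 1]
 proof eventually_elim
  fix n :: nat
  let ?H = "\<Sum>j<m. real n * b' j + real n * zz j * \<eta>1 + (b' j / zz j + \<eta>1)"
  let ?G = "real n * \<kappa> * lp + lp"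
  let ?A = "{w \<in> space M. \<forall>t\<in>F. \<bar>Sbar n w t - \<psi> t\<bar> < \<epsilon>}"
  assume nb: "\<forall>j\<in>{..<m}. real n * zz j \<ge> real (n0 j) + 2" and nC1: "real n * (\<eta> / 8) \<ge> C1" and nC2: "real n * (e2 / 4) \<ge> C2"
   and n\<epsilon>: "real n * (\<epsilon> / 8) \<ge> 2" and n: "1 \<le> n"
  have np: "real n > 0" using n by simp
  \<comment> \<open>The index at which block \<open>j\<close> begins to be counted; rounding changes
    the size of a block by less than one.\<close>
  define K where "K j = nat \<lfloor>real n * Z j\<rfloor>" for j
  have K: "real n * Z j - 1 < real (K j)" "real (K j) \<le> real n * Z j" if "j \<le> m" for j
   by (use Znn[OF that] in \<open>auto simp: K_def of_nat_nat\<close>)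
  have K0: "K 0 = 0" by (simp add: K_def Z0)
  have Kmono: "K i \<le> K j" if "i \<le> j" "j \<le> m" for i j
   unfolding K_def using Zmono[OF that] by (intro nat_mono floor_mono mult_left_mono) auto
  define q where "q = nat \<lceil>real n * \<kappa>\<rceil>"
  have q: "real n * \<kappa> \<le> real q" "real q \<le> real n * \<kappa> + 1"
   unfolding q_def using \<kappa> by (auto simp: real_nat_ceiling_ge of_nat_nat)
  define I where "I j = (if j < m then {Suc (K j)..K (Suc j)} else {Suc (K m)..K m + q})" for j
  have cI: "real (card (I j)) = real (K (Suc j)) - real (K j)" if "j < m" for j
   using that Kmono[of j "Suc j"] by (simp add: I_def of_nat_diff)
  have cIb: "real n * zz j - 1 < real (card (I j))" "real (card (I j)) < real n * zz j + 1" if j: "j < m" for j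
   using K[of j] K[of "Suc j"] j unfolding cI[OF j] ZS distrib_left by auto
  have cIm: "card (I m) = q" by (simp add: I_def)
  have finI: "finite (I j) \<and> I j \<subseteq> {1..}" for j by (auto simp: I_def)
  have disjI: "disjoint_family_on I {..m}" unfolding disjoint_family_on_def
  proof (intro ballI impI)
   have main: "I i \<inter> I j = {}" if "i < j" "j \<le> m" for i j
   proof -
    have "K (Suc i) \<le> K j" using that by (intro Kmono) auto
    then show ?thesis using that by (auto simp: I_def)
   qed
   fix i j assume "i \<in> {..m}" "j \<in> {..m}" "i \<noteq> j"
   then show "I i \<inter> I j = {}" using main[of i j] main[of j i] by (cases "i < j") (auto simp: Int_commute)
  qed
  \<comment> \<open>Each of the first \<open>m\<close> blocks must have mean service time near
    \<open>\<delta> / zz j\<close>; the last one must only be slow.\<close>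
  define Bs where "Bs j = (if j < m then {s. \<bar>s / real (card (I j)) - \<delta> / zz j\<bar> < \<epsilon>1} else {c1 * real q..})" for j
  let ?F = "\<lambda>j. {w \<in> space M. (\<Sum>i\<in>I j. S i w) \<in> Bs j}"
  let ?E = "{w \<in> space M. (\<Sum>i\<in>I m. S i w) \<in> Bs m}"
  have Bs: "Bs j \<in> sets borel" for j by (auto simp: Bs_def)
  define E where "E = {w \<in> space M. \<forall>j\<in>{..m}. (\<Sum>i\<in>I j. S i w) \<in> Bs j}"
  have PE: "prob E = (\<Prod>j\<in>{..m}. prob (?F j))"
   unfolding E_def by (rule block_sums_prob) (use disjI finI Bs in auto)
  have lowj: "exp (- (real n * b' j + real n * zz j * \<eta>1 + (b' j / zz j + \<eta>1))) \<le> prob (?F j)" if j: "j < m" for j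
  proof -
   let ?D = "b' j / zz j + \<eta>1"
   have "real (n0 j) \<le> real (card (I j))" by (use nb j cIb(1)[OF j] in \<open>force\<close>)
   then have "card (I j) \<ge> n0 j" by simp
   then have lw: "exp (- (real (card (I j)) * ?D)) \<le> prob {w \<in> space M. \<bar>(\<Sum>i\<in>I j. S i w) / real (card (I j)) - \<delta> / zz j\<bar> < \<epsilon>1}"
    using n0 j finI by blast
   have "real (card (I j)) * ?D \<le> real n * b' j + real n * zz j * \<eta>1 + ?D"
   proof -
    have "0 \<le> b' j / zz j + \<eta>1" using b'0[OF j] zpos[OF j] \<eta>1 by simp
    then have "real (card (I j)) * ?D \<le> (real n * zz j + 1) * ?D"
     using cIb(2)[OF j] by (intro mult_right_mono) auto
    also have "\<dots> = real n * b' j + real n * zz j * \<eta>1 + ?D" using zpos[OF j] by (simp add: field_simps)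
    finally show ?thesis .
   qed
   then have "exp (- (real n * b' j + real n * zz j * \<eta>1 + ?D)) \<le> exp (- (real (card (I j)) * ?D))" by simp
   from order_trans[OF this lw] show ?thesis using j unfolding Bs_def by simp
  qed
  have lowm: "exp (- ?G) \<le> prob ?E"
  proof -
   have "real q * lp \<le> (real n * \<kappa> + 1) * lp" using q(2) lp by (intro mult_right_mono) auto
   then have "exp (- ?G) \<le> exp (- (real q * lp))" by (simp add: distrib_right)
   also have "exp (- (real q * lp)) = p ^ q" using p by (simp add: lp_def exp_of_nat_mult)
   also have "\<dots> \<le> prob {w \<in> space M. (\<Sum>i\<in>I m. S i w) \<ge> c1 * real (card (I m))}"
    using plow[rule_format, of "I m"] finI[of m] cIm by simp
   also have "\<dots> = prob ?E" by (simp add: Bs_def cIm)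
   finally show ?thesis .
  qed
  have "exp (- (real n * (lv + \<eta>))) \<le> prob E"
  proof -
   \<comment> \<open>Total cost of all blocks. Beyond \<open>n * lv\<close> there are three
     contributions, the \<open>\<kappa>\<close> terms, \<open>Zm * \<eta>1\<close> and the constant
     \<open>C1\<close>, each worth at most \<open>n * \<eta> / 8\<close>.\<close>
   have "?H + ?G
    = real n * (\<Sum>j<m. b' j) + real n * (Zm * \<eta>1) + C1 + real n * (\<kappa> * lp)"
    by (simp add: sum.distrib sum_distrib_left sum_distrib_right Zm_def Z_def C1_def mult.assoc)
   also have "(\<Sum>j<m. b' j) = (\<Sum>j<m. b j) + real m * (\<kappa> * k0)" by (simp add: b'_def sum.distrib)
   also have "real n * ((\<Sum>j<m. b j) + real m * (\<kappa> * k0)) + real n * (Zm * \<eta>1) + C1 + real n * (\<kappa> * lp) \<le> real n * (lv + \<eta>)"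
   proof -
    have z1: "Zm * \<eta>1 \<le> \<eta> / 8"
     by (use \<eta>1 Zm in \<open>auto simp: \<eta>1_def field_simps intro!: mult_right_mono\<close>)
    have "(\<Sum>j<m. b j) + real m * (\<kappa> * k0) + Zm * \<eta>1 + \<eta> / 8 + \<kappa> * lp \<le> lv + \<eta>" using sumb \<kappa>\<eta> z1 \<eta> by linarith
    then have "real n * ((\<Sum>j<m. b j) + real m * (\<kappa> * k0) + Zm * \<eta>1 + \<eta> / 8 + \<kappa> * lp) \<le> real n * (lv + \<eta>)" using np by (intro mult_left_mono) auto
    then show ?thesis using nC1 by (simp add: distrib_left)
   qed
   finally have "exp (- (real n * (lv + \<eta>))) \<le> exp (- (?H + ?G))" by simp
   also have "\<dots> = (\<Prod>j<m. exp (- (real n * b' j + real n * zz j * \<eta>1 + (b' j / zz j + \<eta>1)))) * exp (- ?G)"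
    by (simp only: exp_sum[OF finite_lessThan, symmetric] exp_add[symmetric] sum_negf) (simp only: minus_add_distrib)
   also have "\<dots> \<le> (\<Prod>j<m. prob (?F j)) * prob ?E"
    using lowj lowm by (intro mult_mono prod_mono prod_nonneg) auto
   also have "\<dots> = prob E" unfolding PE by (simp add: lessThan_Suc_atMost[symmetric] mult.commute)
   finally show ?thesis .
  qed
  also have "prob E \<le> prob ?A"
  proof (rule finite_measure_mono_AE)
   have [measurable]: "(\<lambda>w. Sbar n w t) \<in> borel_measurable M" if "t \<in> F" for t
    using F that by (intro Sbar_measurable[OF n]) auto
   show "?A \<in> events" using F by measurable
   show "AE w in M. w \<in> E \<longrightarrow> w \<in> ?A"
    using AE_good
   proof (eventually_elim, intro impI)
    fix w assume g: "good w" and wE: "w \<in> E"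
    have Vstep: "\<bar>V (K (Suc j)) w - V (K j) w - real n * \<delta>\<bar> \<le> \<epsilon>1 * (real n * zz j) + (\<epsilon>1 + \<delta> / zz j)" if j: "j < m" for j
    proof -
     define s where "s = (\<Sum>i\<in>I j. S i w)"
     define c where "c = real (card (I j))"
     have cpos: "c > 0" using nb cIb[OF j] j by (force simp: c_def)
     have "s \<in> Bs j" using wE j by (auto simp: E_def s_def)
     then have sc: "\<bar>s / c - \<delta> / zz j\<bar> < \<epsilon>1" using j by (simp add: Bs_def c_def)
     have sV: "s = V (K (Suc j)) w - V (K j) w" unfolding s_def using j Kmono[of j "Suc j"] by (simp add: I_def V_diff)
     have "\<bar>s - c * (\<delta> / zz j)\<bar> = c * \<bar>s / c - \<delta> / zz j\<bar>"
      by (use cpos in \<open>simp add: right_diff_distrib abs_mult field_simps\<close>)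
     also have "\<dots> \<le> (real n * zz j + 1) * \<epsilon>1" using sc cIb(2)[OF j] cpos by (intro mult_mono) (auto simp: c_def)
     finally have 1: "\<bar>s - c * (\<delta> / zz j)\<bar> \<le> (real n * zz j + 1) * \<epsilon>1" .
     have "\<bar>c * (\<delta> / zz j) - real n * \<delta>\<bar> = \<bar>c - real n * zz j\<bar> * (\<delta> / zz j)"
     proof -
      have "c * (\<delta> / zz j) - real n * \<delta> = (c - real n * zz j) * (\<delta> / zz j)" using zpos[OF j] by (simp add: left_diff_distrib diff_divide_distrib)
      then show ?thesis using \<delta> zpos[OF j] by (simp add: abs_mult)
     qed
     also have "\<dots> \<le> 1 * (\<delta> / zz j)" using cIb[OF j] \<delta> zpos[OF j] by (intro mult_right_mono) (auto simp: c_def)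
     finally have 2: "\<bar>c * (\<delta> / zz j) - real n * \<delta>\<bar> \<le> \<delta> / zz j" by simp
     have "\<bar>s - real n * \<delta>\<bar> = \<bar>(s - c * (\<delta> / zz j)) + (c * (\<delta> / zz j) - real n * \<delta>)\<bar>" by simp
     also have "\<dots> \<le> \<bar>s - c * (\<delta> / zz j)\<bar> + \<bar>c * (\<delta> / zz j) - real n * \<delta>\<bar>" by (rule abs_triangle_ineq)
     also have "\<dots> \<le> (real n * zz j + 1) * \<epsilon>1 + \<delta> / zz j" by (intro add_mono 1 2)
     finally have "\<bar>s - real n * \<delta>\<bar> \<le> (real n * zz j + 1) * \<epsilon>1 + \<delta> / zz j" .
     then show ?thesis unfolding sV by (simp add: algebra_simps)
    qed
    have Vt: "\<bar>V (K j) w - real n * t j\<bar> < real n * e2" if j: "j \<le> m" for j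
    proof -
     have "\<bar>V (K j) w - real n * t j\<bar> \<le> (\<Sum>i<j. \<epsilon>1 * (real n * zz i) + (\<epsilon>1 + \<delta> / zz i))" using j
     proof (induction j)
      case 0
      then show ?case by (simp add: K0 t0)
     next
      case (Suc j)
      have "\<bar>V (K (Suc j)) w - real n * t (Suc j)\<bar> \<le> \<bar>V (K j) w - real n * t j\<bar> + \<bar>V (K (Suc j)) w - V (K j) w - real n * \<delta>\<bar>"
       unfolding tS distrib_left by linarith
      then show ?case using Suc Vstep[of j] by simp
     qed
     also have "\<dots> \<le> (\<Sum>i<m. \<epsilon>1 * (real n * zz i) + (\<epsilon>1 + \<delta> / zz i))"
      using j \<epsilon>1 zpos \<delta> np by (intro sum_mono2) (auto intro!: add_nonneg_nonneg mult_nonneg_nonneg divide_nonneg_pos intro: less_imp_le)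
     also have "\<dots> = real n * (\<epsilon>1 * Zm) + C2" by (simp add: sum.distrib C2_def Zm_def Z_def sum_distrib_left mult.left_commute)
     also have "\<dots> \<le> real n * (e2 / 4) + real n * (e2 / 4)"
     proof -
      have "\<epsilon>1 * Zm \<le> \<epsilon>1 * (Zm + 1)" using \<epsilon>1 by (intro mult_left_mono) auto
      also have "\<dots> = e2 / 4" using Zm by (simp add: \<epsilon>1_def field_simps)
      finally have "real n * (\<epsilon>1 * Zm) \<le> real n * (e2 / 4)" using np by (intro mult_left_mono) auto
      then show ?thesis using nC2 by linarith
     qed
     also have "\<dots> < real n * e2" using np e2 by (simp add: field_simps)
     finally show ?thesis .
    qed
    have e2\<delta>: "real n * e2 < real n * \<delta>" using np e2 \<delta> by (intro mult_strict_left_mono) (auto simp: e2_def)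
    have nt0: "0 \<le> real n * t j" for j using np \<delta> by (simp add: t_def)
    \<comment> \<open>The epoch of index \<open>K j\<close> occurs within \<open>n * e2\<close> of
      time \<open>n * t j\<close>, less than one mesh, so counts at grid times are trapped with a
      shift of one cell.\<close>
    have Rlow: "K j \<le> R w (real n * t (Suc j))" if j: "j \<le> m" for j
     by (use Vt[OF j] e2\<delta> le_renewal_count_iff[OF g nt0] in \<open>fastforce simp: tS distrib_left\<close>)
    have Rup: "R w (real n * t j) < K (Suc j)" if j: "j < m" for j
    proof -
     have "\<bar>V (K (Suc j)) w - real n * t (Suc j)\<bar> < real n * e2" using j by (intro Vt) auto
     then have "real n * t j < V (K (Suc j)) w" using e2\<delta> unfolding tS distrib_left by linarith
     then show ?thesis using renewal_count_less_iff[OF g nt0] by simp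
    qed
    have Rend: "R w (real n * t m) < K m + q"
    proof -
     have "(\<Sum>i\<in>I m. S i w) \<in> Bs m" using wE by (auto simp: E_def)
     then have "c1 * real q \<le> (\<Sum>i\<in>I m. S i w)" by (simp add: Bs_def)
     also have "(\<Sum>i\<in>I m. S i w) = V (K m + q) w - V (K m) w" by (simp add: I_def V_diff)
     finally have "c1 * real q \<le> V (K m + q) w - V (K m) w" .
     moreover have "real n * e2 \<le> c1 * real q"
     proof -
      have "real n * e2 \<le> real n * (c1 * \<kappa>)"
      proof -
       have "e2 \<le> c1 * \<kappa> / 2" by (simp add: e2_def)
       also have "\<dots> \<le> c1 * \<kappa>" using c1 \<kappa> by simp
       finally show ?thesis using np by (intro mult_left_mono) auto
      qed
      also have "\<dots> = c1 * (real n * \<kappa>)" by simp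
      also have "\<dots> \<le> c1 * real q" using q c1 by (intro mult_left_mono) auto
      finally show ?thesis .
     qed
     moreover have "\<bar>V (K m) w - real n * t m\<bar> < real n * e2" by (rule Vt) simp
     ultimately have "real n * t m < V (K m + q) w" by linarith
     then show ?thesis using renewal_count_less_iff[OF g nt0] by simp
    qed
    have closeF: "\<bar>Sbar n w s - \<psi> s\<bar> < \<epsilon>" if s: "s \<in> {0..T}" for s
    proof -
     let ?C = "R w (real n * s)"
     obtain j where j: "j < m" "t j \<le> s" "s \<le> t (Suc j)"
     proof (cases "s = 0")
      case True
      then show ?thesis using that[of 0] m \<delta> by (simp add: t_def)
     next
      case False
      then have s0: "0 < s" using s by simp
      define j where "j = nat (\<lceil>s / \<delta>\<rceil> - 1)"
      have "s / \<delta> > 0" using s0 \<delta> by simp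
      then have c1: "\<lceil>s / \<delta>\<rceil> \<ge> 1" by (simp add: le_ceiling_iff)
      then have rj: "real j = of_int \<lceil>s / \<delta>\<rceil> - 1" by (simp add: j_def)
      then have "real j < s / \<delta>" "s / \<delta> \<le> real (Suc j)" by linarith+
      then have 1: "t j \<le> s" "s \<le> t (Suc j)" using \<delta> by (simp_all add: t_def pos_less_divide_eq pos_divide_le_eq)
      have "s / \<delta> \<le> real m" using s m\<delta> \<delta> by (simp add: pos_divide_le_eq)
      then have "\<lceil>s / \<delta>\<rceil> \<le> int m" by (simp add: ceiling_le_iff)
      then have "j < m" using c1 unfolding j_def by linarith
      then show ?thesis using that 1 by blast
     qed
     have ns: "0 \<le> real n * s" using s np by simp
     have Sb: "Sbar n w s = real ?C / real n" using s by (rule Sbar_eq)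
     have tjT: "t j \<in> {0..T}" "t (Suc j) \<in> {0..T}" using tT[of j] tT[of "Suc j"] j by auto
     \<comment> \<open>One cell to the left; in the first cell the trivial index zero takes its
       place.\<close>
     define lo where "lo = (if j = 0 then 0 else j - 1)"
     have lom: "lo \<le> m" using j by (auto simp: lo_def)
     have Klo: "K lo \<le> R w (real n * s)"
     proof (cases "j = 0")
      case True
      then show ?thesis by (simp add: lo_def K0)
     next
      case False
      then have "K lo \<le> R w (real n * t j)" using Rlow[of lo] lom by (simp add: lo_def)
      also have "\<dots> \<le> R w (real n * s)" using j np nt0 by (intro renewal_count_mono[OF g]) auto
      finally show ?thesis .
     qed
     have "dist (t lo) s < d" by (use j tS[of lo] tS[of j] \<delta> \<delta>d in \<open>auto simp: lo_def dist_real_def\<close>)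
     then have dlo: "\<bar>\<psi> (t lo) - \<psi> s\<bar> < \<epsilon> / 4" using dc[OF s tT[OF lom]] by (simp add: dist_real_def)
     have "real n * \<psi> (t lo) - 1 \<le> real n * Z lo - 1" using Zlow np by (intro diff_right_mono mult_left_mono) auto
     also have "\<dots> \<le> real ?C" using K(1)[OF lom] Klo by linarith
     finally have low: "\<psi> (t lo) - 1 / real n \<le> Sbar n w s"
     proof -
      assume h: "real n * \<psi> (t lo) - 1 \<le> real ?C"
      have "(real n * \<psi> (t lo) - 1) / real n \<le> real ?C / real n" using h by (intro divide_right_mono) auto
      then show ?thesis unfolding Sb using np by (simp add: diff_divide_distrib)
     qed
     have n\<epsilon>': "2 / real n \<le> \<epsilon> / 8" using n\<epsilon> np by (simp add: field_simps)
     have Rs: "R w (real n * s) \<le> R w (real n * t (Suc j))" using j np ns by (intro renewal_count_mono[OF g]) auto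
     \<comment> \<open>In the last cell the slow block bounds the count, in the others the end of
       the following block does; one common estimate covers both.\<close>
     have up: "\<exists>r\<le>m. dist (t r) s < d \<and> real ?C \<le> real n * Z r + real n * \<kappa> + 1"
     proof (cases "Suc j = m")
      case True
      have "R w (real n * s) < K m + q" using Rs Rend True by simp
      then have "real ?C \<le> real (K m) + real q" by linarith
      also have "\<dots> \<le> real n * Z m + (real n * \<kappa> + 1)" using K(2)[of m] q by (intro add_mono) auto
      finally have "real ?C \<le> real n * Z m + real n * \<kappa> + 1" by simp
      moreover have "dist (t m) s < d" using j True tS[of j] \<delta>d \<delta> by (auto simp: dist_real_def)
      ultimately show ?thesis by blast
     next
      case False
      then have jm: "Suc j < m" using j by simp
      have "R w (real n * s) \<le> K (Suc (Suc j))" using Rs Rup[OF jm] by simp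
      then have "real ?C \<le> real n * Z (Suc (Suc j))" using K(2)[of "Suc (Suc j)"] jm by simp
      also have "\<dots> \<le> real n * Z (Suc (Suc j)) + real n * \<kappa> + 1" using np \<kappa> by simp
      finally have "real ?C \<le> real n * Z (Suc (Suc j)) + real n * \<kappa> + 1" .
      moreover have "dist (t (Suc (Suc j))) s < d" using j tS[of j] tS[of "Suc j"] \<delta>d \<delta> by (auto simp: dist_real_def)
      ultimately show ?thesis using jm by (intro exI[of _ "Suc (Suc j)"]) auto
     qed
     then obtain r where r: "r \<le> m" "dist (t r) s < d" "real ?C \<le> real n * Z r + real n * \<kappa> + 1" by blast
     have dr: "\<bar>\<psi> (t r) - \<psi> s\<bar> < \<epsilon> / 4" using dc[OF s tT[OF r(1)] r(2)] by (simp add: dist_real_def)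
     have "Sbar n w s \<le> Z r + \<kappa> + 1 / real n" unfolding Sb using r(3) np by (simp add: field_simps)
     also have "\<dots> \<le> \<psi> (t r) + (real r * \<kappa> + \<kappa>) + 1 / real n" using Zup[of r] by simp
     also have "real r * \<kappa> + \<kappa> \<le> (real m + 1) * \<kappa>" using r \<kappa> by (simp add: distrib_right mult_right_mono)
     finally have upp: "Sbar n w s \<le> \<psi> (t r) + \<epsilon> / 8 + 1 / real n" using \<kappa>\<epsilon> by linarith
     have "1 / real n \<le> 2 / real n" using np by (intro divide_right_mono) auto
     then show ?thesis using low upp dlo dr n\<epsilon>' \<epsilon> unfolding abs_less_iff by linarith
    qed
    show "w \<in> ?A"
     using wE F closeF by (auto simp: E_def)
   qed
  qed
  finally show "exp (- (real n * (lv + \<eta>))) \<le> prob ?A" .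
 qed
qed

end

section \<open>Large deviations of the workload\<close>

text \<open>Polya's argument: monotonicity sandwiches \<open>x t\<close> between grid values, and
  uniform continuity of \<open>\<phi>\<close> closes the gap.\<close>

lemma mono_grid_uniform:
 fixes \<phi> :: "real \<Rightarrow> real"
 assumes T: "0 < T" and cont: "continuous_on {0..T} \<phi>" and \<delta>: "\<delta> > 0"
 obtains F \<epsilon> where "finite F" "F \<subseteq> {0..T}" "\<epsilon> > 0"
  "\<forall>x. mono_on {0..T} x \<and> (\<forall>t\<in>F. \<bar>x t - \<phi> t\<bar> < \<epsilon>) \<longrightarrow> (\<forall>t\<in>{0..T}. \<bar>x t - \<phi> t\<bar> \<le> \<delta>)"
proof -
 have "uniformly_continuous_on {0..T} \<phi>" using cont by (intro compact_uniformly_continuous) auto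
 then obtain d where d: "d > 0" and dc: "\<forall>s\<in>{0..T}. \<forall>t\<in>{0..T}. dist t s < d \<longrightarrow> dist (\<phi> t) (\<phi> s) < \<delta> / 2"
  unfolding uniformly_continuous_on_def using \<delta> half_gt_zero by blast
 obtain m0 :: nat where m0: "T / d < real m0" using reals_Archimedean2 by blast
 have m0p: "real m0 > 0" using m0 T d by (meson divide_pos_pos less_trans)
 define h where "h = T / real m0"
 have h: "h > 0" "h < d" using m0 m0p T d by (simp_all add: h_def field_simps)
 have hm: "real m0 * h = T" using m0p by (simp add: h_def)
 define F where "F = (\<lambda>j. real j * h) ` {..m0}"
 have FT: "F \<subseteq> {0..T}"
 proof
  fix s assume "s \<in> F"
  then obtain j where j: "j \<le> m0" "s = real j * h" by (auto simp: F_def)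
  have "real j * h \<le> real m0 * h" using j h by (intro mult_right_mono) auto
  then show "s \<in> {0..T}" using j h by (simp add: hm)
 qed
 have cell: "\<exists>u\<in>F. \<exists>v\<in>F. u \<le> t \<and> t \<le> v \<and> v - u < d" if t: "t \<in> {0..T}" for t
 proof (cases "t = T")
  case True
  then show ?thesis using hm d by (intro bexI[of _ T]) (auto simp: F_def intro!: image_eqI[of _ _ m0])
 next
  case False
  define j where "j = nat \<lfloor>t / h\<rfloor>"
  have tq: "0 \<le> t / h" using t h by simp
  then have rj: "real j = of_int \<lfloor>t / h\<rfloor>" by (simp add: j_def)
  have j1: "real j \<le> t / h" "t / h < real j + 1" unfolding rj by linarith+
  then have j2: "real j * h \<le> t" "t < (real j + 1) * h" using h by (simp_all add: pos_le_divide_eq pos_divide_less_eq)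
  have "real j * h < real m0 * h" using j2 False t hm by auto
  then have "j < m0" using h by simp
  then have "real j * h \<in> F" "real (Suc j) * h \<in> F" unfolding F_def by (auto intro!: imageI simp del: of_nat_Suc)
  moreover have "real (Suc j) * h - real j * h < d" using h by (simp add: algebra_simps)
  moreover have "t \<le> real (Suc j) * h" using j2 by (simp add: add.commute)
  ultimately show ?thesis using j2(1) by blast
 qed
 show thesis
 proof (rule that[of F "\<delta> / 2"])
  show "finite F" "F \<subseteq> {0..T}" "\<delta> / 2 > 0" using FT \<delta> by (auto simp: F_def)
  show "\<forall>x. mono_on {0..T} x \<and> (\<forall>t\<in>F. \<bar>x t - \<phi> t\<bar> < \<delta> / 2) \<longrightarrow> (\<forall>t\<in>{0..T}. \<bar>x t - \<phi> t\<bar> \<le> \<delta>)"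
  proof (intro allI impI ballI)
   fix x t assume x: "mono_on {0..T} x \<and> (\<forall>t\<in>F. \<bar>x t - \<phi> t\<bar> < \<delta> / 2)" and t: "t \<in> {0..T}"
   obtain u v where uv: "u \<in> F" "v \<in> F" "u \<le> t" "t \<le> v" "v - u < d" using cell[OF t] by blast
   have uT: "u \<in> {0..T}" and vT: "v \<in> {0..T}" using uv FT by auto
   have "x u \<le> x t" "x t \<le> x v" using x uv t uT vT by (auto intro: mono_onD)
   moreover have "\<bar>x u - \<phi> u\<bar> < \<delta> / 2" "\<bar>x v - \<phi> v\<bar> < \<delta> / 2" using x uv by auto
   moreover have "dist (\<phi> u) (\<phi> t) < \<delta> / 2" "dist (\<phi> v) (\<phi> t) < \<delta> / 2"
    using dc t uT vT uv by (auto simp: dist_real_def)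
   ultimately show "\<bar>x t - \<phi> t\<bar> \<le> \<delta>" unfolding dist_real_def by linarith
  qed
 qed
qed

text \<open>Tychonoff's theorem for pairs of functions. The centres are arbitrary functions into
  \<open>{0..R}\<close>, so the hypothesis on \<open>P\<close> cannot presuppose any
  regularity.\<close>

lemma box_pair_cover:
 fixes R T :: real
 assumes P: "\<And>\<phi> \<psi>. \<phi> \<in> ({0..T} \<rightarrow>\<^sub>E {0..R}) \<Longrightarrow> \<psi> \<in> ({0..T} \<rightarrow>\<^sub>E {0..R}) \<Longrightarrow>
  \<exists>F \<epsilon>. finite F \<and> F \<subseteq> {0..T} \<and> \<epsilon> > (0::real) \<and> P F \<epsilon> \<phi> \<psi>"
 obtains D where "finite D" "\<forall>(F, \<epsilon>, \<phi>, \<psi>)\<in>D. P F \<epsilon> \<phi> \<psi>"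
  "\<forall>x\<in>{0..T} \<rightarrow>\<^sub>E {0..R}. \<forall>y\<in>{0..T} \<rightarrow>\<^sub>E {0..R}. \<exists>(F, \<epsilon>, \<phi>, \<psi>)\<in>D. \<forall>t\<in>F. \<bar>x t - \<phi> t\<bar> < \<epsilon> \<and> \<bar>y t - \<psi> t\<bar> < \<epsilon>"
proof -
 define K :: "(real \<Rightarrow> real) set" where "K = ({0..T} \<rightarrow>\<^sub>E {0..R})"
 define X where "X = product_topology (\<lambda>_::real. euclideanreal) {0..T}"
 define cyl where "cyl F \<epsilon> \<phi> = PiE {0..T} (\<lambda>t. if t \<in> F then {y. \<bar>y - \<phi> t\<bar> < \<epsilon>} else UNIV)"
  for F :: "real set" and \<epsilon> :: real and \<phi> :: "real \<Rightarrow> real"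
 have cylo: "openin X (cyl F \<epsilon> \<phi>)" if F: "finite F" for F \<epsilon> \<phi>
  by (use finite_subset[OF _ F] in \<open>auto simp: X_def cyl_def intro!: open_Collect_less continuous_intros openin_PiE_gen[THEN iffD2]\<close>)
 define U where "U = {(F, \<epsilon>, \<phi>, \<psi>). finite F \<and> F \<subseteq> {0..T} \<and> \<epsilon> > 0 \<and> P F \<epsilon> \<phi> \<psi>}"
 define op where "op = (\<lambda>(F, \<epsilon>, \<phi>, \<psi>). cyl F \<epsilon> \<phi> \<times> cyl F \<epsilon> \<psi>)"
 have "compactin (prod_topology X X) (K \<times> K)"
  unfolding compactin_Times by (simp add: X_def K_def compactin_PiE)
 moreover have "\<forall>u\<in>op ` U. openin (prod_topology X X) u"
  by (auto simp: op_def U_def openin_prod_Times_iff cylo)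
 moreover have "K \<times> K \<subseteq> \<Union> (op ` U)"
 proof clarify
  fix \<phi> \<psi> assume k: "\<phi> \<in> K" "\<psi> \<in> K"
  then obtain F \<epsilon> where FP: "finite F \<and> F \<subseteq> {0..T} \<and> \<epsilon> > 0 \<and> P F \<epsilon> \<phi> \<psi>" using P unfolding K_def by meson
  then have "(F, \<epsilon>, \<phi>, \<psi>) \<in> U" by (simp add: U_def)
  moreover have "(\<phi>, \<psi>) \<in> op (F, \<epsilon>, \<phi>, \<psi>)" using k FP by (auto simp: op_def cyl_def K_def PiE_iff)
  ultimately show "(\<phi>, \<psi>) \<in> \<Union> (op ` U)" by blast
 qed
 ultimately obtain \<F> where \<F>: "finite \<F>" "\<F> \<subseteq> op ` U" "K \<times> K \<subseteq> \<Union> \<F>"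
  unfolding compactin_def by meson
 then obtain D where D: "finite D" "D \<subseteq> U" "\<F> = op ` D" by (metis finite_subset_image)
 show thesis
 proof (rule that[of D])
  show "finite D" by fact
  show "\<forall>(F, \<epsilon>, \<phi>, \<psi>)\<in>D. P F \<epsilon> \<phi> \<psi>" using D(2) by (auto simp: U_def)
  show "\<forall>x\<in>{0..T} \<rightarrow>\<^sub>E {0..R}. \<forall>y\<in>{0..T} \<rightarrow>\<^sub>E {0..R}. \<exists>(F, \<epsilon>, \<phi>, \<psi>)\<in>D. \<forall>t\<in>F. \<bar>x t - \<phi> t\<bar> < \<epsilon> \<and> \<bar>y t - \<psi> t\<bar> < \<epsilon>"
  proof (intro ballI)
   fix x y :: "real \<Rightarrow> real" assume "x \<in> {0..T} \<rightarrow>\<^sub>E {0..R}" "y \<in> {0..T} \<rightarrow>\<^sub>E {0..R}"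
   then have "(x, y) \<in> \<Union> (op ` D)" using \<F>(3) unfolding D(3) K_def by blast
   then obtain F \<epsilon> \<phi> \<psi> where q: "(F, \<epsilon>, \<phi>, \<psi>) \<in> D" "(x, y) \<in> op (F, \<epsilon>, \<phi>, \<psi>)" by auto
   have FT: "F \<subseteq> {0..T}" using q D(2) by (auto simp: U_def)
   have "\<forall>t\<in>F. \<bar>x t - \<phi> t\<bar> < \<epsilon> \<and> \<bar>y t - \<psi> t\<bar> < \<epsilon>"
   proof
    fix t assume t: "t \<in> F"
    have xy: "x \<in> cyl F \<epsilon> \<phi>" "y \<in> cyl F \<epsilon> \<psi>" using q(2) by (auto simp: op_def)
    have "t \<in> {0..T}" using t FT by blast
    then have "x t \<in> (if t \<in> F then {y. \<bar>y - \<phi> t\<bar> < \<epsilon>} else UNIV)" "y t \<in> (if t \<in> F then {y. \<bar>y - \<psi> t\<bar> < \<epsilon>} else UNIV)"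
     using PiE_mem[OF xy(1)[unfolded cyl_def]] PiE_mem[OF xy(2)[unfolded cyl_def]] by blast+
    then show "\<bar>x t - \<phi> t\<bar> < \<epsilon> \<and> \<bar>y t - \<psi> t\<bar> < \<epsilon>" using t by simp
   qed
   then show "\<exists>(F, \<epsilon>, \<phi>, \<psi>)\<in>D. \<forall>t\<in>F. \<bar>x t - \<phi> t\<bar> < \<epsilon> \<and> \<bar>y t - \<psi> t\<bar> < \<epsilon>" using q(1) by blast
  qed
 qed
qed

text \<open>What arrivals and services have in common. Upper bounds are demanded at every function,
  because a cover may be centred anywhere; lower bounds only where the rate is finite, and there
  regularity is automatic. The constraint at \<open>T\<close> in \<open>local_upper\<close> serves
  the services, whose estimates need a bounded number of renewals.\<close>

locale monotone_path_rate = prob_space M for M :: "'a measure" +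
 fixes T :: real and X :: "nat \<Rightarrow> 'a \<Rightarrow> real \<Rightarrow> real" and I :: "(real \<Rightarrow> real) \<Rightarrow> ereal"
 assumes T_pos: "0 < T"
  and coord_measurable: "n \<ge> 1 \<Longrightarrow> t \<in> {0..T} \<Longrightarrow> (\<lambda>w. X n w t) \<in> borel_measurable M"
  and regular: "n \<ge> 1 \<Longrightarrow> AE w in M. X n w \<in> cadlag_space T \<and> mono_on {0..T} (X n w) \<and> X n w 0 = 0"
  and rate_nonneg: "0 \<le> I \<phi>"
  and rate_finite_regular: "I \<phi> \<le> ereal a \<Longrightarrow> \<phi> \<in> extensional {0..T} \<Longrightarrow> mono_on {0..T} \<phi> \<and> continuous_on {0..T} \<phi> \<and> \<phi> 0 = 0"
  and exp_tight: "\<exists>R. \<forall>n\<ge>1. prob {w \<in> space M. X n w T > R} \<le> exp (- (real n * a))"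
  and local_upper: "ereal b < I \<phi> \<Longrightarrow> R \<ge> 0 \<Longrightarrow> \<exists>F \<epsilon>. finite F \<and> F \<subseteq> {0..T} \<and> \<epsilon> > 0 \<and>
   eventually (\<lambda>n. prob {w \<in> space M. (\<forall>t\<in>F. \<bar>X n w t - \<phi> t\<bar> < \<epsilon>) \<and> X n w T \<le> R} \<le> exp (- (real n * b))) sequentially"
  and local_lower: "I \<phi> \<le> ereal a \<Longrightarrow> \<phi> \<in> extensional {0..T} \<Longrightarrow> finite F \<Longrightarrow> F \<subseteq> {0..T} \<Longrightarrow> \<epsilon> > 0 \<Longrightarrow> \<eta> > 0 \<Longrightarrow>
   eventually (\<lambda>n. exp (- (real n * (a + \<eta>))) \<le> prob {w \<in> space M. \<forall>t\<in>F. \<bar>X n w t - \<phi> t\<bar> < \<epsilon>}) sequentially"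
begin

lemma rate_finite_cadlag: "I \<phi> \<le> ereal a \<Longrightarrow> \<phi> \<in> extensional {0..T} \<Longrightarrow> \<phi> \<in> cadlag_space T"
proof -
 assume a: "I \<phi> \<le> ereal a" "\<phi> \<in> extensional {0..T}"
 have "(\<lambda>t\<in>{0..T}. \<phi> t) \<in> cadlag_space T" using rate_finite_regular[OF a] by (intro continuous_imp_cadlag) auto
 then show ?thesis using extensional_restrict[OF a(2)] by simp
qed

end

locale queue_ldp = X: monotone_path_rate M T X I + Y: monotone_path_rate M T Y L
 for M :: "'a measure" and T X I Y L +
 assumes XY_indep: "n \<ge> 1 \<Longrightarrow> X.indep_var (path_algebra T) (X n) (path_algebra T) (Y n)"
begin

abbreviation "Q n w \<equiv> reflection_map T (path_diff T (X n w) (Y n w))"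
abbreviation "K \<equiv> workload_rate T I L"

definition regular_at :: "nat \<Rightarrow> 'a \<Rightarrow> bool" where
 "regular_at n w \<longleftrightarrow> X n w \<in> cadlag_space T \<and> mono_on {0..T} (X n w) \<and> X n w 0 = 0 \<and>
   Y n w \<in> cadlag_space T \<and> mono_on {0..T} (Y n w) \<and> Y n w 0 = 0"

lemma AE_regular: "n \<ge> 1 \<Longrightarrow> AE w in M. regular_at n w"
 unfolding regular_at_def using X.regular[of n] Y.regular[of n] by (auto elim!: AE_mp)

lemma exceptional_set:
 assumes "n \<ge> 1"
 obtains N where "N \<in> null_sets M" "\<forall>w\<in>space M - N. regular_at n w"
proof -
 have "\<exists>N\<in>null_sets M. \<forall>w\<in>space M - N. regular_at n w"
  by (rule AE_E3[OF AE_regular[OF assms]]) blast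
 then show thesis using that by blast
qed

lemma queue_cadlag: "regular_at n w \<Longrightarrow> Q n w \<in> cadlag_space T"
 unfolding regular_at_def by (intro reflection_map_cadlag path_diff_cadlag X.T_pos) auto

text \<open>A factor two for the difference of the two paths and two for the reflection; the
  identity time change suffices.\<close>

lemma queue_lipschitz:
 assumes x: "x \<in> cadlag_space T" "y \<in> cadlag_space T" "\<phi> \<in> cadlag_space T" "\<psi> \<in> cadlag_space T"
  and d: "\<forall>t\<in>{0..T}. \<bar>x t - \<phi> t\<bar> \<le> \<delta>" "\<forall>t\<in>{0..T}. \<bar>y t - \<psi> t\<bar> \<le> \<delta>"
 shows "skorokhod_dist T (reflection_map T (path_diff T \<phi> \<psi>)) (reflection_map T (path_diff T x y)) \<le> 4 * \<delta>"
proof (rule skorokhod_dist_le_sup)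
 show "reflection_map T (path_diff T \<phi> \<psi>) \<in> cadlag_space T" "reflection_map T (path_diff T x y) \<in> cadlag_space T" "0 < T"
  using x by (auto intro!: reflection_map_cadlag path_diff_cadlag X.T_pos)
 fix t assume t: "t \<in> {0..T}"
 have "\<forall>t\<in>{0..T}. \<bar>path_diff T \<phi> \<psi> t - path_diff T x y t\<bar> \<le> 2 * \<delta>"
  by (use d in \<open>fastforce simp: path_diff_def\<close>)
 then have "\<bar>reflection_map T (path_diff T \<phi> \<psi>) t - reflection_map T (path_diff T x y) t\<bar> \<le> 2 * (2 * \<delta>)"
  using x t X.T_pos by (intro reflection_map_lipschitz path_diff_cadlag) auto
 then show "\<bar>reflection_map T (path_diff T \<phi> \<psi>) t - reflection_map T (path_diff T x y) t\<bar> \<le> 4 * \<delta>" by simp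
qed

lemma queue_open_measurable:
 assumes n: "n \<ge> 1" and U: "openin (J1_topology T) U"
 shows "{w \<in> space M. Q n w \<in> U} \<in> sets (completion M)"
proof -
 let ?A = "{w \<in> space M. Q n w \<in> U}"
 obtain N where N: "N \<in> null_sets M" "\<forall>w\<in>space M - N. regular_at n w" by (rule exceptional_set[OF n])
 have Nm[measurable]: "N \<in> sets M" using N by auto
 \<comment> \<open>On the exceptional null set the zero path is substituted, so that
   \<open>D\<close> is cadlag at every sample point; the completion then restores the original
   event.\<close>
 define D where "D w = (if w \<in> N then (\<lambda>t\<in>{0..T}. 0) else path_diff T (X n w) (Y n w))" for w
 let ?B = "{w \<in> space M. reflection_map T (D w) \<in> U}"
 have D: "D w \<in> cadlag_space T" if "w \<in> space M" for w
  using that N(2) by (auto simp: D_def regular_at_def intro!: path_diff_cadlag continuous_imp_cadlag)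
 have Dm: "(\<lambda>w. D w t) \<in> borel_measurable M" if t: "t \<in> {0..T}" for t
 proof -
  have [measurable]: "(\<lambda>w. X n w t) \<in> borel_measurable M" "(\<lambda>w. Y n w t) \<in> borel_measurable M"
   using X.coord_measurable[OF n t] Y.coord_measurable[OF n t] by auto
  have "(\<lambda>w. D w t) = (\<lambda>w. if w \<in> N then 0 else X n w t - Y n w t)" using t by (auto simp: D_def path_diff_def)
  also have "\<dots> \<in> borel_measurable M" by measurable
  finally show ?thesis .
 qed
 have m: "?B \<in> sets (completion M)"
  using D by (intro J1_open_measurable[OF X.T_pos U] reflection_map_measurable[OF X.T_pos D Dm] AE_I2 reflection_map_cadlag X.T_pos) auto
 have Nc: "N \<in> null_sets (completion M)" using N(1) by (rule null_sets_completionI)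
 have "?A \<inter> N \<in> null_sets (completion M)" by (rule null_sets_completion_subset[OF _ Nc]) auto
 then have "(?B - N) \<union> (?A \<inter> N) \<in> sets (completion M)"
  using m Nc by auto
 also have "(?B - N) \<union> (?A \<inter> N) = ?A"
  by (auto simp: D_def)
 finally show ?thesis .
qed

lemma indep_product:
 assumes n: "n \<ge> 1" and F: "finite F" "F \<subseteq> {0..T}" "finite G" "G \<subseteq> {0..T}"
  and A: "\<And>t. t \<in> F \<Longrightarrow> A t \<in> sets borel" and B: "\<And>t. t \<in> G \<Longrightarrow> B t \<in> sets borel"
 shows "X.prob ({w \<in> space M. \<forall>t\<in>F. X n w t \<in> A t} \<inter> {w \<in> space M. \<forall>t\<in>G. Y n w t \<in> B t})
  = X.prob {w \<in> space M. \<forall>t\<in>F. X n w t \<in> A t} * X.prob {w \<in> space M. \<forall>t\<in>G. Y n w t \<in> B t}"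
proof -
 let ?B = "{x \<in> space (path_algebra T). \<forall>t\<in>G. x t \<in> B t}"
 let ?A = "\<lambda>F A. {x \<in> space (path_algebra T). \<forall>t\<in>F. x t \<in> A t}"
 have cs: "(?A F A) \<in> sets (path_algebra T)"
  if F: "finite F" "F \<subseteq> {0..T}" and A: "\<And>t. t \<in> F \<Longrightarrow> A t \<in> sets borel" for F and A :: "real \<Rightarrow> real set"
 proof (rule sets.sets_Collect_finite_All[OF _ F(1)])
  show "{x \<in> space (path_algebra T). x t \<in> A t} \<in> sets (path_algebra T)" if "t \<in> F" for t
   using measurable_sets[OF measurable_component_singleton[of t "{0..T}" "\<lambda>_. borel"] A[OF that]] F that
    by (auto simp: vimage_def Int_def conj_commute)
 qed
 have mX: "X n \<in> measurable M (path_algebra T)" and mY: "Y n \<in> measurable M (path_algebra T)"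
  using X.indep_var_rv1[OF XY_indep[OF n]] X.indep_var_rv2[OF XY_indep[OF n]] by auto
 have 1: "X n -` (?A F A) \<inter> space M = {w \<in> space M. \<forall>t\<in>F. X n w t \<in> A t}"
  using measurable_space[OF mX] by auto
 have 2: "Y n -` ?B \<inter> space M = {w \<in> space M. \<forall>t\<in>G. Y n w t \<in> B t}"
  using measurable_space[OF mY] by auto
 have 3: "(\<lambda>w. (X n w, Y n w)) -` ((?A F A) \<times> ?B) \<inter> space M
  = {w \<in> space M. \<forall>t\<in>F. X n w t \<in> A t} \<inter> {w \<in> space M. \<forall>t\<in>G. Y n w t \<in> B t}"
  unfolding 1[symmetric] 2[symmetric] by blast
 have "X.prob ((\<lambda>w. (X n w, Y n w)) -` ((?A F A) \<times> ?B) \<inter> space M)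
  = X.prob (X n -` (?A F A) \<inter> space M) * X.prob (Y n -` ?B \<inter> space M)"
  by (rule X.indep_varD[OF XY_indep[OF n]]) (use F A B in \<open>auto intro!: cs\<close>)
 then show ?thesis unfolding 1 2 3 .
qed

lemma workload_rate_le: "\<phi> \<in> cadlag_space T \<Longrightarrow> \<psi> \<in> cadlag_space T \<Longrightarrow> K (reflection_map T (path_diff T \<phi> \<psi>)) \<le> I \<phi> + L \<psi>"
 unfolding workload_rate_def by (rule Inf_lower) auto

lemma workload_rate_nonneg: "0 \<le> K q"
 unfolding workload_rate_def by (rule Inf_greatest) (auto intro: add_nonneg_nonneg X.rate_nonneg Y.rate_nonneg)

text \<open>Dichotomy on the centre. If its total rate exceeds \<open>a\<close>, independence
  multiplies two local upper bounds. Otherwise both centres are continuous and their workload lies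
  outside the closed set; then so does the workload of all nearby regular paths, and the event is
  empty. A measurable \<open>B\<close> encloses the event, which involves
  \<open>Q n w \<in> C\<close>.\<close>

lemma closed_pair_bound:
 assumes C: "closedin (J1_topology T) C" and a: "ereal a < (INF q\<in>C. K q)" and R: "R \<ge> 0"
  and ext: "\<phi> \<in> extensional {0..T}" "\<psi> \<in> extensional {0..T}"
 shows "\<exists>F \<epsilon>. finite F \<and> F \<subseteq> {0..T} \<and> \<epsilon> > 0 \<and> eventually (\<lambda>n. \<exists>B\<in>sets M. X.prob B \<le> exp (- (real n * a)) \<and>
  {w \<in> space M. regular_at n w \<and> X n w T \<le> R \<and> Y n w T \<le> R \<and> (\<forall>t\<in>F. \<bar>X n w t - \<phi> t\<bar> < \<epsilon> \<and> \<bar>Y n w t - \<psi> t\<bar> < \<epsilon>) \<and> Q n w \<in> C} \<subseteq> B) sequentially"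
proof (cases "ereal a < I \<phi> + L \<psi>")
 case True
 \<comment> \<open>\<open>a\<close> is divided between the two rates; an infinite rate takes
   whatever the finite one leaves, with slack one.\<close>
 obtain b1 b2 where b: "ereal b1 < I \<phi>" "ereal b2 < L \<psi>" "b1 + b2 = a"
 proof (cases "I \<phi>"; cases "L \<psi>")
  fix r s assume rs: "I \<phi> = ereal r" "L \<psi> = ereal s"
  show thesis by (rule that[of "r - (r + s - a) / 2" "s - (r + s - a) / 2"]) (use rs True in \<open>auto simp: field_simps\<close>)
 next
  fix r assume rs: "I \<phi> = ereal r" "L \<psi> = \<infinity>"
  show thesis by (rule that[of "r - 1" "a - r + 1"]) (use rs in auto)
 next
  fix s assume rs: "I \<phi> = \<infinity>" "L \<psi> = ereal s"
  show thesis by (rule that[of "a - s + 1" "s - 1"]) (use rs in auto)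
 next
  assume rs: "I \<phi> = \<infinity>" "L \<psi> = \<infinity>"
  show thesis by (rule that[of a 0]) (use rs in auto)
 qed (use X.rate_nonneg[of \<phi>] Y.rate_nonneg[of \<psi>] in auto)
 obtain F1 \<epsilon>1 where F1: "finite F1" "F1 \<subseteq> {0..T}" "\<epsilon>1 > 0"
  and e1: "eventually (\<lambda>n. X.prob {w \<in> space M. (\<forall>t\<in>F1. \<bar>X n w t - \<phi> t\<bar> < \<epsilon>1) \<and> X n w T \<le> R} \<le> exp (- (real n * b1))) sequentially"
  using X.local_upper[OF b(1) R] by blast
 obtain F2 \<epsilon>2 where F2: "finite F2" "F2 \<subseteq> {0..T}" "\<epsilon>2 > 0"
  and e2: "eventually (\<lambda>n. X.prob {w \<in> space M. (\<forall>t\<in>F2. \<bar>Y n w t - \<psi> t\<bar> < \<epsilon>2) \<and> Y n w T \<le> R} \<le> exp (- (real n * b2))) sequentially"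
  using Y.local_upper[OF b(2) R] by blast
 \<comment> \<open>Brings the extra constraint at \<open>T\<close> into cylinder form, as
   \<open>indep_product\<close> requires.\<close>
 have conv: "{w \<in> space M. \<forall>t\<in>insert T F. Z w t \<in> {y. (t \<in> F \<longrightarrow> \<bar>y - \<phi> t\<bar> < \<epsilon>) \<and> (t = T \<longrightarrow> y \<le> R)}} = {w \<in> space M. (\<forall>t\<in>F. \<bar>Z w t - \<phi> t\<bar> < \<epsilon>) \<and> Z w T \<le> R}"
  for F and Z :: "'a \<Rightarrow> real \<Rightarrow> real" and \<phi> \<epsilon> by auto
 show ?thesis
 proof (intro exI[of _ "F1 \<union> F2"] exI[of _ "min \<epsilon>1 \<epsilon>2"] conjI)
  show "finite (F1 \<union> F2)" "F1 \<union> F2 \<subseteq> {0..T}" "0 < min \<epsilon>1 \<epsilon>2" using F1 F2 by auto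
  show "eventually (\<lambda>n. \<exists>B\<in>sets M. X.prob B \<le> exp (- (real n * a)) \<and>
   {w \<in> space M. regular_at n w \<and> X n w T \<le> R \<and> Y n w T \<le> R \<and> (\<forall>t\<in>F1 \<union> F2. \<bar>X n w t - \<phi> t\<bar> < min \<epsilon>1 \<epsilon>2 \<and> \<bar>Y n w t - \<psi> t\<bar> < min \<epsilon>1 \<epsilon>2) \<and> Q n w \<in> C} \<subseteq> B) sequentially"
   using e1 e2 eventually_ge_at_top[of 1]
  proof eventually_elim
   case (elim n)
   have n: "n \<ge> 1" using elim(3) by simp
   define B1 where "B1 = {w \<in> space M. (\<forall>t\<in>F1. \<bar>X n w t - \<phi> t\<bar> < \<epsilon>1) \<and> X n w T \<le> R}"
   define B2 where "B2 = {w \<in> space M. (\<forall>t\<in>F2. \<bar>Y n w t - \<psi> t\<bar> < \<epsilon>2) \<and> Y n w T \<le> R}"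
   have [measurable]: "(\<lambda>w. X n w t) \<in> borel_measurable M" "(\<lambda>w. Y n w t) \<in> borel_measurable M" if "t \<in> {0..T}" for t
    using X.coord_measurable[OF n that] Y.coord_measurable[OF n that] .
   have T0: "T \<in> {0..T}" using X.T_pos by simp
   have [measurable]: "(\<lambda>w. X n w T) \<in> borel_measurable M" "(\<lambda>w. Y n w T) \<in> borel_measurable M"
    using X.coord_measurable[OF n T0] Y.coord_measurable[OF n T0] .
   have Bm: "B1 \<in> sets M" "B2 \<in> sets M"
    unfolding B1_def B2_def using F1 F2 by (auto intro!: sets.sets_Collect_conj sets.sets_Collect_finite_All borel_measurable_less borel_measurable_le)
   have ms: "{y. (t \<in> F \<longrightarrow> \<bar>y - \<phi> t\<bar> < \<epsilon>) \<and> (t = T \<longrightarrow> y \<le> R)} \<in> sets borel" for t F and \<phi> :: "real \<Rightarrow> real" and \<epsilon>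
    by (cases "t \<in> F"; cases "t = T") auto
   have "X.prob (B1 \<inter> B2) = X.prob B1 * X.prob B2"
    unfolding B1_def B2_def conv[symmetric] by (rule indep_product[OF n]) (use F1 F2 T0 ms in auto)
   also have "\<dots> \<le> exp (- (real n * b1)) * exp (- (real n * b2))"
    using elim unfolding B1_def[symmetric] B2_def[symmetric] by (intro mult_mono) auto
   also have "\<dots> = exp (- (real n * a))" by (simp add: exp_add[symmetric] b(3)[symmetric] algebra_simps)
   finally show ?case using Bm by (intro bexI[of _ "B1 \<inter> B2"]) (auto simp: B1_def B2_def)
  qed
 qed
next
 case False
 have fin: "I \<phi> \<le> ereal a" "L \<psi> \<le> ereal a"
  using False X.rate_nonneg[of \<phi>] Y.rate_nonneg[of \<psi>] by (cases "I \<phi>"; cases "L \<psi>"; auto)+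
 note r\<phi> = X.rate_finite_regular[OF fin(1) ext(1)] and r\<psi> = Y.rate_finite_regular[OF fin(2) ext(2)]
 note c\<phi> = X.rate_finite_cadlag[OF fin(1) ext(1)] and c\<psi> = Y.rate_finite_cadlag[OF fin(2) ext(2)]
 define q where "q = reflection_map T (path_diff T \<phi> \<psi>)"
 have qc: "q \<in> cadlag_space T" unfolding q_def by (intro reflection_map_cadlag path_diff_cadlag c\<phi> c\<psi> X.T_pos)
 have "q \<notin> C"
 proof
  assume "q \<in> C"
  then have "(INF q\<in>C. K q) \<le> K q" by (rule INF_lower)
  also have "\<dots> \<le> I \<phi> + L \<psi>" unfolding q_def by (rule workload_rate_le[OF c\<phi> c\<psi>])
  finally show False using False a by simp
 qed
 moreover have "openin (J1_topology T) (cadlag_space T - C)" using C by (simp add: closedin_def topspace_J1_topology)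
 ultimately obtain e where e: "e > 0" "\<forall>y\<in>cadlag_space T. skorokhod_dist T q y < e \<longrightarrow> y \<notin> C"
  using qc unfolding openin_J1_topology by blast
 \<comment> \<open>The factor four of \<open>queue_lipschitz\<close> turns \<open>e / 8\<close> for
   each path into \<open>e / 2\<close> for the workload.\<close>
 have e8: "e / 8 > 0" using e by simp
 obtain F1 \<epsilon>1 where F1: "finite F1" "F1 \<subseteq> {0..T}" "\<epsilon>1 > 0"
  and g1: "\<forall>x. mono_on {0..T} x \<and> (\<forall>t\<in>F1. \<bar>x t - \<phi> t\<bar> < \<epsilon>1) \<longrightarrow> (\<forall>t\<in>{0..T}. \<bar>x t - \<phi> t\<bar> \<le> e / 8)"
  by (rule mono_grid_uniform[OF X.T_pos _ e8]) (use r\<phi> in auto)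
 obtain F2 \<epsilon>2 where F2: "finite F2" "F2 \<subseteq> {0..T}" "\<epsilon>2 > 0"
  and g2: "\<forall>x. mono_on {0..T} x \<and> (\<forall>t\<in>F2. \<bar>x t - \<psi> t\<bar> < \<epsilon>2) \<longrightarrow> (\<forall>t\<in>{0..T}. \<bar>x t - \<psi> t\<bar> \<le> e / 8)"
  by (rule mono_grid_uniform[OF X.T_pos _ e8]) (use r\<psi> in auto)
 have "Q n w \<notin> C" if reg: "regular_at n w"
  and near: "\<forall>t\<in>F1 \<union> F2. \<bar>X n w t - \<phi> t\<bar> < min \<epsilon>1 \<epsilon>2 \<and> \<bar>Y n w t - \<psi> t\<bar> < min \<epsilon>1 \<epsilon>2" for n w
 proof -
  have "\<forall>t\<in>{0..T}. \<bar>X n w t - \<phi> t\<bar> \<le> e / 8" "\<forall>t\<in>{0..T}. \<bar>Y n w t - \<psi> t\<bar> \<le> e / 8"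
   using reg near unfolding regular_at_def by (intro g1[rule_format] g2[rule_format] ballI; simp)+
  then have "skorokhod_dist T q (Q n w) \<le> 4 * (e / 8)"
   unfolding q_def using reg by (intro queue_lipschitz c\<phi> c\<psi>) (auto simp: regular_at_def)
  then show ?thesis using e queue_cadlag[OF reg] by auto
 qed
 then show ?thesis using F1 F2
  by (intro exI[of _ "F1 \<union> F2"] exI[of _ "min \<epsilon>1 \<epsilon>2"] conjI always_eventually allI bexI[of _ "{}"]) auto
qed

lemma upper_bound:
 assumes C: "closedin (J1_topology T) C" and a: "ereal a < (INF q\<in>C. K q)"
 shows "limsup (\<lambda>n. ereal (1 / real n) * elog (emeasure (completion M) {\<omega> \<in> space M. Q n \<omega> \<in> C})) \<le> ereal (- a)"
proof -
 let ?B = "\<lambda>n. {\<omega> \<in> space M. Q n \<omega> \<in> C}"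
 obtain R1 where R1: "\<forall>n\<ge>1. X.prob {\<omega> \<in> space M. X n \<omega> T > R1} \<le> exp (- (real n * a))" using X.exp_tight by blast
 obtain R2 where R2: "\<forall>n\<ge>1. X.prob {\<omega> \<in> space M. Y n \<omega> T > R2} \<le> exp (- (real n * a))" using Y.exp_tight by blast
 define R where "R = max 0 (max R1 R2)"
 define E where "E n F \<epsilon> \<phi> \<psi> = {\<omega> \<in> space M. regular_at n \<omega> \<and> X n \<omega> T \<le> R \<and> Y n \<omega> T \<le> R \<and>
  (\<forall>t\<in>F. \<bar>X n \<omega> t - \<phi> t\<bar> < \<epsilon> \<and> \<bar>Y n \<omega> t - \<psi> t\<bar> < \<epsilon>) \<and> Q n \<omega> \<in> C}" for n F \<epsilon> \<phi> \<psi>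
 define P where "P F \<epsilon> \<phi> \<psi> \<longleftrightarrow> eventually (\<lambda>n. \<exists>B\<in>sets M. X.prob B \<le> exp (- (real n * a)) \<and> E n F \<epsilon> \<phi> \<psi> \<subseteq> B) sequentially" for F \<epsilon> \<phi> \<psi>
 obtain D where D: "finite D" "\<forall>(F, \<epsilon>, \<phi>, \<psi>)\<in>D. P F \<epsilon> \<phi> \<psi>" and cover:
  "\<forall>x\<in>{0..T} \<rightarrow>\<^sub>E {0..R}. \<forall>y\<in>{0..T} \<rightarrow>\<^sub>E {0..R}. \<exists>(F, \<epsilon>, \<phi>, \<psi>)\<in>D. \<forall>t\<in>F. \<bar>x t - \<phi> t\<bar> < \<epsilon> \<and> \<bar>y t - \<psi> t\<bar> < \<epsilon>"
 proof (rule box_pair_cover[where P=P and T=T and R=R])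
  fix \<phi> \<psi> assume "\<phi> \<in> {0..T} \<rightarrow>\<^sub>E {0..R}" "\<psi> \<in> {0..T} \<rightarrow>\<^sub>E {0..R}"
  then show "\<exists>F \<epsilon>. finite F \<and> F \<subseteq> {0..T} \<and> 0 < \<epsilon> \<and> P F \<epsilon> \<phi> \<psi>"
   unfolding P_def E_def by (intro closed_pair_bound[OF C a]) (auto simp: R_def PiE_def)
 qed
 \<comment> \<open>One term for each member of the cover and one for each of the two tails; the
   factor disappears in the limit as \<open>ln k / real n\<close>.\<close>
 define k where "k = real (card D) + 2"
 have k: "k > 0" by (simp add: k_def)
 have "eventually (\<lambda>n. \<forall>d\<in>D. \<exists>B\<in>sets M. X.prob B \<le> exp (- (real n * a)) \<and> (case d of (F, \<epsilon>, \<phi>, \<psi>) \<Rightarrow> E n F \<epsilon> \<phi> \<psi>) \<subseteq> B) sequentially"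
  using D unfolding P_def by (intro eventually_ball_finite) auto
 with eventually_ge_at_top[of 1]
 have ev: "eventually (\<lambda>n. ereal (1 / real n) * elog (emeasure (completion M) (?B n)) \<le> ereal (ln k / real n - a)) sequentially"
 proof eventually_elim
  case (elim n)
  obtain B where B0: "\<forall>d\<in>D. B d \<in> sets M \<and> X.prob (B d) \<le> exp (- (real n * a)) \<and> (case d of (F, \<epsilon>, \<phi>, \<psi>) \<Rightarrow> E n F \<epsilon> \<phi> \<psi>) \<subseteq> B d"
   using bchoice[OF elim(2)[unfolded Bex_def]] by blast
  then have B: "\<And>d. d \<in> D \<Longrightarrow> B d \<in> sets M" "\<And>d. d \<in> D \<Longrightarrow> X.prob (B d) \<le> exp (- (real n * a))" by auto
  obtain N where N: "N \<in> null_sets M" "\<forall>\<omega>\<in>space M - N. regular_at n \<omega>" using exceptional_set elim(1) by blast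
  define BX where "BX = {\<omega> \<in> space M. X n \<omega> T > R1}"
  define BY where "BY = {\<omega> \<in> space M. Y n \<omega> T > R2}"
  let ?A = "BX \<union> BY \<union> (\<Union>d\<in>D. B d)"
  have [measurable]: "(\<lambda>\<omega>. X n \<omega> T) \<in> borel_measurable M" "(\<lambda>\<omega>. Y n \<omega> T) \<in> borel_measurable M"
   using X.T_pos elim(1) by (auto intro: X.coord_measurable Y.coord_measurable)
  have Bm: "BX \<in> sets M" "BY \<in> sets M" unfolding BX_def BY_def by measurable
  have UD: "(\<Union>d\<in>D. B d) \<in> sets M" using D B by (intro sets.finite_UN) auto
  have sub: "(?B n) \<subseteq> N \<union> ?A"
  proof
   fix \<omega> assume w: "\<omega> \<in> (?B n)"
   show "\<omega> \<in> N \<union> ?A"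
   proof (rule ccontr)
    assume no: "\<omega> \<notin> N \<union> ?A"
    then have r: "regular_at n \<omega>" using N w by auto
    have le: "X n \<omega> T \<le> R" "Y n \<omega> T \<le> R" using no w by (auto simp: BX_def BY_def R_def)
    have box: "x \<in> {0..T} \<rightarrow>\<^sub>E {0..R}" if "x \<in> cadlag_space T" "mono_on {0..T} x" "x 0 = 0" "x T \<le> R" for x
    proof (rule PiE_I)
     show "x t \<in> {0..R}" if t: "t \<in> {0..T}" for t
      using mono_onD[OF \<open>mono_on {0..T} x\<close>, of 0 t] mono_onD[OF \<open>mono_on {0..T} x\<close>, of t T] t X.T_pos \<open>x 0 = 0\<close> \<open>x T \<le> R\<close> by simp
    qed (use \<open>x \<in> cadlag_space T\<close> in \<open>auto simp: cadlag_space_def extensional_def\<close>)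
    have "X n \<omega> \<in> {0..T} \<rightarrow>\<^sub>E {0..R}" "Y n \<omega> \<in> {0..T} \<rightarrow>\<^sub>E {0..R}"
     using r le unfolding regular_at_def by (simp_all add: box)
    then have "\<exists>(F, \<epsilon>, \<phi>, \<psi>)\<in>D. \<forall>t\<in>F. \<bar>X n \<omega> t - \<phi> t\<bar> < \<epsilon> \<and> \<bar>Y n \<omega> t - \<psi> t\<bar> < \<epsilon>" using cover by blast
    then obtain F \<epsilon> \<phi> \<psi> where d: "(F, \<epsilon>, \<phi>, \<psi>) \<in> D"
     "\<forall>t\<in>F. \<bar>X n \<omega> t - \<phi> t\<bar> < \<epsilon> \<and> \<bar>Y n \<omega> t - \<psi> t\<bar> < \<epsilon>"
     by auto
    then have "\<omega> \<in> E n F \<epsilon> \<phi> \<psi>" using r le w by (simp add: E_def)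
    then show False using bspec[OF B0 d(1)] no d(1) by auto
   qed
  qed
  have "emeasure (completion M) (?B n) \<le> emeasure (completion M) (N \<union> ?A)"
   using N Bm UD sub by (intro emeasure_mono) auto
  also have "\<dots> = emeasure M (N \<union> ?A)"
   using N Bm UD by (auto simp: main_part_sets)
  also have "\<dots> = emeasure M ?A" using N Bm UD by (subst Un_commute, intro emeasure_Un_null_set) auto
  also have "\<dots> = ennreal (X.prob ?A)" by (rule X.emeasure_eq_measure)
  also have "X.prob ?A \<le> X.prob BX + X.prob BY + (\<Sum>d\<in>D. X.prob (B d))"
   using Bm UD B(1) D(1) measure_Un_le[OF Bm] measure_Un_le[OF sets.Un[OF Bm] UD]
    X.finite_measure_subadditive_finite[of D B] by (simp add: image_subset_iff)
  also have "\<dots> \<le> exp (- (real n * a)) + exp (- (real n * a)) + (\<Sum>d\<in>D. exp (- (real n * a)))"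
   using R1 R2 elim(1) B(2) unfolding BX_def BY_def by (intro add_mono sum_mono) auto
  also have "\<dots> = exp (ln k - real n * a)" using k by (simp add: k_def exp_diff exp_minus field_simps)
  finally have "elog (emeasure (completion M) (?B n)) \<le> ereal (ln k - real n * a)"
   unfolding elog_le_iff_exp by (simp add: ennreal_leI)
  then have "ereal (1 / real n) * elog (emeasure (completion M) (?B n)) \<le> ereal (1 / real n) * ereal (ln k - real n * a)"
   by (intro ereal_mult_left_mono) auto
  then show ?case using elim(1) by (simp add: field_simps)
 qed
 have "(\<lambda>n. ereal (ln k / real n - a)) \<longlonglongrightarrow> ereal (0 - a)"
  by (intro tendsto_ereal tendsto_diff lim_const_over_n tendsto_const)
 then have "limsup (\<lambda>n. ereal (ln k / real n - a)) = ereal (- a)" by (intro lim_imp_Limsup) auto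
 then show ?thesis using Limsup_mono[OF ev] by simp
qed

text \<open>Finite rates make both paths continuous, so closeness at finitely many times already
  forces the workload into \<open>G\<close>; independence adds the two costs, each with its own
  \<open>\<eta>\<close>.\<close>

lemma lower_bound:
 assumes G: "openin (J1_topology T) G" and \<phi>: "\<phi> \<in> cadlag_space T" and \<psi>: "\<psi> \<in> cadlag_space T"
  and q: "reflection_map T (path_diff T \<phi> \<psi>) \<in> G" and I: "I \<phi> \<le> ereal a" and L: "L \<psi> \<le> ereal b" and \<eta>: "\<eta> > 0"
 shows "ereal (- (a + b + 2 * \<eta>)) \<le> liminf (\<lambda>n. ereal (1 / real n) * elog (emeasure (completion M) {\<omega> \<in> space M. Q n \<omega> \<in> G}))"
proof (rule Liminf_bounded)
 let ?A = "\<lambda>n. {\<omega> \<in> space M. Q n \<omega> \<in> G}"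
 have ext: "\<phi> \<in> extensional {0..T}" "\<psi> \<in> extensional {0..T}" using \<phi> \<psi> by (auto simp: cadlag_space_def)
 note r\<phi> = X.rate_finite_regular[OF I ext(1)] and r\<psi> = Y.rate_finite_regular[OF L ext(2)]
 obtain e where e: "e > 0" "\<forall>y\<in>cadlag_space T. skorokhod_dist T (reflection_map T (path_diff T \<phi> \<psi>)) y < e \<longrightarrow> y \<in> G"
  using q G unfolding openin_J1_topology by blast
 have e8: "e / 8 > 0" using e by simp
 obtain F1 \<epsilon>1 where F1: "finite F1" "F1 \<subseteq> {0..T}" "\<epsilon>1 > 0"
  and g1: "\<forall>x. mono_on {0..T} x \<and> (\<forall>t\<in>F1. \<bar>x t - \<phi> t\<bar> < \<epsilon>1) \<longrightarrow> (\<forall>t\<in>{0..T}. \<bar>x t - \<phi> t\<bar> \<le> e / 8)"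
  by (rule mono_grid_uniform[OF X.T_pos _ e8]) (use r\<phi> in auto)
 obtain F2 \<epsilon>2 where F2: "finite F2" "F2 \<subseteq> {0..T}" "\<epsilon>2 > 0"
  and g2: "\<forall>x. mono_on {0..T} x \<and> (\<forall>t\<in>F2. \<bar>x t - \<psi> t\<bar> < \<epsilon>2) \<longrightarrow> (\<forall>t\<in>{0..T}. \<bar>x t - \<psi> t\<bar> \<le> e / 8)"
  by (rule mono_grid_uniform[OF X.T_pos _ e8]) (use r\<psi> in auto)
 show "eventually (\<lambda>n. ereal (- (a + b + 2 * \<eta>)) \<le> ereal (1 / real n) * elog (emeasure (completion M) (?A n))) sequentially"
  using X.local_lower[OF I ext(1) F1 \<eta>] Y.local_lower[OF L ext(2) F2 \<eta>] eventually_ge_at_top[of 1]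
 proof eventually_elim
  case (elim n)
  define B1 where "B1 = {\<omega> \<in> space M. \<forall>t\<in>F1. \<bar>X n \<omega> t - \<phi> t\<bar> < \<epsilon>1}"
  define B2 where "B2 = {\<omega> \<in> space M. \<forall>t\<in>F2. \<bar>Y n \<omega> t - \<psi> t\<bar> < \<epsilon>2}"
  obtain N where N: "N \<in> null_sets M" "\<forall>\<omega>\<in>space M - N. regular_at n \<omega>" using exceptional_set elim(3) by blast
  have Bm: "B1 \<in> sets M" "B2 \<in> sets M" unfolding B1_def B2_def using F1 F2 elim(3)
   by (auto intro!: sets.sets_Collect_finite_All borel_measurable_less borel_measurable_abs borel_measurable_diff X.coord_measurable Y.coord_measurable)
  have sub: "B1 \<inter> B2 - N \<subseteq> (?A n)"
  proof clarify
   fix \<omega> assume w: "\<omega> \<in> B1" "\<omega> \<in> B2" "\<omega> \<notin> N"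
   then have reg: "regular_at n \<omega>" and ws: "\<omega> \<in> space M" using N by (auto simp: B1_def)
   have "\<forall>t\<in>{0..T}. \<bar>X n \<omega> t - \<phi> t\<bar> \<le> e / 8" "\<forall>t\<in>{0..T}. \<bar>Y n \<omega> t - \<psi> t\<bar> \<le> e / 8"
    using reg w unfolding regular_at_def B1_def B2_def by (intro g1[rule_format] g2[rule_format] ballI; simp)+
   then have "skorokhod_dist T (reflection_map T (path_diff T \<phi> \<psi>)) (Q n \<omega>) \<le> 4 * (e / 8)"
    using reg by (intro queue_lipschitz \<phi> \<psi>) (auto simp: regular_at_def)
   then show "\<omega> \<in> space M \<and> Q n \<omega> \<in> G" using e queue_cadlag[OF reg] ws by auto
  qed
  have ms: "{y. \<bar>y - c\<bar> < \<epsilon>} \<in> sets borel" for c \<epsilon> :: real by measurable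
  have "X.prob (B1 \<inter> B2) = X.prob B1 * X.prob B2"
   using indep_product[OF elim(3) F1(1,2) F2(1,2), of "\<lambda>t. {y. \<bar>y - \<phi> t\<bar> < \<epsilon>1}" "\<lambda>t. {y. \<bar>y - \<psi> t\<bar> < \<epsilon>2}"] ms
   unfolding B1_def B2_def by simp
  moreover have "exp (- (real n * (a + \<eta>))) * exp (- (real n * (b + \<eta>))) \<le> X.prob B1 * X.prob B2"
   using elim(1,2) unfolding B1_def B2_def by (intro mult_mono) auto
  moreover have "- (real n * (a + \<eta>)) + - (real n * (b + \<eta>)) = - (real n * (a + b + 2 * \<eta>))" by (simp add: algebra_simps)
  ultimately have "ennreal (exp (- (real n * (a + b + 2 * \<eta>)))) \<le> ennreal (X.prob (B1 \<inter> B2))"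
   by (intro ennreal_leI) (metis exp_add)
  also have "\<dots> = emeasure M (B1 \<inter> B2)" by (rule X.emeasure_eq_measure[symmetric])
  also have "\<dots> = emeasure M (B1 \<inter> B2 - N)" using N Bm by (simp add: emeasure_Diff_null_set)
  also have "\<dots> = emeasure (completion M) (B1 \<inter> B2 - N)" using N Bm by (auto simp: main_part_sets)
  also have "\<dots> \<le> emeasure (completion M) (?A n)"
   by (intro emeasure_mono sub queue_open_measurable[OF elim(3) G])
  finally have "ereal (- (real n * (a + b + 2 * \<eta>))) \<le> elog (emeasure (completion M) (?A n))"
   unfolding elog_ge_iff_exp .
  then have "ereal (1 / real n) * ereal (- (real n * (a + b + 2 * \<eta>))) \<le> ereal (1 / real n) * elog (emeasure (completion M) (?A n))"
   by (intro ereal_mult_left_mono) auto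
  then show ?case using elim(3) by simp
 qed
qed

theorem workload_LDP: "satisfies_LDP M (J1_topology T) Q K"
 unfolding satisfies_LDP_def topspace_J1_topology
proof (intro conjI allI impI ballI workload_rate_nonneg queue_open_measurable)
 show "AE w in M. Q n w \<in> cadlag_space T" if "1 \<le> n" for n
  using AE_regular[OF that] by eventually_elim (rule queue_cadlag)
next
 fix C assume C: "closedin (J1_topology T) C"
 let ?l = "limsup (\<lambda>n. ereal (1 / real n) * elog (emeasure (completion M) {w \<in> space M. Q n w \<in> C}))"
 show "?l \<le> - (INF q\<in>C. K q)"
 proof (rule ccontr)
  assume "\<not> ?l \<le> - (INF q\<in>C. K q)"
  then have "- (INF q\<in>C. K q) < ?l" by simp
  from ereal_dense2[OF this] obtain z where z: "- (INF q\<in>C. K q) < ereal z" "ereal z < ?l" by blast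
  then have "ereal (- z) < (INF q\<in>C. K q)" using ereal_minus_less_minus[of "INF q\<in>C. K q" "ereal (- z)"] by simp
  from upper_bound[OF C this] show False using z(2) by simp
 qed
next
 fix G assume G: "openin (J1_topology T) G"
 let ?l = "liminf (\<lambda>n. ereal (1 / real n) * elog (emeasure (completion M) {w \<in> space M. Q n w \<in> G}))"
 have "- ?l \<le> I \<phi> + L \<psi>" if p: "\<phi> \<in> cadlag_space T" "\<psi> \<in> cadlag_space T" "reflection_map T (path_diff T \<phi> \<psi>) \<in> G" for \<phi> \<psi>
 proof (cases "I \<phi>"; cases "L \<psi>")
  fix a b assume ab: "I \<phi> = ereal a" "L \<psi> = ereal b"
  have "- ?l \<le> ereal (a + b) + ereal \<eta>" if "\<eta> > 0" for \<eta>
  proof -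
   have "ereal (- (a + b + 2 * (\<eta> / 2))) \<le> ?l" by (rule lower_bound[OF G p]) (use ab that in auto)
   then have "- ?l \<le> - ereal (- (a + b + \<eta>))" by (simp only: ereal_minus_le_minus mult_2[symmetric]) (simp add: algebra_simps)
   moreover have "- ereal (- (a + b + \<eta>)) = ereal (a + b) + ereal \<eta>" by simp
   ultimately show ?thesis by (simp only:)
  qed
  then have "- ?l \<le> ereal (a + b)" by (rule ereal_le_epsilon2)
  then show ?thesis unfolding ab plus_ereal.simps .
 qed (use X.rate_nonneg[of \<phi>] Y.rate_nonneg[of \<psi>] in auto)
 then have "- ?l \<le> (INF q\<in>G. K q)" unfolding workload_rate_def by (intro INF_greatest Inf_greatest) blast
 then show "- (INF q\<in>G. K q) \<le> ?l" by (rule ereal_uminus_le_reorder[THEN iffD1])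
qed

end

context arrival_copies
begin

text \<open>A path with \<open>\<phi> 0 \<noteq> 0\<close> is not penalised by \<open>arrival_rate\<close>, which samples positive times only;
 within the Skorokhod space right-continuity excludes it.\<close>

abbreviation "arrival_rate0 \<phi> \<equiv> (if \<phi> 0 = 0 then arrival_rate N arr T \<phi> else \<infinity>)"

lemma arrival_rate0_eq: "\<phi> \<in> cadlag_space T \<Longrightarrow> arrival_rate0 \<phi> = arrival_rate N arr T \<phi>"
 using arrival_rate_finite_zero[of \<phi>] arrival_rate_nonneg[of \<phi>] by (cases "arrival_rate N arr T \<phi>") auto

lemma arrival_path_rate: "monotone_path_rate M T Abar arrival_rate0"
proof
 show "0 < T" "0 \<le> arrival_rate0 \<phi>" for \<phi> using T_pos arrival_rate_nonneg by auto
 show m: "(\<lambda>w. Abar n w t) \<in> borel_measurable M" if "n \<ge> 1" "t \<in> {0..T}" for n t by (rule Abar_coord_measurable[OF that(2)])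
 show reg: "AE w in M. Abar n w \<in> cadlag_space T \<and> mono_on {0..T} (Abar n w) \<and> Abar n w 0 = 0" if "n \<ge> 1" for n
  using A_regular_AE
 proof eventually_elim
  case (elim w)
  then have A: "\<And>i. i \<in> {1..n} \<Longrightarrow> A i w \<in> cadlag_space T" "\<And>i. i \<in> {1..n} \<Longrightarrow> mono_on {0..T} (A i w)"
   "\<And>i. i \<in> {1..n} \<Longrightarrow> A i w 0 = 0" by auto
  have "mono_on {0..T} (Abar n w)"
   by (intro mono_onI) (auto simp: Abar_eq intro!: divide_right_mono sum_mono mono_onD[OF A(2)])
  then show ?case using sum_cadlag[of "{1..n}" "\<lambda>i. A i w" T "1 / real n"] A T_pos by (simp add: empirical_mean_def)
 qed
 show "mono_on {0..T} \<phi> \<and> continuous_on {0..T} \<phi> \<and> \<phi> 0 = 0" if "arrival_rate0 \<phi> \<le> ereal a" for \<phi> a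
  using that arrival_rate_finite_continuous by (auto split: if_splits)
 show "\<exists>R. \<forall>n\<ge>1. M.prob {w \<in> space M. Abar n w T > R} \<le> exp (- (real n * a))" for a
  by (rule Abar_tail[of a]) blast
 show "\<exists>F \<epsilon>. finite F \<and> F \<subseteq> {0..T} \<and> \<epsilon> > 0 \<and> eventually (\<lambda>n.
  M.prob {w \<in> space M. (\<forall>t\<in>F. \<bar>Abar n w t - \<phi> t\<bar> < \<epsilon>) \<and> Abar n w T \<le> R} \<le> exp (- (real n * b))) sequentially"
  if b: "ereal b < arrival_rate0 \<phi>" for b \<phi> R
 proof (cases "\<phi> 0 = 0")
  case True
  obtain F \<epsilon> where F: "finite F" "F \<subseteq> {0..T}" "\<epsilon> > 0"
   "\<forall>n\<ge>1. M.prob {w \<in> space M. \<forall>t\<in>F. \<bar>Abar n w t - \<phi> t\<bar> < \<epsilon>} \<le> exp (- (real n * b))"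
   using Abar_local_upper[of b \<phi>] b True by auto
  have "M.prob {w \<in> space M. (\<forall>t\<in>F. \<bar>Abar n w t - \<phi> t\<bar> < \<epsilon>) \<and> Abar n w T \<le> R} \<le> exp (- (real n * b))" if n: "n \<ge> 1" for n
  proof (rule order_trans[OF M.finite_measure_mono F(4)[rule_format, OF n]])
   show "{w \<in> space M. \<forall>t\<in>F. \<bar>Abar n w t - \<phi> t\<bar> < \<epsilon>} \<in> sets M" using F m[OF n]
    by (auto intro!: sets.sets_Collect_finite_All borel_measurable_less borel_measurable_abs borel_measurable_diff)
  qed auto
  then show ?thesis using F by (intro exI[of _ F] exI[of _ \<epsilon>] conjI eventually_sequentiallyI[of 1]) auto
 next
  case False
  \<comment> \<open>A centre not starting at zero is excluded by the single coordinate zero, where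
    the empirical mean vanishes almost surely.\<close>
  have "M.prob {w \<in> space M. (\<forall>t\<in>{0}. \<bar>Abar n w t - \<phi> t\<bar> < \<bar>\<phi> 0\<bar>) \<and> Abar n w T \<le> R} \<le> exp (- (real n * b))" if "n \<ge> 1" for n
   by (rule order_trans[OF M.finite_measure_mono_AE[of _ "{}"]]) (use reg[OF that] in auto)
  then show ?thesis using T_pos False
   by (intro exI[of _ "{0}"] exI[of _ "\<bar>\<phi> 0\<bar>"] conjI eventually_sequentiallyI[of 1]) auto
 qed
 show "eventually (\<lambda>n. exp (- (real n * (a + \<eta>))) \<le> M.prob {w \<in> space M. \<forall>t\<in>F. \<bar>Abar n w t - \<phi> t\<bar> < \<epsilon>}) sequentially"
  if "arrival_rate0 \<phi> \<le> ereal a" "finite F" "F \<subseteq> {0..T}" "\<epsilon> > 0" "\<eta> > 0" for \<phi> a F \<epsilon> \<eta>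
  by (rule Abar_local_lower) (use that in \<open>auto split: if_splits\<close>)
qed

end

context renewal_service
begin

lemma Sbar_cadlag:
 assumes g: "good w" and n: "n \<ge> 1"
 shows "Sbar n w \<in> cadlag_space T" "mono_on {0..T} (Sbar n w)" "Sbar n w 0 = 0"
proof -
 show mono: "mono_on {0..T} (Sbar n w)"
  by (intro mono_onI) (auto simp: Sbar_eq intro!: divide_right_mono renewal_count_mono[OF g] mult_left_mono)
 show "Sbar n w 0 = 0" using T_pos renewal_count_0[OF g] by (simp add: Sbar_eq)
 show "Sbar n w \<in> cadlag_space T"
  unfolding cadlag_space_def mem_Collect_eq
 proof (intro conjI ballI)
  show "Sbar n w \<in> extensional {0..T}" by (simp add: scaled_renewal_def)
  show "\<exists>l. (Sbar n w \<longlongrightarrow> l) (at_left t)" if "t \<in> {0<..T}" for t using mono_at_left_limit[OF mono that] by blast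
  fix t assume t: "t \<in> {0..<T}"
  let ?k = "R w (real n * t)"
  have "real n * t < V (Suc ?k) w" using renewal_count_less_iff[OF g, of "real n * t" "Suc ?k"] t by simp
  then have "t < min T (V (Suc ?k) w / real n)" using t n by (simp add: pos_less_divide_eq mult.commute)
  then have "eventually (\<lambda>s. s \<in> {t<..<min T (V (Suc ?k) w / real n)}) (at_right t)" by (rule eventually_at_right_real)
  then have "eventually (\<lambda>s. Sbar n w s = Sbar n w t) (at_right t)"
  proof eventually_elim
   case (elim s)
   have "R w (real n * s) < Suc ?k" using elim t n by (subst renewal_count_less_iff[OF g]) (auto simp: pos_less_divide_eq mult.commute)
   moreover have "?k \<le> R w (real n * s)" using elim t by (intro renewal_count_mono[OF g] mult_left_mono) auto
   ultimately show ?case using elim t by (simp add: Sbar_eq)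
  qed
  then show "(Sbar n w \<longlongrightarrow> Sbar n w t) (at_right t)" by (rule tendsto_eventually)
 qed
qed

text \<open>For the upper bound the irregular centres are removed one by one: a decrease or a
  nonzero start contradicts an almost sure property at one or two times, and a discontinuity is
  excluded by \<open>Sbar_window\<close>. Only for continuous monotone centres does the rate itself
  enter, through a tilted family.\<close>

lemma service_path_rate: "monotone_path_rate M T Sbar (service_rate \<Lambda>S T)"
proof
 show "0 < T" "0 \<le> service_rate \<Lambda>S T \<psi>" for \<psi> using T_pos by (auto simp: service_rate_def)
 show m: "(\<lambda>\<omega>. Sbar n \<omega> t) \<in> borel_measurable M" if "n \<ge> 1" "t \<in> {0..T}" for n t by (rule Sbar_measurable[OF that])
 show reg: "AE \<omega> in M. Sbar n \<omega> \<in> cadlag_space T \<and> mono_on {0..T} (Sbar n \<omega>) \<and> Sbar n \<omega> 0 = 0" if "n \<ge> 1" for n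
  using AE_good by eventually_elim (intro conjI Sbar_cadlag that)
 show fin: "mono_on {0..T} \<psi> \<and> continuous_on {0..T} \<psi> \<and> \<psi> 0 = 0" if "service_rate \<Lambda>S T \<psi> \<le> ereal a" for \<psi> a
  using that by (auto simp: service_rate_def abs_continuous_on_imp_continuous_on split: if_splits)
 show "\<exists>R. \<forall>n\<ge>1. prob {\<omega> \<in> space M. Sbar n \<omega> T > R} \<le> exp (- (real n * a))" for a
  by (rule Sbar_tail[of a]) blast
 show "eventually (\<lambda>n. exp (- (real n * (a + \<eta>))) \<le> prob {\<omega> \<in> space M. \<forall>t\<in>F. \<bar>Sbar n \<omega> t - \<psi> t\<bar> < \<epsilon>}) sequentially"
  if r: "service_rate \<Lambda>S T \<psi> \<le> ereal a" and F: "finite F" "F \<subseteq> {0..T}" "\<epsilon> > 0" "\<eta> > 0" for \<psi> a F \<epsilon> \<eta>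
 proof (rule Sbar_local_lower[OF _ _ _ _ F])
  fix P \<theta> assume "slm.tilted_family T P \<theta>"
  then have "ereal (slm.tilted_value P \<theta> \<psi>) \<le> ereal a" by (rule order_trans[OF slm.tilted_value_le_service_rate[OF T_pos] r])
  then show "slm.tilted_value P \<theta> \<psi> \<le> a" by simp
 qed (use fin[OF r] in auto)
 fix b \<psi> and Rb :: real assume b: "ereal b < service_rate \<Lambda>S T \<psi>" and Rb: "Rb \<ge> 0"
 let ?E = "\<lambda>F \<epsilon> n. {\<omega> \<in> space M. (\<forall>t\<in>F. \<bar>Sbar n \<omega> t - \<psi> t\<bar> < \<epsilon>) \<and> Sbar n \<omega> T \<le> Rb}"
 have null: "prob (?E F \<epsilon> n) \<le> exp (- (real n * b))"
  if "AE \<omega> in M. \<not> (\<forall>t\<in>F. \<bar>Sbar n \<omega> t - \<psi> t\<bar> < \<epsilon>)" for F \<epsilon> n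
  by (rule order_trans[OF finite_measure_mono_AE[of _ "{}"]]) (use that in auto)
 show "\<exists>F \<epsilon>. finite F \<and> F \<subseteq> {0..T} \<and> \<epsilon> > 0 \<and> eventually (\<lambda>n. prob (?E F \<epsilon> n) \<le> exp (- (real n * b))) sequentially"
 proof (cases "mono_on {0..T} \<psi>")
  case False
  then obtain s t where st: "s \<in> {0..T}" "t \<in> {0..T}" "s \<le> t" "\<psi> t < \<psi> s" by (auto simp: mono_on_def not_le)
  have "prob (?E {s, t} ((\<psi> s - \<psi> t) / 2) n) \<le> exp (- (real n * b))" if n: "n \<ge> 1" for n
  proof (rule null)
   show "AE \<omega> in M. \<not> (\<forall>r\<in>{s, t}. \<bar>Sbar n \<omega> r - \<psi> r\<bar> < (\<psi> s - \<psi> t) / 2)" using reg[OF n]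
   proof eventually_elim
    case (elim \<omega>)
    then have "Sbar n \<omega> s \<le> Sbar n \<omega> t" using st by (auto intro: mono_onD)
    then show ?case by (auto simp: abs_if field_simps split: if_splits)
   qed
  qed
  then show ?thesis using st by (intro exI[of _ "{s, t}"] exI[of _ "(\<psi> s - \<psi> t) / 2"] conjI eventually_sequentiallyI[of 1]) auto
 next
  case mono: True
  show ?thesis
  proof (cases "\<psi> 0 = 0")
   case False
   have "prob (?E {0} \<bar>\<psi> 0\<bar> n) \<le> exp (- (real n * b))" if "n \<ge> 1" for n
    by (rule null) (use reg[OF that] in eventually_elim, auto)
   then show ?thesis using T_pos False by (intro exI[of _ "{0}"] exI[of _ "\<bar>\<psi> 0\<bar>"] conjI eventually_sequentiallyI[of 1]) auto
  next
   case z: True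
   show ?thesis
   proof (cases "continuous_on {0..T} \<psi>")
    case True
    have "\<not> (\<forall>P \<theta>. slm.tilted_family T P \<theta> \<longrightarrow> slm.tilted_value P \<theta> \<psi> \<le> b)"
     using slm.service_rate_le_of_tilted_bound[OF T_pos _ mono z, of b] b by (auto simp: not_le[symmetric])
    then obtain P \<theta> where P: "slm.tilted_family T P \<theta>" "b < slm.tilted_value P \<theta> \<psi>" by (auto simp: not_le)
    show ?thesis
     by (rule Sbar_local_upper[OF P(1) mono True Rb, of "slm.tilted_value P \<theta> \<psi> - b"]) (use P(2) in auto)
   next
    case False
    then have "\<not> uniformly_continuous_on {0..T} \<psi>" using uniformly_continuous_imp_continuous by blast
    then obtain e where e: "e > 0" "\<forall>d>0. \<exists>s\<in>{0..T}. \<exists>t\<in>{0..T}. dist t s < d \<and> \<not> dist (\<psi> t) (\<psi> s) < e"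
     unfolding uniformly_continuous_on_def by meson
    obtain d where d: "d > 0" "\<forall>u v. 0 \<le> u \<and> u \<le> v \<and> v \<le> T \<and> v - u < d \<longrightarrow>
     eventually (\<lambda>n. prob {\<omega> \<in> space M. Sbar n \<omega> v - Sbar n \<omega> u \<ge> e / 2 \<and> Sbar n \<omega> T \<le> Rb} \<le> exp (- (real n * b))) sequentially"
     using Sbar_window[of "e / 2" Rb b] e Rb by auto
    obtain s t where st: "s \<in> {0..T}" "t \<in> {0..T}" "dist t s < d" "\<not> dist (\<psi> t) (\<psi> s) < e" using e(2) d(1) by blast
    define u v where "u = min s t" "v = max s t"
    have uv: "0 \<le> u" "u \<le> v" "v \<le> T" "v - u < d" using st by (auto simp: u_v_def dist_real_def)
    have jump: "e \<le> \<psi> v - \<psi> u" using st mono_onD[OF mono, of u v] uv by (auto simp: u_v_def dist_real_def min_def max_def split: if_splits)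
    from uv have w: "0 \<le> u \<and> u \<le> v \<and> v \<le> T \<and> v - u < d" by simp
    have "eventually (\<lambda>n. prob (?E {u, v} (e / 4) n) \<le> exp (- (real n * b))) sequentially"
     using d(2)[rule_format, OF w] eventually_ge_at_top[of 1]
    proof eventually_elim
     case (elim n)
     have [measurable]: "(\<lambda>\<omega>. Sbar n \<omega> u) \<in> borel_measurable M" "(\<lambda>\<omega>. Sbar n \<omega> v) \<in> borel_measurable M" "(\<lambda>\<omega>. Sbar n \<omega> T) \<in> borel_measurable M"
      using uv elim T_pos by (auto intro!: Sbar_measurable)
     have "prob (?E {u, v} (e / 4) n) \<le> prob {\<omega> \<in> space M. Sbar n \<omega> v - Sbar n \<omega> u \<ge> e / 2 \<and> Sbar n \<omega> T \<le> Rb}"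
      using jump by (intro finite_measure_mono) (auto simp: abs_if field_simps split: if_splits)
     then show ?case using elim by simp
    qed
    then show ?thesis using uv e(1) by (intro exI[of _ "{u, v}"] exI[of _ "e / 4"]) auto
   qed
  qed
 qed
qed

end

theorem mainTheorem3:
  fixes \<Delta> T :: real
    and N :: "'b measure" and \<tau> :: "int \<Rightarrow> 'b \<Rightarrow> real" and f :: "real \<Rightarrow> real"
    and M :: "'a measure" and A :: "nat \<Rightarrow> 'a \<Rightarrow> real \<Rightarrow> real" and S :: "nat \<Rightarrow> 'a \<Rightarrow> real"
  assumes "\<Delta> > 0" and "T > 0"
    \<comment> \<open>the perturbations and the generic arrival process\<close>
    and "prob_space N"
    and "prob_space.indep_vars N (\<lambda>_. borel) \<tau> UNIV"
    and "\<And>x. 0 \<le> f x"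
    and "\<And>k. distributed N lborel (\<tau> k) (\<lambda>x. ennreal (f x))"
    and "(SUP u\<in>{0..T}. \<Sum>\<^sub>\<infinity>k::int. ennreal (f (u - real_of_int k * \<Delta>))) < \<infinity>"
    and "prob_space M"
    \<comment> \<open>i.i.d. copies of the arrival process\<close>
    and "prob_space.indep_vars M (\<lambda>_. path_algebra T) A {1..}"
    and "\<And>i. i \<ge> 1 \<Longrightarrow> AE \<omega> in M. A i \<omega> \<in> cadlag_space T"
    and "\<And>i. i \<ge> 1 \<Longrightarrow> distr M (path_algebra T) (A i) =
           distr N (path_algebra T) (\<lambda>\<omega>. \<lambda>t\<in>{0..T}. arrival_count \<Delta> \<tau> \<omega> t)"
    \<comment> \<open>i.i.d. positive service times\<close>
    and "prob_space.indep_vars M (\<lambda>_. borel) S {1..}"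
    and "\<And>i. i \<ge> 1 \<Longrightarrow> distr M borel (S i) = distr M borel (S 1)"
    and "\<And>i. i \<ge> 1 \<Longrightarrow> AE \<omega> in M. 0 < S i \<omega>"
    and "\<And>n. n \<ge> 1 \<Longrightarrow>
           prob_space.indep_var M (path_algebra T) (empirical_mean T A n)
                                  (path_algebra T) (scaled_renewal T S n)"
  shows "satisfies_LDP M (J1_topology T)
           (\<lambda>n \<omega>. reflection_map T (path_diff T (empirical_mean T A n \<omega>) (scaled_renewal T S n \<omega>)))
           (workload_rate T (arrival_rate N (arrival_count \<Delta> \<tau>) T)
                            (service_rate (log_mgf M (S 1)) T))"
proof -
 let ?A = "\<lambda>u k. u - real_of_int k * \<Delta>"
 interpret N: prob_space N by fact
 interpret M: prob_space M by fact
 \<comment> \<open>Finiteness of this supremum yields the real intensity bound of the arrival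
   locale.\<close>
 let ?s = "SUP u\<in>{0..T}. \<Sum>\<^sub>\<infinity>k::int. ennreal (f (?A u k))"
 have "(\<Sum>k\<in>F. f (?A u k)) \<le> enn2real ?s" if "u \<in> {0..T}" "finite F" for u F
 proof -
  have "ennreal (\<Sum>k\<in>F. f (?A u k)) = (\<Sum>k\<in>F. ennreal (f (?A u k)))"
   using assms(5) by (simp add: sum_ennreal)
  also have "\<dots> \<le> (\<Sum>\<^sub>\<infinity>k::int. ennreal (f (?A u k)))"
   using that(2) by (subst nonneg_infsum_complete) (auto intro!: SUP_upper)
  also have "\<dots> \<le> ?s" using that(1) by (rule SUP_upper)
  also have "?s = ennreal (enn2real ?s)" using assms(7) by (simp add: less_top)
  finally show ?thesis by simp
 qed
 then interpret A: arrival_copies N \<tau> f \<Delta> T "enn2real ?s" M A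
  using assms by unfold_locales auto
 interpret S: renewal_service M S T
  using assms M.indep_var_rv2[OF assms(15)] by unfold_locales
 interpret queue_ldp M T "empirical_mean T A" A.arrival_rate0 "scaled_renewal T S" "service_rate S.\<Lambda>S T"
  using A.arrival_path_rate S.service_path_rate assms(15) by (intro queue_ldp.intro queue_ldp_axioms.intro)
 \<comment> \<open>\<open>workload_rate\<close> ranges over cadlag paths only, and there the
   modified arrival rate agrees with the original one.\<close>
 define I where "I \<phi> = A.arrival_rate0 \<phi>" for \<phi>
 have I: "I \<phi> = arrival_rate N (arrival_count \<Delta> \<tau>) T \<phi>" if "\<phi> \<in> cadlag_space T" for \<phi>
  unfolding I_def by (rule A.arrival_rate0_eq[OF that])
 have "workload_rate T I (service_rate S.\<Lambda>S T)
  = workload_rate T (arrival_rate N (arrival_count \<Delta> \<tau>) T) (service_rate S.\<Lambda>S T)"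
  unfolding workload_rate_def by (intro ext arg_cong[where f=Inf] Collect_cong iff_exI) (auto simp: I)
 then show ?thesis using workload_LDP unfolding I_def[abs_def] S.\<Lambda>S_def by (simp only:)
qed

end
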